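(* Let $n\ge 1$, $s\in(0,1)$, let $\Omega\subset\mathbb R^n$ be a bounded open set with Lipschitz boundary, and let $f\in L^{\frac ns}(\Omega)$ satisfy $$\|f\|_{L^{\frac ns}(\Omega)}\le \frac{1}{2S_{n,s}}.$$ For $p\in(1,c_{n,s})$ let $u_p\in \mathcal W_0^{s_p,p}(\Omega)$ be an $(s_p,p)$-minimizer. Then there exists $u_1\in\mathcal W_0^{s,1}(\Omega)$ such that, up to a subsequence, $$u_p\xrightarrow[p\to1]{}u_1\quad\text{in }L^1(\Omega),\ \text{a.e. in }\mathbb R^n,\ \text{and weakly in }L^{\frac{n}{n-s}}(\Omega).$$ Furthermore, $u_1$ is an $(s,1)$-minimizer and a weak solution of $(-\Delta)_1^su=f$ in $\Omega$, $u=0$ in $\mathbb R^n\setminus\Omega$. If $\|f\|_{L^{\frac ns}(\Omega)}<\frac1{2S_{n,s}}$, then $u_1=0$ is the unique $(s,1)$-minimizer, and it is a weak solution of the same problem. Furthermore, $$\lim_{p\to1}\mathcal F_p^{s_p}(u_p)=\mathcal F_1^s(u_1).$$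
   Context: Parameters: $s_p:=n+s-\frac np$, and $c_{n,s}>1$ is a constant such that $s_p\in(s,1)$ and $s_pp<1$ for all $p\in(1,c_{n,s})$; $p\to1$ means $p\to1^+$. Spaces: for $r\in(0,1)$, $p\ge1$ and open $A\subseteq\mathbb R^n$, $[u]_{W^{r,p}(A)}=\left(\int_A\int_A\frac{|u(x)-u(y)|^p}{|x-y|^{n+rp}}dxdy\right)^{1/p}$ and $\|u\|_{W^{r,p}(A)}=(\|u\|_{L^p(A)}^p+[u]_{W^{r,p}(A)}^p)^{1/p}$. $\mathcal W^{r,p}_0(\Omega)$ is the closure of $C_c^\infty(\Omega)$ in the norm $\|\cdot\|_{W^{r,p}(\Omega)}$, its elements being functions on $\mathbb R^n$ that vanish on $\mathbb R^n\setminus\Omega$. For $\Omega$ bounded with Lipschitz boundary and $rp<1$ it equals the set of $u:\mathbb R^n\to\mathbb R$ with $u=0$ on $\mathbb R^n\setminus\Omega$ and $\|u\|_{W^{r,p}(\Omega)}<\infty$. Energy and minimizers: $\mathcal F_p^r(u)=\frac1{2p}\iint_{\mathbb R^{2n}}\frac{|u(x)-u(y)|^p}{|x-y|^{n+rp}}dxdy-\int_\Omega fu\,dx$. A function $u\in\mathcal W_0^{r,p}(\Omega)$ is an $(r,p)$-minimizer if $\mathcal F_p^r(u)\le\mathcal F_p^r(v)$ for all $v\in\mathcal W_0^{r,p}(\Omega)$. Weak solution: $u$ is a weak solution of $(-\Delta)_1^su=f$ in $\Omega$, $u=0$ in $\mathbb R^n\setminus\Omega$, if $u\in\mathcal W_0^{s,1}(\Omega)$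 and there exists $\mathbf z\in L^\infty(\mathbb R^{2n})$ with $\|\mathbf z\|_{L^\infty(\mathbb R^{2n})}\le1$, $\mathbf z(x,y)=-\mathbf z(y,x)$, such that $\frac12\iint_{\mathbb R^{2n}}\frac{\mathbf z(x,y)}{|x-y|^{n+s}}(w(x)-w(y))dxdy=\int_\Omega fw\,dx$ for all $w\in\mathcal W_0^{s,1}(\Omega)$, and $\mathbf z(x,y)\in\operatorname{sgn}(u(x)-u(y))$ for a.e. $(x,y)\in Q(\Omega):=\mathbb R^{2n}\setminus(\mathbb R^n\setminus\Omega)^2$. Here $\operatorname{sgn}$ is the multivalued sign: $\operatorname{sgn}(t)=\{1\}$ if $t>0$, $\{-1\}$ if $t<0$, $[-1,1]$ if $t=0$. Constant: $S_{n,s}$ is the sharp constant in the fractional Sobolev inequality $\|u\|_{L^{\frac n{n-s}}(\mathbb R^n)}\le S_{n,s}[u]_{W^{s,1}(\mathbb R^n)}$; equivalently $S_{n,s}=\frac{|B_1|^{\frac{n-s}n}}{2\operatorname{Per}_s(B_1)}$, where $B_1$ is the unit ball and $\operatorname{Per}_s(E)=\frac12\iint_{\mathbb R^{2n}}\frac{|\chi_E(x)-\chi_E(y)|}{|x-y|^{n+s}}dxdy$. *)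

theory Defs
  imports "HOL-Analysis.Analysis"
begin

text \<open>
  The space \<open>\<real>\<^sup>n\<close> is an arbitrary Euclidean space \<open>'a\<close>, with \<open>n = DIM('a) \<ge> 1\<close>; the space
  \<open>\<real>\<^sup>2\<^sup>n\<close> is \<open>'a \<times> 'a\<close>. Functions are Lebesgue measurable real functions, not equivalence
  classes, so equality in a function space appears as equality almost everywhere. Norms and
  double integrals of nonnegative functions take values in \<^typ>\<open>ennreal\<close>.
\<close>

section \<open>Lebesgue spaces\<close>

text \<open>Only used for \<open>a > 0\<close>.\<close>

definition ennpowr :: "ennreal \<Rightarrow> real \<Rightarrow> ennreal" where
  "ennpowr x a = (if x = \<infinity> then \<infinity> else ennreal (enn2real x powr a))"

definition Lp_norm :: "'b measure \<Rightarrow> real \<Rightarrow> ('b \<Rightarrow> real) \<Rightarrow> ennreal" where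
  "Lp_norm M q u = ennpowr (\<integral>\<^sup>+x. ennreal (\<bar>u x\<bar> powr q) \<partial>M) (1 / q)"

definition Lp_space :: "'b measure \<Rightarrow> real \<Rightarrow> ('b \<Rightarrow> real) set" where
  "Lp_space M q = {u \<in> borel_measurable M. Lp_norm M q u < \<infinity>}"

definition converges_Lp :: "'b measure \<Rightarrow> real \<Rightarrow> (nat \<Rightarrow> 'b \<Rightarrow> real) \<Rightarrow> ('b \<Rightarrow> real) \<Rightarrow> bool" where
  "converges_Lp M q X u \<longleftrightarrow>
     (\<forall>k. X k \<in> Lp_space M q) \<and> u \<in> Lp_space M q \<and>
     (\<lambda>k. Lp_norm M q (\<lambda>x. X k x - u x)) \<longlonglongrightarrow> 0"

text \<open>Weak convergence for \<open>1 < q\<close>, tested against the dual space, that is \<open>L\<close> with the conjugate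
  exponent \<open>q / (q - 1)\<close>.\<close>

definition weakly_converges_Lp ::
    "'b measure \<Rightarrow> real \<Rightarrow> (nat \<Rightarrow> 'b \<Rightarrow> real) \<Rightarrow> ('b \<Rightarrow> real) \<Rightarrow> bool" where
  "weakly_converges_Lp M q X u \<longleftrightarrow>
     (\<forall>k. X k \<in> Lp_space M q) \<and> u \<in> Lp_space M q \<and>
     (\<forall>g \<in> Lp_space M (q / (q - 1)).
        (\<lambda>k. \<integral>x. X k x * g x \<partial>M) \<longlonglongrightarrow> (\<integral>x. u x * g x \<partial>M))"

section \<open>Fractional Sobolev spaces\<close>

text \<open>On the diagonal the quotient is \<open>0 / 0 = 0\<close>; the diagonal is a null set.\<close>

definition gagliardo_integral ::
    "real \<Rightarrow> real \<Rightarrow> 'a::euclidean_space set \<Rightarrow> ('a \<Rightarrow> real) \<Rightarrow> ennreal" where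
  "gagliardo_integral r p A u =
     (\<integral>\<^sup>+(x, y). ennreal (\<bar>u x - u y\<bar> powr p / norm (x - y) powr (real DIM('a) + r * p))
        \<partial>lebesgue_on (A \<times> A))"

definition gagliardo_seminorm ::
    "real \<Rightarrow> real \<Rightarrow> 'a::euclidean_space set \<Rightarrow> ('a \<Rightarrow> real) \<Rightarrow> ennreal" where
  "gagliardo_seminorm r p A u = ennpowr (gagliardo_integral r p A u) (1 / p)"

definition sobolev_norm ::
    "real \<Rightarrow> real \<Rightarrow> 'a::euclidean_space set \<Rightarrow> ('a \<Rightarrow> real) \<Rightarrow> ennreal" where
  "sobolev_norm r p A u =
     ennpowr (ennpowr (Lp_norm (lebesgue_on A) p u) p + ennpowr (gagliardo_seminorm r p A u) p)
       (1 / p)"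

primrec times_differentiable :: "nat \<Rightarrow> ('a::euclidean_space \<Rightarrow> real) \<Rightarrow> bool" where
  "times_differentiable 0 g \<longleftrightarrow> continuous_on UNIV g"
| "times_differentiable (Suc k) g \<longleftrightarrow>
     (\<forall>x. g differentiable (at x)) \<and>
     (\<forall>v. times_differentiable k (\<lambda>x. frechet_derivative g (at x) v))"

definition test_functions :: "'a::euclidean_space set \<Rightarrow> ('a \<Rightarrow> real) set" where
  "test_functions \<Omega> =
     {\<phi>. (\<forall>k. times_differentiable k \<phi>) \<and>
         compact (closure {x. \<phi> x \<noteq> 0}) \<and> closure {x. \<phi> x \<noteq> 0} \<subseteq> \<Omega>}"

text \<open>The space \<open>\<W>\<^sub>0\<close>: the closure of the test functions in the norm over \<open>\<Omega>\<close>, each element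
  being extended by zero.\<close>

definition sobolev_space0 ::
    "real \<Rightarrow> real \<Rightarrow> 'a::euclidean_space set \<Rightarrow> ('a \<Rightarrow> real) set" where
  "sobolev_space0 r p \<Omega> =
     {u \<in> borel_measurable lebesgue.
        (\<forall>x. x \<notin> \<Omega> \<longrightarrow> u x = 0) \<and>
        (\<exists>\<phi>. (\<forall>k. \<phi> k \<in> test_functions \<Omega>) \<and>
             (\<lambda>k. sobolev_norm r p \<Omega> (\<lambda>x. \<phi> k x - u x)) \<longlonglongrightarrow> 0)}"

text \<open>The sharp constant of the fractional Sobolev inequality on \<open>\<real>\<^sup>n\<close>. The inequality is
  required for functions of finite \<open>W\<^sup>s\<^sup>,\<^sup>1\<close> norm; it fails for nonzero constants, whose seminorm
  vanishes.\<close>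

definition sobolev_constant :: "'a::euclidean_space itself \<Rightarrow> real \<Rightarrow> real" where
  "sobolev_constant (T :: 'a itself) s =
     Inf {C. 0 \<le> C \<and>
        (\<forall>u :: 'a \<Rightarrow> real. u \<in> borel_measurable lebesgue \<longrightarrow> sobolev_norm s 1 UNIV u < \<infinity> \<longrightarrow>
           Lp_norm lebesgue (real DIM('a) / (real DIM('a) - s)) u
             \<le> ennreal C * gagliardo_seminorm s 1 UNIV u)}"

section \<open>Lipschitz boundary\<close>

text \<open>Near each boundary point, \<open>\<Omega>\<close> is the region strictly above the graph of a Lipschitz function
  over the hyperplane orthogonal to a unit vector \<open>e\<close>. In dimension one the hyperplane is \<open>{0}\<close>
  and \<open>\<Omega>\<close> is locally a half-line.\<close>

definition lipschitz_boundary :: "'a::euclidean_space set \<Rightarrow> bool" where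
  "lipschitz_boundary \<Omega> \<longleftrightarrow>
     (\<forall>x \<in> frontier \<Omega>. \<exists>e \<rho> L g.
        norm e = 1 \<and> \<rho> > 0 \<and> lipschitz_on L {y. y \<bullet> e = 0} g \<and>
        \<Omega> \<inter> ball x \<rho> = {z \<in> ball x \<rho>. g (z - (z \<bullet> e) *\<^sub>R e) < z \<bullet> e})"

section \<open>Energy, minimizers and weak solutions\<close>

definition shifted_order :: "nat \<Rightarrow> real \<Rightarrow> real \<Rightarrow> real" where
  "shifted_order n s p = real n + s - real n / p"

definition energy ::
    "'a::euclidean_space set \<Rightarrow> ('a \<Rightarrow> real) \<Rightarrow> real \<Rightarrow> real \<Rightarrow> ('a \<Rightarrow> real) \<Rightarrow> ereal" where
  "energy \<Omega> f r p u =
     ereal (1 / (2 * p)) * enn2ereal (gagliardo_integral r p UNIV u)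
       - ereal (\<integral>x. f x * u x \<partial>lebesgue_on \<Omega>)"

definition is_minimizer ::
    "'a::euclidean_space set \<Rightarrow> ('a \<Rightarrow> real) \<Rightarrow> real \<Rightarrow> real \<Rightarrow> ('a \<Rightarrow> real) \<Rightarrow> bool" where
  "is_minimizer \<Omega> f r p u \<longleftrightarrow>
     u \<in> sobolev_space0 r p \<Omega> \<and>
     (\<forall>v \<in> sobolev_space0 r p \<Omega>. energy \<Omega> f r p u \<le> energy \<Omega> f r p v)"

definition multi_sgn :: "real \<Rightarrow> real set" where
  "multi_sgn t = (if t > 0 then {1} else if t < 0 then {-1} else {-1..1})"

definition is_weak_solution ::
    "'a::euclidean_space set \<Rightarrow> ('a \<Rightarrow> real) \<Rightarrow> real \<Rightarrow> ('a \<Rightarrow> real) \<Rightarrow> bool" where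
  "is_weak_solution \<Omega> f s u \<longleftrightarrow>
     u \<in> sobolev_space0 s 1 \<Omega> \<and>
     (\<exists>z :: 'a \<times> 'a \<Rightarrow> real.
        z \<in> borel_measurable lebesgue \<and>
        (AE xy in lebesgue. \<bar>z xy\<bar> \<le> 1) \<and>
        (\<forall>x y. z (x, y) = - z (y, x)) \<and>
        (\<forall>w \<in> sobolev_space0 s 1 \<Omega>.
           1 / 2 * (\<integral>(x, y). z (x, y) / norm (x - y) powr (real DIM('a) + s) * (w x - w y) \<partial>lebesgue)
             = (\<integral>x. f x * w x \<partial>lebesgue_on \<Omega>)) \<and>
        (AE (x, y) in lebesgue. (x, y) \<notin> (- \<Omega>) \<times> (- \<Omega>) \<longrightarrow> z (x, y) \<in> multi_sgn (u x - u y)))"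

end

theory Submission imports Defs "HOL-Complex_Analysis.Great_Picard" begin

text \<open>
  With \<open>r = s\<^sub>p\<close> one has \<open>n + r p = (n + s) p\<close>, so the energy of order \<open>p\<close> is the integral of \<open>\<bar>D u\<bar>\<^sup>p\<close> for
  one and the same quotient \<open>D u (x, y) = (u x - u y) / norm (x - y) powr (n + s)\<close>. The elementary
  inequality \<open>a - a\<^sup>p / p \<le> p - 1\<close> (and its decaying version far from \<open>\<Omega>\<close>) bounds the energy of order 1
  by the one of order \<open>p\<close> up to \<open>O(p - 1)\<close>. Together with the Euler-Lagrange equation and the Sobolev
  inequality this bounds the energies of order 1 of the minimizers, and compactness gives a limit \<open>v\<close>.
  Comparison with test functions, which are dense because a fractional Hardy inequality holds on
  Lipschitz domains, shows that \<open>v\<close> is minimal and that the energies converge.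

  The field \<open>z\<close> is a limit of the signed powers \<open>sgn (D u\<^sub>p) \<bar>D u\<^sub>p\<bar>\<^sup>p\<^sup>-\<^sup>1\<close> truncated to \<open>[-1, 1]\<close>. Instead of weak-star
  compactness, convex combinations that converge almost everywhere are used: they keep the linear
  equation, the antisymmetry and the pointwise limit \<open>sgn (D v)\<close> where \<open>D v \<noteq> 0\<close>.
\<close>

section \<open>Lebesgue and Borel integrals\<close>

text \<open>With S the Sobolev constant, the bound \<open>1 / (2 * S)\<close> on \<open>f\<close>
  gives exactly \<open>F v \<le> E v / 2\<close>. So the energy of order 1 is nonnegative, but in
  the case of equality it is not coercive, and bounds on the minimizers must come from order
  \<open>p\<close>. Testing the Euler-Lagrange equation with the minimizer bounds its energy of
  order \<open>p\<close> by that of order 1. If this is inserted directly into the comparison of the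
  two energies, the factor \<open>p - 1\<close> cancels and the result is empty unless the constants
  are small. Normalising the minimizer first exploits that the two energies have different
  homogeneity; a logarithm then gives the bound. A second obstacle: the norm of
  \<open>sobolev_space0\<close> sees only pairs of points of \<open>\<Omega>\<close>, the energy
  sees all pairs. At order 1 the interaction with the complement is a Hardy integral, and the same
  integral dominates the error of cutting off near the boundary. At order \<open>p\<close>
  finiteness over all pairs is read off from minimality instead. Finally the spaces vary with
  \<open>p\<close>. Test functions compete at every order close to 1 and their energies converge as
  \<open>p\<close> tends to 1, so they are compared first.\<close>

lemma nn_integral_lborel_pair:
  fixes F :: "'a::euclidean_space \<Rightarrow> 'b::euclidean_space \<Rightarrow> ennreal"
  assumes [measurable]: "case_prod F \<in> borel_measurable (lborel \<Otimes>\<^sub>M lborel)"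
  shows "(\<integral>\<^sup>+z. F (fst z) (snd z) \<partial>lborel) = (\<integral>\<^sup>+x. \<integral>\<^sup>+y. F x y \<partial>lborel \<partial>lborel)"
proof -
  have "(\<integral>\<^sup>+x. \<integral>\<^sup>+y. F x y \<partial>lborel \<partial>lborel) = (\<integral>\<^sup>+z. case_prod F z \<partial>(lborel \<Otimes>\<^sub>M lborel))"
    using lborel.nn_integral_fst[of "case_prod F" lborel] assms by simp
  also have "\<dots> = (\<integral>\<^sup>+z. case_prod F z \<partial>lborel)"
    by (simp add: lborel_prod)
  finally show ?thesis by (simp add: case_prod_beta')
qed

lemma nn_integral_lborel_commute:
  fixes F :: "'a::euclidean_space \<Rightarrow> 'b::euclidean_space \<Rightarrow> ennreal"
  assumes "case_prod F \<in> borel_measurable (lborel \<Otimes>\<^sub>M lborel)"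
  shows "(\<integral>\<^sup>+x. \<integral>\<^sup>+y. F x y \<partial>lborel \<partial>lborel) = (\<integral>\<^sup>+y. \<integral>\<^sup>+x. F x y \<partial>lborel \<partial>lborel)"
  using lborel_pair.Fubini'[of F] assms by simp

lemma nn_integral_lborel_shift:
  fixes f :: "'a::euclidean_space \<Rightarrow> ennreal"
  assumes [measurable]: "f \<in> borel_measurable borel"
  shows "(\<integral>\<^sup>+x. f (x + c) \<partial>lborel) = (\<integral>\<^sup>+x. f x \<partial>lborel)"
proof -
  have "(\<integral>\<^sup>+x. f x \<partial>lborel) = (\<integral>\<^sup>+x. f x \<partial>distr lborel borel ((+) c))"
    by (simp add: lborel_distr_plus)
  also have "\<dots> = (\<integral>\<^sup>+x. f (c + x) \<partial>lborel)"
    by (subst nn_integral_distr) auto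
  finally show ?thesis by (simp add: add.commute)
qed

text \<open>Membership in the spaces is insensitive to null sets, but a difference quotient uses
  \<open>u\<close> at both coordinates; this carries almost everywhere statements from points to
  pairs.\<close>

lemma AE_lborel_pair:
  fixes P :: "'a::euclidean_space \<Rightarrow> bool" and Q :: "'b::euclidean_space \<Rightarrow> bool"
  assumes "AE x in lborel. P x" "AE x in lborel. Q x"
  shows "AE z in lborel. P (fst z) \<and> Q (snd z)"
proof -
  from assms obtain N M where N: "{x. \<not> P x} \<subseteq> N" "N \<in> null_sets lborel"
    and M: "{x. \<not> Q x} \<subseteq> M" "M \<in> null_sets lborel"
    by (auto elim!: AE_E simp: null_sets_def) 
  have "N \<times> UNIV \<in> null_sets (lborel \<Otimes>\<^sub>M (lborel :: 'b measure))"
    using N(2) by (intro lborel.times_in_null_sets1) auto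
  moreover have "UNIV \<times> M \<in> null_sets ((lborel :: 'a measure) \<Otimes>\<^sub>M lborel)"
    using M(2) by (intro lborel.times_in_null_sets2) auto
  ultimately have "AE z in lborel. z \<notin> N \<times> UNIV \<and> z \<notin> UNIV \<times> M"
    by (auto simp: lborel_prod intro: AE_not_in)
  then show ?thesis
    by eventually_elim (use N(1) M(1) in \<open>auto simp: mem_Times_iff\<close>)
qed

text \<open>The definitions admit Lebesgue measurable functions, while Tonelli for
  \<open>lborel\<close> wants Borel ones, so all estimates below are made for a Borel
  representative. Vanishing off \<open>A\<close> is kept at every point, as in
  \<open>sobolev_space0\<close>.\<close>

lemma borel_representative:
  fixes u :: "'a::euclidean_space \<Rightarrow> real"
  assumes u: "u \<in> borel_measurable lebesgue" and A: "A \<in> sets borel" "\<And>x. x \<notin> A \<Longrightarrow> u x = 0"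
  obtains v where "v \<in> borel_measurable borel" "\<And>x. x \<notin> A \<Longrightarrow> v x = 0" "AE x in lborel. u x = v x"
proof -
  obtain v where v: "v \<in> borel_measurable lborel" "AE x in lborel. u x = v x"
    using completion_ex_borel_measurable_real[of u lborel] u by auto
  show thesis
  proof (rule that[of "\<lambda>x. if x \<in> A then v x else 0"])
    show "(\<lambda>x. if x \<in> A then v x else 0) \<in> borel_measurable borel"
      using v(1) A(1) by (intro measurable_If_set) auto
    show "AE x in lborel. u x = (if x \<in> A then v x else 0)"
      using v(2) by eventually_elim (use A(2) in auto)
  qed simp
qed

lemma nn_integral_lebesgue_on:
  assumes "A \<in> sets borel"
  shows "(\<integral>\<^sup>+x. f x \<partial>lebesgue_on A) = (\<integral>\<^sup>+x. f x * indicator A x \<partial>lborel)"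
  using assms by (subst nn_integral_restrict_space) (auto simp: nn_integral_completion)

lemma AE_lebesgue_on:
  assumes "A \<in> sets borel"
  shows "(AE x in lebesgue_on A. P x) \<longleftrightarrow> (AE x in lborel. x \<in> A \<longrightarrow> P x)"
  using assms by (subst AE_restrict_space_iff) (auto simp: AE_completion_iff)

section \<open>Lebesgue spaces\<close>

lemma ennpowr_ennreal: "0 \<le> x \<Longrightarrow> ennpowr (ennreal x) a = ennreal (x powr a)"
  by (simp add: ennpowr_def)

lemma ennpowr_one [simp]: "ennpowr x 1 = x"
  by (cases x) (auto simp: ennpowr_def)

lemma ennpowr_less_top [simp]: "ennpowr x a < top \<longleftrightarrow> x < top"
  by (cases x) (auto simp: ennpowr_def)

lemma ennpowr_ennpowr:
  assumes "a \<noteq> 0"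
  shows "ennpowr (ennpowr x a) b = ennpowr x (a * b)"
  by (cases x) (auto simp: ennpowr_def powr_powr)

lemma ennpowr_mono:
  assumes "x \<le> y" "0 \<le> a"
  shows "ennpowr x a \<le> ennpowr y a"
  using assms by (cases x; cases y) (auto simp: ennpowr_def powr_mono2 top_unique)

text \<open>Strips the outer power from \<open>sobolev_norm\<close>. Both directions are one
  implication, applied with the exponents \<open>a\<close> and \<open>1 / a\<close>.\<close>

lemma tendsto_ennpowr_zero_iff:
  fixes X :: "nat \<Rightarrow> ennreal"
  assumes a: "0 < a"
  shows "((\<lambda>k. ennpowr (X k) a) \<longlonglongrightarrow> 0) \<longleftrightarrow> (X \<longlonglongrightarrow> 0)"
proof -
  have *: "(\<lambda>k. ennpowr (X k) a) \<longlonglongrightarrow> 0" if X: "X \<longlonglongrightarrow> 0" and a: "0 < a" for X a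
  proof -
    have "eventually (\<lambda>k. X k < 1) sequentially"
      using order_tendstoD(2)[OF X, of 1] by simp
    then have ev: "eventually (\<lambda>k. ennpowr (X k) a = ennreal (enn2real (X k) powr a)) sequentially"
      by eventually_elim (auto simp: ennpowr_def)
    have "(\<lambda>k. enn2real (X k)) \<longlonglongrightarrow> 0"
      using tendsto_enn2real[of X 0 sequentially] X by simp
    then have "(\<lambda>k. enn2real (X k) powr a) \<longlonglongrightarrow> 0 powr a"
      using a by (intro tendsto_powr') auto
    then have "(\<lambda>k. ennreal (enn2real (X k) powr a)) \<longlonglongrightarrow> ennreal 0"
      by (intro tendsto_ennrealI) simp
    then show ?thesis using tendsto_cong[OF ev] by simp
  qed
  show ?thesis
    using *[of X a] *[of "\<lambda>k. ennpowr (X k) a" "1/a"] a by (auto simp: ennpowr_ennpowr)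
qed

lemma Lp_norm_eq_powr:
  assumes "(\<integral>\<^sup>+x. ennreal (\<bar>u x\<bar> powr q) \<partial>M) = ennreal A" "0 \<le> A"
  shows "Lp_norm M q u = ennreal (A powr (1/q))"
  using assms by (simp add: Lp_norm_def ennpowr_ennreal)

text \<open>Young's inequality for \<open>f\<close> and \<open>g\<close> divided by their norms. The
  normalisation divides by \<open>F\<close> and \<open>G\<close>, so the case where one of them is 0
  is split off: there the product vanishes almost everywhere.\<close>

theorem Holder_inequality_nn:
  fixes f g :: "'b \<Rightarrow> real"
  assumes pq: "p > 1" "q > 1" "1/p + 1/q = 1"
    and [measurable]: "f \<in> borel_measurable M" "g \<in> borel_measurable M"
    and fin: "Lp_norm M p f < \<infinity>" "Lp_norm M q g < \<infinity>"
  shows "(\<integral>\<^sup>+x. ennreal \<bar>f x * g x\<bar> \<partial>M) \<le> Lp_norm M p f * Lp_norm M q g"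
proof -
  define F where "F = enn2real (\<integral>\<^sup>+x. ennreal (\<bar>f x\<bar> powr p) \<partial>M)"
  define G where "G = enn2real (\<integral>\<^sup>+x. ennreal (\<bar>g x\<bar> powr q) \<partial>M)"
  have F: "(\<integral>\<^sup>+x. ennreal (\<bar>f x\<bar> powr p) \<partial>M) = ennreal F" "0 \<le> F"
    using fin(1) by (auto simp: F_def Lp_norm_def)
  have G: "(\<integral>\<^sup>+x. ennreal (\<bar>g x\<bar> powr q) \<partial>M) = ennreal G" "0 \<le> G"
    using fin(2) by (auto simp: G_def Lp_norm_def)
  show ?thesis
  proof (cases "F = 0 \<or> G = 0")
    case True
    then have "AE x in M. f x * g x = 0"
    proof
      assume "F = 0"
      then have "AE x in M. ennreal (\<bar>f x\<bar> powr p) = 0"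
        using F by (subst nn_integral_0_iff_AE[symmetric]) auto
      then show ?thesis by eventually_elim simp
    next
      assume "G = 0"
      then have "AE x in M. ennreal (\<bar>g x\<bar> powr q) = 0"
        using G by (subst nn_integral_0_iff_AE[symmetric]) auto
      then show ?thesis by eventually_elim simp
    qed
    then have "(\<integral>\<^sup>+x. ennreal \<bar>f x * g x\<bar> \<partial>M) = 0"
      by (subst nn_integral_0_iff_AE) auto
    then show ?thesis by simp
  next
    case False
    then have pos: "F > 0" "G > 0" using F(2) G(2) by auto
    let ?a = "F powr (1/p)" and ?b = "G powr (1/q)"
    have ab: "?a > 0" "?b > 0" using pos by auto
    have pt: "\<bar>f x * g x\<bar> \<le> ?a * ?b * (\<bar>f x\<bar> powr p / (p * F) + \<bar>g x\<bar> powr q / (q * G))" for x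
    proof -
      have "\<bar>f x\<bar> / ?a * (\<bar>g x\<bar> / ?b) \<le> (\<bar>f x\<bar> / ?a) powr p / p + (\<bar>g x\<bar> / ?b) powr q / q"
        using pq ab by (intro Youngs_inequality) auto
      also have "(\<bar>f x\<bar> / ?a) powr p = \<bar>f x\<bar> powr p / F"
        using pq pos by (simp add: powr_divide powr_powr)
      also have "(\<bar>g x\<bar> / ?b) powr q = \<bar>g x\<bar> powr q / G"
        using pq pos by (simp add: powr_divide powr_powr)
      finally show ?thesis
        using ab by (simp add: field_simps abs_mult)
    qed
    have "(\<integral>\<^sup>+x. ennreal \<bar>f x * g x\<bar> \<partial>M)
        \<le> (\<integral>\<^sup>+x. ennreal (?a * ?b / (p * F)) * ennreal (\<bar>f x\<bar> powr p)
             + ennreal (?a * ?b / (q * G)) * ennreal (\<bar>g x\<bar> powr q) \<partial>M)"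
    proof (intro nn_integral_mono)
      fix x
      have "0 \<le> ?a * ?b / (p * F)" "0 \<le> ?a * ?b / (q * G)"
        using pq pos by auto
      then have "ennreal (?a * ?b / (p * F)) * ennreal (\<bar>f x\<bar> powr p)
             + ennreal (?a * ?b / (q * G)) * ennreal (\<bar>g x\<bar> powr q)
          = ennreal (?a * ?b / (p * F) * (\<bar>f x\<bar> powr p) + ?a * ?b / (q * G) * (\<bar>g x\<bar> powr q))"
        by (subst ennreal_plus) (auto simp: ennreal_mult' simp del: times_divide_eq_left times_divide_eq_right)
      then show "ennreal \<bar>f x * g x\<bar> \<le> ennreal (?a * ?b / (p * F)) * ennreal (\<bar>f x\<bar> powr p)
             + ennreal (?a * ?b / (q * G)) * ennreal (\<bar>g x\<bar> powr q)"
        using pt[of x] by (auto intro!: ennreal_leI simp: algebra_simps)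
    qed
    also have "\<dots> = ennreal (?a * ?b / (p * F)) * ennreal F + ennreal (?a * ?b / (q * G)) * ennreal G"
      by (subst nn_integral_add) (auto simp: nn_integral_cmult F(1) G(1))
    also have "\<dots> = ennreal (?a * ?b / (p * F) * F + ?a * ?b / (q * G) * G)"
    proof -
      have "0 \<le> ?a * ?b / (p * F)" "0 \<le> ?a * ?b / (q * G)"
        using pq pos by auto
      then show ?thesis
        using pos by (subst ennreal_plus) (auto simp: ennreal_mult' simp del: times_divide_eq_left times_divide_eq_right)
    qed
    also have "?a * ?b / (p * F) * F + ?a * ?b / (q * G) * G = ?a * ?b * (1/p + 1/q)"
      using pos pq by (simp add: field_simps)
    also have "ennreal (?a * ?b * (1/p + 1/q)) = Lp_norm M p f * Lp_norm M q g"
      using pq F G by (simp add: Lp_norm_eq_powr ennreal_mult')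
    finally show ?thesis .
  qed
qed

lemma Holder_integral:
  fixes f g :: "'b \<Rightarrow> real"
  assumes "p > 1" "q > 1" "1/p + 1/q = 1" "f \<in> Lp_space M p" "g \<in> Lp_space M q"
  shows "integrable M (\<lambda>x. f x * g x)"
    and "ennreal \<bar>\<integral>x. f x * g x \<partial>M\<bar> \<le> Lp_norm M p f * Lp_norm M q g"
proof -
  have m[measurable]: "f \<in> borel_measurable M" "g \<in> borel_measurable M" 
    and fin: "Lp_norm M p f < \<infinity>" "Lp_norm M q g < \<infinity>"
    using assms by (auto simp: Lp_space_def)
  note H = Holder_inequality_nn[OF assms(1-3) m fin]
  have "(\<integral>\<^sup>+x. ennreal \<bar>f x * g x\<bar> \<partial>M) < \<infinity>"
    using H fin by (auto simp: ennreal_mult_less_top intro: order_le_less_trans)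
  then show I: "integrable M (\<lambda>x. f x * g x)"
    by (intro integrableI_bounded) auto
  have "ennreal \<bar>\<integral>x. f x * g x \<partial>M\<bar> \<le> ennreal (\<integral>x. \<bar>f x * g x\<bar> \<partial>M)"
    by (intro ennreal_leI integral_abs_bound)
  also have "\<dots> = (\<integral>\<^sup>+x. ennreal \<bar>f x * g x\<bar> \<partial>M)"
    using I by (intro nn_integral_eq_integral[symmetric]) auto
  finally show "ennreal \<bar>\<integral>x. f x * g x \<partial>M\<bar> \<le> Lp_norm M p f * Lp_norm M q g"
    using H by simp
qed

lemma ennreal_le_suminf: "(f :: nat \<Rightarrow> ennreal) j \<le> (\<Sum>j. f j)"
  using sum_le_suminf[of f "{j}"] by auto

section \<open>Integrals of powers of the distance\<close>

lemma power_of_two_powr: "((2::real) ^ j) powr b = (2 powr b) ^ j"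
proof -
  have "((2::real) ^ j) powr b = (2 powr real j) powr b" by (subst powr_realpow) auto
  also have "\<dots> = (2 powr b) powr real j" by (simp only: powr_powr mult.commute)
  also have "\<dots> = (2 powr b) ^ j" by (subst powr_realpow) auto
  finally show ?thesis .
qed

text \<open>Dyadic annuli in place of polar coordinates. Where
  \<open>2 ^ j * r \<le> norm (x - y) < 2 ^ Suc j * r\<close>, the kernel is at most its value at
  the inner radius and the volume at most that of the outer ball; the products form a geometric
  series with ratio \<open>2 powr - a\<close>, and \<open>2 ^ DIM('a)\<close> is the volume ratio of
  the two balls.\<close>

lemma nn_integral_tail_powr:
  fixes x :: "'a::euclidean_space"
  assumes a: "0 < a" and r: "0 < r"
  shows "(\<integral>\<^sup>+y. ennreal (norm (x - y) powr - (real DIM('a) + a)) * indicator {y. r \<le> norm (x - y)} y \<partial>lborel)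
    \<le> ennreal (unit_ball_vol (real DIM('a)) * 2 ^ DIM('a) / (1 - 2 powr - a) * r powr - a)"
proof -
  let ?n = "real DIM('a)"
  define f where "f = (\<lambda>(j::nat) (y::'a). ennreal (((2::real) ^ j * r) powr - (?n + a)) * indicator (ball x ((2::real) ^ Suc j * r)) y :: ennreal)"
  have [measurable]: "f j \<in> borel_measurable borel" for j
    unfolding f_def by (intro borel_measurable_times_ennreal borel_measurable_const borel_measurable_indicator) auto
  have int: "(\<integral>\<^sup>+y. f j y \<partial>lborel) = ennreal (unit_ball_vol ?n * 2 ^ DIM('a) * r powr - a * (2 powr - a) ^ j)" for j
  proof -
    have "(\<integral>\<^sup>+y. f j y \<partial>lborel) = ennreal ((2 ^ j * r) powr - (?n + a)) * ennreal (unit_ball_vol ?n * (2 ^ Suc j * r) ^ DIM('a))"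
      unfolding f_def using r by (subst nn_integral_cmult_indicator) (auto simp: emeasure_ball)
    also have "\<dots> = ennreal ((2 ^ j * r) powr - (?n + a) * (unit_ball_vol ?n * (2 ^ Suc j * r) ^ DIM('a)))"
      by (intro ennreal_mult'[symmetric]) auto
    also have "(2 ^ Suc j * r) ^ DIM('a) = 2 ^ DIM('a) * (2 ^ j * r) powr ?n"
      using r by (simp add: powr_realpow power_mult_distrib)
    also have "(2 ^ j * r) powr - (?n + a) * (unit_ball_vol ?n * (2 ^ DIM('a) * (2 ^ j * r) powr ?n))
        = unit_ball_vol ?n * 2 ^ DIM('a) * ((2 ^ j * r) powr (- (?n + a) + ?n))"
      unfolding powr_add by (simp add: algebra_simps)
    also have "(2 ^ j * r) powr (- (?n + a) + ?n) = r powr - a * (2 powr - a) ^ j"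
      using r power_of_two_powr[of j "- a"] by (simp add: powr_mult)
    finally show ?thesis
      by (simp add: mult.assoc)
  qed
  have "(\<integral>\<^sup>+y. ennreal (norm (x - y) powr - (?n + a)) * indicator {y. r \<le> norm (x - y)} y \<partial>lborel)
     \<le> (\<integral>\<^sup>+y. (\<Sum>j. f j y) \<partial>lborel)"
  proof (intro nn_integral_mono)
    fix y
    show "ennreal (norm (x - y) powr - (?n + a)) * indicator {y. r \<le> norm (x - y)} y \<le> (\<Sum>j. f j y)"
    proof (cases "r \<le> norm (x - y)")
      case True
      define t where "t = norm (x - y) / r"
      have t: "1 \<le> t" using True r by (simp add: t_def)
      obtain m where m: "t < 2 ^ m" using real_arch_pow[of 2 t] by auto
      \<comment> \<open>The least exponent locates the annulus: \<open>t \<ge> 1 = 2 ^ 0\<close>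
        rules out \<open>M = 0\<close>, and the predecessor \<open>j\<close> satisfies
        \<open>2 ^ j \<le> t < 2 ^ Suc j\<close>.\<close>
      define M where "M = (LEAST m. t < 2 ^ m)"
      have M: "t < 2 ^ M" unfolding M_def using m by (rule LeastI)
      have "M \<noteq> 0" using M t by (cases M) auto
      then obtain j where j: "M = Suc j" by (cases M) auto
      have "\<not> t < 2 ^ j" using not_less_Least[of j "\<lambda>m. t < 2 ^ m"] j M_def by simp
      then have lo: "2 ^ j * r \<le> norm (x - y)" and hi: "norm (x - y) < 2 ^ Suc j * r"
        using M j r by (auto simp: t_def field_simps)
      have "norm (x - y) powr - (?n + a) \<le> (2 ^ j * r) powr - (?n + a)"
        using lo r a by (intro powr_mono2') auto
      then have "ennreal (norm (x - y) powr - (?n + a)) * indicator {y. r \<le> norm (x - y)} y \<le> f j y"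
        using hi True by (auto simp: f_def dist_norm indicator_def intro!: ennreal_leI simp del: power_Suc)
      also have "\<dots> \<le> (\<Sum>j. f j y)"
        by (rule ennreal_le_suminf)
      finally show ?thesis .
    qed auto
  qed
  also have "\<dots> = (\<Sum>j. \<integral>\<^sup>+y. f j y \<partial>lborel)"
    by (rule nn_integral_suminf) simp
  also have "\<dots> = (\<Sum>j. ennreal (unit_ball_vol ?n * (2::real) ^ DIM('a) * r powr - a * (2 powr - a) ^ j))"
    by (simp only: int)
  also have "(\<Sum>j. ennreal (unit_ball_vol ?n * (2::real) ^ DIM('a) * r powr - a * (2 powr - a) ^ j))
     = ennreal (unit_ball_vol ?n * 2 ^ DIM('a) * r powr - a * (1 / (1 - 2 powr - a)))"
  proof (rule suminf_ennreal_eq)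
    have "norm (2 powr - a) < 1" using a by (simp add: powr_less_one)
    from sums_mult[OF geometric_sums[OF this], of "unit_ball_vol ?n * 2 ^ DIM('a) * r powr - a"]
    show "(\<lambda>i. unit_ball_vol ?n * 2 ^ DIM('a) * r powr - a * (2 powr - a) ^ i) sums
       (unit_ball_vol ?n * 2 ^ DIM('a) * r powr - a * (1 / (1 - 2 powr - a)))" by simp
  qed auto
  finally show ?thesis by (simp add: field_simps)
qed

text \<open>The same argument with the annuli
  \<open>r / 2 ^ Suc j \<le> norm (x - y) < r / 2 ^ j\<close> shrinking to \<open>x\<close>; the
  centre lies in none of them and is discarded as a null set. The condition
  \<open>a \<le> real DIM('a)\<close> makes the exponent nonpositive, so the kernel is largest at
  the inner radius.\<close>

lemma nn_integral_near_powr: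
  fixes x :: "'a::euclidean_space"
  assumes a: "0 < a" "a \<le> real DIM('a)" and r: "0 < r"
  shows "(\<integral>\<^sup>+y. ennreal (norm (x - y) powr - (real DIM('a) - a)) * indicator {y. norm (x - y) < r} y \<partial>lborel)
    \<le> ennreal (unit_ball_vol (real DIM('a)) * 2 ^ DIM('a) / (1 - 2 powr - a) * r powr a)"
proof -
  let ?n = "real DIM('a)"
  define f where "f = (\<lambda>(j::nat) (y::'a). ennreal ((r / (2::real) ^ Suc j) powr - (?n - a)) * indicator (ball x (r / (2::real) ^ j)) y :: ennreal)"
  have [measurable]: "f j \<in> borel_measurable borel" for j
    unfolding f_def by (intro borel_measurable_times_ennreal borel_measurable_const borel_measurable_indicator) auto
  have pt: "ennreal (norm (x - y) powr - (?n - a)) * indicator {y. norm (x - y) < r} y \<le> (\<Sum>j. f j y)"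
    if "y \<noteq> x" for y
  proof (cases "norm (x - y) < r")
    case True
    define t where "t = r / norm (x - y)"
    have np: "norm (x - y) > 0" using \<open>y \<noteq> x\<close> by simp
    have t: "1 < t" using True np by (simp add: t_def)
    obtain m where m: "t \<le> 2 ^ m" using real_arch_pow[of 2 t] by (auto intro: less_imp_le)
    define M where "M = (LEAST m. t \<le> 2 ^ m)"
    have M: "t \<le> 2 ^ M" unfolding M_def using m by (rule LeastI)
    have "M \<noteq> 0" using M t by (cases M) auto
    then obtain j where j: "M = Suc j" by (cases M) auto
    have "\<not> t \<le> 2 ^ j" using not_less_Least[of j "\<lambda>m. t \<le> 2 ^ m"] j M_def by simp
    then have "2 ^ j * norm (x - y) < r"
      using np by (simp add: t_def not_le pos_less_divide_eq)
    then have hi: "norm (x - y) < r / 2 ^ j"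
      by (simp add: pos_less_divide_eq mult.commute)
    have "r \<le> 2 ^ Suc j * norm (x - y)"
      using M np unfolding j by (simp add: t_def pos_divide_le_eq)
    then have lo: "r / 2 ^ Suc j \<le> norm (x - y)"
      by (simp add: pos_divide_le_eq mult.commute)
    have "norm (x - y) powr - (?n - a) \<le> (r / 2 ^ Suc j) powr - (?n - a)"
      using lo r a by (intro powr_mono2') auto
    then have "ennreal (norm (x - y) powr - (?n - a)) * indicator {y. norm (x - y) < r} y \<le> f j y"
      using hi True by (auto simp: f_def dist_norm indicator_def intro!: ennreal_leI simp del: power_Suc)
    also have "\<dots> \<le> (\<Sum>j. f j y)"
      by (rule ennreal_le_suminf)
    finally show ?thesis .
  qed auto
  have "AE y in lborel. ennreal (norm (x - y) powr - (?n - a)) * indicator {y. norm (x - y) < r} y \<le> (\<Sum>j. f j y)"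
    using AE_lborel_singleton[of x] by eventually_elim (rule pt)
  then have "(\<integral>\<^sup>+y. ennreal (norm (x - y) powr - (?n - a)) * indicator {y. norm (x - y) < r} y \<partial>lborel)
     \<le> (\<integral>\<^sup>+y. (\<Sum>j. f j y) \<partial>lborel)"
    by (rule nn_integral_mono_AE)
  also have "\<dots> = (\<Sum>j. \<integral>\<^sup>+y. f j y \<partial>lborel)"
    by (rule nn_integral_suminf) simp
  also have "\<dots> \<le> (\<Sum>j. ennreal (unit_ball_vol ?n * (2::real) ^ DIM('a) * r powr a * (2 powr - a) ^ j))"
  proof (rule suminf_le)
    fix j
    have "(\<integral>\<^sup>+y. f j y \<partial>lborel) = ennreal ((r / 2 ^ Suc j) powr - (?n - a)) * ennreal (unit_ball_vol ?n * (r / 2 ^ j) ^ DIM('a))"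
      unfolding f_def using r by (subst nn_integral_cmult_indicator) (auto simp: emeasure_ball)
    also have "\<dots> = ennreal ((r / 2 ^ Suc j) powr - (?n - a) * (unit_ball_vol ?n * (r / 2 ^ j) ^ DIM('a)))"
      by (intro ennreal_mult'[symmetric]) auto
    also have "\<dots> \<le> ennreal (unit_ball_vol ?n * 2 ^ DIM('a) * r powr a * (2 powr - a) ^ j)"
    proof (intro ennreal_leI)
      have e1: "(r / 2 ^ j) ^ DIM('a) = 2 ^ DIM('a) * (r / 2 ^ Suc j) powr ?n"
        using r by (simp add: powr_realpow power_mult_distrib power_divide)
      have "(r / 2 ^ Suc j) powr - (?n - a) * (unit_ball_vol ?n * (r / 2 ^ j) ^ DIM('a))
        = unit_ball_vol ?n * 2 ^ DIM('a) * ((r / 2 ^ Suc j) powr (- (?n - a) + ?n))"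
        unfolding e1 powr_add by (simp add: algebra_simps)
      \<comment> \<open>A factor \<open>2 powr - a\<close> is given away so that the constant has
        the same form as in \<open>nn_integral_tail_powr\<close>.\<close>
      also have "(r / 2 ^ Suc j) powr (- (?n - a) + ?n) \<le> (r / 2 ^ j) powr a"
        using r a by (auto intro!: powr_mono2 divide_left_mono)
      also have "(r / 2 ^ j) powr a = r powr a * (2 powr - a) ^ j"
      proof -
        have "(2 powr - a) ^ j = 1 / (2 ^ j) powr a"
          unfolding power_of_two_powr[symmetric] by (simp add: powr_minus_divide)
        then show ?thesis using r by (simp add: powr_divide)
      qed
      finally show "(r / 2 ^ Suc j) powr - (?n - a) * (unit_ball_vol ?n * (r / 2 ^ j) ^ DIM('a))
         \<le> unit_ball_vol ?n * 2 ^ DIM('a) * r powr a * (2 powr - a) ^ j"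
        by (simp add: mult.assoc mult_left_mono)
    qed
    finally show "(\<integral>\<^sup>+y. f j y \<partial>lborel) \<le> ennreal (unit_ball_vol ?n * 2 ^ DIM('a) * r powr a * (2 powr - a) ^ j)" .
  qed auto
  also have "(\<Sum>j. ennreal (unit_ball_vol ?n * (2::real) ^ DIM('a) * r powr a * (2 powr - a) ^ j))
     = ennreal (unit_ball_vol ?n * 2 ^ DIM('a) * r powr a * (1 / (1 - 2 powr - a)))"
  proof (rule suminf_ennreal_eq)
    have "norm (2 powr - a) < 1" using a by (simp add: powr_less_one)
    from sums_mult[OF geometric_sums[OF this], of "unit_ball_vol ?n * 2 ^ DIM('a) * r powr a"]
    show "(\<lambda>i. unit_ball_vol ?n * 2 ^ DIM('a) * r powr a * (2 powr - a) ^ i) sums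
       (unit_ball_vol ?n * 2 ^ DIM('a) * r powr a * (1 / (1 - 2 powr - a)))" by simp
  qed auto
  finally show ?thesis by (simp add: field_simps)
qed

text \<open>The bounds may move with \<open>k\<close>: later they are energies of competitors, which
  themselves converge.\<close>

lemma nn_integral_Fatou_bound:
  fixes X :: "nat \<Rightarrow> 'b \<Rightarrow> ennreal"
  assumes [measurable]: "\<And>k. X k \<in> borel_measurable M"
    and lim: "AE x in M. (\<lambda>k. X k x) \<longlonglongrightarrow> Y x"
    and le: "\<And>k. (\<integral>\<^sup>+x. X k x \<partial>M) \<le> B k" and B: "B \<longlonglongrightarrow> b"
  shows "(\<integral>\<^sup>+x. Y x \<partial>M) \<le> b"
proof -
  have "(\<integral>\<^sup>+x. Y x \<partial>M) = (\<integral>\<^sup>+x. liminf (\<lambda>k. X k x) \<partial>M)"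
    using lim by (intro nn_integral_cong_AE, eventually_elim) (simp add: lim_imp_Liminf)
  also have "\<dots> \<le> liminf (\<lambda>k. \<integral>\<^sup>+x. X k x \<partial>M)"
    by (intro nn_integral_liminf) auto
  also have "\<dots> \<le> liminf B"
    using le by (intro Liminf_mono) auto
  also have "\<dots> = b"
    using B by (simp add: lim_imp_Liminf)
  finally show ?thesis .
qed

section \<open>The fractional difference quotient\<close>

text \<open>With \<open>r = shifted_order n s p\<close> the kernel exponent \<open>n + r p\<close> equals \<open>(n + s) p\<close>, so all
  Gagliardo integrals below are integrals of powers of one and the same difference quotient.\<close>

definition dq :: "real \<Rightarrow> ('a::euclidean_space \<Rightarrow> real) \<Rightarrow> 'a \<Rightarrow> 'a \<Rightarrow> real" where
  "dq s u x y = \<bar>u x - u y\<bar> / norm (x - y) powr (real DIM('a) + s)"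

text \<open>Iterated integrals with indicators, so that estimates at fixed \<open>x\<close> and
  Tonelli apply directly; \<open>gagliardo_integral_eq\<close> is the link to the integral over
  \<open>lebesgue_on (A \<times> A)\<close>.\<close>

definition frac_energy :: "real \<Rightarrow> real \<Rightarrow> 'a::euclidean_space set \<Rightarrow> ('a \<Rightarrow> real) \<Rightarrow> ennreal" where
  "frac_energy s p A u =
     (\<integral>\<^sup>+x. \<integral>\<^sup>+y. ennreal (dq s u x y powr p) * (indicator A x * indicator A y) \<partial>lborel \<partial>lborel)"

lemma dq_nonneg [simp]: "0 \<le> dq s u x y"
  by (simp add: dq_def)

lemma dq_measurable [measurable (raw)]:
  fixes u :: "'a::euclidean_space \<Rightarrow> real"
  assumes [measurable]: "u \<in> borel_measurable borel" "f \<in> M \<rightarrow>\<^sub>M borel" "g \<in> M \<rightarrow>\<^sub>M borel"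
  shows "(\<lambda>w. dq s u (f w) (g w)) \<in> borel_measurable M"
  unfolding dq_def by measurable

lemma borel_measurable_fst_borel [measurable]:
  "(fst :: 'a::euclidean_space \<times> 'b::euclidean_space \<Rightarrow> 'a) \<in> borel_measurable borel"
  "(snd :: 'a::euclidean_space \<times> 'b::euclidean_space \<Rightarrow> 'b) \<in> borel_measurable borel"
  by (auto intro!: borel_measurable_continuous_onI continuous_intros)

lemma frac_energy_UNIV:
  "frac_energy s p UNIV u = (\<integral>\<^sup>+x. \<integral>\<^sup>+y. ennreal (dq s u x y powr p) \<partial>lborel \<partial>lborel)"
  by (simp add: frac_energy_def)

lemma frac_energy_pair:
  assumes [measurable]: "u \<in> borel_measurable borel"
  shows "frac_energy s p UNIV u = (\<integral>\<^sup>+z. ennreal (dq s u (fst z) (snd z) powr p) \<partial>lborel)"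
  unfolding frac_energy_UNIV by (rule nn_integral_lborel_pair[symmetric]) measurable

lemma frac_energy_mono_set:
  assumes "A \<subseteq> B"
  shows "frac_energy s p A u \<le> frac_energy s p B u"
  unfolding frac_energy_def
  by (intro nn_integral_mono mult_left_mono) (use assms in \<open>auto simp: indicator_def\<close>)

text \<open>Serves for truncations such as \<open>min \<bar>u x\<bar> k\<close>, which are
  1-Lipschitz functions of the values of \<open>u\<close>.\<close>

lemma frac_energy_mono:
  assumes "\<And>x y. \<bar>v x - v y\<bar> \<le> \<bar>u x - u y\<bar>" "0 \<le> p"
  shows "frac_energy s p A v \<le> frac_energy s p A u"
  unfolding frac_energy_def dq_def
  by (intro nn_integral_mono mult_right_mono ennreal_leI powr_mono2 divide_right_mono) (use assms in auto)

lemma gagliardo_integral_eq: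
  fixes u v :: "'a::euclidean_space \<Rightarrow> real"
  assumes A [measurable]: "A \<in> sets borel" and v [measurable]: "v \<in> borel_measurable borel"
    and uv: "AE x in lborel. u x = v x" and p: "0 < p"
  shows "gagliardo_integral (shifted_order DIM('a) s p) p A u = frac_energy s p A v"
proof -
  have AA: "A \<times> A \<in> sets (borel :: ('a \<times> 'a) measure)"
    using A by (simp add: borel_prod[symmetric])
  have e: "real DIM('a) + shifted_order DIM('a) s p * p = (real DIM('a) + s) * p"
    using p by (simp add: shifted_order_def field_simps)
  have dqp: "\<bar>w x - w y\<bar> powr p / norm (x - y) powr (real DIM('a) + shifted_order DIM('a) s p * p) = dq s w x y powr p"
    for x y :: 'a and w
    unfolding e dq_def by (simp add: powr_divide powr_powr)
  have "gagliardo_integral (shifted_order DIM('a) s p) p A u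
     = (\<integral>\<^sup>+z. ennreal (dq s u (fst z) (snd z) powr p) * indicator (A \<times> A) z \<partial>lborel)"
    unfolding gagliardo_integral_def dqp nn_integral_lebesgue_on[OF AA] case_prod_beta' ..
  also have "\<dots> = (\<integral>\<^sup>+z. ennreal (dq s v (fst z) (snd z) powr p) * (indicator A (fst z) * indicator A (snd z)) \<partial>lborel)"
  proof (rule nn_integral_cong_AE)
    show "AE z in lborel. ennreal (dq s u (fst z) (snd z) powr p) * indicator (A \<times> A) z
      = ennreal (dq s v (fst z) (snd z) powr p) * (indicator A (fst z) * indicator A (snd z))"
      using AE_lborel_pair[OF uv uv]
      by eventually_elim (auto simp: dq_def indicator_def mem_Times_iff)
  qed
  also have "\<dots> = frac_energy s p A v"
    unfolding frac_energy_def by (rule nn_integral_lborel_pair) measurable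
  finally show ?thesis .
qed

lemma shifted_order_1 [simp]: "shifted_order n s 1 = s"
  by (simp add: shifted_order_def)

lemma gagliardo_integral_1_eq:
  fixes u v :: "'a::euclidean_space \<Rightarrow> real"
  assumes "A \<in> sets borel" "v \<in> borel_measurable borel" "AE x in lborel. u x = v x"
  shows "gagliardo_integral s 1 A u = frac_energy s 1 A v"
  using gagliardo_integral_eq[OF assms, of 1 s] by simp

lemma Lp_norm_lebesgue_on:
  assumes "A \<in> sets borel" "AE x in lborel. x \<in> A \<longrightarrow> u x = v x"
  shows "Lp_norm (lebesgue_on A) q u = ennpowr (\<integral>\<^sup>+x. ennreal (\<bar>v x\<bar> powr q) * indicator A x \<partial>lborel) (1/q)"
  unfolding Lp_norm_def nn_integral_lebesgue_on[OF assms(1)]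
  by (rule arg_cong[where f="\<lambda>x. ennpowr x _"], rule nn_integral_cong_AE)
     (use assms(2) in \<open>eventually_elim, auto simp: indicator_def\<close>)

lemma Lp_norm_lebesgue_on_lborel:
  assumes "A \<in> sets borel" "AE x in lborel. u x = v x" "\<And>x. x \<notin> A \<Longrightarrow> v x = 0"
  shows "Lp_norm (lebesgue_on A) q u = Lp_norm lborel q v"
proof -
  have "AE x in lborel. x \<in> A \<longrightarrow> u x = v x" using assms(2) by eventually_elim simp
  then have "Lp_norm (lebesgue_on A) q u = ennpowr (\<integral>\<^sup>+x. ennreal (\<bar>v x\<bar> powr q) * indicator A x \<partial>lborel) (1/q)"
    by (rule Lp_norm_lebesgue_on[OF assms(1)])
  also have "\<dots> = Lp_norm lborel q v" unfolding Lp_norm_def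
    by (rule arg_cong[where f="\<lambda>x. ennpowr x _"], rule nn_integral_cong) 
       (use assms(3) in \<open>auto simp: indicator_def\<close>)
  finally show ?thesis .
qed

lemma Lp_norm_lebesgue_UNIV:
  assumes "AE x in lborel. u x = v x"
  shows "Lp_norm lebesgue q u = Lp_norm lborel q v"
  using Lp_norm_lebesgue_on_lborel[of UNIV u v q] assms by (simp add: lebesgue_on_UNIV_eq)

lemma Lp_norm_1: "Lp_norm M 1 u = (\<integral>\<^sup>+x. ennreal \<bar>u x\<bar> \<partial>M)"
  by (simp add: Lp_norm_def)

lemma sobolev_norm_1: "sobolev_norm s 1 A u = Lp_norm (lebesgue_on A) 1 u + gagliardo_integral s 1 A u"
  by (simp add: sobolev_norm_def gagliardo_seminorm_def)

section \<open>The fractional Sobolev inequality\<close>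

text \<open>Integrate \<open>\<bar>u x\<bar> \<le> \<bar>u y\<bar> + \<bar>u x - u y\<bar>\<close>
  over the ball: there the denominator of \<open>dq\<close> is at most
  \<open>r powr (n + s)\<close>, with \<open>n\<close> the dimension, so the oscillation is paid for
  by the nonlocal integral at \<open>x\<close>. The next lemma optimises over
  \<open>r\<close>.\<close>

lemma ball_average_bound:
  fixes u :: "'a::euclidean_space \<Rightarrow> real"
  assumes [measurable]: "u \<in> borel_measurable borel" and r: "0 < r" and s: "0 < s"
  shows "ennreal \<bar>u x\<bar> * emeasure lborel (ball x r)
    \<le> (\<integral>\<^sup>+y. ennreal \<bar>u y * indicator (ball x r) y\<bar> \<partial>lborel)
      + ennreal (r powr (real DIM('a) + s)) * (\<integral>\<^sup>+y. ennreal (dq s u x y) \<partial>lborel)"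
proof -
  have "ennreal \<bar>u x\<bar> * emeasure lborel (ball x r) = (\<integral>\<^sup>+y. ennreal \<bar>u x\<bar> * indicator (ball x r) y \<partial>lborel)"
    by (subst nn_integral_cmult_indicator) auto
  also have "\<dots> \<le> (\<integral>\<^sup>+y. ennreal \<bar>u y * indicator (ball x r) y\<bar> + ennreal (r powr (real DIM('a) + s)) * ennreal (dq s u x y) \<partial>lborel)"
  proof (intro nn_integral_mono)
    fix y
    show "ennreal \<bar>u x\<bar> * indicator (ball x r) y
      \<le> ennreal \<bar>u y * indicator (ball x r) y\<bar> + ennreal (r powr (real DIM('a) + s)) * ennreal (dq s u x y)"
    proof (cases "y \<in> ball x r")
      case True
      have "\<bar>u x - u y\<bar> \<le> r powr (real DIM('a) + s) * dq s u x y"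
      proof (cases "x = y")
        case False
        then have pos: "norm (x - y) powr (real DIM('a) + s) > 0" by simp
        have "norm (x - y) powr (real DIM('a) + s) \<le> r powr (real DIM('a) + s)"
          using True s by (intro powr_mono2) (auto simp: dist_norm)
        then have "norm (x - y) powr (real DIM('a) + s) * dq s u x y \<le> r powr (real DIM('a) + s) * dq s u x y"
          by (intro mult_right_mono) auto
        then show ?thesis using pos by (simp add: dq_def)
      qed auto
      then have "\<bar>u x\<bar> \<le> \<bar>u y\<bar> + r powr (real DIM('a) + s) * dq s u x y" by linarith
      then have "ennreal \<bar>u x\<bar> \<le> ennreal (\<bar>u y\<bar> + r powr (real DIM('a) + s) * dq s u x y)"
        by (rule ennreal_leI)
      also have "\<dots> = ennreal \<bar>u y\<bar> + ennreal (r powr (real DIM('a) + s)) * ennreal (dq s u x y)"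
        by (simp add: ennreal_plus ennreal_mult')
      finally show ?thesis using True by simp
    qed auto
  qed
  also have "\<dots> = (\<integral>\<^sup>+y. ennreal \<bar>u y * indicator (ball x r) y\<bar> \<partial>lborel)
      + ennreal (r powr (real DIM('a) + s)) * (\<integral>\<^sup>+y. ennreal (dq s u x y) \<partial>lborel)"
  proof -
    have [measurable]: "(indicator (ball x r) :: 'a \<Rightarrow> real) \<in> borel_measurable borel"
      by (rule borel_measurable_indicator) simp
    show ?thesis
      by (subst nn_integral_add) (auto simp: nn_integral_cmult)
  qed
  finally show ?thesis .
qed

text \<open>The mean of \<open>\<bar>u\<bar>\<close> over a ball is bounded by Hoelder through the
  global norm \<open>Q\<close>, the oscillation through the integral of \<open>dq\<close>, and the
  radius balances the two. After raising to the power \<open>n / (n - s)\<close> the nonlocal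
  integral enters linearly, so the bound can be integrated in \<open>x\<close>. In \<open>K\<close>
  the first summand stems from the mean, the second from the oscillation.\<close>

lemma sobolev_pointwise:
  fixes u :: "'a::euclidean_space \<Rightarrow> real" and s :: real
  defines "n \<equiv> real DIM('a)"
  defines "K \<equiv> unit_ball_vol n powr (s / n - 1) + 1 / unit_ball_vol n"
  assumes u [measurable]: "u \<in> borel_measurable borel" and s: "0 < s" "s < 1"
    and Q: "Lp_norm lborel (n / (n - s)) u = ennreal Q" "0 < Q"
  shows "ennreal (\<bar>u x\<bar> powr (n / (n - s)))
    \<le> ennreal (K powr (n / (n - s)) * Q powr (n / (n - s) - 1)) * (\<integral>\<^sup>+y. ennreal (dq s u x y) \<partial>lborel)"
proof -
  define q where "q = n / (n - s)"
  define w where "w = unit_ball_vol n"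
  define I where "I = (\<integral>\<^sup>+y. ennreal (dq s u x y) \<partial>lborel)"
  have n: "1 \<le> n" unfolding n_def using DIM_positive[where 'a='a] by linarith
  have w: "0 < w" unfolding w_def n_def by simp
  have K: "0 < K" using w unfolding K_def w_def by (intro add_nonneg_pos) auto
  have q: "q > 1" "n / s > 1" "1 / q + 1 / (n / s) = 1"
    using n s by (auto simp: q_def field_simps)
  show ?thesis
  proof (cases "I = \<infinity>")
    case True
    then show ?thesis using K Q(2) unfolding I_def
      by (simp add: ennreal_mult_top)
  next
    case False
    then obtain G where G: "I = ennreal G" "0 \<le> G" by (cases I) auto
    \<comment> \<open>\<open>G\<close> may be 0, and then no finite radius balances the terms; the
      bound is shown for \<open>G + e\<close>, and \<open>e\<close> tends to 0 afterwards.\<close>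
    have main: "\<bar>u x\<bar> powr q \<le> K powr q * Q powr (q - 1) * (G + e)" if e: "0 < e" for e
    proof -
      define G' where "G' = G + e"
      have G': "0 < G'" "G \<le> G'" using e G by (auto simp: G'_def)
      \<comment> \<open>With \<open>r powr n = Q / G'\<close> both terms become a constant times
        \<open>Q powr (s / n) * G' powr (1 - s / n)\<close>.\<close>
      define r where "r = (Q / G') powr (1 / n)"
      have r: "0 < r" using Q G' by (simp add: r_def)
      have rn: "r powr n = Q / G'" using n Q G' by (simp add: r_def powr_powr)
      have vol: "emeasure lborel (ball x r) = ennreal (w * r powr n)"
        using r by (simp add: emeasure_ball w_def n_def powr_realpow)
      have "ennreal \<bar>u x\<bar> * emeasure lborel (ball x r)
        \<le> (\<integral>\<^sup>+y. ennreal \<bar>u y * indicator (ball x r) y\<bar> \<partial>lborel) + ennreal (r powr (n + s)) * I"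
        unfolding n_def I_def by (rule ball_average_bound) (use r s in auto)
      also have "(\<integral>\<^sup>+y. ennreal \<bar>u y * indicator (ball x r) y\<bar> \<partial>lborel)
         \<le> ennreal Q * ennreal ((w * r powr n) powr (s / n))"
      proof -
        have ind: "\<bar>indicator (ball x r) y :: real\<bar> powr (n / s) = indicator (ball x r) y" for y
          by (auto simp: indicator_def)
        have L: "Lp_norm lborel (n / s) (indicator (ball x r)) = ennreal ((w * r powr n) powr (1 / (n/s)))"
        proof (rule Lp_norm_eq_powr)
          show "(\<integral>\<^sup>+y. ennreal (\<bar>indicator (ball x r) y\<bar> powr (n / s)) \<partial>lborel) = ennreal (w * r powr n)"
            unfolding ind ennreal_indicator by (simp add: vol)
        qed (use w in auto)
        have "(\<integral>\<^sup>+y. ennreal \<bar>u y * indicator (ball x r) y\<bar> \<partial>lborel)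
            \<le> Lp_norm lborel q u * Lp_norm lborel (n / s) (indicator (ball x r))"
          using q Q(1) L by (intro Holder_inequality_nn borel_measurable_indicator) (auto simp: q_def)
        then show ?thesis using Q(1) L by (simp add: q_def)
      qed
      also have "ennreal (r powr (n + s)) * I \<le> ennreal (r powr (n + s)) * ennreal G'"
        unfolding G(1) using G' by (intro mult_left_mono ennreal_leI) auto
      finally have "ennreal (\<bar>u x\<bar> * (w * r powr n)) \<le> ennreal (Q * (w * r powr n) powr (s / n) + r powr (n + s) * G')"
        using Q G' w by (simp add: vol ennreal_mult' ennreal_plus)
      then have "\<bar>u x\<bar> * (w * r powr n) \<le> Q * (w * r powr n) powr (s / n) + r powr (n + s) * G'"
        using Q G' by (subst (asm) ennreal_le_iff) auto
      also have "r powr (n + s) * G' = r powr n * (r powr s * G')"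
        by (simp add: powr_add)
      also have "Q * (w * r powr n) powr (s / n) = w * r powr n * (w powr (s / n - 1) * ((r powr n) powr (s / n - 1) * Q))"
        using w r by (simp add: powr_mult powr_diff)
      finally have "w * r powr n * \<bar>u x\<bar> \<le> w * r powr n * (w powr (s / n - 1) * ((r powr n) powr (s / n - 1) * Q) + r powr s * G' / w)"
        using w by (simp add: distrib_left mult.commute mult.left_commute)
      then have "\<bar>u x\<bar> \<le> w powr (s / n - 1) * ((r powr n) powr (s / n - 1) * Q) + r powr s * G' / w"
        using w r by (subst (asm) mult_le_cancel_left_pos) auto
      also have "(r powr n) powr (s / n - 1) * Q = Q powr (s / n) * G' powr (1 - s / n)"
        unfolding rn using Q G' by (simp add: powr_divide powr_diff)
      also have "r powr s * G' = Q powr (s / n) * G' powr (1 - s / n)"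
      proof -
        have "r powr s = (r powr n) powr (s / n)" using n by (simp add: powr_powr)
        also have "\<dots> = Q powr (s / n) / G' powr (s / n)" unfolding rn using Q G' by (simp add: powr_divide)
        finally show ?thesis using G' by (simp add: powr_diff)
      qed
      finally have "\<bar>u x\<bar> \<le> K * (Q powr (s / n) * G' powr (1 - s / n))"
        by (simp add: K_def w_def algebra_simps)
      then have "\<bar>u x\<bar> powr q \<le> (K * (Q powr (s / n) * G' powr (1 - s / n))) powr q"
        using q by (intro powr_mono2) auto
      also have "\<dots> = K powr q * (Q powr (s / n * q) * G' powr ((1 - s / n) * q))"
        using K Q G' by (simp add: powr_mult powr_powr)
      also have "s / n * q = q - 1" using n s by (simp add: q_def field_simps)
      also have "(1 - s / n) * q = 1" using n s by (simp add: q_def field_simps)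
      finally show ?thesis using G' by (simp add: G'_def mult.assoc)
    qed
    define c where "c = K powr q * Q powr (q - 1)"
    have c: "0 < c" using K Q by (simp add: c_def)
    have "\<bar>u x\<bar> powr q \<le> c * G"
    proof (rule field_le_epsilon)
      fix e :: real assume "0 < e"
      then have "\<bar>u x\<bar> powr q \<le> c * (G + e / c)" using main[of "e / c"] c by (simp add: c_def)
      then show "\<bar>u x\<bar> powr q \<le> c * G + e" using c by (simp add: distrib_left)
    qed
    then have "ennreal (\<bar>u x\<bar> powr q) \<le> ennreal c * I"
      unfolding G(1) using c by (subst ennreal_mult'[symmetric]) (auto intro: ennreal_leI)
    then show ?thesis by (simp add: c_def q_def I_def)
  qed
qed

text \<open>Integrating \<open>sobolev_pointwise\<close> gives
  \<open>Q powr q \<le> K powr q * Q powr (q - 1) * E\<close>. Finiteness of \<open>Q\<close> is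
  what allows \<open>Q powr (q - 1)\<close> to be cancelled.\<close>

lemma sobolev_bounded:
  fixes u :: "'a::euclidean_space \<Rightarrow> real" and s :: real
  defines "n \<equiv> real DIM('a)"
  defines "K \<equiv> unit_ball_vol n powr (s / n - 1) + 1 / unit_ball_vol n"
  assumes u [measurable]: "u \<in> borel_measurable borel" and s: "0 < s" "s < 1"
    and fin: "Lp_norm lborel (n / (n - s)) u < \<infinity>"
  shows "Lp_norm lborel (n / (n - s)) u \<le> ennreal (K powr (n / (n - s))) * frac_energy s 1 UNIV u"
proof -
  define q where "q = n / (n - s)"
  have n: "1 \<le> n" unfolding n_def using DIM_positive[where 'a='a] by linarith
  have q: "1 < q" using n s by (simp add: q_def)
  obtain Q where Q: "Lp_norm lborel q u = ennreal Q" "0 \<le> Q" 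
    using fin by (cases "Lp_norm lborel q u") (auto simp: q_def)
  show ?thesis
  proof (cases "Q = 0 \<or> frac_energy s 1 UNIV u = \<infinity>")
    case True
    have K: "K > 0" unfolding K_def n_def by (intro add_nonneg_pos) auto
    from True show ?thesis
      using Q(1) K by (auto simp: q_def ennreal_mult_top)
  next
    case False
    then have Qp: "Q > 0" using Q(2) by simp
    obtain E where E: "frac_energy s 1 UNIV u = ennreal E" "0 \<le> E" 
      using False by (cases "frac_energy s 1 UNIV u") auto
    define c where "c = K powr q * Q powr (q - 1)"
    obtain P where P: "(\<integral>\<^sup>+x. ennreal (\<bar>u x\<bar> powr q) \<partial>lborel) = ennreal P" "0 \<le> P"
      using fin by (cases "\<integral>\<^sup>+x. ennreal (\<bar>u x\<bar> powr q) \<partial>lborel") (auto simp: Lp_norm_def q_def)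
    have "Q = P powr (1 / q)" using Q Lp_norm_eq_powr[OF P] by simp
    then have PQ: "P = Q powr q" using P(2) q by (simp add: powr_powr)
    have "ennreal P \<le> (\<integral>\<^sup>+x. ennreal c * (\<integral>\<^sup>+y. ennreal (dq s u x y) \<partial>lborel) \<partial>lborel)"
      unfolding P(1)[symmetric] c_def q_def K_def n_def
      by (intro nn_integral_mono sobolev_pointwise u s) (use Q Qp in \<open>auto simp: q_def n_def\<close>)
    also have "\<dots> = ennreal c * frac_energy s 1 UNIV u"
      by (subst nn_integral_cmult) (auto simp: frac_energy_UNIV)
    also have "\<dots> = ennreal (c * E)" unfolding E(1) by (simp add: ennreal_mult' c_def)
    finally have "P \<le> c * E" using E(2) by (subst (asm) ennreal_le_iff) (auto simp: c_def)
    then have "Q powr (q - 1) * Q \<le> Q powr (q - 1) * (K powr q * E)"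
      unfolding PQ c_def using Qp by (simp add: powr_diff mult_ac)
    then have "Q \<le> K powr q * E"
      using Qp by (subst (asm) mult_le_cancel_left_pos) auto
    then show ?thesis
      using Q(1) E by (auto simp: q_def ennreal_mult'[symmetric] intro: ennreal_leI)
  qed
qed

text \<open>The truncations of \<open>\<bar>u\<bar>\<close> at height \<open>k\<close> are bounded
  and integrable, hence have finite \<open>q\<close>-norm, and do not increase the energy. So
  \<open>sobolev_bounded\<close> applies to them with a constant independent of \<open>k\<close>,
  and Fatou's lemma removes the truncation.\<close>

theorem fractional_sobolev:
  fixes u :: "'a::euclidean_space \<Rightarrow> real" and s :: real
  defines "n \<equiv> real DIM('a)"
  defines "K \<equiv> unit_ball_vol n powr (s / n - 1) + 1 / unit_ball_vol n"
  assumes u [measurable]: "u \<in> borel_measurable borel" and s: "0 < s" "s < 1"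
    and fin: "(\<integral>\<^sup>+x. ennreal \<bar>u x\<bar> \<partial>lborel) < \<infinity>"
  shows "Lp_norm lborel (n / (n - s)) u \<le> ennreal (K powr (n / (n - s))) * frac_energy s 1 UNIV u"
proof -
  define q where "q = n / (n - s)"
  have n: "1 \<le> n" unfolding n_def using DIM_positive[where 'a='a] by linarith
  have q: "1 < q" using n s by (simp add: q_def)
  define T where "T = (\<lambda>(k::nat) x. min \<bar>u x\<bar> (real k))"
  have [measurable]: "T k \<in> borel_measurable borel" for k unfolding T_def by measurable
  define B where "B = ennreal (K powr q) * frac_energy s 1 UNIV u"
  have le: "Lp_norm lborel q (T k) \<le> B" for k
  proof -
    have "(\<integral>\<^sup>+x. ennreal (\<bar>T k x\<bar> powr q) \<partial>lborel) \<le> (\<integral>\<^sup>+x. ennreal (real k powr (q - 1)) * ennreal \<bar>u x\<bar> \<partial>lborel)"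
    proof (intro nn_integral_mono)
      fix x
      have "\<bar>T k x\<bar> powr q = T k x powr (q - 1) * T k x powr 1"
        unfolding powr_add[symmetric] by (simp add: T_def)
      also have "\<dots> \<le> real k powr (q - 1) * \<bar>u x\<bar>"
        using q by (intro mult_mono powr_mono2) (auto simp: T_def)
      finally show "ennreal (\<bar>T k x\<bar> powr q) \<le> ennreal (real k powr (q - 1)) * ennreal \<bar>u x\<bar>"
        by (simp add: ennreal_leI flip: ennreal_mult')
    qed
    also have "\<dots> < \<infinity>" using fin by (simp add: nn_integral_cmult ennreal_mult_less_top)
    finally have "Lp_norm lborel q (T k) < \<infinity>" by (simp add: Lp_norm_def)
    then have "Lp_norm lborel q (T k) \<le> ennreal (K powr q) * frac_energy s 1 UNIV (T k)"
      unfolding q_def K_def n_def by (intro sobolev_bounded s) auto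
    also have "\<dots> \<le> B" unfolding B_def
      by (intro mult_left_mono frac_energy_mono) (auto simp: T_def)
    finally show ?thesis .
  qed
  have "ennpowr (Lp_norm lborel q u) q \<le> ennpowr B q"
  proof -
    have ee: "ennpowr (Lp_norm lborel q v) q = (\<integral>\<^sup>+x. ennreal (\<bar>v x\<bar> powr q) \<partial>lborel)" for v :: "'a \<Rightarrow> real"
      using q by (simp add: Lp_norm_def ennpowr_ennpowr)
    show ?thesis unfolding ee
    proof (rule nn_integral_Fatou_bound[where B="\<lambda>_. ennpowr B q" and X="\<lambda>k x. ennreal (\<bar>T k x\<bar> powr q)"])
      show "(\<integral>\<^sup>+x. ennreal (\<bar>T k x\<bar> powr q) \<partial>lborel) \<le> ennpowr B q" for k
        unfolding ee[symmetric] using le q by (intro ennpowr_mono) auto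
      show "AE x in lborel. (\<lambda>k. ennreal (\<bar>T k x\<bar> powr q)) \<longlonglongrightarrow> ennreal (\<bar>u x\<bar> powr q)"
      proof (intro AE_I2 tendsto_eventually)
        fix x
        obtain N where "\<bar>u x\<bar> \<le> real N" using real_arch_simple by blast
        then show "eventually (\<lambda>k. ennreal (\<bar>T k x\<bar> powr q) = ennreal (\<bar>u x\<bar> powr q)) sequentially"
          by (intro eventually_sequentiallyI[of N]) (auto simp: T_def min_def)
      qed
    qed auto
  qed
  then have le: "ennpowr (ennpowr (Lp_norm lborel q u) q) (1/q) \<le> ennpowr (ennpowr B q) (1/q)"
    using q by (auto intro: ennpowr_mono[of _ _ "1/q"])
  have "ennpowr (ennpowr L q) (1/q) = L" for L
    using q ennpowr_ennpowr[of q L "1/q"] by simp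
  with le show ?thesis by (simp add: B_def q_def)
qed

text \<open>The crude constant of \<open>fractional_sobolev\<close> shows that the set under
  \<open>Inf\<close> is nonempty; \<open>Inf\<close> of an empty set would be an unspecified real.
  The inequality then passes to the infimum after division by the finite seminorm \<open>g\<close>,
  the case \<open>g = 0\<close> being separate.\<close>

theorem sobolev_constant_inequality:
  fixes u :: "'a::euclidean_space \<Rightarrow> real"
  assumes s: "0 < s" "s < 1" and u: "u \<in> borel_measurable lebesgue" "sobolev_norm s 1 UNIV u < \<infinity>"
  shows "Lp_norm lebesgue (real DIM('a) / (real DIM('a) - s)) u
    \<le> ennreal (sobolev_constant TYPE('a) s) * gagliardo_integral s 1 UNIV u"
    and "0 \<le> sobolev_constant TYPE('a) s"
proof -
  let ?n = "real DIM('a)"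
  let ?q = "?n / (?n - s)"
  define X where "X = {C. 0 \<le> C \<and>
        (\<forall>u :: 'a \<Rightarrow> real. u \<in> borel_measurable lebesgue \<longrightarrow> sobolev_norm s 1 UNIV u < \<infinity> \<longrightarrow>
           Lp_norm lebesgue ?q u \<le> ennreal C * gagliardo_seminorm s 1 UNIV u)}"
  have S: "sobolev_constant TYPE('a) s = Inf X" by (simp add: sobolev_constant_def X_def)
  define K where "K = (unit_ball_vol ?n powr (s / ?n - 1) + 1 / unit_ball_vol ?n) powr ?q"
  have "Lp_norm lebesgue ?q v \<le> ennreal K * gagliardo_seminorm s 1 UNIV v"
    if v: "v \<in> borel_measurable lebesgue" "sobolev_norm s 1 UNIV v < \<infinity>" for v :: "'a \<Rightarrow> real"
  proof -
    obtain w where w: "w \<in> borel_measurable borel" "AE x in lborel. v x = w x"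
      using borel_representative[OF v(1), of UNIV] by auto
    have "(\<integral>\<^sup>+x. ennreal \<bar>w x\<bar> \<partial>lborel) < \<infinity>"
      using v(2) Lp_norm_lebesgue_UNIV[OF w(2), of 1] by (simp add: sobolev_norm_1 lebesgue_on_UNIV_eq Lp_norm_1)
    from fractional_sobolev[OF w(1) s this] show ?thesis
      using w by (simp add: K_def Lp_norm_lebesgue_UNIV[OF w(2)] gagliardo_seminorm_def gagliardo_integral_1_eq[OF _ w])
  qed
  then have K: "K \<in> X" by (auto simp: X_def K_def)
  have nn: "\<And>C. C \<in> X \<Longrightarrow> 0 \<le> C" by (auto simp: X_def)
  show "0 \<le> sobolev_constant TYPE('a) s"
    unfolding S using K nn by (intro cInf_greatest) auto
  have X: "Lp_norm lebesgue ?q u \<le> ennreal C * gagliardo_integral s 1 UNIV u" if "C \<in> X" for C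
    using that u by (auto simp: X_def gagliardo_seminorm_def)
  obtain g where g: "gagliardo_integral s 1 UNIV u = ennreal g" "0 \<le> g"
    using u(2) by (cases "gagliardo_integral s 1 UNIV u") (auto simp: sobolev_norm_1)
  have "Lp_norm lebesgue ?q u < \<infinity>"
    using X[OF K] g by (auto simp: ennreal_mult_less_top intro: order_le_less_trans)
  then obtain l where l: "Lp_norm lebesgue ?q u = ennreal l" "0 \<le> l"
    by (cases "Lp_norm lebesgue ?q u") auto
  have lC: "l \<le> C * g" if "C \<in> X" for C
    using X[OF that] nn[OF that] g l by (simp add: ennreal_mult'[symmetric])
  have "l \<le> Inf X * g"
  proof (cases "g = 0")
    case False
    then have "l / g \<le> Inf X" using K lC g by (intro cInf_greatest) (auto simp: divide_le_eq)
    then show ?thesis using False g by (simp add: divide_le_eq)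
  qed (use lC[OF K] in auto)
  then show "Lp_norm lebesgue ?q u \<le> ennreal (sobolev_constant TYPE('a) s) * gagliardo_integral s 1 UNIV u"
    unfolding S l g using g cInf_greatest[of X 0] K nn
    by (subst ennreal_mult'[symmetric]) (auto intro: ennreal_leI)
qed

section \<open>Compactness\<close>

lemma tendsto_0_if_le_ennreal:
  fixes X :: "nat \<Rightarrow> ennreal"
  assumes "\<And>e. 0 < e \<Longrightarrow> \<exists>N. \<forall>k\<ge>N. X k \<le> ennreal e"
  shows "X \<longlonglongrightarrow> 0"
proof (rule order_tendstoI)
  fix a :: ennreal assume "0 < a"
  then obtain e where e: "0 < e" "ennreal e < a"
    by (metis dense ennreal_cases ennreal_less_iff ennreal_less_top less_top not_less_iff_gr_or_eq zero_less_iff_neq_zero ennreal_eq_0_iff not_le)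
  with assms[OF e(1)] show "eventually (\<lambda>k. X k < a) sequentially"
    by (auto simp: eventually_sequentially intro: order_le_less_trans)
qed auto

text \<open>Rounds every coordinate down to a grid of step \<open>d / (2 * n)\<close>, with
  \<open>n\<close> the dimension. The countable range reduces the convergence of local averages to
  countably many real sequences.\<close>

lemma countable_quantisation:
  fixes d :: real
  assumes d: "0 < d"
  obtains q :: "'a::euclidean_space \<Rightarrow> 'a"
  where "q \<in> borel_measurable borel" "countable (range q)" "\<And>x. norm (x - q x) < d"
proof -
  define e where "e = d / (2 * real DIM('a))"
  have e: "0 < e" using d by (simp add: e_def)
  define q where "q = (\<lambda>x::'a. \<Sum>b\<in>Basis. (of_int \<lfloor>(x \<bullet> b) / e\<rfloor> * e) *\<^sub>R b)"
  show thesis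
  proof (rule that[of q])
    show "q \<in> borel_measurable borel" unfolding q_def by measurable
    have "range q \<subseteq> (\<lambda>g. \<Sum>b\<in>Basis. (of_int (g b) * e) *\<^sub>R b) ` (Basis \<rightarrow>\<^sub>E (UNIV :: int set))"
    proof safe
      fix x
      have "q x = (\<Sum>b\<in>Basis. (of_int ((\<lambda>b\<in>Basis. \<lfloor>(x \<bullet> b) / e\<rfloor>) b) * e) *\<^sub>R b)"
        unfolding q_def by (intro sum.cong) auto
      then show "q x \<in> (\<lambda>g. \<Sum>b\<in>Basis. (of_int (g b) * e) *\<^sub>R b) ` (Basis \<rightarrow>\<^sub>E (UNIV :: int set))"
        by (rule image_eqI[where x="\<lambda>b\<in>Basis. \<lfloor>(x \<bullet> b) / e\<rfloor>"]) auto
    qed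
    then show "countable (range q)"
      by (rule countable_subset) (intro countable_image countable_PiE, auto)
    fix x
    have "norm (x - q x) \<le> (\<Sum>b\<in>Basis. \<bar>(x - q x) \<bullet> b\<bar>)" by (rule norm_le_l1)
    also have "\<dots> \<le> (\<Sum>b\<in>(Basis::'a set). e)"
    proof (intro sum_mono)
      fix b :: 'a assume b: "b \<in> Basis"
      then have "(x - q x) \<bullet> b = x \<bullet> b - of_int \<lfloor>(x \<bullet> b) / e\<rfloor> * e"
        by (simp add: q_def inner_diff_left inner_sum_left inner_Basis if_distrib cong: if_cong)
      also have "\<dots> = e * frac ((x \<bullet> b) / e)" using e by (simp add: frac_def field_simps)
      finally show "\<bar>(x - q x) \<bullet> b\<bar> \<le> e"
        using e frac_lt_1[of "(x \<bullet> b) / e"] frac_ge_0[of "(x \<bullet> b) / e"] by (simp add: abs_mult mult_le_cancel_left1)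
    qed
    also have "\<dots> < d" using d by (simp add: e_def)
    finally show "norm (x - q x) < d" .
  qed
qed

text \<open>The average is taken around the rounded point \<open>q x\<close>. A point
  \<open>y\<close> of that ball has distance less than \<open>2 * d\<close> from \<open>x\<close>,
  so \<open>\<bar>u x - u y\<bar>\<close> is at most
  \<open>(2 * d) powr (n + s) * dq s u x y\<close>; dividing by the volume of the ball leaves the
  rate \<open>d powr s\<close>.\<close>

lemma quantised_average_error:
  fixes u :: "'a::euclidean_space \<Rightarrow> real"
  assumes u [measurable]: "u \<in> borel_measurable borel" and iu: "integrable lborel u"
    and d: "0 < d" and s: "0 < s"
    and q [measurable]: "q \<in> borel_measurable borel" and qd: "\<And>x. norm (x - q x) < d"
  shows "(\<integral>\<^sup>+x. ennreal \<bar>u x - (\<integral>y. u y * (if norm (q x - y) < d then 1 else 0) \<partial>lborel) / (unit_ball_vol (real DIM('a)) * d powr real DIM('a))\<bar> \<partial>lborel)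
    \<le> ennreal (2 powr (real DIM('a) + s) / unit_ball_vol (real DIM('a)) * d powr s) * frac_energy s 1 UNIV u"
proof -
  define n where "n = real DIM('a)"
  define V where "V = unit_ball_vol n * d powr n"
  have V: "0 < V" using d by (simp add: V_def n_def)
  define k where "k = (\<lambda>x y. if norm (q x - y) < d then 1 else (0::real))"
  have kb: "k x = indicator (ball (q x) d)" for x
    by (auto simp: k_def fun_eq_iff indicator_def dist_norm)
  have km: "k x \<in> borel_measurable borel" for x unfolding kb by (intro borel_measurable_indicator) simp
  have kV: "(\<integral>\<^sup>+y. ennreal (k x y) \<partial>lborel) = ennreal V" for x
    using d unfolding kb ennreal_indicator
    by (simp add: emeasure_ball V_def n_def powr_realpow)
  then have ik: "integrable lborel (k x)" for x
    using km by (intro integrableI_nn_integral_finite[where x=V]) (use V in \<open>auto simp: k_def\<close>)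
  have iV: "(\<integral>y. k x y \<partial>lborel) = V" for x
    using nn_integral_eq_integral[OF ik, of x] kV[of x] V
    by (simp add: k_def integral_nonneg_AE)
  define c where "c = (2 * d) powr (n + s) / V"
  have c: "0 \<le> c" using V d by (simp add: c_def)
  have pt: "ennreal \<bar>u x - (\<integral>y. u y * k x y \<partial>lborel) / V\<bar> \<le> ennreal c * (\<integral>\<^sup>+y. ennreal (dq s u x y) \<partial>lborel)" for x
  proof -
    have iuk: "integrable lborel (\<lambda>y. u y * k x y)"
      by (rule Bochner_Integration.integrable_bound[OF iu])
         (use km in \<open>auto simp: k_def intro!: borel_measurable_times\<close>)
    have "u x - (\<integral>y. u y * k x y \<partial>lborel) / V = ((\<integral>y. u x * k x y \<partial>lborel) - (\<integral>y. u y * k x y \<partial>lborel)) / V"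
      using V iV[of x] by (simp add: field_simps)
    also have "(\<integral>y. u x * k x y \<partial>lborel) - (\<integral>y. u y * k x y \<partial>lborel) = (\<integral>y. u x * k x y - u y * k x y \<partial>lborel)"
      using ik iuk by (intro Bochner_Integration.integral_diff[symmetric]) auto
    finally have e: "\<bar>u x - (\<integral>y. u y * k x y \<partial>lborel) / V\<bar> = \<bar>\<integral>y. u x * k x y - u y * k x y \<partial>lborel\<bar> / V"
      using V by simp
    have "ennreal \<bar>\<integral>y. u x * k x y - u y * k x y \<partial>lborel\<bar> \<le> ennreal (\<integral>y. \<bar>u x * k x y - u y * k x y\<bar> \<partial>lborel)"
      by (intro ennreal_leI integral_abs_bound)
    also have "\<dots> = (\<integral>\<^sup>+y. ennreal \<bar>u x * k x y - u y * k x y\<bar> \<partial>lborel)"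
      using ik iuk by (intro nn_integral_eq_integral[symmetric]) auto
    also have "\<dots> \<le> (\<integral>\<^sup>+y. ennreal ((2 * d) powr (n + s)) * ennreal (dq s u x y) \<partial>lborel)"
    proof (intro nn_integral_mono)
      fix y
      have "\<bar>u x * k x y - u y * k x y\<bar> \<le> (2 * d) powr (n + s) * dq s u x y"
      proof (cases "norm (q x - y) < d \<and> x \<noteq> y")
        case True
        have "norm (x - y) < 2 * d"
          using True qd[of x] norm_triangle_ineq[of "x - q x" "q x - y"] by simp
        then have "norm (x - y) powr (n + s) \<le> (2 * d) powr (n + s)"
          using s by (intro powr_mono2) (auto simp: n_def)
        then have "norm (x - y) powr (n + s) * dq s u x y \<le> (2 * d) powr (n + s) * dq s u x y"
          by (intro mult_right_mono) auto
        moreover have "norm (x - y) powr (n + s) * dq s u x y = \<bar>u x - u y\<bar>"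
          using True by (simp add: dq_def n_def)
        ultimately show ?thesis using True by (simp add: k_def)
      qed (auto simp: k_def)
      then show "ennreal \<bar>u x * k x y - u y * k x y\<bar> \<le> ennreal ((2 * d) powr (n + s)) * ennreal (dq s u x y)"
        by (simp add: ennreal_leI flip: ennreal_mult')
    qed
    also have "\<dots> = ennreal ((2 * d) powr (n + s)) * (\<integral>\<^sup>+y. ennreal (dq s u x y) \<partial>lborel)"
      by (rule nn_integral_cmult) measurable
    finally have "ennreal (1 / V) * ennreal \<bar>\<integral>y. u x * k x y - u y * k x y \<partial>lborel\<bar> \<le> 
       ennreal (1 / V) * (ennreal ((2 * d) powr (n + s)) * (\<integral>\<^sup>+y. ennreal (dq s u x y) \<partial>lborel))"
      by (intro mult_left_mono) auto
    then show ?thesis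
      unfolding e c_def using V by (simp add: ennreal_mult'[symmetric] mult.assoc[symmetric])
  qed
  have "(\<integral>\<^sup>+x. ennreal \<bar>u x - (\<integral>y. u y * k x y \<partial>lborel) / V\<bar> \<partial>lborel) 
      \<le> (\<integral>\<^sup>+x. ennreal c * (\<integral>\<^sup>+y. ennreal (dq s u x y) \<partial>lborel) \<partial>lborel)"
    by (intro nn_integral_mono pt)
  also have "\<dots> = ennreal c * frac_energy s 1 UNIV u"
    by (subst nn_integral_cmult) (auto simp: frac_energy_UNIV)
  also have "c = 2 powr (n + s) / unit_ball_vol n * d powr s"
    using d by (simp add: c_def V_def powr_mult powr_add)
  finally show ?thesis unfolding k_def V_def n_def .
qed

text \<open>A Frechet-Kolmogorov argument: averages at scale \<open>d m\<close> approximate all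
  \<open>u k\<close> in the mean with an error of order \<open>d m powr s\<close> that is uniform in
  \<open>k\<close>. Only countably many averages occur, so one diagonal subsequence makes them all
  converge.\<close>

theorem fractional_compactness:
  fixes u :: "nat \<Rightarrow> 'a::euclidean_space \<Rightarrow> real"
  assumes u [measurable]: "\<And>k. u k \<in> borel_measurable borel" and A: "bounded A" "A \<in> sets borel"
    and off: "\<And>k x. x \<notin> A \<Longrightarrow> u k x = 0" and s: "0 < s"
    and M: "\<And>k. (\<integral>\<^sup>+x. ennreal \<bar>u k x\<bar> \<partial>lborel) \<le> ennreal M"
    and E: "\<And>k. frac_energy s 1 UNIV (u k) \<le> ennreal E"
  obtains r v where "strict_mono r" "v \<in> borel_measurable borel" "\<And>x. x \<notin> A \<Longrightarrow> v x = 0"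
    "AE x in lborel. (\<lambda>k. u (r k) x) \<longlonglongrightarrow> v x"
    "(\<lambda>k. \<integral>\<^sup>+x. ennreal \<bar>u (r k) x - v x\<bar> \<partial>lborel) \<longlonglongrightarrow> 0"
proof -
  define n where "n = real DIM('a)"
  define w where "w = unit_ball_vol n"
  have w: "0 < w" by (simp add: w_def n_def)
  define d where "d = (\<lambda>m. 1 / real (Suc m))"
  have d: "0 < d m" for m by (simp add: d_def)
  have iu: "integrable lborel (u k)" for k
    by (rule integrableI_bounded) (use M[of k] in \<open>auto intro: order_le_less_trans\<close>)
  have "\<exists>q :: 'a \<Rightarrow> 'a. q \<in> borel_measurable borel \<and> countable (range q) \<and> (\<forall>x. norm (x - q x) < d m)" for m
    using countable_quantisation[OF d[of m]] by metis
  then obtain q :: "nat \<Rightarrow> 'a \<Rightarrow> 'a" where q [measurable]: "\<And>m. q m \<in> borel_measurable borel"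
    and qc: "\<And>m. countable (range (q m))" and qd: "\<And>m x. norm (x - q m x) < d m"
    by metis
  \<comment> \<open>A pair consists of a scale and the centre of a ball of that scale; quantisation
    makes the set of pairs countable.\<close>
  define S where "S = (SIGMA m:UNIV. range (q m))"
  have S: "countable S" unfolding S_def by (intro countable_SIGMA qc) auto
  define I where "I = (\<lambda>k (m, c). \<integral>y. u k y * (if norm (c - y) < d m then 1 else 0) \<partial>lborel)"
  have Ib: "norm (I k z) \<le> \<bar>M\<bar>" for k z
  proof (cases z)
    case (Pair m c)
    have "ennreal \<bar>I k z\<bar> \<le> ennreal (\<integral>y. \<bar>u k y * (if norm (c - y) < d m then 1 else 0)\<bar> \<partial>lborel)"
      unfolding I_def Pair by (auto intro!: ennreal_leI integral_abs_bound)
    also have "\<dots> \<le> ennreal (\<integral>y. \<bar>u k y\<bar> \<partial>lborel)"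
      by (intro ennreal_leI integral_mono' integrable_abs iu) auto
    also have "\<dots> = (\<integral>\<^sup>+x. ennreal \<bar>u k x\<bar> \<partial>lborel)"
      using iu by (intro nn_integral_eq_integral[symmetric]) auto
    also have "\<dots> \<le> ennreal \<bar>M\<bar>" using M[of k] by (meson abs_ge_self ennreal_leI order_trans)
    finally show ?thesis by simp
  qed
  obtain r where r: "strict_mono r" and rc: "\<And>z. z \<in> S \<Longrightarrow> \<exists>l. (\<lambda>k. I (r k) z) \<longlonglongrightarrow> l"
    using function_convergent_subsequence[OF S, of I "\<bar>M\<bar>"] Ib by metis
  define V where "V = (\<lambda>m. w * d m powr n)"
  have V: "0 < V m" for m using w d[of m] by (simp add: V_def)
  define T where "T = (\<lambda>m k x. I k (m, q m x) / V m)"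
  have Tm [measurable]: "T m k \<in> borel_measurable borel" for m k
  proof -
    have "(\<lambda>x. \<integral>y. u k y * (if norm (q m x - y) < d m then 1 else 0) \<partial>lborel) \<in> borel_measurable lborel"
      by (rule lborel.borel_measurable_lebesgue_integral) measurable
    then show ?thesis unfolding T_def I_def by simp
  qed
  define c where "c = 2 powr (n + s) / w * \<bar>E\<bar>"
  have err: "(\<integral>\<^sup>+x. ennreal \<bar>u k x - T m k x\<bar> \<partial>lborel) \<le> ennreal (c * d m powr s)" for m k
  proof -
    have "(\<integral>\<^sup>+x. ennreal \<bar>u k x - T m k x\<bar> \<partial>lborel) \<le> ennreal (2 powr (n + s) / w * d m powr s) * frac_energy s 1 UNIV (u k)"
      unfolding T_def I_def V_def w_def n_def prod.case
      by (rule quantised_average_error[OF u iu d s q qd])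
    also have "\<dots> \<le> ennreal (2 powr (n + s) / w * d m powr s) * ennreal \<bar>E\<bar>"
      using E[of k] by (intro mult_left_mono) (auto intro: order_trans ennreal_leI)
    also have "\<dots> = ennreal (c * d m powr s)"
      using w by (simp add: ennreal_mult'[symmetric] c_def)
    finally show ?thesis .
  qed
  note A(2)[measurable]
  have A_fin: "emeasure lborel A < \<infinity>" using emeasure_bounded_finite[OF A(1)] by simp
  \<comment> \<open>At a fixed scale the averages converge pointwise and are bounded by
    \<open>\<bar>M\<bar> / V m\<close>; on \<open>A\<close>, which has finite measure, dominated
    convergence makes them Cauchy in the mean.\<close>
  have Tconv: "\<exists>N. \<forall>i\<ge>N. \<forall>j\<ge>N. (\<integral>\<^sup>+x. ennreal \<bar>T m (r i) x - T m (r j) x\<bar> * indicator A x \<partial>lborel) \<le> ennreal e"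
    if e: "0 < e" for m e
  proof -
    define L where "L = (\<lambda>x. lim (\<lambda>k. T m (r k) x))"
    have L: "(\<lambda>k. T m (r k) x) \<longlonglongrightarrow> L x" for x
    proof -
      have "(m, q m x) \<in> S" by (auto simp: S_def)
      from rc[OF this] obtain l where l: "(\<lambda>k. I (r k) (m, q m x)) \<longlonglongrightarrow> l" by blast
      have "(\<lambda>k. T m (r k) x) \<longlonglongrightarrow> l / V m"
        unfolding T_def by (rule tendsto_divide[OF l tendsto_const]) (use V[of m] in simp)
      then have "convergent (\<lambda>k. T m (r k) x)"
        unfolding convergent_def by blast
      then show ?thesis by (simp add: L_def convergent_LIMSEQ_iff)
    qed
    have [measurable]: "L \<in> borel_measurable borel"
      by (rule borel_measurable_LIMSEQ_metric[where f="\<lambda>k. T m (r k)"]) (use Tm L in simp_all)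
    have Tb: "\<bar>T m k x\<bar> \<le> \<bar>M\<bar> / V m" for k x
      using Ib[of k "(m, q m x)"] V[of m] by (simp add: T_def divide_right_mono)
    have "(\<lambda>k. \<integral>\<^sup>+x. ennreal \<bar>T m (r k) x - L x\<bar> * indicator A x \<partial>lborel) \<longlonglongrightarrow> (\<integral>\<^sup>+x. 0 \<partial>(lborel :: 'a measure))"
    proof (rule nn_integral_dominated_convergence[where w="\<lambda>x. ennreal (2 * (\<bar>M\<bar> / V m)) * indicator A x"])
      show "(\<integral>\<^sup>+x. ennreal (2 * (\<bar>M\<bar> / V m)) * indicator A x \<partial>lborel) < \<infinity>"
        using A A_fin by (subst nn_integral_cmult_indicator) (auto simp: ennreal_mult_less_top)
      have "\<bar>L x\<bar> \<le> \<bar>M\<bar> / V m" for x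
        using tendsto_rabs[OF L[of x]] Tb by (intro LIMSEQ_le_const2) auto
      then have "\<bar>T m (r k) x\<bar> + \<bar>L x\<bar> \<le> 2 * (\<bar>M\<bar> / V m)" for k x
        unfolding mult_2 using Tb by (intro add_mono) auto
      then have "\<bar>T m (r k) x - L x\<bar> \<le> 2 * (\<bar>M\<bar> / V m)" for k x
        using abs_triangle_ineq4 order_trans by blast
      then show "AE x in lborel. ennreal \<bar>T m (r k) x - L x\<bar> * indicator A x \<le> ennreal (2 * (\<bar>M\<bar> / V m)) * indicator A x" for k
        by (intro AE_I2 mult_right_mono ennreal_leI) auto
      show "AE x in lborel. (\<lambda>k. ennreal \<bar>T m (r k) x - L x\<bar> * indicator A x) \<longlonglongrightarrow> 0"
      proof (intro AE_I2)
        fix x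
        have "(\<lambda>k. \<bar>T m (r k) x - L x\<bar>) \<longlonglongrightarrow> 0"
          using L[of x] by (simp add: LIM_zero_iff tendsto_rabs_zero_iff)
        then have "(\<lambda>k. ennreal \<bar>T m (r k) x - L x\<bar>) \<longlonglongrightarrow> ennreal 0" by (rule tendsto_ennrealI)
        then show "(\<lambda>k. ennreal \<bar>T m (r k) x - L x\<bar> * indicator A x) \<longlonglongrightarrow> 0"
          by (auto simp: indicator_def)
      qed
    qed measurable
    then have "(\<lambda>k. \<integral>\<^sup>+x. ennreal \<bar>T m (r k) x - L x\<bar> * indicator A x \<partial>lborel) \<longlonglongrightarrow> 0" by simp
    then have "eventually (\<lambda>k. (\<integral>\<^sup>+x. ennreal \<bar>T m (r k) x - L x\<bar> * indicator A x \<partial>lborel) < ennreal (e/2)) sequentially"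
      using e by (intro order_tendstoD(2)) auto
    then obtain N where N: "\<And>k. k \<ge> N \<Longrightarrow> (\<integral>\<^sup>+x. ennreal \<bar>T m (r k) x - L x\<bar> * indicator A x \<partial>lborel) < ennreal (e/2)"
      by (auto simp: eventually_sequentially)
    have "(\<integral>\<^sup>+x. ennreal \<bar>T m (r i) x - T m (r j) x\<bar> * indicator A x \<partial>lborel) \<le> ennreal e" if ij: "i \<ge> N" "j \<ge> N" for i j
    proof -
      have "(\<integral>\<^sup>+x. ennreal \<bar>T m (r i) x - T m (r j) x\<bar> * indicator A x \<partial>lborel)
         \<le> (\<integral>\<^sup>+x. ennreal \<bar>T m (r i) x - L x\<bar> * indicator A x + ennreal \<bar>T m (r j) x - L x\<bar> * indicator A x \<partial>lborel)"
        by (intro nn_integral_mono) (auto simp: indicator_def ennreal_plus[symmetric] simp del: ennreal_plus intro!: ennreal_leI)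
      also have "\<dots> = (\<integral>\<^sup>+x. ennreal \<bar>T m (r i) x - L x\<bar> * indicator A x \<partial>lborel) + (\<integral>\<^sup>+x. ennreal \<bar>T m (r j) x - L x\<bar> * indicator A x \<partial>lborel)"
        by (rule nn_integral_add) measurable
      also have "\<dots> \<le> ennreal (e/2) + ennreal (e/2)"
        using N[OF ij(1)] N[OF ij(2)] by (intro add_mono) auto
      also have "\<dots> = ennreal e" using e by (simp flip: ennreal_plus)
      finally show ?thesis .
    qed
    then show ?thesis by blast
  qed
  \<comment> \<open>Two thirds of \<open>e\<close> pay for replacing the functions by averages at a
    fine scale, the last third is \<open>Tconv\<close>. Outside \<open>A\<close> the functions
    vanish, so \<open>Tconv\<close> over \<open>A\<close> is enough.\<close>
  have cauchy: "\<exists>N. \<forall>i\<ge>N. \<forall>j\<ge>N. (\<integral>\<^sup>+x. ennreal \<bar>u (r i) x - u (r j) x\<bar> \<partial>lborel) \<le> ennreal e" if e: "0 < e" for e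
  proof -
    have "(\<lambda>m. d m) \<longlonglongrightarrow> 0" unfolding d_def by (rule LIMSEQ_Suc) (rule lim_1_over_n)
    then have "(\<lambda>m. c * d m powr s) \<longlonglongrightarrow> c * 0 powr s"
      using s d by (intro tendsto_mult tendsto_powr' tendsto_const) (auto simp: less_imp_le intro!: always_eventually)
    then have "eventually (\<lambda>m. c * d m powr s < e / 3) sequentially"
      using e by (intro order_tendstoD(2)) auto
    then obtain m where m: "c * d m powr s < e / 3" by (auto dest: eventually_happens)
    obtain N where N: "\<And>i j. i \<ge> N \<Longrightarrow> j \<ge> N \<Longrightarrow> (\<integral>\<^sup>+x. ennreal \<bar>T m (r i) x - T m (r j) x\<bar> * indicator A x \<partial>lborel) \<le> ennreal (e/3)"
      using Tconv[of "e/3" m] e by auto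
    have err': "(\<integral>\<^sup>+x. ennreal \<bar>u k x - T m k x\<bar> \<partial>lborel) \<le> ennreal (e/3)" for k
      using err[of k m] m by (meson ennreal_leI less_imp_le order_trans)
    have "(\<integral>\<^sup>+x. ennreal \<bar>u (r i) x - u (r j) x\<bar> \<partial>lborel) \<le> ennreal e" if ij: "i \<ge> N" "j \<ge> N" for i j
    proof -
      have "(\<integral>\<^sup>+x. ennreal \<bar>u (r i) x - u (r j) x\<bar> \<partial>lborel)
        \<le> (\<integral>\<^sup>+x. ennreal \<bar>u (r i) x - T m (r i) x\<bar> + (ennreal \<bar>u (r j) x - T m (r j) x\<bar> + ennreal \<bar>T m (r i) x - T m (r j) x\<bar> * indicator A x) \<partial>lborel)"
      proof (intro nn_integral_mono)
        fix x
        show "ennreal \<bar>u (r i) x - u (r j) x\<bar> \<le> ennreal \<bar>u (r i) x - T m (r i) x\<bar> + (ennreal \<bar>u (r j) x - T m (r j) x\<bar> + ennreal \<bar>T m (r i) x - T m (r j) x\<bar> * indicator A x)"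
          by (cases "x \<in> A") (auto simp: off ennreal_plus[symmetric] simp del: ennreal_plus intro!: ennreal_leI)
      qed
      also have "\<dots> = (\<integral>\<^sup>+x. ennreal \<bar>u (r i) x - T m (r i) x\<bar> \<partial>lborel) + ((\<integral>\<^sup>+x. ennreal \<bar>u (r j) x - T m (r j) x\<bar> \<partial>lborel) + (\<integral>\<^sup>+x. ennreal \<bar>T m (r i) x - T m (r j) x\<bar> * indicator A x \<partial>lborel))"
        by (simp add: nn_integral_add)
      also have "\<dots> \<le> ennreal (e/3) + (ennreal (e/3) + ennreal (e/3))"
        using N[OF ij] by (intro add_mono err')
      also have "\<dots> = ennreal e" using e by (simp flip: ennreal_plus)
      finally show ?thesis .
    qed
    then show ?thesis by blast
  qed
  obtain r' where r': "strict_mono r'" "AE x in lborel. Cauchy (\<lambda>i. u (r (r' i)) x)"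
  proof (rule cauchy_L1_AE_cauchy_subseq[of lborel "\<lambda>i. u (r i)"])
    show "integrable lborel (u (r i))" for i by (rule iu)
    show "\<exists>N. \<forall>i\<ge>N. \<forall>j\<ge>N. (LINT x|lborel. norm (u (r i) x - u (r j) x)) < e" if "0 < e" for e
    proof -
      obtain N where N: "\<And>i j. i \<ge> N \<Longrightarrow> j \<ge> N \<Longrightarrow> (\<integral>\<^sup>+x. ennreal \<bar>u (r i) x - u (r j) x\<bar> \<partial>lborel) \<le> ennreal (e/2)"
        using cauchy[of "e/2"] \<open>0 < e\<close> by (meson half_gt_zero)
      have "(LINT x|lborel. norm (u (r i) x - u (r j) x)) < e" if ij: "i \<ge> N" "j \<ge> N" for i j
      proof -
        have "ennreal (LINT x|lborel. norm (u (r i) x - u (r j) x)) = (\<integral>\<^sup>+x. ennreal (norm (u (r i) x - u (r j) x)) \<partial>lborel)"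
          using iu by (intro nn_integral_eq_integral[symmetric]) auto
        also have "\<dots> \<le> ennreal (e/2)" using N[OF ij] by simp
        finally have "(LINT x|lborel. norm (u (r i) x - u (r j) x)) \<le> e / 2" using \<open>0 < e\<close> by simp
        then show ?thesis using \<open>0 < e\<close> by simp
      qed
      then show ?thesis by blast
    qed
  qed blast
  define v where "v = (\<lambda>x. lim (\<lambda>i. u (r (r' i)) x))"
  have lim: "AE x in lborel. (\<lambda>i. u (r (r' i)) x) \<longlonglongrightarrow> v x"
    using r'(2) by eventually_elim (simp add: v_def Cauchy_convergent_iff convergent_LIMSEQ_iff)
  have [measurable]: "v \<in> borel_measurable borel"
    unfolding v_def by (rule borel_measurable_lim_metric) auto
  show thesis
  proof (rule that[of "r \<circ> r'" v])
    show "strict_mono (r \<circ> r')" using r r'(1) by (rule strict_mono_o)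
    show "v \<in> borel_measurable borel" by fact
    show "v x = 0" if "x \<notin> A" for x using off[OF that] by (simp add: v_def)
    show "AE x in lborel. (\<lambda>k. u ((r \<circ> r') k) x) \<longlonglongrightarrow> v x" using lim by simp
    show "(\<lambda>k. \<integral>\<^sup>+x. ennreal \<bar>u ((r \<circ> r') k) x - v x\<bar> \<partial>lborel) \<longlonglongrightarrow> 0"
    proof (rule tendsto_0_if_le_ennreal)
      fix e :: real assume "0 < e"
      then obtain N where N: "\<And>i j. i \<ge> N \<Longrightarrow> j \<ge> N \<Longrightarrow> (\<integral>\<^sup>+x. ennreal \<bar>u (r i) x - u (r j) x\<bar> \<partial>lborel) \<le> ennreal e"
        using cauchy by blast
      have "(\<integral>\<^sup>+x. ennreal \<bar>u ((r \<circ> r') k) x - v x\<bar> \<partial>lborel) \<le> ennreal e" if k: "k \<ge> N" for k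
      \<comment> \<open>Fatou in the second index turns the Cauchy bound into a bound on the
        distance to the limit; the shift by \<open>N\<close> keeps that index in the Cauchy
        range.\<close>
      proof (rule nn_integral_Fatou_bound[where X="\<lambda>j x. ennreal \<bar>u (r (r' k)) x - u (r (r' (j + N))) x\<bar>" and B="\<lambda>_. ennreal e"])
        show "AE x in lborel. (\<lambda>j. ennreal \<bar>u (r (r' k)) x - u (r (r' (j + N))) x\<bar>) \<longlonglongrightarrow> ennreal \<bar>u ((r \<circ> r') k) x - v x\<bar>"
          using lim
        proof eventually_elim
          case (elim x)
          then have "(\<lambda>j. u (r (r' (j + N))) x) \<longlonglongrightarrow> v x" by (rule LIMSEQ_ignore_initial_segment)
          then show ?case by (auto intro!: tendsto_ennrealI tendsto_rabs tendsto_diff)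
        qed
        show "(\<integral>\<^sup>+x. ennreal \<bar>u (r (r' k)) x - u (r (r' (j + N))) x\<bar> \<partial>lborel) \<le> ennreal e" for j
          using k seq_suble[OF r'(1), of k] seq_suble[OF r'(1), of "j + N"] by (intro N) auto
      qed auto
      then show "\<exists>N. \<forall>k\<ge>N. (\<integral>\<^sup>+x. ennreal \<bar>u ((r \<circ> r') k) x - v x\<bar> \<partial>lborel) \<le> ennreal e" by blast
    qed
  qed
qed

section \<open>A fractional Hardy inequality\<close>

lemma nn_integral_half_line_powr:
  fixes t :: real
  assumes a: "0 < a" and t: "0 < t"
  shows "(\<integral>\<^sup>+h. ennreal (if t < h then h powr - (1 + a) else 0) \<partial>lborel)
    \<le> ennreal (unit_ball_vol 1 * 2 / (1 - 2 powr - a) * t powr - a)"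
proof -
  have "(\<integral>\<^sup>+h. ennreal (if t < h then h powr - (1 + a) else 0) \<partial>lborel)
     \<le> (\<integral>\<^sup>+h. ennreal (norm (0 - h) powr - (real DIM(real) + a)) * indicator {h. t \<le> norm (0 - h)} h \<partial>(lborel :: real measure))"
    by (intro nn_integral_mono) (use t in \<open>auto simp: indicator_def\<close>)
  also have "\<dots> \<le> ennreal (unit_ball_vol (real DIM(real)) * 2 ^ DIM(real) / (1 - 2 powr - a) * t powr - a)"
    by (rule nn_integral_tail_powr[OF a t])
  finally show ?thesis by simp
qed

text \<open>Here \<open>\<tau>\<close> is the height above a Lipschitz graph. The one-dimensional Hardy argument is run in
  direction \<open>e\<close>; the shifts \<open>h \<in> (\<tau>, (1 + \<kappa>) \<tau>)\<close> contract the weighted integral by the factor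
  \<open>(2 + \<kappa>)\<^sup>s / 2 < 1\<close>, which is where \<open>s < 1\<close> enters.\<close>

locale epigraph =
  fixes e :: "'a::euclidean_space" and \<tau> :: "'a \<Rightarrow> real" and \<Lambda> s :: real
  assumes e: "norm e = 1" and \<tau>_lip: "\<And>x y. \<bar>\<tau> x - \<tau> y\<bar> \<le> \<Lambda> * norm (x - y)"
    and \<tau>_shift: "\<And>x h. \<tau> (x + h *\<^sub>R e) = \<tau> x + h"
    and \<Lambda>: "1 \<le> \<Lambda>" and s: "0 < s" "s < 1"
begin

lemma \<tau>_measurable [measurable]: "\<tau> \<in> borel_measurable borel"
proof (rule borel_measurable_continuous_onI)
  have "lipschitz_on \<Lambda> UNIV \<tau>"
    by (rule lipschitz_onI) (use \<tau>_lip \<Lambda> in \<open>auto simp: dist_norm\<close>)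
  then show "continuous_on UNIV \<tau>" by (rule lipschitz_on_continuous_on)
qed

text \<open>The oscillation of \<open>v\<close> around \<open>x\<close> at scale \<open>h\<close>,
  restricted to the epigraph and not divided by the volume; \<open>directional_difference\<close>
  supplies the volume factor.\<close>

definition local_osc :: "('a \<Rightarrow> real) \<Rightarrow> 'a \<Rightarrow> real \<Rightarrow> ennreal" where
  "local_osc v x h = (\<integral>\<^sup>+y. ennreal (if 0 < \<tau> y \<and> norm (x - y) < h then \<bar>v x - v y\<bar> else 0) \<partial>lborel)"

lemma local_osc_measurable [measurable (raw)]:
  assumes [measurable]: "v \<in> borel_measurable borel" "f \<in> M \<rightarrow>\<^sub>M borel" "g \<in> M \<rightarrow>\<^sub>M borel"
  shows "(\<lambda>w. local_osc v (f w) (g w)) \<in> borel_measurable M"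
  unfolding local_osc_def by measurable

text \<open>Both ends of the segment are compared with the points \<open>y\<close> of a ball around
  its midpoint \<open>z\<close>. The radius \<open>h / (4 * \<Lambda>)\<close> is small enough that
  \<open>\<tau> y \<ge> \<tau> x + h / 4\<close> and that \<open>y\<close> has distance less than
  \<open>h\<close> from both ends.\<close>

lemma directional_difference:
  assumes v [measurable]: "v \<in> borel_measurable borel" and x: "0 < \<tau> x" and h: "0 < h"
  shows "ennreal (unit_ball_vol (real DIM('a)) * (h / (4 * \<Lambda>)) powr real DIM('a)) * ennreal \<bar>v (x + h *\<^sub>R e) - v x\<bar>
    \<le> local_osc v x h + local_osc v (x + h *\<^sub>R e) h"
proof -
  define z where "z = x + (h / 2) *\<^sub>R e"
  define r where "r = h / (4 * \<Lambda>)"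
  have r: "0 < r" "r \<le> h / 4" "\<Lambda> * r = h / 4" using h \<Lambda> by (auto simp: r_def field_simps)
  have "ennreal (unit_ball_vol (real DIM('a)) * r powr real DIM('a)) * ennreal \<bar>v (x + h *\<^sub>R e) - v x\<bar>
     = (\<integral>\<^sup>+y. ennreal \<bar>v (x + h *\<^sub>R e) - v x\<bar> * indicator (ball z r) y \<partial>lborel)"
    using r by (subst nn_integral_cmult_indicator) (auto simp: emeasure_ball powr_realpow mult.commute)
  also have "\<dots> \<le> (\<integral>\<^sup>+y. ennreal (if 0 < \<tau> y \<and> norm (x - y) < h then \<bar>v x - v y\<bar> else 0)
     + ennreal (if 0 < \<tau> y \<and> norm (x + h *\<^sub>R e - y) < h then \<bar>v (x + h *\<^sub>R e) - v y\<bar> else 0) \<partial>lborel)"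
  proof (intro nn_integral_mono)
    fix y
    show "ennreal \<bar>v (x + h *\<^sub>R e) - v x\<bar> * indicator (ball z r) y
      \<le> ennreal (if 0 < \<tau> y \<and> norm (x - y) < h then \<bar>v x - v y\<bar> else 0)
     + ennreal (if 0 < \<tau> y \<and> norm (x + h *\<^sub>R e - y) < h then \<bar>v (x + h *\<^sub>R e) - v y\<bar> else 0)"
    proof (cases "y \<in> ball z r")
      case True
      then have zy: "norm (z - y) < r" by (simp add: dist_norm)
      have "\<tau> z - \<tau> y \<le> \<Lambda> * norm (z - y)" using \<tau>_lip[of z y] by linarith
      also have "\<dots> \<le> \<Lambda> * r" using zy \<Lambda> by (intro mult_left_mono) auto
      finally have 1: "0 < \<tau> y" using r x h \<tau>_shift[of x "h/2"] by (simp add: z_def)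
      have "x - y = (z - y) - (h / 2) *\<^sub>R e" by (simp add: z_def)
      then have "norm (x - y) \<le> norm (z - y) + norm ((h / 2) *\<^sub>R e)" by (metis norm_triangle_ineq4)
      then have 2: "norm (x - y) < h" using zy r h e by simp
      have "x + h *\<^sub>R e - y = (z - y) + (h / 2) *\<^sub>R e"
        by (simp add: z_def algebra_simps flip: scaleR_left.add)
      then have "norm (x + h *\<^sub>R e - y) \<le> norm (z - y) + norm ((h / 2) *\<^sub>R e)" by (metis norm_triangle_ineq)
      then have 3: "norm (x + h *\<^sub>R e - y) < h" using zy r h e by simp
      have "ennreal \<bar>v (x + h *\<^sub>R e) - v x\<bar> \<le> ennreal (\<bar>v x - v y\<bar> + \<bar>v (x + h *\<^sub>R e) - v y\<bar>)"
        by (intro ennreal_leI) linarith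
      then show ?thesis using True 1 2 3 by (simp add: ennreal_plus)
    qed auto
  qed
  also have "\<dots> = local_osc v x h + local_osc v (x + h *\<^sub>R e) h"
    unfolding local_osc_def by (rule nn_integral_add) measurable
  finally show ?thesis unfolding r_def .
qed

text \<open>Tonelli puts the integration over \<open>h\<close> innermost: for fixed \<open>x\<close>
  and \<open>y\<close> the scales \<open>h > norm (x - y)\<close> contribute a multiple of
  \<open>norm (x - y) powr - (n + s)\<close>, the kernel of \<open>dq\<close>.\<close>

lemma local_osc_integral:
  assumes v [measurable]: "v \<in> borel_measurable borel"
  shows "(\<integral>\<^sup>+h. \<integral>\<^sup>+x. ennreal (if 0 < h \<and> 0 < \<tau> x then h powr - (1 + (real DIM('a) + s)) else 0) * local_osc v x h \<partial>lborel \<partial>lborel)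
    \<le> ennreal (unit_ball_vol 1 * 2 / (1 - 2 powr - (real DIM('a) + s))) * frac_energy s 1 {x. 0 < \<tau> x} v"
proof -
  define a where "a = real DIM('a) + s"
  have a: "0 < a" using s by (simp add: a_def add_nonneg_pos)
  define c where "c = unit_ball_vol 1 * 2 / (1 - 2 powr - a)"
  have c: "0 \<le> c" using a by (simp add: c_def powr_le_one_le less_imp_le powr_less_one)
  let ?g = "\<lambda>h x y. ennreal (if norm (x - y) < h then h powr - (1 + a) else 0) * ennreal (if 0 < \<tau> x \<and> 0 < \<tau> y then \<bar>v x - v y\<bar> else 0)"
  have "(\<integral>\<^sup>+h. \<integral>\<^sup>+x. ennreal (if 0 < h \<and> 0 < \<tau> x then h powr - (1 + a) else 0) * local_osc v x h \<partial>lborel \<partial>lborel)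
     = (\<integral>\<^sup>+h. \<integral>\<^sup>+x. \<integral>\<^sup>+y. ?g h x y \<partial>lborel \<partial>lborel \<partial>lborel)"
  proof (intro nn_integral_cong)
    fix h x
    have "ennreal (if 0 < h \<and> 0 < \<tau> x then h powr - (1 + a) else 0) * local_osc v x h
      = (\<integral>\<^sup>+y. ennreal (if 0 < h \<and> 0 < \<tau> x then h powr - (1 + a) else 0) * ennreal (if 0 < \<tau> y \<and> norm (x - y) < h then \<bar>v x - v y\<bar> else 0) \<partial>lborel)"
      unfolding local_osc_def by (rule nn_integral_cmult[symmetric]) measurable
    also have "\<dots> = (\<integral>\<^sup>+y. ?g h x y \<partial>lborel)"
      by (intro nn_integral_cong) (auto dest: order_le_less_trans[OF norm_ge_zero])
    finally show "ennreal (if 0 < h \<and> 0 < \<tau> x then h powr - (1 + a) else 0) * local_osc v x h = (\<integral>\<^sup>+y. ?g h x y \<partial>lborel)" .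
  qed
  also have "\<dots> = (\<integral>\<^sup>+x. \<integral>\<^sup>+h. \<integral>\<^sup>+y. ?g h x y \<partial>lborel \<partial>lborel \<partial>lborel)"
    by (rule nn_integral_lborel_commute) measurable
  also have "\<dots> = (\<integral>\<^sup>+x. \<integral>\<^sup>+y. \<integral>\<^sup>+h. ?g h x y \<partial>lborel \<partial>lborel \<partial>lborel)"
    by (intro nn_integral_cong nn_integral_lborel_commute) measurable
  also have "\<dots> \<le> (\<integral>\<^sup>+x. \<integral>\<^sup>+y. ennreal c * (ennreal (dq s v x y powr 1) * (indicator {x. 0 < \<tau> x} x * indicator {x. 0 < \<tau> x} y)) \<partial>lborel \<partial>lborel)"
  proof (intro nn_integral_mono)
    fix x y
    show "(\<integral>\<^sup>+h. ?g h x y \<partial>lborel) \<le> ennreal c * (ennreal (dq s v x y powr 1) * (indicator {x. 0 < \<tau> x} x * indicator {x. 0 < \<tau> x} y))"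
    proof (cases "0 < \<tau> x \<and> 0 < \<tau> y \<and> x \<noteq> y")
      case True
      have "(\<integral>\<^sup>+h. ?g h x y \<partial>lborel) = (\<integral>\<^sup>+h. ennreal (if norm (x - y) < h then h powr - (1 + a) else 0) \<partial>lborel) * ennreal \<bar>v x - v y\<bar>"
        using True by (subst nn_integral_multc) auto
      also have "\<dots> \<le> ennreal (c * norm (x - y) powr - a) * ennreal \<bar>v x - v y\<bar>"
        unfolding c_def using True a by (intro mult_right_mono nn_integral_half_line_powr) auto
      also have "\<dots> = ennreal c * ennreal (dq s v x y)"
        using c by (simp add: ennreal_mult'[symmetric] dq_def a_def[symmetric] powr_minus_divide[of _ a])
      finally show ?thesis using True by simp
    qed auto
  qed
  also have "\<dots> = ennreal c * frac_energy s 1 {x. 0 < \<tau> x} v"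
    unfolding frac_energy_def by (simp add: nn_integral_cmult)
  finally show ?thesis unfolding a_def c_def .
qed

text \<open>Reduction to one dimension along \<open>e\<close>. The ball of
  \<open>directional_difference\<close> has volume proportional to \<open>h powr n\<close>, which
  turns the weight \<open>h powr - (1 + (n + s))\<close> into \<open>h powr - (1 + s)\<close>. The
  second oscillation has the same integral as the first by translation along \<open>e\<close>, which
  only increases \<open>\<tau>\<close>.\<close>

lemma directional_seminorm:
  obtains C where "0 \<le> C" "\<And>v. v \<in> borel_measurable borel \<Longrightarrow>
    (\<integral>\<^sup>+h. \<integral>\<^sup>+x. ennreal (if 0 < h \<and> 0 < \<tau> x then h powr - (1 + s) * \<bar>v (x + h *\<^sub>R e) - v x\<bar> else 0) \<partial>lborel \<partial>lborel)
    \<le> ennreal C * frac_energy s 1 {x. 0 < \<tau> x} v"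
proof -
  define n where "n = real DIM('a)"
  define b where "b = unit_ball_vol n / (4 * \<Lambda>) powr n"
  have b: "0 < b" using \<Lambda> by (simp add: b_def n_def)
  define c where "c = unit_ball_vol 1 * 2 / (1 - 2 powr - (n + s))"
  have c: "0 \<le> c" using s by (simp add: c_def n_def powr_less_one less_imp_le add_nonneg_pos)
  show thesis
  proof (rule that[of "2 * c / b"])
    show "0 \<le> 2 * c / b" using b c by simp
    fix v :: "'a \<Rightarrow> real" assume v [measurable]: "v \<in> borel_measurable borel"
    define E where "E = frac_energy s 1 {x. 0 < \<tau> x} v"
    let ?k = "\<lambda>h x. ennreal (if 0 < h \<and> 0 < \<tau> x then h powr - (1 + (n + s)) else 0)"
    have pt: "ennreal (if 0 < h \<and> 0 < \<tau> x then h powr - (1 + s) * \<bar>v (x + h *\<^sub>R e) - v x\<bar> else 0)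
       \<le> ennreal (1 / b) * (?k h x * local_osc v x h + ?k h (x + h *\<^sub>R e) * local_osc v (x + h *\<^sub>R e) h)" for h x
    proof (cases "0 < h \<and> 0 < \<tau> x")
      case True
      have e1: "unit_ball_vol n * (h / (4 * \<Lambda>)) powr n = b * h powr n"
        using True \<Lambda> by (simp add: b_def powr_divide)
      have e2: "1 / b * (h powr - (1 + (n + s)) * (b * h powr n)) = h powr - (1 + s)"
      proof -
        have "h powr - (1 + (n + s)) * h powr n = h powr (- (1 + (n + s)) + n)"
          by (rule powr_add[symmetric])
        also have "- (1 + (n + s)) + n = - (1 + s)" by simp
        finally have "h powr - (1 + (n + s)) * h powr n = h powr - (1 + s)" .
        then show ?thesis using b by (simp add: field_simps)
      qed
      have "ennreal (1 / b) * (ennreal (h powr - (1 + (n + s))) * (ennreal (b * h powr n) * ennreal \<bar>v (x + h *\<^sub>R e) - v x\<bar>))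
        \<le> ennreal (1 / b) * (ennreal (h powr - (1 + (n + s))) * (local_osc v x h + local_osc v (x + h *\<^sub>R e) h))"
        using directional_difference[OF v, of x h] True unfolding n_def[symmetric] e1
        by (intro mult_left_mono) auto
      moreover have "ennreal (1 / b) * (ennreal (h powr - (1 + (n + s))) * (ennreal (b * h powr n) * ennreal \<bar>v (x + h *\<^sub>R e) - v x\<bar>))
         = ennreal (1 / b * (h powr - (1 + (n + s)) * (b * h powr n)) * \<bar>v (x + h *\<^sub>R e) - v x\<bar>)"
        using b by (simp only: ennreal_mult'[symmetric] powr_ge_zero mult_nonneg_nonneg less_imp_le divide_nonneg_nonneg zero_le_one mult.assoc)
      moreover have "0 < \<tau> (x + h *\<^sub>R e)" using True \<tau>_shift by simp
      ultimately show ?thesis using True unfolding e2 by (simp add: distrib_left)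
    qed auto
    have L: "(\<integral>\<^sup>+h. \<integral>\<^sup>+x. ?k h x * local_osc v x h \<partial>lborel \<partial>lborel) \<le> ennreal c * E"
      unfolding c_def E_def n_def by (rule local_osc_integral[OF v])
    have "(\<integral>\<^sup>+h. \<integral>\<^sup>+x. ennreal (if 0 < h \<and> 0 < \<tau> x then h powr - (1 + s) * \<bar>v (x + h *\<^sub>R e) - v x\<bar> else 0) \<partial>lborel \<partial>lborel)
      \<le> (\<integral>\<^sup>+h. \<integral>\<^sup>+x. ennreal (1 / b) * (?k h x * local_osc v x h + ?k h (x + h *\<^sub>R e) * local_osc v (x + h *\<^sub>R e) h) \<partial>lborel \<partial>lborel)"
      by (intro nn_integral_mono pt)
    also have "\<dots> = ennreal (1 / b) * ((\<integral>\<^sup>+h. \<integral>\<^sup>+x. ?k h x * local_osc v x h \<partial>lborel \<partial>lborel)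
       + (\<integral>\<^sup>+h. \<integral>\<^sup>+x. ?k h (x + h *\<^sub>R e) * local_osc v (x + h *\<^sub>R e) h \<partial>lborel \<partial>lborel))"
      by (simp add: nn_integral_cmult nn_integral_add)
    also have "(\<integral>\<^sup>+h. \<integral>\<^sup>+x. ?k h (x + h *\<^sub>R e) * local_osc v (x + h *\<^sub>R e) h \<partial>lborel \<partial>lborel)
       = (\<integral>\<^sup>+h. \<integral>\<^sup>+x. ?k h x * local_osc v x h \<partial>lborel \<partial>lborel)"
      by (intro nn_integral_cong nn_integral_lborel_shift) measurable
    also have "ennreal (1 / b) * ((\<integral>\<^sup>+h. \<integral>\<^sup>+x. ?k h x * local_osc v x h \<partial>lborel \<partial>lborel) + (\<integral>\<^sup>+h. \<integral>\<^sup>+x. ?k h x * local_osc v x h \<partial>lborel \<partial>lborel))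
       \<le> ennreal (1 / b) * (ennreal c * E + ennreal c * E)"
      by (intro mult_left_mono add_mono L) auto
    also have "\<dots> = ennreal (2 * c / b) * E"
    proof -
      have "ennreal c * E + ennreal c * E = ennreal (2 * c) * E"
        using c by (simp add: ennreal_mult' mult_2[symmetric] mult.assoc)
      then show ?thesis using b c by (simp add: ennreal_mult'[symmetric] mult.assoc[symmetric])
    qed
    finally show "(\<integral>\<^sup>+h. \<integral>\<^sup>+x. ennreal (if 0 < h \<and> 0 < \<tau> x then h powr - (1 + s) * \<bar>v (x + h *\<^sub>R e) - v x\<bar> else 0) \<partial>lborel \<partial>lborel)
       \<le> ennreal (2 * c / b) * frac_energy s 1 {x. 0 < \<tau> x} v" unfolding E_def .
  qed
qed

lemma nn_integral_if_interval:
  fixes a b c :: real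
  assumes "a \<le> b" "0 \<le> c"
  shows "(\<integral>\<^sup>+h. ennreal (if a < h \<and> h < b then c else 0) \<partial>lborel) = ennreal (c * (b - a))"
proof -
  have "(\<integral>\<^sup>+h. ennreal (if a < h \<and> h < b then c else 0) \<partial>lborel) = (\<integral>\<^sup>+h. ennreal c * indicator {a<..<b} h \<partial>lborel)"
    by (intro nn_integral_cong) (auto simp: indicator_def)
  also have "\<dots> = ennreal c * ennreal (b - a)"
    using assms by (subst nn_integral_cmult_indicator) auto
  finally show ?thesis using assms by (simp add: ennreal_mult')
qed

text \<open>Restricting to \<open>\<epsilon> < \<tau> x\<close> makes the left side finite, so that
  its contracted copy on the right can be absorbed. The resulting constant does not involve
  \<open>\<epsilon>\<close>.\<close>

lemma hardy_truncated:
  fixes \<epsilon> \<kappa> :: real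
  assumes C: "0 \<le> C" "(\<integral>\<^sup>+h. \<integral>\<^sup>+x. ennreal (if 0 < h \<and> 0 < \<tau> x then h powr - (1 + s) * \<bar>v (x + h *\<^sub>R e) - v x\<bar> else 0) \<partial>lborel \<partial>lborel)
    \<le> ennreal C * E"
    and v [measurable]: "v \<in> borel_measurable borel" and fin: "(\<integral>\<^sup>+x. ennreal \<bar>v x\<bar> \<partial>lborel) < \<infinity>"
    and \<epsilon>: "0 < \<epsilon>" and \<kappa>: "0 < \<kappa>" "(2 + \<kappa>) powr s < 2"
  shows "(\<integral>\<^sup>+x. ennreal (if \<epsilon> < \<tau> x then \<bar>v x\<bar> * \<tau> x powr - s else 0) \<partial>lborel)
    \<le> ennreal ((1 + \<kappa>) powr (1 + s) * C / (\<kappa> * (1 - (2 + \<kappa>) powr s / 2))) * E"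
proof -
  define \<theta> where "\<theta> = (2 + \<kappa>) powr s / 2"
  have \<theta>: "0 < \<theta>" "\<theta> < 1" using \<kappa> by (auto simp: \<theta>_def)
  define B where "B = (1 + \<kappa>) powr (1 + s) * C"
  have B: "0 \<le> B" using C by (simp add: B_def)
  define H where "H = (\<integral>\<^sup>+x. ennreal (if \<epsilon> < \<tau> x then \<bar>v x\<bar> * \<tau> x powr - s else 0) \<partial>lborel)"
  \<comment> \<open>A weight for averaging over the shifts \<open>h\<close> at a point of height
    \<open>t\<close>: its integral over \<open>h\<close> is \<open>\<kappa> * t powr - s\<close>,
    the Hardy weight.\<close>
  define k where "k = (\<lambda>t h::real. if \<epsilon> < t \<and> t < h \<and> h < (1 + \<kappa>) * t then t powr - (1 + s) else 0)"
  have [measurable]: "case_prod k \<in> borel_measurable (borel \<Otimes>\<^sub>M borel)"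
    unfolding k_def case_prod_beta' by measurable
  have k0: "0 \<le> k t h" for t h by (simp add: k_def)
  have kint: "(\<integral>\<^sup>+h. ennreal (k t h) \<partial>lborel) = ennreal (if \<epsilon> < t then \<kappa> * t powr - s else 0)" for t
  proof (cases "\<epsilon> < t")
    case True
    have "(\<integral>\<^sup>+h. ennreal (k t h) \<partial>lborel) = ennreal (t powr - (1 + s) * ((1 + \<kappa>) * t - t))"
      using True nn_integral_if_interval[of t "(1 + \<kappa>) * t" "t powr - (1 + s)"] \<epsilon> \<kappa>
      by (simp add: k_def mult_le_cancel_right1)
    also have "t powr - (1 + s) * ((1 + \<kappa>) * t - t) = \<kappa> * (t powr - (1 + s) * t powr 1)"
      using True \<epsilon> by (simp add: algebra_simps)
    also have "t powr - (1 + s) * t powr 1 = t powr - s"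
      unfolding powr_add[symmetric] by simp
    finally show ?thesis using True by simp
  qed (auto simp: k_def)
  \<comment> \<open>Seen from the shifted point, of height \<open>t = \<tau> x + h\<close>, the
    shifts lie in an interval of length \<open>t * \<kappa> / (2 * (2 + \<kappa>))\<close>, on which
    the weight is at most \<open>(t / (2 + \<kappa>)) powr - (1 + s)\<close>. The product is
    \<open>\<kappa> * \<theta> * t powr - s\<close>.\<close>
  have kint2: "(\<integral>\<^sup>+h. ennreal (k (t - h) h) \<partial>lborel) \<le> ennreal (if \<epsilon> < t then \<kappa> * \<theta> * t powr - s else 0)" for t
  proof (cases "\<epsilon> < t")
    case True
    then have t: "0 < t" using \<epsilon> by simp
    have "(\<integral>\<^sup>+h. ennreal (k (t - h) h) \<partial>lborel)
       \<le> (\<integral>\<^sup>+h. ennreal (if t / 2 < h \<and> h < (1 + \<kappa>) * t / (2 + \<kappa>) then (t / (2 + \<kappa>)) powr - (1 + s) else 0) \<partial>lborel)"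
    proof (intro nn_integral_mono ennreal_leI)
      fix h
      show "k (t - h) h \<le> (if t / 2 < h \<and> h < (1 + \<kappa>) * t / (2 + \<kappa>) then (t / (2 + \<kappa>)) powr - (1 + s) else 0)"
      proof (cases "\<epsilon> < t - h \<and> t - h < h \<and> h < (1 + \<kappa>) * (t - h)")
        case c: True
        have h1: "t / 2 < h" using c by simp
        have h2: "h < (1 + \<kappa>) * t / (2 + \<kappa>)" using c \<kappa> by (simp add: pos_less_divide_eq algebra_simps)
        have "t \<le> (t - h) * (2 + \<kappa>)" using c by (simp add: algebra_simps)
        then have h3: "t / (2 + \<kappa>) \<le> t - h" using \<kappa> by (simp add: pos_divide_le_eq)
        have "(t - h) powr - (1 + s) \<le> (t / (2 + \<kappa>)) powr - (1 + s)"
          using h3 t \<kappa> s by (intro powr_mono2') auto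
        then show ?thesis using c h1 h2 by (simp add: k_def)
      qed (auto simp: k_def)
    qed
    also have "\<dots> = ennreal ((t / (2 + \<kappa>)) powr - (1 + s) * ((1 + \<kappa>) * t / (2 + \<kappa>) - t / 2))"
      using t \<kappa> by (intro nn_integral_if_interval) (auto simp: field_simps)
    also have "(1 + \<kappa>) * t / (2 + \<kappa>) - t / 2 = t * \<kappa> / (2 * (2 + \<kappa>))"
      using \<kappa> by (simp add: field_simps)
    also have "(t / (2 + \<kappa>)) powr - (1 + s) * (t * \<kappa> / (2 * (2 + \<kappa>))) = \<kappa> / 2 * ((t / (2 + \<kappa>)) powr - (1 + s) * (t / (2 + \<kappa>)) powr 1)"
      using t \<kappa> by simp
    also have "(t / (2 + \<kappa>)) powr - (1 + s) * (t / (2 + \<kappa>)) powr 1 = t powr - s * (2 + \<kappa>) powr s"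
      unfolding powr_add[symmetric] using t \<kappa> by (simp add: powr_minus powr_divide field_simps)
    finally show ?thesis using True by (simp add: \<theta>_def mult_ac)
  next
    case False
    then have "k (t - h) h = 0" for h using \<epsilon> by (auto simp: k_def)
    then show ?thesis by simp
  qed
  have "H \<le> ennreal (\<epsilon> powr - s) * (\<integral>\<^sup>+x. ennreal \<bar>v x\<bar> \<partial>lborel)"
    unfolding H_def
  proof (subst nn_integral_cmult[symmetric])
    show "(\<integral>\<^sup>+x. ennreal (if \<epsilon> < \<tau> x then \<bar>v x\<bar> * \<tau> x powr - s else 0) \<partial>lborel) \<le> (\<integral>\<^sup>+x. ennreal (\<epsilon> powr - s) * ennreal \<bar>v x\<bar> \<partial>lborel)"
    proof (intro nn_integral_mono)
      fix x
      have "(if \<epsilon> < \<tau> x then \<bar>v x\<bar> * \<tau> x powr - s else 0) \<le> \<epsilon> powr - s * \<bar>v x\<bar>"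
        using \<epsilon> s by (auto simp: mult.commute intro!: mult_left_mono powr_mono2')
      then show "ennreal (if \<epsilon> < \<tau> x then \<bar>v x\<bar> * \<tau> x powr - s else 0) \<le> ennreal (\<epsilon> powr - s) * ennreal \<bar>v x\<bar>"
        by (simp add: ennreal_leI flip: ennreal_mult')
    qed
  qed auto
  also have "\<dots> < \<infinity>" using fin by (simp add: ennreal_mult_less_top)
  finally have Hfin: "H < \<infinity>" .
  have "ennreal \<kappa> * H = (\<integral>\<^sup>+x. \<integral>\<^sup>+h. ennreal \<bar>v x\<bar> * ennreal (k (\<tau> x) h) \<partial>lborel \<partial>lborel)"
  proof -
    have "ennreal \<kappa> * H = (\<integral>\<^sup>+x. ennreal \<kappa> * ennreal (if \<epsilon> < \<tau> x then \<bar>v x\<bar> * \<tau> x powr - s else 0) \<partial>lborel)"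
      unfolding H_def by (rule nn_integral_cmult[symmetric]) measurable
    also have "\<dots> = (\<integral>\<^sup>+x. ennreal \<bar>v x\<bar> * ennreal (if \<epsilon> < \<tau> x then \<kappa> * \<tau> x powr - s else 0) \<partial>lborel)"
      using \<kappa> by (intro nn_integral_cong) (auto simp: ennreal_mult'[symmetric] mult_ac)
    also have "\<dots> = (\<integral>\<^sup>+x. \<integral>\<^sup>+h. ennreal \<bar>v x\<bar> * ennreal (k (\<tau> x) h) \<partial>lborel \<partial>lborel)"
      unfolding kint[symmetric] by (intro nn_integral_cong nn_integral_cmult[symmetric]) measurable
    finally show ?thesis .
  qed
  also have "\<dots> \<le> (\<integral>\<^sup>+x. \<integral>\<^sup>+h. ennreal \<bar>v (x + h *\<^sub>R e)\<bar> * ennreal (k (\<tau> (x + h *\<^sub>R e) - h) h)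
      + ennreal ((1 + \<kappa>) powr (1 + s)) * ennreal (if 0 < h \<and> 0 < \<tau> x then h powr - (1 + s) * \<bar>v (x + h *\<^sub>R e) - v x\<bar> else 0) \<partial>lborel \<partial>lborel)"
  proof (intro nn_integral_mono)
    fix x h
    \<comment> \<open>On the support of \<open>k\<close> shift and height are comparable,
      \<open>h < (1 + \<kappa>) * \<tau> x\<close>, so the power of \<open>\<tau> x\<close> may be
      exchanged for the same power of \<open>h\<close>, the weight of the directional
      seminorm.\<close>
    have D: "\<bar>v (x + h *\<^sub>R e) - v x\<bar> * k (\<tau> x) h \<le> (1 + \<kappa>) powr (1 + s) * (if 0 < h \<and> 0 < \<tau> x then h powr - (1 + s) * \<bar>v (x + h *\<^sub>R e) - v x\<bar> else 0)"
    proof (cases "\<epsilon> < \<tau> x \<and> \<tau> x < h \<and> h < (1 + \<kappa>) * \<tau> x")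
      case True
      then have p: "0 < \<tau> x" "0 < h" using \<epsilon> by auto
      have "\<tau> x powr - (1 + s) \<le> (h / (1 + \<kappa>)) powr - (1 + s)"
        using True p \<kappa> s by (intro powr_mono2') (auto simp: pos_divide_le_eq mult.commute)
      also have "\<dots> = (1 + \<kappa>) powr (1 + s) * h powr - (1 + s)"
      proof -
        have "(h / (1 + \<kappa>)) powr - (1 + s) = h powr - (1 + s) / (1 + \<kappa>) powr - (1 + s)"
          using p \<kappa> by (simp only: powr_divide)
        then show ?thesis by (simp only: powr_minus[of "1 + \<kappa>"] divide_inverse inverse_inverse_eq mult.commute)
      qed
      finally have "\<tau> x powr - (1 + s) * \<bar>v (x + h *\<^sub>R e) - v x\<bar> \<le> (1 + \<kappa>) powr (1 + s) * h powr - (1 + s) * \<bar>v (x + h *\<^sub>R e) - v x\<bar>"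
        by (rule mult_right_mono) simp
      then show ?thesis using True p by (simp add: k_def mult_ac)
    qed (auto simp: k_def)
    have "\<bar>v x\<bar> * k (\<tau> x) h \<le> (\<bar>v (x + h *\<^sub>R e)\<bar> + \<bar>v (x + h *\<^sub>R e) - v x\<bar>) * k (\<tau> x) h"
      using k0 by (intro mult_right_mono) auto
    also have "\<dots> \<le> \<bar>v (x + h *\<^sub>R e)\<bar> * k (\<tau> (x + h *\<^sub>R e) - h) h
       + (1 + \<kappa>) powr (1 + s) * (if 0 < h \<and> 0 < \<tau> x then h powr - (1 + s) * \<bar>v (x + h *\<^sub>R e) - v x\<bar> else 0)"
      using D by (simp add: distrib_right \<tau>_shift)
    finally show "ennreal \<bar>v x\<bar> * ennreal (k (\<tau> x) h) \<le> ennreal \<bar>v (x + h *\<^sub>R e)\<bar> * ennreal (k (\<tau> (x + h *\<^sub>R e) - h) h)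
      + ennreal ((1 + \<kappa>) powr (1 + s)) * ennreal (if 0 < h \<and> 0 < \<tau> x then h powr - (1 + s) * \<bar>v (x + h *\<^sub>R e) - v x\<bar> else 0)"
      using k0 by (simp add: ennreal_mult'[symmetric] ennreal_plus[symmetric] ennreal_leI del: ennreal_plus)
  qed
  also have "\<dots> = (\<integral>\<^sup>+x. \<integral>\<^sup>+h. ennreal \<bar>v (x + h *\<^sub>R e)\<bar> * ennreal (k (\<tau> (x + h *\<^sub>R e) - h) h) \<partial>lborel \<partial>lborel)
      + ennreal ((1 + \<kappa>) powr (1 + s)) * (\<integral>\<^sup>+x. \<integral>\<^sup>+h. ennreal (if 0 < h \<and> 0 < \<tau> x then h powr - (1 + s) * \<bar>v (x + h *\<^sub>R e) - v x\<bar> else 0) \<partial>lborel \<partial>lborel)"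
    by (simp add: nn_integral_add nn_integral_cmult)
  also have "(\<integral>\<^sup>+x. \<integral>\<^sup>+h. ennreal (if 0 < h \<and> 0 < \<tau> x then h powr - (1 + s) * \<bar>v (x + h *\<^sub>R e) - v x\<bar> else 0) \<partial>lborel \<partial>lborel)
     = (\<integral>\<^sup>+h. \<integral>\<^sup>+x. ennreal (if 0 < h \<and> 0 < \<tau> x then h powr - (1 + s) * \<bar>v (x + h *\<^sub>R e) - v x\<bar> else 0) \<partial>lborel \<partial>lborel)"
    by (rule nn_integral_lborel_commute) measurable
  also have "(\<integral>\<^sup>+x. \<integral>\<^sup>+h. ennreal \<bar>v (x + h *\<^sub>R e)\<bar> * ennreal (k (\<tau> (x + h *\<^sub>R e) - h) h) \<partial>lborel \<partial>lborel)
      = (\<integral>\<^sup>+h. \<integral>\<^sup>+x. ennreal \<bar>v (x + h *\<^sub>R e)\<bar> * ennreal (k (\<tau> (x + h *\<^sub>R e) - h) h) \<partial>lborel \<partial>lborel)"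
    by (rule nn_integral_lborel_commute) measurable
  also have "\<dots> = (\<integral>\<^sup>+h. \<integral>\<^sup>+x. ennreal \<bar>v x\<bar> * ennreal (k (\<tau> x - h) h) \<partial>lborel \<partial>lborel)"
    by (intro nn_integral_cong nn_integral_lborel_shift[where f="\<lambda>x. ennreal \<bar>v x\<bar> * ennreal (k (\<tau> x - _) _)"]) measurable
  also have "\<dots> = (\<integral>\<^sup>+x. \<integral>\<^sup>+h. ennreal \<bar>v x\<bar> * ennreal (k (\<tau> x - h) h) \<partial>lborel \<partial>lborel)"
    by (rule nn_integral_lborel_commute) measurable
  also have "\<dots> = (\<integral>\<^sup>+x. ennreal \<bar>v x\<bar> * (\<integral>\<^sup>+h. ennreal (k (\<tau> x - h) h) \<partial>lborel) \<partial>lborel)"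
    by (intro nn_integral_cong nn_integral_cmult) measurable
  also have "\<dots> \<le> (\<integral>\<^sup>+x. ennreal \<bar>v x\<bar> * ennreal (if \<epsilon> < \<tau> x then \<kappa> * \<theta> * \<tau> x powr - s else 0) \<partial>lborel)"
    by (intro nn_integral_mono mult_left_mono kint2) auto
  also have "\<dots> = (\<integral>\<^sup>+x. ennreal (\<kappa> * \<theta>) * ennreal (if \<epsilon> < \<tau> x then \<bar>v x\<bar> * \<tau> x powr - s else 0) \<partial>lborel)"
    using \<kappa> \<theta> by (intro nn_integral_cong) (auto simp: ennreal_mult'[symmetric] mult_ac)
  also have "\<dots> = ennreal (\<kappa> * \<theta>) * H"
    unfolding H_def by (rule nn_integral_cmult) measurable
  also note C(2)
  finally have "ennreal \<kappa> * H \<le> ennreal (\<kappa> * \<theta>) * H + ennreal ((1 + \<kappa>) powr (1 + s)) * (ennreal C * E)"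
    by (simp add: add_mono mult_left_mono)
  also have "ennreal ((1 + \<kappa>) powr (1 + s)) * (ennreal C * E) = ennreal B * E"
    using C(1) by (simp add: B_def ennreal_mult' mult.assoc)
  finally have main: "ennreal \<kappa> * H \<le> ennreal (\<kappa> * \<theta>) * H + ennreal B * E" .
  obtain H' where H': "H = ennreal H'" "0 \<le> H'" using Hfin by (cases H) auto
  have "H \<le> ennreal (B / (\<kappa> * (1 - \<theta>))) * E"
  proof (cases "ennreal B * E = \<infinity>")
    case True
    then have "B \<noteq> 0" "E = \<infinity>" using B by (auto simp: ennreal_mult_eq_top_iff)
    then show ?thesis using B \<kappa> \<theta> by (simp add: ennreal_mult_top)
  next
    case False
    show ?thesis
    proof (cases "B = 0")
      case True
      have "\<kappa> * H' \<le> \<kappa> * \<theta> * H'" using main H' \<kappa> \<theta> True by (simp add: ennreal_mult'[symmetric])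
      then have "H' \<le> \<theta> * H'" using \<kappa> by simp
      moreover have "\<theta> * H' \<le> 1 * H'" using \<theta> H' by (intro mult_right_mono) auto
      moreover have "\<theta> * H' < 1 * H'" if "H' \<noteq> 0" using \<theta> H' that by (intro mult_strict_right_mono) auto
      ultimately have "H' = 0" by linarith
      then show ?thesis using H' by simp
    next
      case B0: False
      then have "E \<noteq> \<infinity>" using False B by (auto simp: ennreal_mult_top)
      then obtain E' where E': "E = ennreal E'" "0 \<le> E'" by (cases E) auto
      have "ennreal (\<kappa> * H') \<le> ennreal (\<kappa> * \<theta> * H' + B * E')"
        using main H' E' B \<kappa> \<theta> by (simp add: ennreal_mult'[symmetric] ennreal_plus[symmetric] del: ennreal_plus)
      then have "\<kappa> * H' \<le> \<kappa> * \<theta> * H' + B * E'"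
        using H' E' B \<kappa> \<theta> by (subst (asm) ennreal_le_iff) auto
      then have "H' * (\<kappa> * (1 - \<theta>)) \<le> B * E'" by (simp add: algebra_simps)
      then have "H' \<le> B * E' / (\<kappa> * (1 - \<theta>))" using \<kappa> \<theta> by (subst pos_le_divide_eq) auto
      then show ?thesis using H' E' B \<kappa> \<theta> by (simp add: ennreal_mult'[symmetric] ennreal_leI)
    qed
  qed
  then show ?thesis unfolding H_def B_def \<theta>_def .
qed

theorem hardy_epigraph:
  obtains C where "0 \<le> C" "\<And>v. v \<in> borel_measurable borel \<Longrightarrow> (\<integral>\<^sup>+x. ennreal \<bar>v x\<bar> \<partial>lborel) < \<infinity> \<Longrightarrow>
    (\<integral>\<^sup>+x. ennreal (if 0 < \<tau> x then \<bar>v x\<bar> * \<tau> x powr - s else 0) \<partial>lborel) \<le> ennreal C * frac_energy s 1 {x. 0 < \<tau> x} v"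
proof -
  obtain C where C: "0 \<le> C" "\<And>v. v \<in> borel_measurable borel \<Longrightarrow>
    (\<integral>\<^sup>+h. \<integral>\<^sup>+x. ennreal (if 0 < h \<and> 0 < \<tau> x then h powr - (1 + s) * \<bar>v (x + h *\<^sub>R e) - v x\<bar> else 0) \<partial>lborel \<partial>lborel)
    \<le> ennreal C * frac_energy s 1 {x. 0 < \<tau> x} v"
    using directional_seminorm by blast
  \<comment> \<open>Solves \<open>(2 + \<kappa>) powr s = 2 powr ((1 + s) / 2)\<close>, a value
    strictly between \<open>2 powr s\<close> and 2. The first comparison gives
    \<open>0 < \<kappa>\<close>, the second the contraction.\<close>
  define \<kappa> where "\<kappa> = 2 powr ((1 + s) / (2 * s)) - (2::real)"
  have "(2::real) powr 1 < 2 powr ((1 + s) / (2 * s))"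
    using s by (intro powr_less_mono) (auto simp: field_simps)
  then have \<kappa>1: "0 < \<kappa>" by (simp add: \<kappa>_def)
  have "(2 + \<kappa>) powr s = 2 powr ((1 + s) / 2)"
    using s by (simp add: \<kappa>_def powr_powr)
  also have "\<dots> < 2 powr 1" using s by (intro powr_less_mono) auto
  finally have \<kappa>2: "(2 + \<kappa>) powr s < 2" by simp
  define B where "B = (1 + \<kappa>) powr (1 + s) * C / (\<kappa> * (1 - (2 + \<kappa>) powr s / 2))"
  show thesis
  proof (rule that[of B])
    show "0 \<le> B" using C \<kappa>1 \<kappa>2 by (auto simp: B_def)
    fix v :: "'a \<Rightarrow> real" assume v [measurable]: "v \<in> borel_measurable borel" and fin: "(\<integral>\<^sup>+x. ennreal \<bar>v x\<bar> \<partial>lborel) < \<infinity>"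
    show "(\<integral>\<^sup>+x. ennreal (if 0 < \<tau> x then \<bar>v x\<bar> * \<tau> x powr - s else 0) \<partial>lborel) \<le> ennreal B * frac_energy s 1 {x. 0 < \<tau> x} v"
    proof (rule nn_integral_Fatou_bound[where X="\<lambda>m x. ennreal (if 1 / real (Suc m) < \<tau> x then \<bar>v x\<bar> * \<tau> x powr - s else 0)"
          and B="\<lambda>_. ennreal B * frac_energy s 1 {x. 0 < \<tau> x} v"])
      show "(\<integral>\<^sup>+x. ennreal (if 1 / real (Suc m) < \<tau> x then \<bar>v x\<bar> * \<tau> x powr - s else 0) \<partial>lborel) \<le> ennreal B * frac_energy s 1 {x. 0 < \<tau> x} v" for m
        unfolding B_def by (rule hardy_truncated[OF C(1) C(2)[OF v] v fin _ \<kappa>1 \<kappa>2]) simp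
      show "AE x in lborel. (\<lambda>m. ennreal (if 1 / real (Suc m) < \<tau> x then \<bar>v x\<bar> * \<tau> x powr - s else 0)) \<longlonglongrightarrow> ennreal (if 0 < \<tau> x then \<bar>v x\<bar> * \<tau> x powr - s else 0)"
      proof (intro AE_I2 tendsto_eventually)
        fix x
        show "eventually (\<lambda>m. ennreal (if 1 / real (Suc m) < \<tau> x then \<bar>v x\<bar> * \<tau> x powr - s else 0) = ennreal (if 0 < \<tau> x then \<bar>v x\<bar> * \<tau> x powr - s else 0)) sequentially"
        proof (cases "0 < \<tau> x")
          case True
          have "(\<lambda>m. 1 / real (Suc m)) \<longlonglongrightarrow> 0" by (rule LIMSEQ_Suc) (rule lim_1_over_n)
          then have "eventually (\<lambda>m. 1 / real (Suc m) < \<tau> x) sequentially" using True by (rule order_tendstoD(2))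
          then show ?thesis by eventually_elim (use True in auto)
        next
          case False
          then have "\<not> 1 / real (Suc m) < \<tau> x" for m using divide_nonneg_pos[of 1 "real (Suc m)"] by (smt (verit) of_nat_0_less_iff zero_less_Suc)
          then show ?thesis using False by simp
        qed
      qed
    qed auto
  qed
qed

end

text \<open>This kernel appears whenever a function is multiplied by a cutoff of scale
  \<open>a\<close>. Inside radius \<open>a\<close> the numerator gains one power of the distance, so
  the exponent is \<open>n - (1 - s)\<close>, integrable because \<open>s < 1\<close>; outside it is
  a tail of order \<open>n + s\<close>. Both parts scale like \<open>a powr - s\<close>.\<close>

lemma nn_integral_truncated_kernel:
  fixes s :: real
  assumes s: "0 < s" "s < 1"
  obtains C where "0 \<le> C" "\<And>a (x :: 'a::euclidean_space). 0 < a \<Longrightarrow>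
    (\<integral>\<^sup>+y. ennreal (min 1 (norm (x - y) / a) / norm (x - y) powr (real DIM('a) + s)) \<partial>lborel) \<le> ennreal (C * a powr - s)"
proof -
  define n where "n = real DIM('a)"
  have n: "1 \<le> n" unfolding n_def using DIM_positive[where 'a='a] by linarith
  have n': "1 - s \<le> real DIM('a)" using n s unfolding n_def by linarith
  define c1 where "c1 = unit_ball_vol n * 2 ^ DIM('a) / (1 - 2 powr - (1 - s))"
  define c2 where "c2 = unit_ball_vol n * 2 ^ DIM('a) / (1 - 2 powr - s)"
  have c: "0 \<le> c1" "0 \<le> c2" using s by (auto simp: c1_def c2_def n_def powr_less_one less_imp_le)
  show thesis
  proof (rule that[of "c1 + c2"])
    show "0 \<le> c1 + c2" using c by simp
    fix a :: real and x :: 'a assume a: "0 < a"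
    have m [measurable]: "{y. norm (x - y) < a} \<in> sets lborel" "{y. a \<le> norm (x - y)} \<in> sets lborel"
      by simp_all
    have "(\<integral>\<^sup>+y. ennreal (min 1 (norm (x - y) / a) / norm (x - y) powr (n + s)) \<partial>lborel)
      \<le> (\<integral>\<^sup>+y. ennreal (1 / a) * (ennreal (norm (x - y) powr - (n - (1 - s))) * indicator {y. norm (x - y) < a} y)
         + ennreal (norm (x - y) powr - (n + s)) * indicator {y. a \<le> norm (x - y)} y \<partial>lborel)"
    proof (intro nn_integral_mono)
      fix y
      show "ennreal (min 1 (norm (x - y) / a) / norm (x - y) powr (n + s))
        \<le> ennreal (1 / a) * (ennreal (norm (x - y) powr - (n - (1 - s))) * indicator {y. norm (x - y) < a} y)
         + ennreal (norm (x - y) powr - (n + s)) * indicator {y. a \<le> norm (x - y)} y"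
      proof (cases "norm (x - y) < a")
        case True
        have e: "- (n - (1 - s)) = 1 + - (n + s)" by simp
        have "norm (x - y) powr - (n - (1 - s)) = norm (x - y) powr 1 * norm (x - y) powr - (n + s)"
          unfolding e by (rule powr_add)
        then have "norm (x - y) / norm (x - y) powr (n + s) = norm (x - y) powr - (n - (1 - s))"
          by (simp only: powr_minus divide_inverse powr_one norm_ge_zero)
        then have "min 1 (norm (x - y) / a) / norm (x - y) powr (n + s) = 1 / a * norm (x - y) powr - (n - (1 - s))"
          using True a by (simp add: min_def field_simps)
        then show ?thesis using True a by (simp add: ennreal_mult'[symmetric])
      next
        case False
        then have "min 1 (norm (x - y) / a) / norm (x - y) powr (n + s) = norm (x - y) powr - (n + s)"
          using a by (simp only: powr_minus_divide) (simp add: min_def)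
        then show ?thesis using False by simp
      qed
    qed
    also have "\<dots> = ennreal (1 / a) * (\<integral>\<^sup>+y. ennreal (norm (x - y) powr - (n - (1 - s))) * indicator {y. norm (x - y) < a} y \<partial>lborel)
         + (\<integral>\<^sup>+y. ennreal (norm (x - y) powr - (n + s)) * indicator {y. a \<le> norm (x - y)} y \<partial>lborel)"
      by (simp add: nn_integral_add nn_integral_cmult)
    also have "\<dots> \<le> ennreal (1 / a) * ennreal (c1 * a powr (1 - s)) + ennreal (c2 * a powr - s)"
      unfolding c1_def c2_def n_def using s a n'
      by (intro add_mono mult_left_mono nn_integral_near_powr nn_integral_tail_powr) auto
    also have "ennreal (1 / a) * ennreal (c1 * a powr (1 - s)) = ennreal (c1 * a powr - s)"
    proof -
      have "a powr (1 - s) = a * a powr - s" using a by (simp add: powr_diff powr_minus divide_inverse)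
      then show ?thesis using a by (simp add: ennreal_mult'[symmetric])
    qed
    also have "ennreal (c1 * a powr - s) + ennreal (c2 * a powr - s) = ennreal ((c1 + c2) * a powr - s)"
      using c by (simp add: distrib_right)
    finally show "(\<integral>\<^sup>+y. ennreal (min 1 (norm (x - y) / a) / norm (x - y) powr (real DIM('a) + s)) \<partial>lborel) \<le> ennreal ((c1 + c2) * a powr - s)"
      unfolding n_def .
  qed
qed

text \<open>For two points of \<open>\<Omega>\<close> this is the product rule for the tent
  \<open>\<eta>\<close>. A pair with a point of \<open>U\<close> outside \<open>\<Omega>\<close>
  cannot be charged to the energy over \<open>\<Omega>\<close>. But that point lies outside
  \<open>ball x0 \<rho>\<close>, while \<open>\<eta>\<close> lives on the ball of half the radius,
  so the distance is at least \<open>\<rho> / 2\<close> and the second term covers the pair.\<close>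

lemma frac_energy_localised:
  fixes \<eta> w :: "'a::euclidean_space \<Rightarrow> real"
  assumes s: "0 < s" "s < 1"
    and \<Omega>: "\<And>x. w x \<noteq> 0 \<Longrightarrow> x \<in> \<Omega>" and US: "\<And>x. x \<in> U \<Longrightarrow> x \<in> ball x0 \<rho> \<Longrightarrow> x \<in> \<Omega>"
    and \<eta>: "\<And>x. \<eta> x = max 0 (1 - 2 * norm (x - x0) / \<rho>)" and \<rho>: "0 < \<rho>" and xy: "x \<in> U" "y \<in> U"
  shows "dq s (\<lambda>x. \<eta> x * w x) x y \<le> dq s w x y * (indicator \<Omega> x * indicator \<Omega> y)
    + (\<bar>w x\<bar> + \<bar>w y\<bar>) * (min 1 (norm (x - y) / (\<rho> / 2)) / norm (x - y) powr (real DIM('a) + s))"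
proof -
  have \<eta>0: "0 \<le> \<eta> z" "\<eta> z \<le> 1" for z using \<rho> by (auto simp: \<eta>)
  have \<eta>lip: "\<bar>\<eta> x - \<eta> y\<bar> \<le> min 1 (norm (x - y) / (\<rho> / 2))"
  proof -
    have "\<bar>norm (x - x0) - norm (y - x0)\<bar> \<le> norm (x - y)"
      using norm_triangle_ineq3[of "x - x0" "y - x0"] by simp
    then have "\<bar>2 * norm (x - x0) / \<rho> - 2 * norm (y - x0) / \<rho>\<bar> \<le> norm (x - y) / (\<rho> / 2)"
      using \<rho> by (simp add: field_simps abs_le_iff)
    then have "\<bar>\<eta> x - \<eta> y\<bar> \<le> norm (x - y) / (\<rho> / 2)" unfolding \<eta> by linarith
    moreover have "\<bar>\<eta> x - \<eta> y\<bar> \<le> 1" using \<eta>0[of x] \<eta>0[of y] by linarith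
    ultimately show ?thesis by simp
  qed
  define m where "m = min 1 (norm (x - y) / (\<rho> / 2))"
  have m: "0 \<le> m" using \<rho> by (simp add: m_def)
  have key: "\<bar>\<eta> x * w x - \<eta> y * w y\<bar> \<le> \<bar>w x - w y\<bar> * (indicator \<Omega> x * indicator \<Omega> y) + (\<bar>w x\<bar> + \<bar>w y\<bar>) * m"
  proof (cases "x \<in> \<Omega> \<and> y \<in> \<Omega>")
    case True
    have "\<eta> x * w x - \<eta> y * w y = \<eta> x * (w x - w y) + w y * (\<eta> x - \<eta> y)" by (simp add: algebra_simps)
    also have "\<bar>\<dots>\<bar> \<le> \<eta> x * \<bar>w x - w y\<bar> + \<bar>w y\<bar> * \<bar>\<eta> x - \<eta> y\<bar>"
      using \<eta>0[of x] by (intro order_trans[OF abs_triangle_ineq]) (simp add: abs_mult)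
    also have "\<dots> \<le> 1 * \<bar>w x - w y\<bar> + \<bar>w y\<bar> * m"
      unfolding m_def using \<eta>0[of x] \<eta>lip by (intro add_mono mult_mono) auto
    also have "\<dots> \<le> \<bar>w x - w y\<bar> + (\<bar>w x\<bar> + \<bar>w y\<bar>) * m" using m by (simp add: distrib_right)
    finally show ?thesis using True by simp
  next
    case False
    have far: "\<bar>\<eta> z * w z\<bar> \<le> \<bar>w z\<bar> * m" if z: "z \<in> U" "z' \<in> U" "z' \<notin> \<Omega>" "norm (z - z') = norm (x - y)" for z z'
    proof (cases "norm (z - x0) < \<rho> / 2")
      case True
      have "z' \<notin> ball x0 \<rho>" using US z by auto
      then have "\<rho> \<le> norm (x0 - z')" by (simp add: dist_norm)
      also have "\<dots> \<le> norm (z - z') + norm (z - x0)"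
        using norm_triangle_ineq4[of "z - z'" "z - x0"] by simp
      finally have "\<rho> / 2 \<le> norm (x - y)" using True z by simp
      then have "m = 1" using \<rho> by (simp add: m_def min_def)
      then show ?thesis using \<eta>0[of z] by (simp add: abs_mult mult_left_le_one_le)
    next
      case False
      then have "\<eta> z = 0" using \<rho> by (simp add: \<eta> field_simps max_def)
      then show ?thesis using m by simp
    qed
    show ?thesis
    proof (cases "y \<in> \<Omega>")
      case True
      then have "x \<notin> \<Omega>" using False by simp
      then have "w x = 0" using \<Omega> by auto
      then show ?thesis using far[of y x] xy \<open>x \<notin> \<Omega>\<close> m by (simp add: norm_minus_commute)
    next
      case yn: False
      then have "w y = 0" using \<Omega> by auto
      then show ?thesis using far[of x y] xy yn m by simp
    qed
  qed
  show ?thesis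
    unfolding dq_def m_def[symmetric]
    using divide_right_mono[OF key, of "norm (x - y) powr (real DIM('a) + s)"] by (simp add: add_divide_distrib)
qed

text \<open>Near \<open>x0\<close> the domain agrees with an epigraph. A tent localises
  \<open>w\<close>, at the price of a multiple of its L1 norm; \<open>hardy_epigraph\<close> applies
  to the product, and the height over the graph is then exchanged for the distance to the
  complement.\<close>

lemma hardy_boundary_point:
  fixes \<Omega> :: "'a::euclidean_space set"
  assumes s: "0 < s" "s < 1" and \<Omega>: "open \<Omega>" "bounded \<Omega>" "lipschitz_boundary \<Omega>" and x0: "x0 \<in> frontier \<Omega>"
  obtains C r where "0 \<le> C" "0 < r"
    "\<And>w. w \<in> borel_measurable borel \<Longrightarrow> (\<And>x. x \<notin> \<Omega> \<Longrightarrow> w x = 0) \<Longrightarrow> (\<integral>\<^sup>+x. ennreal \<bar>w x\<bar> \<partial>lborel) < \<infinity> \<Longrightarrow>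
      (\<integral>\<^sup>+x. ennreal (if norm (x - x0) < r then \<bar>w x\<bar> * infdist x (- \<Omega>) powr - s else 0) \<partial>lborel)
        \<le> ennreal C * (frac_energy s 1 \<Omega> w + (\<integral>\<^sup>+x. ennreal \<bar>w x\<bar> \<partial>lborel))"
proof -
  obtain e \<rho> L g where e: "norm e = 1" and \<rho>: "0 < \<rho>" and g: "lipschitz_on L {y. y \<bullet> e = 0} g"
    and chart: "\<Omega> \<inter> ball x0 \<rho> = {z \<in> ball x0 \<rho>. g (z - (z \<bullet> e) *\<^sub>R e) < z \<bullet> e}"
    using \<Omega>(3) x0 unfolding lipschitz_boundary_def by blast
  define \<pi> where "\<pi> = (\<lambda>x. x - (x \<bullet> e) *\<^sub>R e)"
  define \<tau> where "\<tau> = (\<lambda>x. x \<bullet> e - g (\<pi> x))"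
  \<comment> \<open>The coordinate along \<open>e\<close> contributes 1, and \<open>g\<close>
    composed with the projection \<open>\<pi>\<close> contributes \<open>L * 2\<close>, since
    \<open>\<pi>\<close> is estimated by the factor 2.\<close>
  define \<Lambda> where "\<Lambda> = 1 + L * 2"
  have L: "0 \<le> L" using g by (rule lipschitz_on_nonneg)
  have ee: "e \<bullet> e = 1" using e by (simp add: dot_square_norm)
  have \<pi>e: "\<pi> x \<bullet> e = 0" for x by (simp add: \<pi>_def inner_diff_left ee)
  have ie: "\<bar>x \<bullet> e\<bar> \<le> norm x" for x using Cauchy_Schwarz_ineq2[of x e] e by simp
  have \<tau>_lip: "\<bar>\<tau> x - \<tau> y\<bar> \<le> \<Lambda> * norm (x - y)" for x y
  proof -
    have "\<bar>g (\<pi> x) - g (\<pi> y)\<bar> \<le> L * norm (\<pi> x - \<pi> y)"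
      using lipschitz_onD[OF g, of "\<pi> x" "\<pi> y"] \<pi>e by (simp add: dist_norm)
    also have "\<pi> x - \<pi> y = (x - y) - ((x - y) \<bullet> e) *\<^sub>R e" by (simp add: \<pi>_def inner_diff_left algebra_simps)
    also have "norm \<dots> \<le> norm (x - y) + norm (((x - y) \<bullet> e) *\<^sub>R e)" by (rule norm_triangle_ineq4)
    also have "\<dots> \<le> 2 * norm (x - y)" using ie[of "x - y"] e by simp
    finally have "\<bar>g (\<pi> x) - g (\<pi> y)\<bar> \<le> L * (2 * norm (x - y))" using L by (simp add: mult_left_mono)
    moreover have "\<bar>x \<bullet> e - y \<bullet> e\<bar> \<le> norm (x - y)" using ie[of "x - y"] by (simp add: inner_diff_left)
    ultimately show ?thesis unfolding \<tau>_def \<Lambda>_def by (simp add: algebra_simps)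
  qed
  interpret epigraph e \<tau> \<Lambda> s
  proof
    show "\<tau> (x + h *\<^sub>R e) = \<tau> x + h" for x h
    proof -
      have "\<pi> (x + h *\<^sub>R e) = \<pi> x" by (simp add: \<pi>_def inner_add_left ee algebra_simps)
      then show ?thesis by (simp add: \<tau>_def inner_add_left ee)
    qed
    show "norm e = 1" "0 < s" "s < 1" by fact+
    show "1 \<le> \<Lambda>" using L by (simp add: \<Lambda>_def)
    show "\<bar>\<tau> x - \<tau> y\<bar> \<le> \<Lambda> * norm (x - y)" for x y by (rule \<tau>_lip)
  qed
  define U where "U = {x. 0 < \<tau> x}"
  have US: "x \<in> U \<longleftrightarrow> x \<in> \<Omega>" if "x \<in> ball x0 \<rho>" for x
  proof -
    have "x \<in> \<Omega> \<inter> ball x0 \<rho> \<longleftrightarrow> x \<in> {z \<in> ball x0 \<rho>. g (z - (z \<bullet> e) *\<^sub>R e) < z \<bullet> e}"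
      by (simp only: chart)
    then show ?thesis unfolding U_def \<tau>_def \<pi>_def Int_iff mem_Collect_eq using that by auto
  qed
  have x0\<Omega>: "x0 \<notin> \<Omega>" using x0 \<Omega>(1) by (simp add: frontier_def interior_open)
  have ne: "- \<Omega> \<noteq> {}" using x0\<Omega> by blast
  have x0\<tau>: "\<tau> x0 \<le> 0" using US[of x0] x0\<Omega> \<rho> by (auto simp: U_def)
  obtain C where C: "0 \<le> C" "\<And>v. v \<in> borel_measurable borel \<Longrightarrow> (\<integral>\<^sup>+x. ennreal \<bar>v x\<bar> \<partial>lborel) < \<infinity> \<Longrightarrow>
    (\<integral>\<^sup>+x. ennreal (if 0 < \<tau> x then \<bar>v x\<bar> * \<tau> x powr - s else 0) \<partial>lborel) \<le> ennreal C * frac_energy s 1 {x. 0 < \<tau> x} v"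
    using hardy_epigraph by blast
  obtain K where K: "0 \<le> K" "\<And>a (x :: 'a). 0 < a \<Longrightarrow>
    (\<integral>\<^sup>+y. ennreal (min 1 (norm (x - y) / a) / norm (x - y) powr (real DIM('a) + s)) \<partial>lborel) \<le> ennreal (K * a powr - s)"
    using nn_integral_truncated_kernel[OF s] by blast
  define K' where "K' = 2 * (K * (\<rho> / 2) powr - s)"
  have K': "0 \<le> K'" using K by (simp add: K'_def)
  \<comment> \<open>The factor 2 comes from \<open>\<eta> x \<ge> 1 / 2\<close> within
    \<open>\<rho> / 4\<close> of \<open>x0\<close>, \<open>\<Lambda> powr s\<close> from
    \<open>\<tau> x / \<Lambda> \<le> infdist x (- \<Omega>)\<close>, \<open>C\<close> from the
    epigraph and \<open>1 + K'\<close> from the localisation.\<close>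
  define B where "B = 2 * \<Lambda> powr s * C * (1 + K')"
  show thesis
  proof (rule that[of B "\<rho> / 4"])
    show "0 \<le> B" using C(1) K' by (simp add: B_def)
    show "0 < \<rho> / 4" using \<rho> by simp
    fix w :: "'a \<Rightarrow> real"
    assume w [measurable]: "w \<in> borel_measurable borel" and off: "\<And>x. x \<notin> \<Omega> \<Longrightarrow> w x = 0" and fin: "(\<integral>\<^sup>+x. ennreal \<bar>w x\<bar> \<partial>lborel) < \<infinity>"
    define \<eta> where "\<eta> = (\<lambda>x. max 0 (1 - 2 * norm (x - x0) / \<rho>))"
    define v where "v = (\<lambda>x. \<eta> x * w x)"
    have [measurable]: "\<eta> \<in> borel_measurable borel" unfolding \<eta>_def by measurable
    have v [measurable]: "v \<in> borel_measurable borel" unfolding v_def by measurable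
    have \<eta>1: "0 \<le> \<eta> x" "\<eta> x \<le> 1" for x using \<rho> by (auto simp: \<eta>_def)
    have vw: "\<bar>v x\<bar> \<le> \<bar>w x\<bar>" for x using \<eta>1[of x] by (simp add: v_def abs_mult mult_left_le_one_le)
    have vfin: "(\<integral>\<^sup>+x. ennreal \<bar>v x\<bar> \<partial>lborel) < \<infinity>"
      using fin by (rule order_le_less_trans[rotated]) (intro nn_integral_mono ennreal_leI vw)
    define W where "W = (\<integral>\<^sup>+x. ennreal \<bar>w x\<bar> \<partial>lborel)"
    define k where "k = (\<lambda>x y::'a. min 1 (norm (x - y) / (\<rho> / 2)) / norm (x - y) powr (real DIM('a) + s))"
    have k0: "0 \<le> k x y" for x y using \<rho> by (simp add: k_def)
    have kc: "k x y = k y x" for x y by (simp add: k_def norm_minus_commute)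
    have km [measurable]: "case_prod k \<in> borel_measurable (borel \<Otimes>\<^sub>M borel)"
      unfolding k_def case_prod_beta' by measurable
    have kW: "(\<integral>\<^sup>+x. \<integral>\<^sup>+y. ennreal \<bar>w x\<bar> * ennreal (k x y) \<partial>lborel \<partial>lborel) \<le> ennreal (K * (\<rho> / 2) powr - s) * W"
    proof -
      have "(\<integral>\<^sup>+x. \<integral>\<^sup>+y. ennreal \<bar>w x\<bar> * ennreal (k x y) \<partial>lborel \<partial>lborel) = (\<integral>\<^sup>+x. ennreal \<bar>w x\<bar> * (\<integral>\<^sup>+y. ennreal (k x y) \<partial>lborel) \<partial>lborel)"
        by (intro nn_integral_cong nn_integral_cmult) measurable
      also have "\<dots> \<le> (\<integral>\<^sup>+x. ennreal \<bar>w x\<bar> * ennreal (K * (\<rho> / 2) powr - s) \<partial>lborel)"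
        unfolding k_def using \<rho> by (intro nn_integral_mono mult_left_mono K) auto
      also have "\<dots> = ennreal (K * (\<rho> / 2) powr - s) * W"
        by (simp add: nn_integral_multc W_def mult.commute)
      finally show ?thesis .
    qed
    have kW': "(\<integral>\<^sup>+x. \<integral>\<^sup>+y. ennreal \<bar>w y\<bar> * ennreal (k x y) \<partial>lborel \<partial>lborel) \<le> ennreal (K * (\<rho> / 2) powr - s) * W"
    proof -
      have "(\<integral>\<^sup>+x. \<integral>\<^sup>+y. ennreal \<bar>w y\<bar> * ennreal (k x y) \<partial>lborel \<partial>lborel) = (\<integral>\<^sup>+y. \<integral>\<^sup>+x. ennreal \<bar>w y\<bar> * ennreal (k x y) \<partial>lborel \<partial>lborel)"
        by (rule nn_integral_lborel_commute) measurable
      also have "\<dots> = (\<integral>\<^sup>+x. \<integral>\<^sup>+y. ennreal \<bar>w x\<bar> * ennreal (k x y) \<partial>lborel \<partial>lborel)"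
        using kc by simp
      finally show ?thesis using kW by simp
    qed
    have [measurable]: "\<Omega> \<in> sets borel" using \<Omega>(1) by simp
    have "frac_energy s 1 U v \<le> (\<integral>\<^sup>+x. \<integral>\<^sup>+y. ennreal (dq s w x y powr 1) * (indicator \<Omega> x * indicator \<Omega> y)
        + (ennreal \<bar>w x\<bar> * ennreal (k x y) + ennreal \<bar>w y\<bar> * ennreal (k x y)) \<partial>lborel \<partial>lborel)"
      unfolding frac_energy_def
    proof (intro nn_integral_mono)
      fix x y
      show "ennreal (dq s v x y powr 1) * (indicator U x * indicator U y) \<le> ennreal (dq s w x y powr 1) * (indicator \<Omega> x * indicator \<Omega> y)
        + (ennreal \<bar>w x\<bar> * ennreal (k x y) + ennreal \<bar>w y\<bar> * ennreal (k x y))"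
      proof (cases "x \<in> U \<and> y \<in> U")
        case True
        have "dq s v x y \<le> dq s w x y * (indicator \<Omega> x * indicator \<Omega> y) + (\<bar>w x\<bar> + \<bar>w y\<bar>) * k x y"
          unfolding v_def k_def using True US off \<rho>
          by (intro frac_energy_localised[OF s, where U=U and ?x0.0=x0]) (auto simp: \<eta>_def)
        then have "ennreal (dq s v x y) \<le> ennreal (dq s w x y * (indicator \<Omega> x * indicator \<Omega> y) + (\<bar>w x\<bar> * k x y + \<bar>w y\<bar> * k x y))"
          by (intro ennreal_leI) (simp add: distrib_right)
        also have "\<dots> = ennreal (dq s w x y) * (indicator \<Omega> x * indicator \<Omega> y) + (ennreal \<bar>w x\<bar> * ennreal (k x y) + ennreal \<bar>w y\<bar> * ennreal (k x y))"
          using k0[of x y] by (simp add: ennreal_mult' ennreal_indicator)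
        finally show ?thesis using True by simp
      qed auto
    qed
    also have "\<dots> = frac_energy s 1 \<Omega> w + ((\<integral>\<^sup>+x. \<integral>\<^sup>+y. ennreal \<bar>w x\<bar> * ennreal (k x y) \<partial>lborel \<partial>lborel)
        + (\<integral>\<^sup>+x. \<integral>\<^sup>+y. ennreal \<bar>w y\<bar> * ennreal (k x y) \<partial>lborel \<partial>lborel))"
      unfolding frac_energy_def by (simp add: nn_integral_add)
    also have "\<dots> \<le> frac_energy s 1 \<Omega> w + (ennreal (K * (\<rho> / 2) powr - s) * W + ennreal (K * (\<rho> / 2) powr - s) * W)"
      by (intro add_left_mono add_mono kW kW')
    also have "ennreal (K * (\<rho> / 2) powr - s) * W + ennreal (K * (\<rho> / 2) powr - s) * W = ennreal K' * W"
      using K(1) by (simp add: K'_def ennreal_mult' mult_2[symmetric] mult.assoc)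
    also have "frac_energy s 1 \<Omega> w + ennreal K' * W \<le> ennreal (1 + K') * (frac_energy s 1 \<Omega> w + W)"
    proof -
      have "frac_energy s 1 \<Omega> w + ennreal K' * W \<le> (frac_energy s 1 \<Omega> w + W) + ennreal K' * (frac_energy s 1 \<Omega> w + W)"
        by (intro add_mono mult_left_mono) simp_all
      then show ?thesis using K' by (simp add: distrib_right)
    qed
    finally have Ev: "frac_energy s 1 U v \<le> ennreal (1 + K') * (frac_energy s 1 \<Omega> w + W)" .
    have "(\<integral>\<^sup>+x. ennreal (if norm (x - x0) < \<rho> / 4 then \<bar>w x\<bar> * infdist x (- \<Omega>) powr - s else 0) \<partial>lborel)
       \<le> (\<integral>\<^sup>+x. ennreal (2 * \<Lambda> powr s) * ennreal (if 0 < \<tau> x then \<bar>v x\<bar> * \<tau> x powr - s else 0) \<partial>lborel)"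
    proof (intro nn_integral_mono)
      fix x
      have "(if norm (x - x0) < \<rho> / 4 then \<bar>w x\<bar> * infdist x (- \<Omega>) powr - s else 0) \<le> 2 * \<Lambda> powr s * (if 0 < \<tau> x then \<bar>v x\<bar> * \<tau> x powr - s else 0)"
      proof (cases "norm (x - x0) < \<rho> / 4 \<and> x \<in> \<Omega>")
        case True
        then have xb: "x \<in> ball x0 \<rho>" using \<rho> by (simp add: dist_norm norm_minus_commute)
        have \<tau>x: "0 < \<tau> x" using US[OF xb] True by (simp add: U_def)
        \<comment> \<open>A complementary point inside the chart has height at most 0, so the
          Lipschitz bound applies to it. One outside the chart is at least as far from
          \<open>x\<close> as \<open>x0\<close> is, and \<open>x0\<close> has height at most
          0.\<close>
        have d: "\<tau> x / \<Lambda> \<le> infdist x (- \<Omega>)"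
          unfolding infdist_notempty[OF ne]
        proof (rule cINF_greatest[OF ne])
          fix y assume y: "y \<in> - \<Omega>"
          have "\<tau> x \<le> \<Lambda> * norm (x - y)"
          proof (cases "y \<in> ball x0 \<rho>")
            case True
            then have "\<tau> y \<le> 0" using US[of y] y by (auto simp: U_def)
            then show ?thesis using \<tau>_lip[of x y] by linarith
          next
            case False
            then have "\<rho> \<le> norm (x0 - y)" by (simp add: dist_norm)
            also have "\<dots> \<le> norm (x - y) + norm (x - x0)" using norm_triangle_ineq4[of "x - y" "x - x0"] by simp
            finally have "norm (x - x0) \<le> norm (x - y)" using True \<rho> by linarith
            then have "\<Lambda> * norm (x - x0) \<le> \<Lambda> * norm (x - y)" using \<Lambda> by (intro mult_left_mono) auto
            then show ?thesis using \<tau>_lip[of x x0] x0\<tau> by linarith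
          qed
          then show "\<tau> x / \<Lambda> \<le> dist x y" using \<Lambda> by (simp add: dist_norm pos_divide_le_eq mult.commute)
        qed
        have "infdist x (- \<Omega>) powr - s \<le> (\<tau> x / \<Lambda>) powr - s"
          using d \<tau>x \<Lambda> s by (intro powr_mono2') auto
        also have "\<dots> = \<Lambda> powr s * \<tau> x powr - s"
          using \<tau>x \<Lambda> by (simp add: powr_divide powr_minus field_simps)
        finally have i: "infdist x (- \<Omega>) powr - s \<le> \<Lambda> powr s * \<tau> x powr - s" .
        have "1 / 2 \<le> \<eta> x" using True \<rho> by (simp add: \<eta>_def field_simps max_def)
        then have "\<bar>w x\<bar> \<le> 2 * \<bar>v x\<bar>" using mult_right_mono[of "1/2" "\<eta> x" "\<bar>w x\<bar>"] \<eta>1[of x] by (simp add: v_def abs_mult)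
        then have "\<bar>w x\<bar> * infdist x (- \<Omega>) powr - s \<le> (2 * \<bar>v x\<bar>) * (\<Lambda> powr s * \<tau> x powr - s)"
          using i by (intro mult_mono) auto
        then show ?thesis using True \<tau>x by (simp add: mult_ac)
      next
        case False
        then show ?thesis using off[of x] by auto
      qed
      then show "ennreal (if norm (x - x0) < \<rho> / 4 then \<bar>w x\<bar> * infdist x (- \<Omega>) powr - s else 0) \<le> ennreal (2 * \<Lambda> powr s) * ennreal (if 0 < \<tau> x then \<bar>v x\<bar> * \<tau> x powr - s else 0)"
        by (subst ennreal_mult'[symmetric]) (auto intro: ennreal_leI)
    qed
    also have "\<dots> = ennreal (2 * \<Lambda> powr s) * (\<integral>\<^sup>+x. ennreal (if 0 < \<tau> x then \<bar>v x\<bar> * \<tau> x powr - s else 0) \<partial>lborel)"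
      by (rule nn_integral_cmult) measurable
    also have "\<dots> \<le> ennreal (2 * \<Lambda> powr s) * (ennreal C * (ennreal (1 + K') * (frac_energy s 1 \<Omega> w + W)))"
      by (intro mult_left_mono order_trans[OF C(2)[OF v vfin]] Ev[unfolded U_def]) auto
    also have "\<dots> = ennreal B * (frac_energy s 1 \<Omega> w + W)"
      using C(1) K' by (simp add: B_def ennreal_mult' mult.assoc)
    finally show "(\<integral>\<^sup>+x. ennreal (if norm (x - x0) < \<rho> / 4 then \<bar>w x\<bar> * infdist x (- \<Omega>) powr - s else 0) \<partial>lborel)
        \<le> ennreal B * (frac_energy s 1 \<Omega> w + (\<integral>\<^sup>+x. ennreal \<bar>w x\<bar> \<partial>lborel))" unfolding W_def .
  qed
qed

lemma sum_of_bounds_ennreal: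
  assumes "finite D" "\<And>i. i \<in> D \<Longrightarrow> X i \<le> ennreal (c i) * Y" "\<And>i. i \<in> D \<Longrightarrow> 0 \<le> c i"
  shows "(\<Sum>i\<in>D. X i) \<le> ennreal (\<Sum>i\<in>D. c i) * Y"
proof -
  have "(\<Sum>i\<in>D. X i) \<le> (\<Sum>i\<in>D. ennreal (c i) * Y)" using assms by (intro sum_mono) auto
  also have "\<dots> = ennreal (\<Sum>i\<in>D. c i) * Y" using assms by (simp add: sum_distrib_right[symmetric])
  finally show ?thesis .
qed

lemma borel_measurable_infdist [measurable]: "(\<lambda>x::'a::euclidean_space. infdist x A) \<in> borel_measurable borel"
  by (intro borel_measurable_continuous_onI continuous_intros)

text \<open>Finitely many boundary balls cover the compact frontier. What they leave of the closure
  is a compact subset of \<open>\<Omega>\<close>, on which the distance to the complement is at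
  least some \<open>d0\<close> and the weight is bounded.\<close>

theorem hardy_lipschitz_domain:
  fixes \<Omega> :: "'a::euclidean_space set"
  assumes s: "0 < s" "s < 1" and \<Omega>: "open \<Omega>" "bounded \<Omega>" "lipschitz_boundary \<Omega>"
  obtains C where "0 \<le> C"
    "\<And>w. w \<in> borel_measurable borel \<Longrightarrow> (\<And>x. x \<notin> \<Omega> \<Longrightarrow> w x = 0) \<Longrightarrow> (\<integral>\<^sup>+x. ennreal \<bar>w x\<bar> \<partial>lborel) < \<infinity> \<Longrightarrow>
      (\<integral>\<^sup>+x. ennreal (\<bar>w x\<bar> * infdist x (- \<Omega>) powr - s) \<partial>lborel)
        \<le> ennreal C * (frac_energy s 1 \<Omega> w + (\<integral>\<^sup>+x. ennreal \<bar>w x\<bar> \<partial>lborel))"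
proof -
  define P where "P = (\<lambda>x0 C r. 0 \<le> C \<and> 0 < r \<and> (\<forall>w. w \<in> borel_measurable borel \<longrightarrow> (\<forall>x. x \<notin> \<Omega> \<longrightarrow> w x = 0) \<longrightarrow> (\<integral>\<^sup>+x. ennreal \<bar>w x\<bar> \<partial>lborel) < \<infinity> \<longrightarrow>
      (\<integral>\<^sup>+x. ennreal (if norm (x - x0) < r then \<bar>w x\<bar> * infdist x (- \<Omega>) powr - s else 0) \<partial>lborel)
        \<le> ennreal C * (frac_energy s 1 \<Omega> w + (\<integral>\<^sup>+x. ennreal \<bar>w x\<bar> \<partial>lborel))))"
  have "\<exists>C r. P x0 C r" if "x0 \<in> frontier \<Omega>" for x0
  proof (rule hardy_boundary_point[OF s \<Omega> that], goal_cases)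
    case (1 C r)
    have "P x0 C r" unfolding P_def by (intro conjI allI impI 1) auto
    then show ?case by blast
  qed
  then obtain C r where P: "\<And>x0. x0 \<in> frontier \<Omega> \<Longrightarrow> P x0 (C x0) (r x0)" by metis
  have "compact (frontier \<Omega>)" using \<Omega>(2) by (rule compact_frontier_bounded)
  then obtain D where D: "D \<subseteq> frontier \<Omega>" "finite D" "frontier \<Omega> \<subseteq> (\<Union>x0\<in>D. ball x0 (r x0))"
  proof (rule compactE_image[of _ "frontier \<Omega>" "\<lambda>x0. ball x0 (r x0)"])
    show "frontier \<Omega> \<subseteq> (\<Union>x0\<in>frontier \<Omega>. ball x0 (r x0))" using P by (force simp: P_def)
  qed auto
  define K where "K = closure \<Omega> - (\<Union>x0\<in>D. ball x0 (r x0))"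
  have Kc: "compact K" unfolding K_def using \<Omega>(2) by (intro compact_diff open_UN) auto
  have K\<Omega>: "K \<subseteq> \<Omega>" using D(3) closure_Un_frontier[of \<Omega>] by (auto simp: K_def)
  have "\<exists>d0>0. \<forall>x\<in>K. d0 \<le> infdist x (- \<Omega>)"
  proof (cases "K = {} \<or> - \<Omega> = {}")
    case False
    have "continuous_on K (\<lambda>x. infdist x (- \<Omega>))" by (intro continuous_intros)
    then obtain x where x: "x \<in> K" "\<And>y. y \<in> K \<Longrightarrow> infdist x (- \<Omega>) \<le> infdist y (- \<Omega>)"
      using continuous_attains_inf[OF Kc, of "\<lambda>x. infdist x (- \<Omega>)"] False by blast
    have "0 < infdist x (- \<Omega>)"
      using x(1) K\<Omega> \<Omega>(1) False by (intro infdist_pos_not_in_closed) auto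
    then show ?thesis using x(2) by blast
  next
    case True
    have "- \<Omega> \<noteq> {}" using \<Omega>(2) not_bounded_UNIV by (metis Compl_empty_eq double_compl)
    then show ?thesis using True by (auto intro: exI[of _ 1])
  qed
  then obtain d0 where d0: "0 < d0" "\<And>x. x \<in> K \<Longrightarrow> d0 \<le> infdist x (- \<Omega>)" by blast
  define B where "B = (\<Sum>x0\<in>D. C x0) + d0 powr - s"
  have C0: "0 \<le> C x0" if "x0 \<in> D" for x0 using P[of x0] D that by (auto simp: P_def)
  then have CD: "0 \<le> (\<Sum>x0\<in>D. C x0)" by (simp add: sum_nonneg)
  show thesis
  proof (rule that[of B])
    show "0 \<le> B" using CD by (simp add: B_def)
    fix w :: "'a \<Rightarrow> real"
    assume w [measurable]: "w \<in> borel_measurable borel" and off: "\<And>x. x \<notin> \<Omega> \<Longrightarrow> w x = 0" and fin: "(\<integral>\<^sup>+x. ennreal \<bar>w x\<bar> \<partial>lborel) < \<infinity>"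
    define Y where "Y = frac_energy s 1 \<Omega> w + (\<integral>\<^sup>+x. ennreal \<bar>w x\<bar> \<partial>lborel)"
    define h where "h = (\<lambda>x0 x. ennreal (if norm (x - x0) < r x0 then \<bar>w x\<bar> * infdist x (- \<Omega>) powr - s else 0))"
    have [measurable]: "h x0 \<in> borel_measurable borel" for x0 unfolding h_def by measurable
    have "(\<integral>\<^sup>+x. ennreal (\<bar>w x\<bar> * infdist x (- \<Omega>) powr - s) \<partial>lborel)
       \<le> (\<integral>\<^sup>+x. (\<Sum>x0\<in>D. h x0 x) + ennreal (d0 powr - s) * ennreal \<bar>w x\<bar> \<partial>lborel)"
    proof (intro nn_integral_mono)
      fix x
      show "ennreal (\<bar>w x\<bar> * infdist x (- \<Omega>) powr - s) \<le> (\<Sum>x0\<in>D. h x0 x) + ennreal (d0 powr - s) * ennreal \<bar>w x\<bar>"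
      proof (cases "\<exists>x0\<in>D. norm (x - x0) < r x0")
        case True
        then obtain x0 where x0: "x0 \<in> D" "norm (x - x0) < r x0" by blast
        have "ennreal (\<bar>w x\<bar> * infdist x (- \<Omega>) powr - s) = h x0 x" using x0 by (simp add: h_def)
        also have "\<dots> \<le> (\<Sum>x0\<in>D. h x0 x)" using x0 D(2) by (intro member_le_sum) auto
        finally show ?thesis by (simp add: add_increasing2)
      next
        case False
        show ?thesis
        proof (cases "x \<in> \<Omega>")
          case True
          then have "x \<in> K" using False closure_subset by (auto simp: K_def dist_norm norm_minus_commute)
          then have "infdist x (- \<Omega>) powr - s \<le> d0 powr - s" using d0 s by (intro powr_mono2') auto
          then have "\<bar>w x\<bar> * infdist x (- \<Omega>) powr - s \<le> d0 powr - s * \<bar>w x\<bar>" by (simp add: mult.commute mult_left_mono)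
          then have "ennreal (\<bar>w x\<bar> * infdist x (- \<Omega>) powr - s) \<le> ennreal (d0 powr - s) * ennreal \<bar>w x\<bar>"
            by (subst ennreal_mult'[symmetric]) (auto intro: ennreal_leI)
          then show ?thesis by (simp add: add_increasing)
        qed (simp add: off)
      qed
    qed
    also have "\<dots> = (\<Sum>x0\<in>D. \<integral>\<^sup>+x. h x0 x \<partial>lborel) + ennreal (d0 powr - s) * (\<integral>\<^sup>+x. ennreal \<bar>w x\<bar> \<partial>lborel)"
      by (subst nn_integral_add) (auto simp: nn_integral_sum nn_integral_cmult)
    also have "\<dots> \<le> ennreal (\<Sum>x0\<in>D. C x0) * Y + ennreal (d0 powr - s) * Y"
    proof (intro add_mono mult_left_mono sum_of_bounds_ennreal D(2) C0)
      show "(\<integral>\<^sup>+x. h x0 x \<partial>lborel) \<le> ennreal (C x0) * Y" if "x0 \<in> D" for x0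
        using P[of x0] D(1) that w off fin unfolding P_def Y_def h_def by blast
      show "(\<integral>\<^sup>+x. ennreal \<bar>w x\<bar> \<partial>lborel) \<le> Y" by (simp add: Y_def)
    qed auto
    also have "\<dots> = ennreal B * Y" unfolding B_def using CD by (simp add: distrib_right)
    finally show "(\<integral>\<^sup>+x. ennreal (\<bar>w x\<bar> * infdist x (- \<Omega>) powr - s) \<partial>lborel)
        \<le> ennreal B * (frac_energy s 1 \<Omega> w + (\<integral>\<^sup>+x. ennreal \<bar>w x\<bar> \<partial>lborel))" unfolding Y_def .
  qed
qed

text \<open>For \<open>x\<close> in \<open>\<Omega>\<close> and \<open>y\<close> outside,
  \<open>norm (x - y)\<close> is at least the distance of \<open>x\<close> to the complement, and
  the kernel integrated over such \<open>y\<close> is at most a multiple of that distance to the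
  power \<open>- s\<close>. So the interaction of \<open>\<Omega>\<close> with its complement is a
  Hardy integral.\<close>

theorem zero_extension_bound:
  fixes \<Omega> :: "'a::euclidean_space set"
  assumes s: "0 < s" "s < 1" and \<Omega>: "open \<Omega>" "bounded \<Omega>" "lipschitz_boundary \<Omega>"
  obtains C where "0 \<le> C"
    "\<And>w. w \<in> borel_measurable borel \<Longrightarrow> (\<And>x. x \<notin> \<Omega> \<Longrightarrow> w x = 0) \<Longrightarrow> (\<integral>\<^sup>+x. ennreal \<bar>w x\<bar> \<partial>lborel) < \<infinity> \<Longrightarrow>
      frac_energy s 1 UNIV w \<le> ennreal C * (frac_energy s 1 \<Omega> w + (\<integral>\<^sup>+x. ennreal \<bar>w x\<bar> \<partial>lborel))"
proof -
  obtain H where H: "0 \<le> H"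
    "\<And>w. w \<in> borel_measurable borel \<Longrightarrow> (\<And>x. x \<notin> \<Omega> \<Longrightarrow> w x = 0) \<Longrightarrow> (\<integral>\<^sup>+x. ennreal \<bar>w x\<bar> \<partial>lborel) < \<infinity> \<Longrightarrow>
      (\<integral>\<^sup>+x. ennreal (\<bar>w x\<bar> * infdist x (- \<Omega>) powr - s) \<partial>lborel)
        \<le> ennreal H * (frac_energy s 1 \<Omega> w + (\<integral>\<^sup>+x. ennreal \<bar>w x\<bar> \<partial>lborel))"
    using hardy_lipschitz_domain[OF s \<Omega>] by blast
  define c where "c = unit_ball_vol (real DIM('a)) * 2 ^ DIM('a) / (1 - 2 powr - s)"
  have c: "0 \<le> c" using s by (auto simp: c_def powr_less_one less_imp_le)
  have ne: "- \<Omega> \<noteq> {}" using \<Omega>(2) not_bounded_UNIV by (metis Compl_empty_eq double_compl)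
  show thesis
  proof (rule that[of "1 + 2 * (c * H)"])
    show "0 \<le> 1 + 2 * (c * H)" using c H(1) by simp
    fix w :: "'a \<Rightarrow> real"
    assume w [measurable]: "w \<in> borel_measurable borel" and off: "\<And>x. x \<notin> \<Omega> \<Longrightarrow> w x = 0" and fin: "(\<integral>\<^sup>+x. ennreal \<bar>w x\<bar> \<partial>lborel) < \<infinity>"
    define Y where "Y = frac_energy s 1 \<Omega> w + (\<integral>\<^sup>+x. ennreal \<bar>w x\<bar> \<partial>lborel)"
    define k where "k = (\<lambda>x y. if infdist x (- \<Omega>) \<le> norm (x - y) then norm (x - y) powr - (real DIM('a) + s) else 0)"
    have [measurable]: "case_prod k \<in> borel_measurable (borel \<Otimes>\<^sub>M borel)"
      unfolding k_def case_prod_beta' by measurable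
    have [measurable]: "\<Omega> \<in> sets borel" using \<Omega>(1) by simp
    have kd: "infdist x (- \<Omega>) \<le> norm (x - y)" if "y \<notin> \<Omega>" for x y
      using that by (metis ComplI dist_norm infdist_le)
    have J: "(\<integral>\<^sup>+x. \<integral>\<^sup>+y. ennreal \<bar>w x\<bar> * ennreal (k x y) \<partial>lborel \<partial>lborel) \<le> ennreal (c * H) * Y"
    proof -
      have "(\<integral>\<^sup>+x. \<integral>\<^sup>+y. ennreal \<bar>w x\<bar> * ennreal (k x y) \<partial>lborel \<partial>lborel) \<le> (\<integral>\<^sup>+x. ennreal c * ennreal (\<bar>w x\<bar> * infdist x (- \<Omega>) powr - s) \<partial>lborel)"
      proof (intro nn_integral_mono)
        fix x
        show "(\<integral>\<^sup>+y. ennreal \<bar>w x\<bar> * ennreal (k x y) \<partial>lborel) \<le> ennreal c * ennreal (\<bar>w x\<bar> * infdist x (- \<Omega>) powr - s)"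
        proof (cases "x \<in> \<Omega>")
          case True
          then have d: "0 < infdist x (- \<Omega>)" using \<Omega>(1) ne by (intro infdist_pos_not_in_closed) auto
          have "(\<integral>\<^sup>+y. ennreal \<bar>w x\<bar> * ennreal (k x y) \<partial>lborel) = ennreal \<bar>w x\<bar> * (\<integral>\<^sup>+y. ennreal (k x y) \<partial>lborel)"
            by (rule nn_integral_cmult) measurable
          also have "(\<integral>\<^sup>+y. ennreal (k x y) \<partial>lborel) = (\<integral>\<^sup>+y. ennreal (norm (x - y) powr - (real DIM('a) + s)) * indicator {y. infdist x (- \<Omega>) \<le> norm (x - y)} y \<partial>lborel)"
            by (intro nn_integral_cong) (auto simp: k_def indicator_def)
          also have "\<dots> \<le> ennreal (c * infdist x (- \<Omega>) powr - s)"
            unfolding c_def by (rule nn_integral_tail_powr[OF s(1) d])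
          finally have "(\<integral>\<^sup>+y. ennreal \<bar>w x\<bar> * ennreal (k x y) \<partial>lborel) \<le> ennreal \<bar>w x\<bar> * ennreal (c * infdist x (- \<Omega>) powr - s)"
            by (simp add: mult_left_mono)
          also have "\<dots> = ennreal c * ennreal (\<bar>w x\<bar> * infdist x (- \<Omega>) powr - s)"
            using c by (simp add: ennreal_mult'[symmetric] mult_ac)
          finally show ?thesis .
        qed (simp add: off)
      qed
      also have "\<dots> = ennreal c * (\<integral>\<^sup>+x. ennreal (\<bar>w x\<bar> * infdist x (- \<Omega>) powr - s) \<partial>lborel)"
        by (rule nn_integral_cmult) measurable
      also have "\<dots> \<le> ennreal c * (ennreal H * Y)"
        unfolding Y_def by (intro mult_left_mono H w off fin) auto
      also have "\<dots> = ennreal (c * H) * Y" using c by (simp add: ennreal_mult' mult.assoc)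
      finally show ?thesis .
    qed
    have J': "(\<integral>\<^sup>+x. \<integral>\<^sup>+y. ennreal \<bar>w y\<bar> * ennreal (k y x) \<partial>lborel \<partial>lborel) \<le> ennreal (c * H) * Y"
    proof -
      have "(\<integral>\<^sup>+x. \<integral>\<^sup>+y. ennreal \<bar>w y\<bar> * ennreal (k y x) \<partial>lborel \<partial>lborel) = (\<integral>\<^sup>+y. \<integral>\<^sup>+x. ennreal \<bar>w y\<bar> * ennreal (k y x) \<partial>lborel \<partial>lborel)"
        by (rule nn_integral_lborel_commute) measurable
      then show ?thesis using J by simp
    qed
    have "frac_energy s 1 UNIV w \<le> (\<integral>\<^sup>+x. \<integral>\<^sup>+y. ennreal (dq s w x y powr 1) * (indicator \<Omega> x * indicator \<Omega> y)
        + (ennreal \<bar>w x\<bar> * ennreal (k x y) + ennreal \<bar>w y\<bar> * ennreal (k y x)) \<partial>lborel \<partial>lborel)"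
      unfolding frac_energy_UNIV
    proof (intro nn_integral_mono)
      fix x y
      have q: "dq s w x y = \<bar>w x - w y\<bar> * norm (x - y) powr - (real DIM('a) + s)"
        by (simp only: dq_def powr_minus divide_inverse)
      show "ennreal (dq s w x y powr 1) \<le> ennreal (dq s w x y powr 1) * (indicator \<Omega> x * indicator \<Omega> y)
        + (ennreal \<bar>w x\<bar> * ennreal (k x y) + ennreal \<bar>w y\<bar> * ennreal (k y x))"
      proof (cases "x \<in> \<Omega>"; cases "y \<in> \<Omega>")
        assume "x \<in> \<Omega>" "y \<notin> \<Omega>"
        then have "ennreal (dq s w x y) = ennreal \<bar>w x\<bar> * ennreal (k x y)"
          using kd[of y x] by (simp add: q off k_def ennreal_mult')
        then show ?thesis by (simp add: add_increasing add_increasing2)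
      next
        assume "x \<notin> \<Omega>" "y \<in> \<Omega>"
        then have "ennreal (dq s w x y) = ennreal \<bar>w y\<bar> * ennreal (k y x)"
          using kd[of x y] by (simp add: q off k_def ennreal_mult' norm_minus_commute)
        then show ?thesis by (simp add: add_increasing add_increasing2)
      next
        assume "x \<notin> \<Omega>" "y \<notin> \<Omega>"
        then show ?thesis by (simp add: q off)
      qed auto
    qed
    also have "\<dots> = frac_energy s 1 \<Omega> w + ((\<integral>\<^sup>+x. \<integral>\<^sup>+y. ennreal \<bar>w x\<bar> * ennreal (k x y) \<partial>lborel \<partial>lborel)
        + (\<integral>\<^sup>+x. \<integral>\<^sup>+y. ennreal \<bar>w y\<bar> * ennreal (k y x) \<partial>lborel \<partial>lborel))"
      unfolding frac_energy_def by (simp add: nn_integral_add)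
    also have "\<dots> \<le> Y + (ennreal (c * H) * Y + ennreal (c * H) * Y)"
      by (intro add_mono J J') (simp add: Y_def)
    also have "\<dots> = ennreal (1 + 2 * (c * H)) * Y"
    proof -
      have "ennreal (1 + 2 * (c * H)) = 1 + (ennreal (c * H) + ennreal (c * H))"
        using c H(1) by (simp flip: ennreal_plus ennreal_1)
      then show ?thesis by (simp add: distrib_right)
    qed
    finally show "frac_energy s 1 UNIV w \<le> ennreal (1 + 2 * (c * H)) * (frac_energy s 1 \<Omega> w + (\<integral>\<^sup>+x. ennreal \<bar>w x\<bar> \<partial>lborel))"
      unfolding Y_def .
  qed
qed

section \<open>Smooth functions\<close>

lemma times_differentiable_SucI:
  assumes "\<And>x. (f has_derivative f' x) (at x)" "\<And>v. times_differentiable k (\<lambda>x. f' x v)"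
  shows "times_differentiable (Suc k) f"
proof -
  have e: "frechet_derivative f (at x) = f' x" for x
    using frechet_derivative_at[OF assms(1)[of x]] by simp
  have "f differentiable (at x)" for x using assms(1)[of x] differentiable_def by blast
  then show ?thesis using assms(2) by (simp add: e)
qed

lemma times_differentiable_SucD:
  assumes "times_differentiable (Suc k) f"
  shows "(f has_derivative frechet_derivative f (at x)) (at x)"
    and "times_differentiable k (\<lambda>x. frechet_derivative f (at x) v)"
  using assms by (auto simp: frechet_derivative_works)

lemma times_differentiable_Suc_imp: "times_differentiable (Suc k) f \<Longrightarrow> times_differentiable k f"
proof (induction k arbitrary: f)
  case 0
  then have "f differentiable (at x)" for x by simp
  then show ?case
    by (simp add: continuous_on_eq_continuous_at differentiable_imp_continuous_within)
next
  case (Suc k)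
  show ?case
    by (rule times_differentiable_SucI[OF times_differentiable_SucD(1)[OF Suc.prems]])
       (rule Suc.IH, rule times_differentiable_SucD(2)[OF Suc.prems])
qed

lemma times_differentiable_const: "times_differentiable k (\<lambda>x. c)"
proof (induction k arbitrary: c)
  case (Suc k)
  show ?case by (rule times_differentiable_SucI[where f'="\<lambda>x v. 0"]) (auto intro: Suc.IH)
qed simp

lemma times_differentiable_add:
  "times_differentiable k f \<Longrightarrow> times_differentiable k g \<Longrightarrow> times_differentiable k (\<lambda>x. f x + g x)"
proof (induction k arbitrary: f g)
  case (Suc k)
  show ?case
    by (rule times_differentiable_SucI[OF has_derivative_add[OF times_differentiable_SucD(1)[OF Suc.prems(1)] times_differentiable_SucD(1)[OF Suc.prems(2)]]])
       (intro Suc.IH times_differentiable_SucD(2) Suc.prems)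
qed (simp add: continuous_on_add)

lemma times_differentiable_mult:
  fixes f g :: "'a::euclidean_space \<Rightarrow> real"
  shows "times_differentiable k f \<Longrightarrow> times_differentiable k g \<Longrightarrow> times_differentiable k (\<lambda>x. f x * g x)"
proof (induction k arbitrary: f g)
  case (Suc k)
  show ?case
    by (rule times_differentiable_SucI[OF has_derivative_mult[OF times_differentiable_SucD(1)[OF Suc.prems(1)] times_differentiable_SucD(1)[OF Suc.prems(2)]]])
       (intro times_differentiable_add Suc.IH times_differentiable_SucD(2) Suc.prems times_differentiable_Suc_imp)
qed (simp add: continuous_on_mult)

lemma times_differentiable_cmult:
  "times_differentiable k f \<Longrightarrow> times_differentiable k (\<lambda>x. c * f x)"
  by (intro times_differentiable_mult times_differentiable_const)

lemma times_differentiable_prod: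
  "(\<And>i. i \<in> I \<Longrightarrow> times_differentiable k (f i)) \<Longrightarrow> times_differentiable k (\<lambda>x. \<Prod>i\<in>I. f i x)"
  by (induction I rule: infinite_finite_induct) (auto intro: times_differentiable_const times_differentiable_mult)

lemma times_differentiable_rescale:
  "times_differentiable k f \<Longrightarrow> times_differentiable k (\<lambda>x. f (c *\<^sub>R x))"
proof (induction k arbitrary: f)
  case 0
  have "continuous_on UNIV (f \<circ> (\<lambda>x. c *\<^sub>R x))"
    using 0 by (intro continuous_on_compose continuous_intros) (auto intro: continuous_on_subset)
  then show ?case by (simp add: o_def)
next
  case (Suc k)
  show ?case
  proof (rule times_differentiable_SucI)
    show "((\<lambda>x. f (c *\<^sub>R x)) has_derivative (\<lambda>v. frechet_derivative f (at (c *\<^sub>R x)) (c *\<^sub>R v))) (at x)" for x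
      by (rule has_derivative_compose[OF _ times_differentiable_SucD(1)[OF Suc.prems]])
         (auto intro!: derivative_eq_intros)
    show "times_differentiable k (\<lambda>x. frechet_derivative f (at (c *\<^sub>R x)) (c *\<^sub>R v))" for v
      by (rule Suc.IH, rule times_differentiable_SucD(2)[OF Suc.prems])
  qed
qed

text \<open>\<open>F\<close> is a family closed under differentiation, so the induction over the
  order may pass from \<open>h\<close> to its derivative.\<close>

lemma times_differentiable_ridge:
  fixes a :: real and b :: "'a::euclidean_space"
  assumes F: "\<And>h. h \<in> F \<Longrightarrow> \<exists>h'\<in>F. \<forall>t. (h has_real_derivative h' t) (at t)"
  shows "h \<in> F \<Longrightarrow> times_differentiable k (\<lambda>x. h (a + x \<bullet> b))"
proof (induction k arbitrary: h)
  case 0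
  then obtain h' where "\<And>t. (h has_real_derivative h' t) (at t)" using F by blast
  then have "isCont h t" for t using DERIV_isCont by blast
  then have "continuous_on UNIV (h \<circ> (\<lambda>x. a + x \<bullet> b))"
    by (intro continuous_on_compose continuous_intros) (simp add: continuous_at_imp_continuous_on)
  then show ?case by (simp add: o_def)
next
  case (Suc k)
  then obtain h' where h': "h' \<in> F" "\<And>t. (h has_real_derivative h' t) (at t)" using F by blast
  show ?case
  proof (rule times_differentiable_SucI)
    show "((\<lambda>x. h (a + x \<bullet> b)) has_derivative (\<lambda>v. (v \<bullet> b) * h' (a + x \<bullet> b))) (at x)" for x
      by (rule has_derivative_compose[of "\<lambda>x. a + x \<bullet> b" "\<lambda>v. v \<bullet> b", OF _ h'(2)[unfolded has_field_derivative_def], simplified mult.commute])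
         (auto intro!: derivative_eq_intros)
    show "times_differentiable k (\<lambda>x. (v \<bullet> b) * h' (a + x \<bullet> b))" for v
      by (intro times_differentiable_cmult Suc.IH h'(1))
  qed
qed

section \<open>A smooth bump function\<close>

text \<open>The classical function \<open>exp (- (1 / t))\<close> that vanishes to infinite order at
  0; the polynomial in \<open>1 / t\<close> makes the family closed under differentiation.\<close>

definition flat :: "real poly \<Rightarrow> real \<Rightarrow> real" where
  "flat P t = (if t \<le> 0 then 0 else poly P (1 / t) * exp (- (1 / t)))"

lemma poly_exp_tendsto_0: "((\<lambda>y. poly P y * exp (- y)) \<longlongrightarrow> (0::real)) at_top"
proof -
  have "((\<lambda>y. \<Sum>i\<le>degree P. coeff P i * (y ^ i / exp y)) \<longlongrightarrow> (\<Sum>i\<le>degree P. coeff P i * 0)) at_top"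
    by (intro tendsto_intros tendsto_power_div_exp_0)
  moreover have "(\<lambda>y. \<Sum>i\<le>degree P. coeff P i * (y ^ i / exp y)) = (\<lambda>y. poly P y * exp (- y))"
    by (simp add: poly_altdef sum_distrib_right exp_minus divide_inverse mult.assoc fun_eq_iff)
  ultimately show ?thesis by simp
qed

text \<open>For \<open>t > 0\<close> the chain rule yields the factor \<open>1 / t\<^sup>2\<close>,
  encoded by \<open>[:0, 0, 1:]\<close>, and the difference \<open>P - pderiv P\<close>. At 0 the
  right difference quotient is \<open>poly ([:0, 1:] * P) y * exp (- y)\<close> with
  \<open>y = 1 / h\<close>, which tends to 0.\<close>

lemma flat_has_derivative:
  "(flat P has_real_derivative flat ([:0, 0, 1:] * (P - pderiv P)) t) (at t)"
proof -
  consider "t < 0" | "t = 0" | "0 < t" by linarith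
  then show ?thesis
  proof cases
    case 1
    have "((\<lambda>t. 0) has_real_derivative 0) (at t)" by simp
    then have "(flat P has_real_derivative 0) (at t)"
      by (rule DERIV_cong_ev[THEN iffD1, rotated -1, OF _ refl _ refl])
         (use 1 in \<open>auto simp: flat_def intro: eventually_mono[OF eventually_nhds_in_open[of "{..<0}"]]\<close>)
    then show ?thesis using 1 by (simp add: flat_def)
  next
    case 3
    have "((\<lambda>t. poly P (1 / t) * exp (- (1 / t))) has_real_derivative
       poly P (1 / t) * (exp (- (1 / t)) * (1 / t\<^sup>2)) + (poly (pderiv P) (1 / t) * (- (1 / t\<^sup>2))) * exp (- (1 / t))) (at t)"
      using 3 by (auto intro!: derivative_eq_intros DERIV_chain'[OF _ poly_DERIV] simp: power2_eq_square)
    also have "poly P (1 / t) * (exp (- (1 / t)) * (1 / t\<^sup>2)) + (poly (pderiv P) (1 / t) * (- (1 / t\<^sup>2))) * exp (- (1 / t))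
      = flat ([:0, 0, 1:] * (P - pderiv P)) t"
      using 3 by (simp add: flat_def power2_eq_square algebra_simps)
    finally have d: "((\<lambda>t. poly P (1 / t) * exp (- (1 / t))) has_real_derivative flat ([:0, 0, 1:] * (P - pderiv P)) t) (at t)" .
    have ev: "eventually (\<lambda>t. poly P (1 / t) * exp (- (1 / t)) = flat P t) (nhds t)"
      using eventually_nhds_in_open[of "{0<..}" t] 3 by (auto simp: flat_def elim: eventually_mono)
    show ?thesis using DERIV_cong_ev[OF refl ev refl] d by blast
  next
    case 2
    have r: "((\<lambda>h. flat P h / h) \<longlongrightarrow> 0) (at_right 0)"
    proof -
      have "((\<lambda>h. poly ([:0, 1:] * P) (inverse h) * exp (- (inverse h))) \<longlongrightarrow> 0) (at_right 0)"
        by (rule filterlim_compose[OF poly_exp_tendsto_0 filterlim_inverse_at_top_right])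
      then show ?thesis
        by (rule Lim_transform_eventually)
           (auto simp: flat_def divide_inverse mult_ac intro: eventually_mono[OF eventually_at_right_less])
    qed
    have l: "((\<lambda>h. flat P h / h) \<longlongrightarrow> 0) (at_left 0)"
      by (rule tendsto_eventually) (auto simp: flat_def eventually_at_filter)
    have "((\<lambda>h. flat P h / h) \<longlongrightarrow> 0) (at 0)"
      using l r by (simp add: filterlim_split_at)
    then show ?thesis using 2 by (simp add: DERIV_def flat_def)
  qed
qed

text \<open>The two factors of a coordinate vanish together for
  \<open>\<bar>x \<bullet> b\<bar> \<ge> 1\<close>, so the function lives on a cube. A product over
  coordinates inherits smoothness from dimension one.\<close>

definition bump :: "'a::euclidean_space \<Rightarrow> real" where
  "bump x = (\<Prod>b\<in>Basis. flat [:1:] (1 + x \<bullet> b) * flat [:1:] (1 + x \<bullet> (- b)))"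

lemma times_differentiable_bump: "times_differentiable k (bump :: 'a::euclidean_space \<Rightarrow> real)"
proof -
  have *: "times_differentiable k (\<lambda>x::'a. flat [:1:] (1 + x \<bullet> b))" for b
    by (rule times_differentiable_ridge[where F="range flat"]) (use flat_has_derivative in blast)+
  show ?thesis unfolding bump_def by (intro times_differentiable_prod times_differentiable_mult *)
qed

lemma bump_bounds: "0 \<le> bump x" "bump x \<le> 1"
proof -
  have f: "0 \<le> flat [:1:] t" "flat [:1:] t \<le> 1" for t by (auto simp: flat_def)
  show "0 \<le> bump x" unfolding bump_def by (intro prod_nonneg ballI mult_nonneg_nonneg f)
  show "bump x \<le> 1" unfolding bump_def by (intro prod_le_1 conjI mult_nonneg_nonneg mult_le_one f)
qed

lemma bump_eq_0:
  fixes x :: "'a::euclidean_space"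
  assumes "real DIM('a) \<le> norm x"
  shows "bump x = 0"
proof -
  have "\<exists>b\<in>Basis. 1 \<le> \<bar>x \<bullet> b\<bar>"
  proof (rule ccontr)
    assume "\<not> ?thesis"
    then have "(\<Sum>b\<in>Basis. \<bar>x \<bullet> b\<bar>) < (\<Sum>b\<in>(Basis::'a set). 1)"
      by (intro sum_strict_mono) (auto simp: not_le)
    with norm_le_l1[of x] assms show False by simp
  qed
  then obtain b where b: "b \<in> Basis" "1 \<le> \<bar>x \<bullet> b\<bar>" by blast
  then have "flat [:1:] (1 + x \<bullet> b) * flat [:1:] (1 + x \<bullet> (- b)) = 0" by (auto simp: flat_def)
  then show ?thesis unfolding bump_def using b by (intro prod_zero) auto
qed

text \<open>Makes the mass of \<open>bump\<close> positive, so that it can be normalised.\<close>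

lemma bump_lower:
  fixes x :: "'a::euclidean_space"
  assumes "norm x < 1 / 2"
  shows "exp (- 4) ^ DIM('a) \<le> bump x"
proof -
  have f: "exp (- 2) \<le> flat [:1:] t" if "1 / 2 < t" for t
    using that by (simp add: flat_def pos_divide_le_eq)
  have "exp (- 4) \<le> flat [:1:] (1 + x \<bullet> b) * flat [:1:] (1 + x \<bullet> (- b))" if "b \<in> Basis" for b
  proof -
    have "\<bar>x \<bullet> b\<bar> < 1 / 2" using Basis_le_norm[OF that, of x] assms by linarith
    then have "exp (- 2) * exp (- 2) \<le> flat [:1:] (1 + x \<bullet> b) * flat [:1:] (1 + x \<bullet> (- b))"
      by (intro mult_mono f) (auto intro: order_trans[OF _ f])
    then show ?thesis by (simp flip: exp_add)
  qed
  then have "(\<Prod>b\<in>(Basis::'a set). exp (- 4)) \<le> bump x"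
    unfolding bump_def by (intro prod_mono) auto
  then show ?thesis by simp
qed

section \<open>Rescaled bumps of mass 1\<close>

lemma nn_integral_lborel_scale:
  fixes f :: "'a::euclidean_space \<Rightarrow> ennreal"
  assumes [measurable]: "f \<in> borel_measurable borel" and c: "c \<noteq> 0"
  shows "(\<integral>\<^sup>+x. f x \<partial>lborel) = ennreal (\<bar>c\<bar> ^ DIM('a)) * (\<integral>\<^sup>+x. f (c *\<^sub>R x) \<partial>lborel)"
proof -
  have "(\<integral>\<^sup>+x. f x \<partial>lborel) = (\<integral>\<^sup>+x. f x \<partial>density (distr lborel borel (\<lambda>x. 0 + c *\<^sub>R x)) (\<lambda>_. \<bar>c\<bar> ^ DIM('a)))"
    using lborel_affine[OF c, of "0::'a"] by simp
  also have "\<dots> = (\<integral>\<^sup>+x. ennreal (\<bar>c\<bar> ^ DIM('a)) * f x \<partial>distr lborel borel (\<lambda>x. c *\<^sub>R x))"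
    by (subst nn_integral_density) auto
  also have "\<dots> = ennreal (\<bar>c\<bar> ^ DIM('a)) * (\<integral>\<^sup>+x. f (c *\<^sub>R x) \<partial>lborel)"
    by (subst nn_integral_distr) (auto simp: nn_integral_cmult)
  finally show ?thesis .
qed

text \<open>The support is only required to be bounded, with no reference to
  \<open>\<Omega>\<close>. The class is closed under directional derivatives, which drives the
  induction for convolutions.\<close>

definition smooth_compact :: "('a::euclidean_space \<Rightarrow> real) \<Rightarrow> bool" where
  "smooth_compact K \<longleftrightarrow> (\<forall>k. times_differentiable k K) \<and> (\<exists>R. \<forall>x. R < norm x \<longrightarrow> K x = 0)"

text \<open>A rescaled bump divided by its mass \<open>i\<close>. The height bound, with
  \<open>M\<close> independent of \<open>\<delta>\<close>, is what \<open>convol_L1\<close> balances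
  against the energy.\<close>

theorem mollifier:
  obtains M where "0 \<le> M" "\<And>\<delta>. 0 < \<delta> \<Longrightarrow> \<exists>K :: 'a::euclidean_space \<Rightarrow> real. smooth_compact K \<and>
    (\<forall>x. 0 \<le> K x \<and> K x \<le> M * \<delta> powr - real DIM('a)) \<and> (\<forall>x. \<delta> \<le> norm x \<longrightarrow> K x = 0) \<and> (\<integral>\<^sup>+x. ennreal (K x) \<partial>lborel) = 1"
proof -
  define n where "n = real DIM('a)"
  have n: "0 < n" by (simp add: n_def)
  have "continuous_on UNIV (bump :: 'a \<Rightarrow> real)" using times_differentiable_bump[of 0] by simp
  then have m [measurable]: "(bump :: 'a \<Rightarrow> real) \<in> borel_measurable borel" by (rule borel_measurable_continuous_onI)
  define I where "I = (\<integral>\<^sup>+x. ennreal (bump (x::'a)) \<partial>lborel)"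
  have "I \<le> (\<integral>\<^sup>+x. indicator (ball 0 (n + 1)) (x::'a) \<partial>lborel)"
    unfolding I_def
  proof (intro nn_integral_mono)
    fix x :: 'a
    show "ennreal (bump x) \<le> indicator (ball 0 (n + 1)) x"
      using bump_bounds[of x] bump_eq_0[of x] by (cases "norm x < n + 1") (auto simp: indicator_def n_def)
  qed
  also have "\<dots> = emeasure lborel (ball (0::'a) (n + 1))" by (rule nn_integral_indicator) simp
  also have "\<dots> < \<infinity>" by (rule emeasure_lborel_ball_finite)
  finally have Ifin: "I < \<infinity>" .
  have "(\<integral>\<^sup>+x. ennreal (exp (- 4) ^ DIM('a)) * indicator (ball (0::'a) (1/2)) x \<partial>lborel) \<le> I"
    unfolding I_def
  proof (intro nn_integral_mono)
    fix x :: 'a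
    show "ennreal (exp (- 4) ^ DIM('a)) * indicator (ball (0::'a) (1/2)) x \<le> ennreal (bump x)"
      using bump_lower[of x] by (cases "norm x < 1/2") (auto simp: indicator_def intro: ennreal_leI)
  qed
  moreover have "0 < (\<integral>\<^sup>+x. ennreal (exp (- 4) ^ DIM('a)) * indicator (ball (0::'a) (1/2)) x \<partial>lborel)"
    by (subst nn_integral_cmult_indicator) (auto simp: emeasure_ball ennreal_zero_less_mult_iff)
  ultimately have Ipos: "0 < I" by simp
  obtain i where i: "I = ennreal i" "0 < i"
    using Ifin Ipos by (cases I) (auto simp: ennreal_less_zero_iff)
  show thesis
  proof (rule that[of "n powr n / i"])
    show "0 \<le> n powr n / i" using i by simp
    fix \<delta> :: real assume \<delta>: "0 < \<delta>"
    \<comment> \<open>\<open>bump\<close> vanishes from norm \<open>n\<close> on, so this dilation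
      moves the support into the ball of radius \<open>\<delta>\<close>.\<close>
    define c where "c = n / \<delta>"
    have c: "0 < c" using n \<delta> by (simp add: c_def)
    define K where "K = (\<lambda>x::'a. c powr n / i * bump (c *\<^sub>R x))"
    have "c powr n / i = n powr n / i * \<delta> powr - n"
      using n \<delta> by (simp add: c_def powr_divide powr_minus field_simps)
    then have b: "0 \<le> K x \<and> K x \<le> n powr n / i * \<delta> powr - n" for x
      using bump_bounds[of "c *\<^sub>R x"] i mult_left_mono[of "bump (c *\<^sub>R x)" 1 "c powr n / i"] by (auto simp: K_def)
    have z: "K x = 0" if "\<delta> \<le> norm x" for x
    proof -
      have "n \<le> c * norm x" using that n \<delta> by (simp add: c_def field_simps)
      then have "bump (c *\<^sub>R x) = 0" using c by (intro bump_eq_0) (simp add: n_def)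
      then show ?thesis by (simp add: K_def)
    qed
    have "times_differentiable k K" for k
      unfolding K_def by (intro times_differentiable_cmult times_differentiable_rescale times_differentiable_bump)
    then have sc: "smooth_compact K" using z unfolding smooth_compact_def by (auto intro!: exI[of _ \<delta>])
    have "(\<integral>\<^sup>+x. ennreal (K x) \<partial>lborel) = (\<integral>\<^sup>+x. ennreal (c powr n / i) * ennreal (bump (c *\<^sub>R (x::'a))) \<partial>lborel)"
      unfolding K_def using i by (intro nn_integral_cong ennreal_mult') (simp add: bump_bounds)
    also have "\<dots> = ennreal (c powr n / i) * (\<integral>\<^sup>+x. ennreal (bump (c *\<^sub>R (x::'a))) \<partial>lborel)"
      by (rule nn_integral_cmult) measurable
    also have "\<dots> = ennreal (1 / i) * (ennreal (\<bar>c\<bar> ^ DIM('a)) * (\<integral>\<^sup>+x. ennreal (bump (c *\<^sub>R (x::'a))) \<partial>lborel))"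
      using c i by (simp add: mult.assoc[symmetric] ennreal_mult'[symmetric] n_def powr_realpow)
    also have "ennreal (\<bar>c\<bar> ^ DIM('a)) * (\<integral>\<^sup>+x. ennreal (bump (c *\<^sub>R (x::'a))) \<partial>lborel) = I"
      unfolding I_def using c by (intro nn_integral_lborel_scale[symmetric]) auto
    also have "ennreal (1 / i) * I = 1" using i by (simp add: ennreal_mult'[symmetric])
    finally show "\<exists>K :: 'a \<Rightarrow> real. smooth_compact K \<and>
      (\<forall>x. 0 \<le> K x \<and> K x \<le> n powr n / i * \<delta> powr - real DIM('a)) \<and> (\<forall>x. \<delta> \<le> norm x \<longrightarrow> K x = 0) \<and> (\<integral>\<^sup>+x. ennreal (K x) \<partial>lborel) = 1"
      using sc b z unfolding n_def by blast
  qed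
qed

section \<open>Compactly supported smooth functions and convolution\<close>

lemma smooth_compact_derivative:
  assumes "smooth_compact K"
  shows "(K has_derivative frechet_derivative K (at x)) (at x)" "smooth_compact (\<lambda>x. frechet_derivative K (at x) v)"
proof -
  from assms have td: "times_differentiable k K" for k by (simp add: smooth_compact_def)
  show d: "(K has_derivative frechet_derivative K (at x)) (at x)" for x
    by (rule times_differentiable_SucD(1)[OF td[of "Suc 0"]])
  obtain R where R: "\<And>x. R < norm x \<Longrightarrow> K x = 0" using assms by (auto simp: smooth_compact_def)
  have "frechet_derivative K (at x) v = 0" if x: "R < norm x" for x
  proof -
    have "open {x. R < norm x}" by (intro open_Collect_less continuous_intros)
    then have "(K has_derivative (\<lambda>v. 0)) (at x)"
      using has_derivative_transform_within_open[of "\<lambda>x. 0" "\<lambda>v. 0" x UNIV "{x. R < norm x}" K] x R by auto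
    then show ?thesis using frechet_derivative_at[of K "\<lambda>v. 0" x] by metis
  qed
  moreover have "times_differentiable k (\<lambda>x. frechet_derivative K (at x) v)" for k
    by (rule times_differentiable_SucD(2)[OF td])
  ultimately show "smooth_compact (\<lambda>x. frechet_derivative K (at x) v)"
    unfolding smooth_compact_def by blast
qed

lemma smooth_compact_continuous: "smooth_compact K \<Longrightarrow> continuous_on UNIV K"
  by (metis smooth_compact_def times_differentiable.simps(1))

lemma smooth_compact_measurable: "smooth_compact K \<Longrightarrow> K \<in> borel_measurable borel"
  by (intro borel_measurable_continuous_onI smooth_compact_continuous)

lemma smooth_compact_bounded:
  assumes "smooth_compact K"
  obtains M where "0 \<le> M" "\<And>x. \<bar>K x\<bar> \<le> M"
proof -
  obtain R where R: "\<And>x. R < norm x \<Longrightarrow> K x = 0" using assms by (auto simp: smooth_compact_def)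
  have "compact (K ` cball 0 R)"
    using smooth_compact_continuous[OF assms] by (intro compact_continuous_image) (auto intro: continuous_on_subset)
  then obtain M where "\<forall>y\<in>K ` cball 0 R. norm y \<le> M"
    using compact_imp_bounded bounded_iff by blast
  then have M: "\<And>x. x \<in> cball 0 R \<Longrightarrow> \<bar>K x\<bar> \<le> M" by simp
  show thesis
  proof (rule that[of "\<bar>M\<bar>"])
    show "\<bar>K x\<bar> \<le> \<bar>M\<bar>" for x
      using M[of x] R[of x] by (cases "norm x \<le> R") auto
  qed simp
qed

lemma smooth_compact_derivative_bound:
  fixes K :: "'a::euclidean_space \<Rightarrow> real"
  assumes "smooth_compact K"
  obtains M where "0 \<le> M" "\<And>x v. \<bar>frechet_derivative K (at x) v\<bar> \<le> M * norm v"
proof -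
  have "\<exists>M. 0 \<le> M \<and> (\<forall>x. \<bar>frechet_derivative K (at x) b\<bar> \<le> M)" for b
    using smooth_compact_bounded[OF smooth_compact_derivative(2)[OF assms]] by metis
  then obtain M where M: "\<And>b. 0 \<le> M b" "\<And>b x. \<bar>frechet_derivative K (at x) b\<bar> \<le> M b" by metis
  show thesis
  proof (rule that[of "\<Sum>b\<in>Basis. M b"])
    show "0 \<le> (\<Sum>b\<in>Basis. M b)" using M by (intro sum_nonneg) auto
    fix x v
    interpret l: bounded_linear "frechet_derivative K (at x)"
      using smooth_compact_derivative(1)[OF assms] by (rule has_derivative_bounded_linear)
    have "frechet_derivative K (at x) v = (\<Sum>b\<in>Basis. (v \<bullet> b) * frechet_derivative K (at x) b)"
      by (subst (1) euclidean_representation[of v, symmetric]) (simp add: l.sum l.scaleR)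
    also have "\<bar>\<dots>\<bar> \<le> (\<Sum>b\<in>Basis. \<bar>(v \<bullet> b) * frechet_derivative K (at x) b\<bar>)" by (rule sum_abs)
    also have "\<dots> \<le> (\<Sum>b\<in>Basis. M b * norm v)"
    proof (intro sum_mono)
      fix b :: 'a assume "b \<in> Basis"
      then show "\<bar>(v \<bullet> b) * frechet_derivative K (at x) b\<bar> \<le> M b * norm v"
        unfolding abs_mult using M Basis_le_norm[of b v] by (subst mult.commute) (intro mult_mono, auto)
    qed
    finally show "\<bar>frechet_derivative K (at x) v\<bar> \<le> (\<Sum>b\<in>Basis. M b) * norm v" by (simp add: sum_distrib_right)
  qed
qed

lemma smooth_compact_lipschitz:
  fixes K :: "'a::euclidean_space \<Rightarrow> real"
  assumes "smooth_compact K"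
  obtains M where "0 \<le> M" "\<And>x y. \<bar>K x - K y\<bar> \<le> M * norm (x - y)"
proof -
  obtain M where M: "0 \<le> M" "\<And>x v. \<bar>frechet_derivative K (at x) v\<bar> \<le> M * norm v"
    using smooth_compact_derivative_bound[OF assms] by blast
  show thesis
  proof (rule that[OF M(1)])
    fix x y
    have "norm (K x - K y) \<le> M * norm (x - y)"
      using smooth_compact_derivative(1)[OF assms]
      by (rule differentiable_bound[OF convex_UNIV]) (auto intro!: onorm_le M(2)[THEN order_trans] simp: M(1) onorm_bound M(2))
    then show "\<bar>K x - K y\<bar> \<le> M * norm (x - y)" by simp
  qed
qed

text \<open>The derivative is Lipschitz because it is itself smooth with bounded support. The
  remainder constant is uniform in the base point, so the remainder can be integrated in
  \<open>convol_has_derivative\<close>.\<close>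

lemma smooth_compact_taylor:
  fixes K :: "'a::euclidean_space \<Rightarrow> real"
  assumes K: "smooth_compact K"
  obtains M where "0 \<le> M" "\<And>x y. \<bar>K y - K x - frechet_derivative K (at x) (y - x)\<bar> \<le> M * norm (y - x) ^ 2"
proof -
  have "\<exists>M. 0 \<le> M \<and> (\<forall>x y. \<bar>frechet_derivative K (at x) b - frechet_derivative K (at y) b\<bar> \<le> M * norm (x - y))" for b
    using smooth_compact_lipschitz[OF smooth_compact_derivative(2)[OF K]] by metis
  then obtain M where M: "\<And>b. 0 \<le> M b" "\<And>b x y. \<bar>frechet_derivative K (at x) b - frechet_derivative K (at y) b\<bar> \<le> M b * norm (x - y)"
    by metis
  define B where "B = (\<Sum>b\<in>Basis. M b)"
  have B: "0 \<le> B" unfolding B_def using M by (intro sum_nonneg) auto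
  have D: "\<bar>frechet_derivative K (at x) v - frechet_derivative K (at y) v\<bar> \<le> B * norm (x - y) * norm v" for x y v
  proof -
    interpret l: bounded_linear "frechet_derivative K (at x)"
      using smooth_compact_derivative(1)[OF K] by (rule has_derivative_bounded_linear)
    interpret l': bounded_linear "frechet_derivative K (at y)"
      using smooth_compact_derivative(1)[OF K] by (rule has_derivative_bounded_linear)
    have "frechet_derivative K (at x) v - frechet_derivative K (at y) v
       = (\<Sum>b\<in>Basis. (v \<bullet> b) * (frechet_derivative K (at x) b - frechet_derivative K (at y) b))"
      by (subst (1 2) euclidean_representation[of v, symmetric]) (simp add: l.sum l.scaleR l'.sum l'.scaleR sum_subtractf right_diff_distrib)
    also have "\<bar>\<dots>\<bar> \<le> (\<Sum>b\<in>Basis. \<bar>(v \<bullet> b) * (frechet_derivative K (at x) b - frechet_derivative K (at y) b)\<bar>)" by (rule sum_abs)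
    also have "\<dots> \<le> (\<Sum>b\<in>Basis. norm v * (M b * norm (x - y)))"
      unfolding abs_mult by (intro sum_mono mult_mono M(2) Basis_le_norm) auto
    also have "\<dots> = B * norm (x - y) * norm v" by (simp add: B_def sum_distrib_left sum_distrib_right mult_ac)
    finally show ?thesis .
  qed
  show thesis
  proof (rule that[OF B])
    fix x y
    have "norm (K y - K x - frechet_derivative K (at x) (y - x)) \<le> norm (y - x) * (B * norm (y - x))"
    proof (rule differentiable_bound_linearization[where S="closed_segment x y"])
      show "x + t *\<^sub>R (y - x) \<in> closed_segment x y" if "t \<in> {0..1}" for t
        using that by (auto simp: closed_segment_def algebra_simps intro!: exI[of _ t])
      show "(K has_derivative frechet_derivative K (at z)) (at z within closed_segment x y)" for z
        by (rule has_derivative_at_withinI[OF smooth_compact_derivative(1)[OF K]])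
      fix z assume z: "z \<in> closed_segment x y"
      show "onorm (frechet_derivative K (at z) - frechet_derivative K (at x)) \<le> B * norm (y - x)"
      proof (rule onorm_bound)
        show "0 \<le> B * norm (y - x)" using B by simp
        fix v
        have "norm ((frechet_derivative K (at z) - frechet_derivative K (at x)) v) \<le> B * norm (z - x) * norm v"
          using D[of z v x] by simp
        also have "\<dots> \<le> B * norm (y - x) * norm v"
          using z B by (intro mult_right_mono mult_left_mono) (auto dest: segment_bound1)
        finally show "norm ((frechet_derivative K (at z) - frechet_derivative K (at x)) v) \<le> B * norm (y - x) * norm v" .
      qed
    qed auto
    then show "\<bar>K y - K x - frechet_derivative K (at x) (y - x)\<bar> \<le> B * norm (y - x) ^ 2"
      by (simp add: power2_eq_square mult_ac)
  qed
qed

definition convol :: "('a::euclidean_space \<Rightarrow> real) \<Rightarrow> ('a \<Rightarrow> real) \<Rightarrow> 'a \<Rightarrow> real" where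
  "convol K v x = (\<integral>y. K (x - y) * v y \<partial>lborel)"

lemma convol_integrable:
  assumes K: "smooth_compact K" and v: "integrable lborel v"
  shows "integrable lborel (\<lambda>y. K (x - y) * v y)"
proof -
  obtain M where M: "0 \<le> M" "\<And>x. \<bar>K x\<bar> \<le> M" using smooth_compact_bounded[OF K] by blast
  have [measurable]: "K \<in> borel_measurable borel" by (rule smooth_compact_measurable[OF K])
  show ?thesis
  proof (rule Bochner_Integration.integrable_bound)
    show "integrable lborel (\<lambda>y. M * v y)" using v by simp
    show "AE y in lborel. norm (K (x - y) * v y) \<le> norm (M * v y)"
      using M by (auto simp: abs_mult mult_right_mono)
  qed (use v in measurable)
qed

text \<open>The Taylor remainder of the kernel is at most a multiple of
  \<open>norm (y - x) ^ 2\<close>, uniformly in the integration variable; multiplied by the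
  integrable \<open>v\<close> it stays quadratic after integration.\<close>

lemma convol_has_derivative:
  assumes K: "smooth_compact K" and v: "integrable lborel v"
  shows "(convol K v has_derivative (\<lambda>h. convol (\<lambda>z. frechet_derivative K (at z) h) v x)) (at x)"
proof -
  let ?D = "\<lambda>z. frechet_derivative K (at z)"
  obtain M where M: "0 \<le> M" "\<And>x y. \<bar>K y - K x - ?D x (y - x)\<bar> \<le> M * norm (y - x) ^ 2"
    using smooth_compact_taylor[OF K] by blast
  obtain B where B: "0 \<le> B" "\<And>x h. \<bar>?D x h\<bar> \<le> B * norm h"
    using smooth_compact_derivative_bound[OF K] by blast
  have lin: "linear (?D z)" for z
    using has_derivative_linear[OF smooth_compact_derivative(1)[OF K]] .
  note int = convol_integrable[OF smooth_compact_derivative(2)[OF K] v]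
  define V where "V = (\<integral>y. \<bar>v y\<bar> \<partial>lborel)"
  have bl: "bounded_linear (\<lambda>h. convol (\<lambda>z. ?D z h) v x)"
  proof (rule bounded_linear_intro[where K="B * V"])
    show "convol (\<lambda>z. ?D z (h + k)) v x = convol (\<lambda>z. ?D z h) v x + convol (\<lambda>z. ?D z k) v x" for h k
      unfolding convol_def using int by (simp add: linear_add[OF lin] distrib_right)
    show "convol (\<lambda>z. ?D z (c *\<^sub>R h)) v x = c *\<^sub>R convol (\<lambda>z. ?D z h) v x" for h c
      unfolding convol_def by (simp add: linear_scale[OF lin] mult.assoc)
    fix h
    have "\<bar>convol (\<lambda>z. ?D z h) v x\<bar> \<le> (\<integral>y. \<bar>?D (x - y) h * v y\<bar> \<partial>lborel)"
      unfolding convol_def by (rule integral_abs_bound)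
    also have "\<dots> \<le> (\<integral>y. B * norm h * \<bar>v y\<bar> \<partial>lborel)"
    proof (intro integral_mono integrable_abs int)
      show "\<bar>?D (x - y) h * v y\<bar> \<le> B * norm h * \<bar>v y\<bar>" for y
        unfolding abs_mult by (intro mult_right_mono B) auto
    qed (use v in simp)
    finally show "norm (convol (\<lambda>z. ?D z h) v x) \<le> norm h * (B * V)"
      by (simp add: V_def mult_ac)
  qed
  show ?thesis
  proof (rule has_derivativeI_sandwich[OF zero_less_one bl, where H="\<lambda>y. M * V * norm (y - x)"])
    show "((\<lambda>y. M * V * norm (y - x)) \<longlongrightarrow> 0) (at x within UNIV)"
      by (rule tendsto_eq_intros | simp)+
    fix y assume "y \<noteq> x"
    have i: "integrable lborel (\<lambda>t. K (y - t) * v t - K (x - t) * v t - ?D (x - t) (y - x) * v t)"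
      by (rule Bochner_Integration.integrable_diff[OF Bochner_Integration.integrable_diff[OF convol_integrable[OF K v] convol_integrable[OF K v]] int])
    have eq: "convol K v y - convol K v x - convol (\<lambda>z. ?D z (y - x)) v x
       = (\<integral>t. (K (y - t) - K (x - t) - ?D (x - t) (y - x)) * v t \<partial>lborel)"
      unfolding convol_def using int convol_integrable[OF K v] by (simp add: left_diff_distrib)
    have "norm (convol K v y - convol K v x - convol (\<lambda>z. ?D z (y - x)) v x) \<le> (\<integral>t. \<bar>(K (y - t) - K (x - t) - ?D (x - t) (y - x)) * v t\<bar> \<partial>lborel)"
      unfolding eq real_norm_def by (rule integral_abs_bound)
    also have "\<dots> \<le> (\<integral>t. M * norm (y - x) ^ 2 * \<bar>v t\<bar> \<partial>lborel)"
    proof (intro integral_mono)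
      show "integrable lborel (\<lambda>t. \<bar>(K (y - t) - K (x - t) - ?D (x - t) (y - x)) * v t\<bar>)"
        using integrable_abs[OF i] by (simp only: left_diff_distrib)
      show "\<bar>(K (y - t) - K (x - t) - ?D (x - t) (y - x)) * v t\<bar> \<le> M * norm (y - x) ^ 2 * \<bar>v t\<bar>" for t
        unfolding abs_mult using M(2)[of "y - t" "x - t"] by (intro mult_right_mono) auto
    qed (use v in simp)
    also have "\<dots> = M * V * norm (y - x) * norm (y - x)" by (simp add: V_def power2_eq_square)
    finally show "norm (convol K v y - convol K v x - convol (\<lambda>z. ?D z (y - x)) v x) / norm (y - x) \<le> M * V * norm (y - x)"
      using \<open>y \<noteq> x\<close> by (simp add: pos_divide_le_eq)
  qed
qed

lemma convol_times_differentiable: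
  "smooth_compact K \<Longrightarrow> integrable lborel v \<Longrightarrow> times_differentiable k (convol K v)"
proof (induction k arbitrary: K)
  case 0
  then have "convol K v differentiable (at x)" for x
    using convol_has_derivative differentiable_def by blast
  then show ?case by (simp add: continuous_on_eq_continuous_at differentiable_imp_continuous_within)
next
  case (Suc k)
  show ?case
    by (rule times_differentiable_SucI[OF convol_has_derivative[OF Suc.prems]])
       (intro Suc.IH smooth_compact_derivative(2) Suc.prems)
qed

section \<open>Mollification\<close>

lemma tendsto_0_le_ennreal:
  fixes X Y :: "nat \<Rightarrow> ennreal"
  assumes "\<And>k. X k \<le> Y k" "Y \<longlonglongrightarrow> 0"
  shows "X \<longlonglongrightarrow> 0"
  by (rule tendsto_sandwich[OF _ _ tendsto_const assms(2)]) (simp_all add: assms(1))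

lemma lborel_distr_reflect: "distr lborel borel (\<lambda>y. x - y) = (lborel :: 'a::euclidean_space measure)"
proof -
  have "lborel = density (distr lborel borel (\<lambda>y. x + (- 1) *\<^sub>R y)) (\<lambda>_. ennreal (\<bar>- 1\<bar> ^ DIM('a)))"
    by (rule lborel_affine) simp
  then show ?thesis by (simp add: density_1)
qed

lemma nn_integral_lborel_reflect:
  fixes f :: "'a::euclidean_space \<Rightarrow> ennreal"
  assumes [measurable]: "f \<in> borel_measurable borel"
  shows "(\<integral>\<^sup>+y. f (x - y) \<partial>lborel) = (\<integral>\<^sup>+y. f y \<partial>lborel)"
proof -
  have "(\<integral>\<^sup>+y. f y \<partial>lborel) = (\<integral>\<^sup>+y. f y \<partial>distr lborel borel (\<lambda>y. x - y))"
    by (simp add: lborel_distr_reflect)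
  also have "\<dots> = (\<integral>\<^sup>+y. f (x - y) \<partial>lborel)" by (subst nn_integral_distr) auto
  finally show ?thesis by simp
qed

lemma convol_commute:
  assumes [measurable]: "K \<in> borel_measurable borel" "v \<in> borel_measurable borel"
  shows "convol K v x = (\<integral>z. K z * v (x - z) \<partial>lborel)"
proof -
  have "convol K v x = (\<integral>y. K (x - y) * v (x - (x - y)) \<partial>lborel)" by (simp add: convol_def)
  also have "\<dots> = (\<integral>z. K z * v (x - z) \<partial>distr lborel borel (\<lambda>y. x - y))"
    by (subst integral_distr) auto
  finally show ?thesis by (simp add: lborel_distr_reflect)
qed

text \<open>A convolution with a kernel of mass 1 is an average of translates of \<open>v\<close>,
  and the energy is convex and translation invariant. Concretely, the quotient of the average is at
  most the average of the quotients, and Tonelli does the rest.\<close>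

lemma convol_energy:
  fixes K :: "'a::euclidean_space \<Rightarrow> real"
  assumes K: "smooth_compact K" "\<And>x. 0 \<le> K x" "(\<integral>\<^sup>+x. ennreal (K x) \<partial>lborel) = 1"
    and v: "integrable lborel v"
  shows "frac_energy s 1 UNIV (convol K v) \<le> frac_energy s 1 UNIV v"
proof -
  have [measurable]: "K \<in> borel_measurable borel" by (rule smooth_compact_measurable[OF K(1)])
  have [measurable]: "v \<in> borel_measurable borel" using v by auto
  have int: "integrable lborel (\<lambda>z. K z * v (x - z))" for x
  proof -
    have "integrable (distr lborel borel (\<lambda>y. x - y)) (\<lambda>z. K z * v (x - z))"
      using convol_integrable[OF K(1) v, of x] by (subst integrable_distr_eq) auto
    then show ?thesis by (simp add: lborel_distr_reflect)
  qed
  have pt: "ennreal (dq s (convol K v) x x') \<le> (\<integral>\<^sup>+z. ennreal (K z) * ennreal (dq s v (x - z) (x' - z)) \<partial>lborel)" for x x'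
  proof -
    define c where "c = 1 / norm (x - x') powr (real DIM('a) + s)"
    have c: "0 \<le> c" by (simp add: c_def)
    have "convol K v x - convol K v x' = (\<integral>z. K z * v (x - z) - K z * v (x' - z) \<partial>lborel)"
      by (simp add: convol_commute Bochner_Integration.integral_diff[OF int int])
    then have "ennreal \<bar>convol K v x - convol K v x'\<bar> \<le> ennreal (\<integral>z. \<bar>K z * v (x - z) - K z * v (x' - z)\<bar> \<partial>lborel)"
      by (auto intro!: ennreal_leI integral_abs_bound)
    also have "\<dots> = (\<integral>\<^sup>+z. ennreal \<bar>K z * v (x - z) - K z * v (x' - z)\<bar> \<partial>lborel)"
      by (intro nn_integral_eq_integral[symmetric] integrable_abs Bochner_Integration.integrable_diff int) auto
    also have "\<dots> = (\<integral>\<^sup>+z. ennreal (K z) * ennreal \<bar>v (x - z) - v (x' - z)\<bar> \<partial>lborel)"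
      using K(2) by (intro nn_integral_cong) (simp add: ennreal_mult'[symmetric] abs_mult right_diff_distrib[symmetric])
    finally have "ennreal c * ennreal \<bar>convol K v x - convol K v x'\<bar> \<le> ennreal c * (\<integral>\<^sup>+z. ennreal (K z) * ennreal \<bar>v (x - z) - v (x' - z)\<bar> \<partial>lborel)"
      by (rule mult_left_mono) simp
    also have "\<dots> = (\<integral>\<^sup>+z. ennreal c * (ennreal (K z) * ennreal \<bar>v (x - z) - v (x' - z)\<bar>) \<partial>lborel)"
      by (rule nn_integral_cmult[symmetric]) measurable
    also have "\<dots> = (\<integral>\<^sup>+z. ennreal (K z) * ennreal (dq s v (x - z) (x' - z)) \<partial>lborel)"
    proof (intro nn_integral_cong)
      fix z
      have "dq s v (x - z) (x' - z) = c * \<bar>v (x - z) - v (x' - z)\<bar>" by (simp add: dq_def c_def)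
      then show "ennreal c * (ennreal (K z) * ennreal \<bar>v (x - z) - v (x' - z)\<bar>) = ennreal (K z) * ennreal (dq s v (x - z) (x' - z))"
        using c by (simp add: ennreal_mult' mult.left_commute)
    qed
    also have "ennreal c * ennreal \<bar>convol K v x - convol K v x'\<bar> = ennreal (dq s (convol K v) x x')"
      using c by (simp add: dq_def c_def flip: ennreal_mult')
    finally show ?thesis .
  qed
  have "frac_energy s 1 UNIV (convol K v) \<le> (\<integral>\<^sup>+x. \<integral>\<^sup>+x'. \<integral>\<^sup>+z. ennreal (K z) * ennreal (dq s v (x - z) (x' - z)) \<partial>lborel \<partial>lborel \<partial>lborel)"
    unfolding frac_energy_UNIV using pt by (auto intro!: nn_integral_mono)
  also have "\<dots> = (\<integral>\<^sup>+x. \<integral>\<^sup>+z. \<integral>\<^sup>+x'. ennreal (K z) * ennreal (dq s v (x - z) (x' - z)) \<partial>lborel \<partial>lborel \<partial>lborel)"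
    by (intro nn_integral_cong nn_integral_lborel_commute) measurable
  also have "\<dots> = (\<integral>\<^sup>+z. \<integral>\<^sup>+x. \<integral>\<^sup>+x'. ennreal (K z) * ennreal (dq s v (x - z) (x' - z)) \<partial>lborel \<partial>lborel \<partial>lborel)"
    by (rule nn_integral_lborel_commute) measurable
  also have "\<dots> = (\<integral>\<^sup>+z. ennreal (K z) * frac_energy s 1 UNIV v \<partial>lborel)"
  proof (intro nn_integral_cong)
    fix z
    have "(\<integral>\<^sup>+x. \<integral>\<^sup>+x'. ennreal (K z) * ennreal (dq s v (x - z) (x' - z)) \<partial>lborel \<partial>lborel)
       = ennreal (K z) * (\<integral>\<^sup>+x. \<integral>\<^sup>+x'. ennreal (dq s v (x - z) (x' - z)) \<partial>lborel \<partial>lborel)"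
      by (simp add: nn_integral_cmult)
    also have "(\<integral>\<^sup>+x. \<integral>\<^sup>+x'. ennreal (dq s v (x - z) (x' - z)) \<partial>lborel \<partial>lborel)
       = (\<integral>\<^sup>+x. \<integral>\<^sup>+x'. ennreal (dq s v (x - z) x') \<partial>lborel \<partial>lborel)"
      using nn_integral_lborel_shift[of "\<lambda>x'. ennreal (dq s v _ x')" "- z"] by simp
    also have "\<dots> = (\<integral>\<^sup>+x. \<integral>\<^sup>+x'. ennreal (dq s v x x') \<partial>lborel \<partial>lborel)"
      using nn_integral_lborel_shift[of "\<lambda>x. \<integral>\<^sup>+x'. ennreal (dq s v x x') \<partial>lborel" "- z"] by simp
    finally show "(\<integral>\<^sup>+x. \<integral>\<^sup>+x'. ennreal (K z) * ennreal (dq s v (x - z) (x' - z)) \<partial>lborel \<partial>lborel) = ennreal (K z) * frac_energy s 1 UNIV v"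
      by (simp add: frac_energy_UNIV)
  qed
  also have "\<dots> = frac_energy s 1 UNIV v"
    by (simp add: nn_integral_multc K(3))
  finally show ?thesis .
qed

text \<open>On the support of the kernel, \<open>norm (x - y) powr (n + s)\<close> is at most
  \<open>\<delta> powr (n + s)\<close>; multiplied by the height
  \<open>M * \<delta> powr - n\<close> this leaves the rate \<open>\<delta> powr s\<close>. The
  finite energy takes the place of continuity of translations in L1.\<close>

lemma convol_L1:
  fixes K :: "'a::euclidean_space \<Rightarrow> real"
  assumes K: "smooth_compact K" "\<And>x. 0 \<le> K x" "(\<integral>\<^sup>+x. ennreal (K x) \<partial>lborel) = 1"
    and \<delta>: "0 < \<delta>" "\<And>x. K x \<le> M * \<delta> powr - real DIM('a)" "\<And>x. \<delta> \<le> norm x \<Longrightarrow> K x = 0"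
    and v: "integrable lborel v" and s: "0 < s" and M: "0 \<le> M"
  shows "(\<integral>\<^sup>+x. ennreal \<bar>convol K v x - v x\<bar> \<partial>lborel) \<le> ennreal (M * \<delta> powr s) * frac_energy s 1 UNIV v"
proof -
  have [measurable]: "K \<in> borel_measurable borel" by (rule smooth_compact_measurable[OF K(1)])
  have [measurable]: "v \<in> borel_measurable borel" using v by auto
  have K1: "(\<integral>\<^sup>+y. ennreal (K (x - y)) \<partial>lborel) = 1" for x
    using nn_integral_lborel_reflect[of "\<lambda>z. ennreal (K z)" x] K(3) by simp
  have iK: "integrable lborel (\<lambda>y. K (x - y))" for x
    by (rule integrableI_nn_integral_finite[where x=1]) (use K1 K(2) in auto)
  have iK1: "(\<integral>y. K (x - y) \<partial>lborel) = 1" for x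
    using K1[of x] K(2) by (intro integral_eq_nn_integral[THEN trans]) auto
  have pt: "ennreal \<bar>convol K v x - v x\<bar> \<le> ennreal (M * \<delta> powr s) * (\<integral>\<^sup>+y. ennreal (dq s v x y) \<partial>lborel)" for x
  proof -
    note i = convol_integrable[OF K(1) v]
    have "v x = (\<integral>y. K (x - y) * v x \<partial>lborel)" using iK1[of x] by simp
    then have "convol K v x - v x = (\<integral>y. K (x - y) * v y \<partial>lborel) - (\<integral>y. K (x - y) * v x \<partial>lborel)" by (simp add: convol_def)
    also have "\<dots> = (\<integral>y. K (x - y) * v y - K (x - y) * v x \<partial>lborel)"
      by (rule Bochner_Integration.integral_diff[symmetric, OF i]) (use iK in simp)
    finally have "ennreal \<bar>convol K v x - v x\<bar> \<le> ennreal (\<integral>y. \<bar>K (x - y) * v y - K (x - y) * v x\<bar> \<partial>lborel)"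
      by (auto intro!: ennreal_leI integral_abs_bound)
    also have "\<dots> = (\<integral>\<^sup>+y. ennreal \<bar>K (x - y) * v y - K (x - y) * v x\<bar> \<partial>lborel)"
      by (intro nn_integral_eq_integral[symmetric] integrable_abs Bochner_Integration.integrable_diff i) (use iK in auto)
    also have "\<dots> \<le> (\<integral>\<^sup>+y. ennreal (M * \<delta> powr s) * ennreal (dq s v x y) \<partial>lborel)"
    proof (intro nn_integral_mono)
      fix y
      have "\<bar>K (x - y) * v y - K (x - y) * v x\<bar> \<le> M * \<delta> powr s * dq s v x y"
      proof (cases "norm (x - y) < \<delta> \<and> x \<noteq> y")
        case True
        have "\<bar>K (x - y) * v y - K (x - y) * v x\<bar> = K (x - y) * \<bar>v x - v y\<bar>"
          using K(2) by (simp add: abs_mult right_diff_distrib[symmetric] abs_minus_commute)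
        also have "\<bar>v x - v y\<bar> = norm (x - y) powr (real DIM('a) + s) * dq s v x y" using True by (simp add: dq_def)
        also have "K (x - y) * (norm (x - y) powr (real DIM('a) + s) * dq s v x y) 
           \<le> (M * \<delta> powr - real DIM('a)) * (\<delta> powr (real DIM('a) + s) * dq s v x y)"
          using True s M K(2) \<delta>(1) by (intro mult_mono \<delta>(2) mult_right_mono powr_mono2) auto
        also have "\<dots> = M * (\<delta> powr - real DIM('a) * \<delta> powr (real DIM('a) + s)) * dq s v x y" by simp
        also have "\<delta> powr - real DIM('a) * \<delta> powr (real DIM('a) + s) = \<delta> powr s"
          unfolding powr_add[symmetric] by simp
        finally show ?thesis .
      next
        case False
        then have "x = y \<or> K (x - y) = 0" using \<delta>(3)[of "x - y"] by auto
        then show ?thesis using M by auto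
      qed
      then show "ennreal \<bar>K (x - y) * v y - K (x - y) * v x\<bar> \<le> ennreal (M * \<delta> powr s) * ennreal (dq s v x y)"
        using M by (subst ennreal_mult'[symmetric]) (auto intro: ennreal_leI)
    qed
    also have "\<dots> = ennreal (M * \<delta> powr s) * (\<integral>\<^sup>+y. ennreal (dq s v x y) \<partial>lborel)"
      by (rule nn_integral_cmult) measurable
    finally show ?thesis .
  qed
  have "(\<integral>\<^sup>+x. ennreal \<bar>convol K v x - v x\<bar> \<partial>lborel) \<le> (\<integral>\<^sup>+x. ennreal (M * \<delta> powr s) * (\<integral>\<^sup>+y. ennreal (dq s v x y) \<partial>lborel) \<partial>lborel)"
    by (intro nn_integral_mono pt)
  also have "\<dots> = ennreal (M * \<delta> powr s) * frac_energy s 1 UNIV v"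
    by (simp add: nn_integral_cmult frac_energy_UNIV)
  finally show ?thesis .
qed

lemma test_functionsI:
  assumes "\<And>k. times_differentiable k \<phi>" "compact C" "C \<subseteq> \<Omega>" "\<And>x. \<phi> x \<noteq> 0 \<Longrightarrow> x \<in> C"
  shows "\<phi> \<in> test_functions \<Omega>"
proof -
  have sub: "closure {x. \<phi> x \<noteq> 0} \<subseteq> C" using assms by (intro closure_minimal compact_imp_closed) auto
  have "bounded (closure {x. \<phi> x \<noteq> 0})"
    using bounded_subset[OF compact_imp_bounded[OF assms(2)] sub] .
  then have "compact (closure {x. \<phi> x \<noteq> 0})" by (simp add: compact_eq_bounded_closed)
  with sub show ?thesis using assms by (auto simp: test_functions_def)
qed

text \<open>Scheffe's lemma for the signed quotients: they converge almost everywhere on pairs, and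
  their L1 norms do not exceed that of the limit.\<close>

lemma frac_energy_tendsto_0:
  fixes \<phi> :: "nat \<Rightarrow> 'a::euclidean_space \<Rightarrow> real"
  assumes [measurable]: "\<And>k. \<phi> k \<in> borel_measurable borel" "v \<in> borel_measurable borel"
    and lim: "AE x in lborel. (\<lambda>k. \<phi> k x) \<longlonglongrightarrow> v x"
    and le: "\<And>k. frac_energy s 1 UNIV (\<phi> k) \<le> frac_energy s 1 UNIV v" and fin: "frac_energy s 1 UNIV v < \<infinity>"
  shows "(\<lambda>k. frac_energy s 1 UNIV (\<lambda>x. \<phi> k x - v x)) \<longlonglongrightarrow> 0"
proof -
  define F where "F = (\<lambda>u (z :: 'a \<times> 'a). (u (fst z) - u (snd z)) / norm (fst z - snd z) powr (real DIM('a) + s))"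
  have Fm [measurable]: "F u \<in> borel_measurable borel" if [measurable]: "u \<in> borel_measurable borel" for u
    unfolding F_def by measurable
  have nF: "(\<integral>\<^sup>+z. ennreal \<bar>F u z\<bar> \<partial>lborel) = frac_energy s 1 UNIV u" if [measurable]: "u \<in> borel_measurable borel" for u
    by (subst frac_energy_pair[OF that]) (simp add: F_def dq_def)
  have "(\<lambda>k. \<integral>\<^sup>+z. ennreal (norm (F (\<phi> k) z - F v z)) \<partial>lborel) \<longlonglongrightarrow> 0"
  proof (rule Scheffe_lemma1)
    show "integrable lborel (F (\<phi> k))" for k
      using le[of k] fin nF[of "\<phi> k"] by (intro integrableI_bounded) auto
    show "integrable lborel (F v)" using fin nF[of v] by (intro integrableI_bounded) auto
    show "AE z in lborel. (\<lambda>k. F (\<phi> k) z) \<longlonglongrightarrow> F v z"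
      using AE_lborel_pair[OF lim lim]
    proof eventually_elim
      case (elim z)
      show ?case
      proof (cases "fst z = snd z")
        case False
        then have "norm (fst z - snd z) powr (real DIM('a) + s) \<noteq> 0" by simp
        then show ?thesis unfolding F_def using elim by (intro tendsto_divide tendsto_diff tendsto_const) auto
      qed (simp add: F_def)
    qed
    show "limsup (\<lambda>k. \<integral>\<^sup>+z. ennreal (norm (F (\<phi> k) z)) \<partial>lborel) \<le> (\<integral>\<^sup>+z. ennreal (norm (F v z)) \<partial>lborel)"
      using le by (intro Limsup_bounded always_eventually allI) (simp add: nF)
  qed
  moreover have "F (\<phi> k) z - F v z = F (\<lambda>x. \<phi> k x - v x) z" for k z
    by (simp add: F_def diff_divide_distrib[symmetric])
  ultimately show ?thesis by (simp add: nF)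
qed

lemma mollify:
  fixes v :: "'a::euclidean_space \<Rightarrow> real"
  assumes \<Omega>: "bounded \<Omega>" and a: "0 < a" and s: "0 < s"
    and v [measurable]: "v \<in> borel_measurable borel" and off: "\<And>x. infdist x (- \<Omega>) < a \<Longrightarrow> v x = 0"
    and L1: "(\<integral>\<^sup>+x. ennreal \<bar>v x\<bar> \<partial>lborel) < \<infinity>" and E: "frac_energy s 1 UNIV v < \<infinity>"
  obtains \<phi> where "\<And>k::nat. \<phi> k \<in> test_functions \<Omega>" "(\<lambda>k. \<integral>\<^sup>+x. ennreal \<bar>\<phi> k x - v x\<bar> \<partial>lborel) \<longlonglongrightarrow> 0"
    "(\<lambda>k. frac_energy s 1 UNIV (\<lambda>x. \<phi> k x - v x)) \<longlonglongrightarrow> 0"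
proof -
  obtain M where M: "0 \<le> M" "\<And>\<delta>. 0 < \<delta> \<Longrightarrow> \<exists>K :: 'a \<Rightarrow> real. smooth_compact K \<and>
    (\<forall>x. 0 \<le> K x \<and> K x \<le> M * \<delta> powr - real DIM('a)) \<and> (\<forall>x. \<delta> \<le> norm x \<longrightarrow> K x = 0) \<and> (\<integral>\<^sup>+x. ennreal (K x) \<partial>lborel) = 1"
    using mollifier by blast
  \<comment> \<open>Radii of at most \<open>a / 2\<close>: \<open>v\<close> vanishes within distance
    \<open>a\<close> of the complement, so the mollified functions vanish within
    \<open>a / 2\<close> of it and have compact support in \<open>\<Omega>\<close>.\<close>
  define d where "d = (\<lambda>k. a / 2 * (1 / real (Suc k)))"
  have d: "0 < d k" "d k \<le> a / 2" for k using a by (auto simp: d_def field_simps)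
  have "\<exists>K :: 'a \<Rightarrow> real. smooth_compact K \<and>
    (\<forall>x. 0 \<le> K x \<and> K x \<le> M * d k powr - real DIM('a)) \<and> (\<forall>x. d k \<le> norm x \<longrightarrow> K x = 0) \<and> (\<integral>\<^sup>+x. ennreal (K x) \<partial>lborel) = 1" for k
    by (rule M(2)[OF d(1)])
  then obtain K :: "nat \<Rightarrow> 'a \<Rightarrow> real" where K: "\<And>k. smooth_compact (K k)" "\<And>k x. 0 \<le> K k x"
    "\<And>k x. K k x \<le> M * d k powr - real DIM('a)" "\<And>k x. d k \<le> norm x \<Longrightarrow> K k x = 0" "\<And>k. (\<integral>\<^sup>+x. ennreal (K k x) \<partial>lborel) = 1"
    by metis
  have iv: "integrable lborel v" using L1 by (intro integrableI_bounded) auto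
  define \<psi> where "\<psi> = (\<lambda>k. convol (K k) v)"
  define C where "C = {x. a / 2 \<le> infdist x (- \<Omega>)}"
  have C\<Omega>: "C \<subseteq> \<Omega>" using a by (auto simp: C_def intro: ccontr)
  have Cc: "compact C"
    unfolding compact_eq_bounded_closed C_def
    using bounded_subset[OF \<Omega> C\<Omega>] by (auto simp: C_def intro!: closed_Collect_le continuous_intros)
  have test: "\<psi> k \<in> test_functions \<Omega>" for k
  proof (rule test_functionsI[OF _ Cc C\<Omega>])
    show "times_differentiable m (\<psi> k)" for m
      unfolding \<psi>_def by (rule convol_times_differentiable[OF K(1) iv])
    fix x assume nz: "\<psi> k x \<noteq> 0"
    show "x \<in> C"
    proof (rule ccontr)
      assume x: "x \<notin> C"
      have "K k (x - y) * v y = 0" for y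
      proof (cases "norm (x - y) < d k")
        case True
        have "infdist y (- \<Omega>) \<le> infdist x (- \<Omega>) + dist y x" by (rule infdist_triangle)
        also have "\<dots> < a / 2 + a / 2" using x True d(2)[of k] by (intro add_strict_mono) (auto simp: C_def dist_norm norm_minus_commute)
        finally show ?thesis using off[of y] by simp
      qed (simp add: K(4))
      then have "(\<lambda>y. K k (x - y) * v y) = (\<lambda>y. 0)" by blast
      then have "\<psi> k x = (\<integral>y. 0 \<partial>(lborel :: 'a measure))" unfolding \<psi>_def convol_def by (rule arg_cong)
      then show False using nz by simp
    qed
  qed
  then have [measurable]: "\<psi> k \<in> borel_measurable borel" for k
    using convol_times_differentiable[OF K(1) iv, of 0] unfolding \<psi>_def by (intro borel_measurable_continuous_onI) simp
  obtain E' where E': "frac_energy s 1 UNIV v = ennreal E'" "0 \<le> E'" using E by (cases "frac_energy s 1 UNIV v") auto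
  have L: "(\<integral>\<^sup>+x. ennreal \<bar>\<psi> k x - v x\<bar> \<partial>lborel) \<le> ennreal (M * d k powr s * E')" for k
    unfolding \<psi>_def using convol_L1[OF K(1) K(2) K(5) d(1) K(3) K(4) iv s M(1)] M(1) E' by (simp add: ennreal_mult')
  have d0: "d \<longlonglongrightarrow> 0"
    unfolding d_def using tendsto_mult[OF tendsto_const LIMSEQ_Suc[OF lim_1_over_n], of "a/2"] by simp
  then have "(\<lambda>k. M * d k powr s * E') \<longlonglongrightarrow> M * 0 powr s * E'"
    using s d by (intro tendsto_mult tendsto_powr' tendsto_const) (auto simp: less_imp_le)
  then have "(\<lambda>k. ennreal (M * d k powr s * E')) \<longlonglongrightarrow> ennreal (M * 0 powr s * E')" by (rule tendsto_ennrealI)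
  then have "(\<lambda>k. ennreal (M * d k powr s * E')) \<longlonglongrightarrow> 0" by simp
  then have L0: "(\<lambda>k. \<integral>\<^sup>+x. ennreal \<bar>\<psi> k x - v x\<bar> \<partial>lborel) \<longlonglongrightarrow> 0"
    by (rule tendsto_0_le_ennreal[rotated]) (simp add: L)
  have iD: "integrable lborel (\<lambda>x. \<psi> k x - v x)" for k
  proof (rule integrableI_bounded)
    have "(\<integral>\<^sup>+x. ennreal \<bar>\<psi> k x - v x\<bar> \<partial>lborel) < \<infinity>" using L[of k] by (rule order_le_less_trans) simp
    then show "(\<integral>\<^sup>+x. ennreal (norm (\<psi> k x - v x)) \<partial>lborel) < \<infinity>" by simp
  qed measurable
  have "(\<lambda>k. \<integral>x. norm (\<psi> k x - v x) \<partial>lborel) \<longlonglongrightarrow> 0"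
  proof -
    have "(\<integral>\<^sup>+x. ennreal \<bar>\<psi> k x - v x\<bar> \<partial>lborel) = ennreal (\<integral>x. norm (\<psi> k x - v x) \<partial>lborel)" for k
      using iD[of k] by (subst nn_integral_eq_integral) auto
    then have "(\<lambda>k. ennreal (\<integral>x. norm (\<psi> k x - v x) \<partial>lborel)) \<longlonglongrightarrow> ennreal 0" using L0 by simp
    then show ?thesis by (subst (asm) tendsto_ennreal_iff) auto
  qed
  \<comment> \<open>Scheffe's lemma asks for convergence almost everywhere, hence the passage to a
    subsequence.\<close>
  then obtain r :: "nat \<Rightarrow> nat" where r: "strict_mono r" "AE x in lborel. (\<lambda>k. \<psi> (r k) x - v x) \<longlonglongrightarrow> 0"
    using tendsto_L1_AE_subseq[of lborel "\<lambda>k x. \<psi> k x - v x"] iD by auto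
  show thesis
  proof (rule that[of "\<lambda>k. \<psi> (r k)"])
    show "(\<lambda>k. \<integral>\<^sup>+x. ennreal \<bar>\<psi> (r k) x - v x\<bar> \<partial>lborel) \<longlonglongrightarrow> 0"
      using LIMSEQ_subseq_LIMSEQ[OF L0 r(1)] by (simp add: o_def)
    show "(\<lambda>k. frac_energy s 1 UNIV (\<lambda>x. \<psi> (r k) x - v x)) \<longlonglongrightarrow> 0"
    proof (rule frac_energy_tendsto_0)
      show "AE x in lborel. (\<lambda>k. \<psi> (r k) x) \<longlonglongrightarrow> v x" using r(2) by eventually_elim (rule LIM_zero_cancel)
      show "frac_energy s 1 UNIV (\<psi> (r k)) \<le> frac_energy s 1 UNIV v" for k
        unfolding \<psi>_def by (rule convol_energy[OF K(1) K(2) K(5) iv])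
    qed (use E in auto)
  qed (rule test)
qed

section \<open>Cutting off near the boundary\<close>

text \<open>The cutoff has slope \<open>c\<close>, which is unbounded as it sharpens, but relative
  to the distance the slope is at most \<open>4 / d\<close>. For \<open>c * d \<le> 4\<close> this
  is immediate. For \<open>c * d > 4\<close> both arguments lie where the cutoff equals 1, unless
  \<open>t \<ge> d / 4\<close>, and then the right side is 1.\<close>

lemma cutoff_lipschitz:
  fixes c t d d' :: real
  assumes c: "0 < c" and d: "0 < d" and t: "\<bar>d' - d\<bar> \<le> t"
  shows "\<bar>max 0 (min 1 (c * d' - 1)) - max 0 (min 1 (c * d - 1))\<bar> \<le> min 1 (t / (d / 4))"
proof (cases "d / 4 \<le> t")
  case True
  then have "min 1 (t / (d / 4)) = 1" using d by (simp add: min_def field_simps)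
  then show ?thesis by linarith
next
  case False
  have t0: "0 \<le> t" using t by linarith
  show ?thesis
  proof (cases "c * d \<le> 4")
    case True
    have "\<bar>max 0 (min 1 (c * d' - 1)) - max 0 (min 1 (c * d - 1))\<bar> \<le> \<bar>c * d' - c * d\<bar>" by linarith
    also have "\<dots> = c * \<bar>d' - d\<bar>" using c by (simp add: abs_mult right_diff_distrib[symmetric])
    also have "\<dots> \<le> c * t" using c t by (intro mult_left_mono) auto
    also have "\<dots> \<le> 4 / d * t" using True d t0 by (intro mult_right_mono) (auto simp: field_simps)
    finally show ?thesis by (simp add: min_def mult.commute) linarith
  next
    case c4: False
    have "3 / 4 * d \<le> d'" using t False by linarith
    then have "c * (3 / 4 * d) \<le> c * d'" using c by (intro mult_left_mono) auto
    then have "2 \<le> c * d'" "2 \<le> c * d" using c4 by linarith+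
    then show ?thesis using t0 d by (simp add: min_def max_def)
  qed
qed

lemma frac_energy_triangle:
  fixes u v :: "'a::euclidean_space \<Rightarrow> real"
  assumes [measurable]: "u \<in> borel_measurable borel" "v \<in> borel_measurable borel" "A \<in> sets borel"
  shows "frac_energy s 1 A (\<lambda>x. u x + v x) \<le> frac_energy s 1 A u + frac_energy s 1 A v"
proof -
  have "frac_energy s 1 A (\<lambda>x. u x + v x) \<le> (\<integral>\<^sup>+x. \<integral>\<^sup>+y. ennreal (dq s u x y powr 1) * (indicator A x * indicator A y)
     + ennreal (dq s v x y powr 1) * (indicator A x * indicator A y) \<partial>lborel \<partial>lborel)"
    unfolding frac_energy_def distrib_right[symmetric]
  proof (intro nn_integral_mono mult_right_mono)
    fix x y
    have "dq s (\<lambda>x. u x + v x) x y \<le> dq s u x y + dq s v x y"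
      unfolding dq_def add_divide_distrib[symmetric] by (intro divide_right_mono) auto
    then show "ennreal (dq s (\<lambda>x. u x + v x) x y powr 1) \<le> ennreal (dq s u x y powr 1) + ennreal (dq s v x y powr 1)"
      by (simp add: ennreal_leI flip: ennreal_plus)
  qed auto
  also have "\<dots> = frac_energy s 1 A u + frac_energy s 1 A v"
    unfolding frac_energy_def by (simp add: nn_integral_add)
  finally show ?thesis .
qed

lemma frac_energy_uminus [simp]: "frac_energy s p A (\<lambda>x. - u x) = frac_energy s p A u"
  by (simp add: frac_energy_def dq_def abs_minus_commute)

lemma frac_energy_diff_commute: "frac_energy s p A (\<lambda>x. u x - v x) = frac_energy s p A (\<lambda>x. v x - u x)"
  using frac_energy_uminus[of s p A "\<lambda>x. u x - v x"] by simp

text \<open>Dominated convergence on pairs. By \<open>cutoff_lipschitz\<close> the quotients have a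
  majorant independent of \<open>k\<close>: the quotient of \<open>u\<close> plus
  \<open>\<bar>u x\<bar>\<close> times a truncated kernel at the scale of
  \<open>infdist x (- \<Omega>)\<close>. Integrating the kernel first leaves the Hardy integral
  \<open>H\<close>.\<close>

lemma cutoff:
  fixes u :: "'a::euclidean_space \<Rightarrow> real"
  assumes \<Omega>: "open \<Omega>" "bounded \<Omega>" and s: "0 < s" "s < 1"
    and u [measurable]: "u \<in> borel_measurable borel" and off: "\<And>x. x \<notin> \<Omega> \<Longrightarrow> u x = 0"
    and L1: "(\<integral>\<^sup>+x. ennreal \<bar>u x\<bar> \<partial>lborel) < \<infinity>" and E: "frac_energy s 1 UNIV u < \<infinity>"
    and H: "(\<integral>\<^sup>+x. ennreal (\<bar>u x\<bar> * infdist x (- \<Omega>) powr - s) \<partial>lborel) < \<infinity>"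
  defines "v \<equiv> \<lambda>k x. max 0 (min 1 (real (Suc k) * infdist x (- \<Omega>) - 1)) * u x"
  shows "(\<lambda>k. \<integral>\<^sup>+x. ennreal \<bar>v k x - u x\<bar> \<partial>lborel) \<longlonglongrightarrow> 0"
    and "(\<lambda>k. frac_energy s 1 UNIV (\<lambda>x. v k x - u x)) \<longlonglongrightarrow> 0"
proof -
  have ne: "- \<Omega> \<noteq> {}" using \<Omega>(2) not_bounded_UNIV by (metis Compl_empty_eq double_compl)
  define d where "d = (\<lambda>x. infdist x (- \<Omega>))"
  have d: "0 < d x" if "x \<in> \<Omega>" for x unfolding d_def using that \<Omega>(1) ne by (intro infdist_pos_not_in_closed) auto
  have [measurable]: "d \<in> borel_measurable borel" unfolding d_def by measurable
  define \<psi> where "\<psi> = (\<lambda>k x. max 0 (min 1 (real (Suc k) * d x - 1)))"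
  have v: "v k x = \<psi> k x * u x" for k x by (simp add: v_def \<psi>_def d_def)
  have [measurable]: "\<psi> k \<in> borel_measurable borel" for k unfolding \<psi>_def by measurable
  have [measurable]: "v k \<in> borel_measurable borel" for k unfolding v by measurable
  have \<psi>01: "0 \<le> \<psi> k x" "\<psi> k x \<le> 1" for k x by (auto simp: \<psi>_def)
  have ev: "eventually (\<lambda>k. v k x = u x) sequentially" for x
  proof (cases "x \<in> \<Omega>")
    case True
    obtain N where N: "2 / d x < real N" using reals_Archimedean2 by blast
    have "v k x = u x" if "k \<ge> N" for k
    proof -
      have "2 / d x \<le> real (Suc k)" using N that by linarith
      then have "2 \<le> real (Suc k) * d x" using d[OF True] by (simp add: pos_divide_le_eq)
      then show ?thesis by (simp add: v \<psi>_def)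
    qed
    then show ?thesis by (auto simp: eventually_sequentially)
  qed (simp add: v off)
  show "(\<lambda>k. \<integral>\<^sup>+x. ennreal \<bar>v k x - u x\<bar> \<partial>lborel) \<longlonglongrightarrow> 0"
  proof -
    have "(\<lambda>k. \<integral>\<^sup>+x. ennreal \<bar>v k x - u x\<bar> \<partial>lborel) \<longlonglongrightarrow> (\<integral>\<^sup>+x. 0 \<partial>(lborel :: 'a measure))"
    proof (rule nn_integral_dominated_convergence[where w="\<lambda>x. ennreal \<bar>u x\<bar>"])
      show "AE x in lborel. ennreal \<bar>v k x - u x\<bar> \<le> ennreal \<bar>u x\<bar>" for k
      proof (intro AE_I2 ennreal_leI)
        fix x
        have "v k x - u x = - ((1 - \<psi> k x) * u x)" by (simp add: v algebra_simps)
        then show "\<bar>v k x - u x\<bar> \<le> \<bar>u x\<bar>" using \<psi>01[of k x] by (simp add: abs_mult mult_left_le_one_le)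
      qed
      show "AE x in lborel. (\<lambda>k. ennreal \<bar>v k x - u x\<bar>) \<longlonglongrightarrow> 0"
        by (intro AE_I2 tendsto_eventually eventually_mono[OF ev]) auto
    qed (use L1 in auto)
    then show ?thesis by simp
  qed
  obtain K where K: "0 \<le> K" "\<And>a (x :: 'a). 0 < a \<Longrightarrow>
    (\<integral>\<^sup>+y. ennreal (min 1 (norm (x - y) / a) / norm (x - y) powr (real DIM('a) + s)) \<partial>lborel) \<le> ennreal (K * a powr - s)"
    using nn_integral_truncated_kernel[OF s] by blast
  define k where "k = (\<lambda>x y. min 1 (norm (x - y) / (d x / 4)) / norm (x - y) powr (real DIM('a) + s))"
  have [measurable]: "case_prod k \<in> borel_measurable (borel \<Otimes>\<^sub>M borel)"
    unfolding k_def case_prod_beta' by measurable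
  define G where "G = (\<lambda>x y. ennreal (dq s u x y) + ennreal \<bar>u x\<bar> * ennreal (k x y))"
  have [measurable]: "case_prod G \<in> borel_measurable (borel \<Otimes>\<^sub>M borel)"
    unfolding G_def case_prod_beta' by measurable
  have Gfin: "(\<integral>\<^sup>+x. \<integral>\<^sup>+y. G x y \<partial>lborel \<partial>lborel) < \<infinity>"
  proof -
    have "(\<integral>\<^sup>+x. \<integral>\<^sup>+y. G x y \<partial>lborel \<partial>lborel) = frac_energy s 1 UNIV u + (\<integral>\<^sup>+x. ennreal \<bar>u x\<bar> * (\<integral>\<^sup>+y. ennreal (k x y) \<partial>lborel) \<partial>lborel)"
      unfolding G_def by (simp add: nn_integral_add nn_integral_cmult frac_energy_UNIV)
    also have "\<dots> \<le> frac_energy s 1 UNIV u + (\<integral>\<^sup>+x. ennreal (K * 4 powr s) * ennreal (\<bar>u x\<bar> * infdist x (- \<Omega>) powr - s) \<partial>lborel)"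
    proof (intro add_left_mono nn_integral_mono)
      fix x
      show "ennreal \<bar>u x\<bar> * (\<integral>\<^sup>+y. ennreal (k x y) \<partial>lborel) \<le> ennreal (K * 4 powr s) * ennreal (\<bar>u x\<bar> * infdist x (- \<Omega>) powr - s)"
      proof (cases "x \<in> \<Omega>")
        case True
        have "ennreal \<bar>u x\<bar> * (\<integral>\<^sup>+y. ennreal (k x y) \<partial>lborel) \<le> ennreal \<bar>u x\<bar> * ennreal (K * (d x / 4) powr - s)"
          unfolding k_def using d[OF True] by (intro mult_left_mono K) auto
        also have "(d x / 4) powr - s = 4 powr s * d x powr - s"
          using d[OF True] by (simp add: powr_divide powr_minus field_simps)
        finally show ?thesis using K(1) by (simp add: ennreal_mult'[symmetric] d_def mult_ac)
      qed (simp add: off)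
    qed
    also have "\<dots> < \<infinity>" using E H by (simp add: nn_integral_cmult ennreal_mult_less_top)
    finally show ?thesis .
  qed
  have dom: "ennreal (dq s (\<lambda>x. v m x - u x) x y) \<le> G x y" for m x y
  proof -
    have w: "v m z - u z = - ((1 - \<psi> m z) * u z)" for z by (simp add: v algebra_simps)
    \<comment> \<open>The product rule is split so that the difference of cutoffs is multiplied by
      \<open>u x\<close>; the majorant then involves the distance at \<open>x\<close> only and can
      be integrated over \<open>y\<close> first.\<close>
    have "\<bar>(v m x - u x) - (v m y - u y)\<bar> = \<bar>(1 - \<psi> m y) * (u x - u y) + u x * (\<psi> m y - \<psi> m x)\<bar>"
      unfolding w by (simp add: algebra_simps abs_minus_commute)
    also have "\<dots> \<le> \<bar>(1 - \<psi> m y) * (u x - u y)\<bar> + \<bar>u x * (\<psi> m y - \<psi> m x)\<bar>" by (rule abs_triangle_ineq)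
    also have "\<dots> \<le> \<bar>u x - u y\<bar> + \<bar>u x\<bar> * min 1 (norm (x - y) / (d x / 4))"
    proof (rule add_mono)
      show "\<bar>(1 - \<psi> m y) * (u x - u y)\<bar> \<le> \<bar>u x - u y\<bar>"
        using \<psi>01[of m y] by (simp add: abs_mult mult_left_le_one_le)
      show "\<bar>u x * (\<psi> m y - \<psi> m x)\<bar> \<le> \<bar>u x\<bar> * min 1 (norm (x - y) / (d x / 4))"
      proof (cases "x \<in> \<Omega>")
        case True
        have "\<bar>d y - d x\<bar> \<le> norm (x - y)"
          using infdist_triangle_abs[of x "- \<Omega>" y] by (simp add: d_def dist_norm abs_minus_commute)
        then have "\<bar>\<psi> m y - \<psi> m x\<bar> \<le> min 1 (norm (x - y) / (d x / 4))"
          unfolding \<psi>_def using d[OF True] by (intro cutoff_lipschitz) auto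
        then show ?thesis by (simp add: abs_mult mult_left_mono)
      qed (simp add: off)
    qed
    finally have "dq s (\<lambda>x. v m x - u x) x y \<le> dq s u x y + \<bar>u x\<bar> * k x y"
      unfolding dq_def k_def by (simp add: divide_right_mono add_divide_distrib[symmetric])
    moreover have "0 \<le> k x y" using infdist_nonneg[of x "- \<Omega>"] by (simp add: k_def d_def)
    ultimately show ?thesis unfolding G_def by (simp add: ennreal_leI flip: ennreal_mult' ennreal_plus)
  qed
  have "(\<lambda>m. \<integral>\<^sup>+z. ennreal (dq s (\<lambda>x. v m x - u x) (fst z) (snd z)) \<partial>lborel) \<longlonglongrightarrow> (\<integral>\<^sup>+z. 0 \<partial>(lborel :: ('a \<times> 'a) measure))"
  proof (rule nn_integral_dominated_convergence[where w="\<lambda>z. G (fst z) (snd z)"])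
    show "AE z in lborel. ennreal (dq s (\<lambda>x. v m x - u x) (fst z) (snd z)) \<le> G (fst z) (snd z)" for m
      using dom by simp
    have "(\<integral>\<^sup>+z. G (fst z) (snd z) \<partial>lborel) = (\<integral>\<^sup>+x. \<integral>\<^sup>+y. G x y \<partial>lborel \<partial>lborel)"
      by (rule nn_integral_lborel_pair) measurable
    then show "(\<integral>\<^sup>+z. G (fst z) (snd z) \<partial>lborel) < \<infinity>" using Gfin by simp
    show "AE z in lborel. (\<lambda>m. ennreal (dq s (\<lambda>x. v m x - u x) (fst z) (snd z))) \<longlonglongrightarrow> 0"
    proof (intro AE_I2 tendsto_eventually)
      fix z :: "'a \<times> 'a"
      show "eventually (\<lambda>m. ennreal (dq s (\<lambda>x. v m x - u x) (fst z) (snd z)) = 0) sequentially"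
        using ev[of "fst z"] ev[of "snd z"] by eventually_elim (simp add: dq_def)
    qed
  qed measurable
  then show "(\<lambda>k. frac_energy s 1 UNIV (\<lambda>x. v k x - u x)) \<longlonglongrightarrow> 0"
    by (subst frac_energy_pair) auto
qed

section \<open>Test functions\<close>

lemma test_functions_eq_0: "\<phi> \<in> test_functions \<Omega> \<Longrightarrow> x \<notin> \<Omega> \<Longrightarrow> \<phi> x = 0"
  using closure_subset[of "{x. \<phi> x \<noteq> 0}"] by (auto simp: test_functions_def)

lemma test_functions_smooth_compact:
  assumes "\<phi> \<in> test_functions \<Omega>"
  shows "smooth_compact \<phi>"
proof -
  have "bounded {x. \<phi> x \<noteq> 0}"
    using assms bounded_subset[OF compact_imp_bounded closure_subset] by (auto simp: test_functions_def)
  then obtain R where R: "\<forall>x\<in>{x. \<phi> x \<noteq> 0}. norm x \<le> R" unfolding bounded_iff by blast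
  have "\<phi> x = 0" if "R < norm x" for x
    using R that by (meson leD mem_Collect_eq)
  then show ?thesis using assms unfolding smooth_compact_def test_functions_def by blast
qed

lemma test_functions_measurable: "\<phi> \<in> test_functions \<Omega> \<Longrightarrow> \<phi> \<in> borel_measurable borel"
  by (intro smooth_compact_measurable test_functions_smooth_compact)

lemma test_functions_add_cmult:
  assumes "\<phi> \<in> test_functions \<Omega>" "\<psi> \<in> test_functions \<Omega>"
  shows "(\<lambda>x. \<phi> x + t * \<psi> x) \<in> test_functions \<Omega>"
proof (rule test_functionsI)
  show "times_differentiable k (\<lambda>x. \<phi> x + t * \<psi> x)" for k
    using assms by (intro times_differentiable_add times_differentiable_cmult) (auto simp: test_functions_def)
  show "compact (closure {x. \<phi> x \<noteq> 0} \<union> closure {x. \<psi> x \<noteq> 0})"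
    using assms by (auto simp: test_functions_def)
  show "closure {x. \<phi> x \<noteq> 0} \<union> closure {x. \<psi> x \<noteq> 0} \<subseteq> \<Omega>"
    using assms by (auto simp: test_functions_def)
  show "x \<in> closure {x. \<phi> x \<noteq> 0} \<union> closure {x. \<psi> x \<noteq> 0}" if "\<phi> x + t * \<psi> x \<noteq> 0" for x
    using that closure_subset[of "{x. \<phi> x \<noteq> 0}"] closure_subset[of "{x. \<psi> x \<noteq> 0}"] by (cases "\<phi> x = 0") auto
qed

lemma zero_in_test_functions: "(\<lambda>x. 0) \<in> test_functions \<Omega>"
  by (rule test_functionsI[where C="{}"]) (auto intro: times_differentiable_const)

lemma smooth_compact_integrable_powr:
  fixes \<phi> :: "'a::euclidean_space \<Rightarrow> real"
  assumes \<phi>: "smooth_compact \<phi>" and p: "0 < p"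
  shows "(\<integral>\<^sup>+x. ennreal (\<bar>\<phi> x\<bar> powr p) \<partial>lborel) < \<infinity>"
proof -
  obtain M where M: "0 \<le> M" "\<And>x. \<bar>\<phi> x\<bar> \<le> M" using smooth_compact_bounded[OF \<phi>] by blast
  obtain R where R: "\<And>x. R < norm x \<Longrightarrow> \<phi> x = 0" using \<phi> by (auto simp: smooth_compact_def)
  have "(\<integral>\<^sup>+x. ennreal (\<bar>\<phi> x\<bar> powr p) \<partial>lborel) \<le> (\<integral>\<^sup>+x. ennreal (M powr p) * indicator (cball (0::'a) R) x \<partial>lborel)"
  proof (intro nn_integral_mono)
    fix x
    show "ennreal (\<bar>\<phi> x\<bar> powr p) \<le> ennreal (M powr p) * indicator (cball 0 R) x"
      using M(2)[of x] R[of x] p by (cases "norm x \<le> R") (auto intro!: ennreal_leI powr_mono2)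
  qed
  also have "\<dots> = ennreal (M powr p) * emeasure lborel (cball (0::'a) R)"
    by (rule nn_integral_cmult_indicator) simp
  also have "\<dots> < \<infinity>" using emeasure_lborel_cball_finite[of "0::'a" R] by (simp add: ennreal_mult_less_top)
  finally show ?thesis .
qed

text \<open>Near the diagonal the Lipschitz bound leaves the exponent
  \<open>p - (n + s) * p\<close>, and \<open>(n + s - 1) * p < n\<close> makes it integrable. Far
  away boundedness suffices because \<open>(n + s) * p > n\<close>. Pairs with both points off the
  support contribute nothing.\<close>

lemma smooth_compact_energy_finite:
  fixes \<phi> :: "'a::euclidean_space \<Rightarrow> real"
  assumes \<phi>: "smooth_compact \<phi>" and s: "0 < s" "s < 1"
    and p: "1 \<le> p" "(real DIM('a) + s - 1) * p < real DIM('a)"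
  shows "frac_energy s p UNIV \<phi> < \<infinity>"
proof -
  define n where "n = real DIM('a)"
  have n: "1 \<le> n" unfolding n_def using DIM_positive[where 'a='a] by linarith
  have [measurable]: "\<phi> \<in> borel_measurable borel" by (rule smooth_compact_measurable[OF \<phi>])
  obtain M where M: "0 \<le> M" "\<And>x. \<bar>\<phi> x\<bar> \<le> M" using smooth_compact_bounded[OF \<phi>] by blast
  obtain L where L: "0 \<le> L" "\<And>x y. \<bar>\<phi> x - \<phi> y\<bar> \<le> L * norm (x - y)" using smooth_compact_lipschitz[OF \<phi>] by blast
  obtain R where R: "\<And>x. R < norm x \<Longrightarrow> \<phi> x = 0" using \<phi> by (auto simp: smooth_compact_def)
  define a where "a = n - (n + s - 1) * p"
  have "0 \<le> (n + s - 1) * p" using p n s by (intro mult_nonneg_nonneg) auto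
  then have a: "0 < a" "a \<le> n" using p(2) unfolding a_def n_def[symmetric] by linarith+
  define b where "b = (n + s) * p - n"
  have b: "0 < b"
  proof -
    have "(n + s) * 1 \<le> (n + s) * p" using n s p by (intro mult_left_mono) auto
    then show ?thesis using s by (simp add: b_def)
  qed
  define \<kappa> where "\<kappa> = (\<lambda>x y::'a. ennreal (L powr p) * (ennreal (norm (x - y) powr - (n - a)) * indicator {y. norm (x - y) < 1} y)
     + ennreal ((2 * M) powr p) * (ennreal (norm (x - y) powr - (n + b)) * indicator {y. 1 \<le> norm (x - y)} y))"
  have \<kappa>c: "\<kappa> x y = \<kappa> y x" for x y by (simp add: \<kappa>_def norm_minus_commute indicator_def)
  have \<kappa>if: "\<kappa> x y = ennreal (if norm (x - y) < 1 then L powr p * norm (x - y) powr - (n - a) else (2 * M) powr p * norm (x - y) powr - (n + b))" for x y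
    by (auto simp: \<kappa>_def indicator_def ennreal_mult')
  have [measurable]: "case_prod \<kappa> \<in> borel_measurable (borel \<Otimes>\<^sub>M borel)"
    unfolding \<kappa>if case_prod_beta' by measurable
  define C where "C = ennreal (L powr p) * ennreal (unit_ball_vol n * 2 ^ DIM('a) / (1 - 2 powr - a) * 1 powr a)
     + ennreal ((2 * M) powr p) * ennreal (unit_ball_vol n * 2 ^ DIM('a) / (1 - 2 powr - b) * 1 powr - b)"
  have Cfin: "C < \<infinity>" by (simp add: C_def ennreal_mult_less_top)
  have \<kappa>C: "(\<integral>\<^sup>+y. \<kappa> x y \<partial>lborel) \<le> C" for x
  proof -
    have [measurable]: "{y. norm (x - y) < 1} \<in> sets lborel" "{y. 1 \<le> norm (x - y)} \<in> sets lborel" by simp_all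
    have "(\<integral>\<^sup>+y. \<kappa> x y \<partial>lborel) = ennreal (L powr p) * (\<integral>\<^sup>+y. ennreal (norm (x - y) powr - (n - a)) * indicator {y. norm (x - y) < 1} y \<partial>lborel)
      + ennreal ((2 * M) powr p) * (\<integral>\<^sup>+y. ennreal (norm (x - y) powr - (n + b)) * indicator {y. 1 \<le> norm (x - y)} y \<partial>lborel)"
      unfolding \<kappa>_def by (simp add: nn_integral_add nn_integral_cmult)
    also have "\<dots> \<le> C"
      unfolding C_def n_def using a b
      by (intro add_mono mult_left_mono nn_integral_near_powr nn_integral_tail_powr) (auto simp: n_def)
    finally show ?thesis .
  qed
  let ?A = "cball (0::'a) R"
  have pt: "ennreal (dq s \<phi> x y powr p) \<le> indicator ?A x * \<kappa> x y + indicator ?A y * \<kappa> x y" for x y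
  proof (cases "x \<in> ?A \<or> y \<in> ?A")
    case True
    have e: "dq s \<phi> x y powr p = \<bar>\<phi> x - \<phi> y\<bar> powr p * norm (x - y) powr - ((n + s) * p)"
      by (simp add: dq_def n_def[symmetric] powr_divide powr_powr powr_minus_divide[of _ "(n + s) * p"] del: minus_mult_left)
    have "ennreal (dq s \<phi> x y powr p) \<le> \<kappa> x y"
    proof (cases "norm (x - y) < 1")
      case True
      have "\<bar>\<phi> x - \<phi> y\<bar> powr p \<le> (L * norm (x - y)) powr p"
        using p by (intro powr_mono2 L) auto
      then have "dq s \<phi> x y powr p \<le> (L * norm (x - y)) powr p * norm (x - y) powr - ((n + s) * p)"
        unfolding e by (rule mult_right_mono) simp
      also have "\<dots> = L powr p * (norm (x - y) powr p * norm (x - y) powr - ((n + s) * p))"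
        using L by (simp add: powr_mult)
      also have "norm (x - y) powr p * norm (x - y) powr - ((n + s) * p) = norm (x - y) powr (p + - ((n + s) * p))"
        by (rule powr_add[symmetric])
      also have "p + - ((n + s) * p) = - (n - a)" by (simp add: a_def algebra_simps)
      finally show ?thesis unfolding \<kappa>if using True by (simp add: ennreal_leI)
    next
      case False
      have "\<bar>\<phi> x - \<phi> y\<bar> \<le> 2 * M" using M(2)[of x] M(2)[of y] by linarith
      then have "\<bar>\<phi> x - \<phi> y\<bar> powr p \<le> (2 * M) powr p" using p by (intro powr_mono2) auto
      then have "dq s \<phi> x y powr p \<le> (2 * M) powr p * norm (x - y) powr - ((n + s) * p)"
        unfolding e by (rule mult_right_mono) simp
      also have "(n + s) * p = n + b" by (simp add: b_def)
      finally show ?thesis unfolding \<kappa>if using False by (simp add: ennreal_leI)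
    qed
    then show ?thesis using True by (auto simp: indicator_def add_increasing add_increasing2)
  next
    case False
    then have "\<phi> x = 0" "\<phi> y = 0" using R by auto
    then show ?thesis using p by (simp add: dq_def)
  qed
  have Am [measurable]: "?A \<in> sets borel" by simp
  have half: "(\<integral>\<^sup>+x. \<integral>\<^sup>+y. indicator ?A x * \<kappa> x y \<partial>lborel \<partial>lborel) \<le> C * emeasure lborel ?A"
  proof -
    have "(\<integral>\<^sup>+x. \<integral>\<^sup>+y. indicator ?A x * \<kappa> x y \<partial>lborel \<partial>lborel) = (\<integral>\<^sup>+x. indicator ?A x * (\<integral>\<^sup>+y. \<kappa> x y \<partial>lborel) \<partial>lborel)"
      by (simp add: nn_integral_cmult)
    also have "\<dots> \<le> (\<integral>\<^sup>+x. C * indicator ?A x \<partial>lborel)"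
      by (intro nn_integral_mono) (auto simp: indicator_def \<kappa>C)
    also have "\<dots> = C * emeasure lborel ?A" by (rule nn_integral_cmult_indicator) simp
    finally show ?thesis .
  qed
  have half': "(\<integral>\<^sup>+x. \<integral>\<^sup>+y. indicator ?A y * \<kappa> x y \<partial>lborel \<partial>lborel) \<le> C * emeasure lborel ?A"
  proof -
    have "(\<integral>\<^sup>+x. \<integral>\<^sup>+y. indicator ?A y * \<kappa> x y \<partial>lborel \<partial>lborel) = (\<integral>\<^sup>+y. \<integral>\<^sup>+x. indicator ?A y * \<kappa> x y \<partial>lborel \<partial>lborel)"
      by (rule nn_integral_lborel_commute) measurable
    also have "\<dots> = (\<integral>\<^sup>+x. \<integral>\<^sup>+y. indicator ?A x * \<kappa> x y \<partial>lborel \<partial>lborel)" using \<kappa>c by simp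
    finally show ?thesis using half by simp
  qed
  have "frac_energy s p UNIV \<phi> \<le> (\<integral>\<^sup>+x. \<integral>\<^sup>+y. indicator ?A x * \<kappa> x y + indicator ?A y * \<kappa> x y \<partial>lborel \<partial>lborel)"
    unfolding frac_energy_UNIV by (intro nn_integral_mono pt)
  also have "\<dots> = (\<integral>\<^sup>+x. \<integral>\<^sup>+y. indicator ?A x * \<kappa> x y \<partial>lborel \<partial>lborel) + (\<integral>\<^sup>+x. \<integral>\<^sup>+y. indicator ?A y * \<kappa> x y \<partial>lborel \<partial>lborel)"
    by (simp add: nn_integral_add)
  also have "\<dots> \<le> C * emeasure lborel ?A + C * emeasure lborel ?A"
    by (intro add_mono half half')
  also have "\<dots> < \<infinity>" using Cfin emeasure_lborel_cball_finite[of "0::'a" R] by (simp add: ennreal_mult_less_top)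
  finally show ?thesis .
qed

text \<open>For exponents between 1 and \<open>p1\<close> the power \<open>d powr p\<close> lies
  below \<open>d powr 1 + d powr p1\<close>, and both summands are integrable by
  \<open>smooth_compact_energy_finite\<close>.\<close>

lemma smooth_compact_energy_tendsto:
  fixes \<phi> :: "'a::euclidean_space \<Rightarrow> real"
  assumes \<phi>: "smooth_compact \<phi>" and s: "0 < s" "s < 1"
    and p1: "1 \<le> p1" "(real DIM('a) + s - 1) * p1 < real DIM('a)"
    and P: "\<And>k. 1 \<le> P k" "\<And>k. P k \<le> p1" "P \<longlonglongrightarrow> 1"
  shows "(\<lambda>k. frac_energy s (P k) UNIV \<phi>) \<longlonglongrightarrow> frac_energy s 1 UNIV \<phi>"
proof -
  have m [measurable]: "\<phi> \<in> borel_measurable borel" by (rule smooth_compact_measurable[OF \<phi>])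
  show ?thesis unfolding frac_energy_pair[OF m]
  proof (rule nn_integral_dominated_convergence[where w="\<lambda>z. ennreal (dq s \<phi> (fst z) (snd z) powr 1) + ennreal (dq s \<phi> (fst z) (snd z) powr p1)"])
    have p1': "(real DIM('a) + s - 1) * 1 < real DIM('a)" using s by simp
    show "(\<integral>\<^sup>+z. ennreal (dq s \<phi> (fst z) (snd z) powr 1) + ennreal (dq s \<phi> (fst z) (snd z) powr p1) \<partial>lborel) < \<infinity>"
      using smooth_compact_energy_finite[OF \<phi> s p1] smooth_compact_energy_finite[OF \<phi> s _ p1']
      by (subst nn_integral_add) (auto simp: frac_energy_pair[OF m])
    show "AE z in lborel. ennreal (dq s \<phi> (fst z) (snd z) powr P k) \<le> ennreal (dq s \<phi> (fst z) (snd z) powr 1) + ennreal (dq s \<phi> (fst z) (snd z) powr p1)" for k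
    proof (intro AE_I2)
      fix z :: "'a \<times> 'a"
      define d where "d = dq s \<phi> (fst z) (snd z)"
      have "d powr P k \<le> d powr 1 + d powr p1"
      proof (cases "d \<le> 1")
        case True
        then have "d powr P k \<le> d powr 1" using P(1)[of k] by (intro powr_mono') (auto simp: d_def)
        then show ?thesis by (simp add: add_increasing2)
      next
        case False
        then have "d powr P k \<le> d powr p1" using P(2)[of k] by (intro powr_mono) auto
        then show ?thesis by (simp add: add_increasing)
      qed
      then show "ennreal (dq s \<phi> (fst z) (snd z) powr P k) \<le> ennreal (dq s \<phi> (fst z) (snd z) powr 1) + ennreal (dq s \<phi> (fst z) (snd z) powr p1)"
        by (simp add: d_def ennreal_leI flip: ennreal_plus)
    qed
    show "AE z in lborel. (\<lambda>k. ennreal (dq s \<phi> (fst z) (snd z) powr P k)) \<longlonglongrightarrow> ennreal (dq s \<phi> (fst z) (snd z) powr 1)"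
    proof (intro AE_I2 tendsto_ennrealI)
      fix z :: "'a \<times> 'a"
      show "(\<lambda>k. dq s \<phi> (fst z) (snd z) powr P k) \<longlonglongrightarrow> dq s \<phi> (fst z) (snd z) powr 1"
        by (cases "dq s \<phi> (fst z) (snd z) = 0") (simp, rule tendsto_powr[OF tendsto_const P(3)])
    qed
  qed measurable
qed

section \<open>Density of test functions\<close>

text \<open>The Hardy inequality makes the cutoffs converge in energy; each cutoff vanishes near the
  boundary and can be mollified. Each of the two steps costs \<open>e\<close>, whence
  \<open>2 * e\<close>.\<close>

theorem test_functions_dense:
  fixes u :: "'a::euclidean_space \<Rightarrow> real"
  assumes s: "0 < s" "s < 1" and \<Omega>: "open \<Omega>" "bounded \<Omega>" "lipschitz_boundary \<Omega>"
    and u [measurable]: "u \<in> borel_measurable borel" and off: "\<And>x. x \<notin> \<Omega> \<Longrightarrow> u x = 0"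
    and L1: "(\<integral>\<^sup>+x. ennreal \<bar>u x\<bar> \<partial>lborel) < \<infinity>" and E: "frac_energy s 1 UNIV u < \<infinity>"
  obtains \<phi> where "\<And>k::nat. \<phi> k \<in> test_functions \<Omega>" "(\<lambda>k. \<integral>\<^sup>+x. ennreal \<bar>\<phi> k x - u x\<bar> \<partial>lborel) \<longlonglongrightarrow> 0"
    "(\<lambda>k. frac_energy s 1 UNIV (\<lambda>x. \<phi> k x - u x)) \<longlonglongrightarrow> 0"
proof -
  have ex: "\<exists>\<phi>\<in>test_functions \<Omega>. (\<integral>\<^sup>+x. ennreal \<bar>\<phi> x - u x\<bar> \<partial>lborel) \<le> ennreal (2 * e) \<and> frac_energy s 1 UNIV (\<lambda>x. \<phi> x - u x) \<le> ennreal (2 * e)"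
    if e: "0 < e" for e
  proof -
    obtain H where H: "0 \<le> H"
      "\<And>w. w \<in> borel_measurable borel \<Longrightarrow> (\<And>x. x \<notin> \<Omega> \<Longrightarrow> w x = 0) \<Longrightarrow> (\<integral>\<^sup>+x. ennreal \<bar>w x\<bar> \<partial>lborel) < \<infinity> \<Longrightarrow>
        (\<integral>\<^sup>+x. ennreal (\<bar>w x\<bar> * infdist x (- \<Omega>) powr - s) \<partial>lborel)
          \<le> ennreal H * (frac_energy s 1 \<Omega> w + (\<integral>\<^sup>+x. ennreal \<bar>w x\<bar> \<partial>lborel))"
      using hardy_lipschitz_domain[OF s \<Omega>] by blast
    have "frac_energy s 1 \<Omega> u < \<infinity>"
      using E frac_energy_mono_set[of \<Omega> UNIV s 1 u] by (simp add: order_le_less_trans)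
    then have "ennreal H * (frac_energy s 1 \<Omega> u + (\<integral>\<^sup>+x. ennreal \<bar>u x\<bar> \<partial>lborel)) < \<infinity>"
      using L1 by (simp add: ennreal_mult_less_top)
    with H(2)[OF u off L1] have Hu: "(\<integral>\<^sup>+x. ennreal (\<bar>u x\<bar> * infdist x (- \<Omega>) powr - s) \<partial>lborel) < \<infinity>"
      by (rule order_le_less_trans)
    define v where "v = (\<lambda>(k::nat) x. max 0 (min 1 (real (Suc k) * infdist x (- \<Omega>) - 1)) * u x)"
    have cut: "(\<lambda>k. \<integral>\<^sup>+x. ennreal \<bar>v k x - u x\<bar> \<partial>lborel) \<longlonglongrightarrow> 0" "(\<lambda>k. frac_energy s 1 UNIV (\<lambda>x. v k x - u x)) \<longlonglongrightarrow> 0"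
      unfolding v_def by (rule cutoff[OF \<Omega>(1,2) s u off L1 E Hu], assumption)+
    have "eventually (\<lambda>k. (\<integral>\<^sup>+x. ennreal \<bar>v k x - u x\<bar> \<partial>lborel) < ennreal e) sequentially"
      "eventually (\<lambda>k. frac_energy s 1 UNIV (\<lambda>x. v k x - u x) < ennreal e) sequentially"
      using e by (auto intro: order_tendstoD(2)[OF cut(1)] order_tendstoD(2)[OF cut(2)])
    then have "eventually (\<lambda>k. (\<integral>\<^sup>+x. ennreal \<bar>v k x - u x\<bar> \<partial>lborel) < ennreal e \<and> frac_energy s 1 UNIV (\<lambda>x. v k x - u x) < ennreal e) sequentially"
      by (rule eventually_conj)
    then obtain k where k: "(\<integral>\<^sup>+x. ennreal \<bar>v k x - u x\<bar> \<partial>lborel) < ennreal e" "frac_energy s 1 UNIV (\<lambda>x. v k x - u x) < ennreal e"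
      using eventually_happens'[OF sequentially_bot] by blast
    have [measurable]: "v k \<in> borel_measurable borel" unfolding v_def by measurable
    have vL1: "(\<integral>\<^sup>+x. ennreal \<bar>v k x\<bar> \<partial>lborel) < \<infinity>"
      using L1 by (rule order_le_less_trans[rotated])
         (auto simp: v_def abs_mult intro!: nn_integral_mono ennreal_leI mult_left_le_one_le)
    have "frac_energy s 1 UNIV (v k) \<le> frac_energy s 1 UNIV (\<lambda>x. v k x - u x) + frac_energy s 1 UNIV u"
      using frac_energy_triangle[of "\<lambda>x. v k x - u x" u UNIV s] by simp
    also have "\<dots> < \<infinity>" using k(2) E by (auto intro: less_trans)
    finally have vE: "frac_energy s 1 UNIV (v k) < \<infinity>" .
    have voff: "v k x = 0" if "infdist x (- \<Omega>) < 1 / real (Suc k)" for x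
    proof -
      have "real (Suc k) * infdist x (- \<Omega>) < 1" using that by (simp add: pos_less_divide_eq mult.commute)
      then show ?thesis by (simp add: v_def)
    qed
    obtain \<phi> where \<phi>: "\<And>k::nat. \<phi> k \<in> test_functions \<Omega>" "(\<lambda>j. \<integral>\<^sup>+x. ennreal \<bar>\<phi> j x - v k x\<bar> \<partial>lborel) \<longlonglongrightarrow> 0"
      "(\<lambda>j. frac_energy s 1 UNIV (\<lambda>x. \<phi> j x - v k x)) \<longlonglongrightarrow> 0"
    proof (rule mollify[OF \<Omega>(2), of "1 / real (Suc k)" s "v k"], goal_cases)
      case (7 \<psi>) then show ?case using that by blast
    qed (use s vL1 vE voff in auto)
    have "eventually (\<lambda>j. (\<integral>\<^sup>+x. ennreal \<bar>\<phi> j x - v k x\<bar> \<partial>lborel) < ennreal e) sequentially"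
      "eventually (\<lambda>j. frac_energy s 1 UNIV (\<lambda>x. \<phi> j x - v k x) < ennreal e) sequentially"
      using e by (auto intro: order_tendstoD(2)[OF \<phi>(2)] order_tendstoD(2)[OF \<phi>(3)])
    then have "eventually (\<lambda>j. (\<integral>\<^sup>+x. ennreal \<bar>\<phi> j x - v k x\<bar> \<partial>lborel) < ennreal e \<and> frac_energy s 1 UNIV (\<lambda>x. \<phi> j x - v k x) < ennreal e) sequentially"
      by (rule eventually_conj)
    then obtain j where j: "(\<integral>\<^sup>+x. ennreal \<bar>\<phi> j x - v k x\<bar> \<partial>lborel) < ennreal e" "frac_energy s 1 UNIV (\<lambda>x. \<phi> j x - v k x) < ennreal e"
      using eventually_happens'[OF sequentially_bot] by blast
    have [measurable]: "\<phi> j \<in> borel_measurable borel" by (rule test_functions_measurable[OF \<phi>(1)])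
    have e2: "ennreal e + ennreal e = ennreal (2 * e)" using e by (simp flip: ennreal_plus)
    have "(\<integral>\<^sup>+x. ennreal \<bar>\<phi> j x - u x\<bar> \<partial>lborel) \<le> (\<integral>\<^sup>+x. ennreal \<bar>\<phi> j x - v k x\<bar> + ennreal \<bar>v k x - u x\<bar> \<partial>lborel)"
      by (intro nn_integral_mono) (auto simp: ennreal_leI simp flip: ennreal_plus)
    also have "\<dots> = (\<integral>\<^sup>+x. ennreal \<bar>\<phi> j x - v k x\<bar> \<partial>lborel) + (\<integral>\<^sup>+x. ennreal \<bar>v k x - u x\<bar> \<partial>lborel)"
      by (rule nn_integral_add) measurable
    also have "\<dots> \<le> ennreal (2 * e)" unfolding e2[symmetric] using j k by (intro add_mono) auto
    finally have 1: "(\<integral>\<^sup>+x. ennreal \<bar>\<phi> j x - u x\<bar> \<partial>lborel) \<le> ennreal (2 * e)" .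
    have "frac_energy s 1 UNIV (\<lambda>x. \<phi> j x - u x) \<le> frac_energy s 1 UNIV (\<lambda>x. \<phi> j x - v k x) + frac_energy s 1 UNIV (\<lambda>x. v k x - u x)"
      using frac_energy_triangle[of "\<lambda>x. \<phi> j x - v k x" "\<lambda>x. v k x - u x" UNIV s] by simp
    also have "\<dots> \<le> ennreal (2 * e)" unfolding e2[symmetric] using j k by (intro add_mono) auto
    finally show ?thesis using 1 \<phi>(1) by blast
  qed
  have "\<exists>\<phi>\<in>test_functions \<Omega>. (\<integral>\<^sup>+x. ennreal \<bar>\<phi> x - u x\<bar> \<partial>lborel) \<le> ennreal (2 * (1 / real (Suc k))) \<and> frac_energy s 1 UNIV (\<lambda>x. \<phi> x - u x) \<le> ennreal (2 * (1 / real (Suc k)))" for k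
    by (rule ex) simp
  then obtain \<phi> where \<phi>: "\<And>k. \<phi> k \<in> test_functions \<Omega>" "\<And>k. (\<integral>\<^sup>+x. ennreal \<bar>\<phi> k x - u x\<bar> \<partial>lborel) \<le> ennreal (2 * (1 / real (Suc k)))"
    "\<And>k. frac_energy s 1 UNIV (\<lambda>x. \<phi> k x - u x) \<le> ennreal (2 * (1 / real (Suc k)))" by metis
  have "(\<lambda>k. 2 * (1 / real (Suc k))) \<longlonglongrightarrow> 2 * 0"
    by (intro tendsto_mult tendsto_const LIMSEQ_Suc[OF lim_1_over_n])
  then have "(\<lambda>k. ennreal (2 * (1 / real (Suc k)))) \<longlonglongrightarrow> ennreal (2 * 0)" by (rule tendsto_ennrealI)
  then have lim: "(\<lambda>k. ennreal (2 * (1 / real (Suc k)))) \<longlonglongrightarrow> 0" by simp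
  show thesis
    by (rule that[OF \<phi>(1) tendsto_0_le_ennreal[OF \<phi>(2) lim] tendsto_0_le_ennreal[OF \<phi>(3) lim]])
qed

section \<open>The spaces \<open>\<W>\<^sub>0\<close>\<close>

lemma sobolev_norm_eq:
  fixes u v :: "'a::euclidean_space \<Rightarrow> real"
  assumes "0 < p" "A \<in> sets borel" "v \<in> borel_measurable borel" "AE x in lborel. u x = v x"
  shows "sobolev_norm (shifted_order DIM('a) s p) p A u
    = ennpowr ((\<integral>\<^sup>+x. ennreal (\<bar>v x\<bar> powr p) * indicator A x \<partial>lborel) + frac_energy s p A v) (1 / p)"
proof -
  have "AE x in lborel. x \<in> A \<longrightarrow> u x = v x" using assms(4) by eventually_elim simp
  then have "ennpowr (Lp_norm (lebesgue_on A) p u) p = (\<integral>\<^sup>+x. ennreal (\<bar>v x\<bar> powr p) * indicator A x \<partial>lborel)"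
    using assms(1,2) by (simp add: Lp_norm_lebesgue_on ennpowr_ennpowr)
  moreover have "ennpowr (gagliardo_seminorm (shifted_order DIM('a) s p) p A u) p = frac_energy s p A v"
    using assms(1) by (simp add: gagliardo_seminorm_def ennpowr_ennpowr gagliardo_integral_eq[OF assms(2,3,4,1)])
  ultimately show ?thesis by (simp add: sobolev_norm_def)
qed

lemma powr_add_cmult_le:
  fixes a b t :: real
  assumes "0 < p"
  shows "\<bar>a + t * b\<bar> powr p \<le> 2 powr p * (\<bar>a\<bar> powr p + \<bar>t\<bar> powr p * \<bar>b\<bar> powr p)"
proof -
  define m where "m = max \<bar>a\<bar> \<bar>t * b\<bar>"
  have "\<bar>a + t * b\<bar> \<le> 2 * m" by (auto simp: m_def)
  then have "\<bar>a + t * b\<bar> powr p \<le> (2 * m) powr p" using assms by (intro powr_mono2) auto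
  also have "\<dots> = 2 powr p * m powr p" by (simp add: powr_mult m_def)
  also have "m powr p \<le> \<bar>a\<bar> powr p + \<bar>t * b\<bar> powr p"
    by (auto simp: m_def max_def)
  finally show ?thesis by (simp add: abs_mult powr_mult)
qed

text \<open>The crude bound \<open>powr_add_cmult_le\<close> with factor \<open>2 powr p\<close>
  replaces Minkowski's inequality; it is enough for quantities that tend to 0.\<close>

lemma sobolev_space0_add_cmult:
  fixes u w :: "'a::euclidean_space \<Rightarrow> real"
  assumes \<Omega>: "open \<Omega>" and p: "0 < p"
    and u: "u \<in> sobolev_space0 (shifted_order DIM('a) s p) p \<Omega>" and w: "w \<in> sobolev_space0 (shifted_order DIM('a) s p) p \<Omega>"
  shows "(\<lambda>x. u x + t * w x) \<in> sobolev_space0 (shifted_order DIM('a) s p) p \<Omega>"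
proof -
  let ?r = "shifted_order DIM('a) s p"
  have \<Omega>m [measurable]: "\<Omega> \<in> sets borel" using \<Omega> by simp
  have um: "u \<in> borel_measurable lebesgue" "\<And>x. x \<notin> \<Omega> \<Longrightarrow> u x = 0" using u by (auto simp: sobolev_space0_def)
  have wm: "w \<in> borel_measurable lebesgue" "\<And>x. x \<notin> \<Omega> \<Longrightarrow> w x = 0" using w by (auto simp: sobolev_space0_def)
  obtain u' where u': "u' \<in> borel_measurable borel" "AE x in lborel. u x = u' x" using borel_representative[OF um(1) \<Omega>m um(2)] by blast
  obtain w' where w': "w' \<in> borel_measurable borel" "AE x in lborel. w x = w' x" using borel_representative[OF wm(1) \<Omega>m wm(2)] by blast
  note [measurable] = u'(1) w'(1)
  obtain \<phi> where \<phi>: "\<And>k. \<phi> k \<in> test_functions \<Omega>" "(\<lambda>k. sobolev_norm ?r p \<Omega> (\<lambda>x. \<phi> k x - u x)) \<longlonglongrightarrow> 0"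
    using u by (auto simp: sobolev_space0_def)
  obtain \<psi> where \<psi>: "\<And>k. \<psi> k \<in> test_functions \<Omega>" "(\<lambda>k. sobolev_norm ?r p \<Omega> (\<lambda>x. \<psi> k x - w x)) \<longlonglongrightarrow> 0"
    using w by (auto simp: sobolev_space0_def)
  have [measurable]: "\<phi> k \<in> borel_measurable borel" "\<psi> k \<in> borel_measurable borel" for k
    using test_functions_measurable \<phi>(1) \<psi>(1) by blast+
  define N where "N = (\<lambda>v :: 'a \<Rightarrow> real. (\<integral>\<^sup>+x. ennreal (\<bar>v x\<bar> powr p) * indicator \<Omega> x \<partial>lborel) + frac_energy s p \<Omega> v)"
  have n1: "sobolev_norm ?r p \<Omega> (\<lambda>x. \<phi> k x - u x) = ennpowr (N (\<lambda>x. \<phi> k x - u' x)) (1 / p)" for k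
    unfolding N_def by (rule sobolev_norm_eq[OF p \<Omega>m]) (use u'(2) in \<open>auto elim: eventually_mono\<close>)
  have n2: "sobolev_norm ?r p \<Omega> (\<lambda>x. \<psi> k x - w x) = ennpowr (N (\<lambda>x. \<psi> k x - w' x)) (1 / p)" for k
    unfolding N_def by (rule sobolev_norm_eq[OF p \<Omega>m]) (use w'(2) in \<open>auto elim: eventually_mono\<close>)
  have "AE x in lborel. u x + t * w x = u' x + t * w' x" using u'(2) w'(2) by eventually_elim simp
  then have n3: "sobolev_norm ?r p \<Omega> (\<lambda>x. (\<phi> k x + t * \<psi> k x) - (u x + t * w x)) = ennpowr (N (\<lambda>x. (\<phi> k x - u' x) + t * (\<psi> k x - w' x))) (1 / p)" for k
    unfolding N_def by (intro sobolev_norm_eq[OF p \<Omega>m]) (auto elim: eventually_mono simp: algebra_simps)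
  have N0: "(\<lambda>k. N (\<lambda>x. \<phi> k x - u' x)) \<longlonglongrightarrow> 0" "(\<lambda>k. N (\<lambda>x. \<psi> k x - w' x)) \<longlonglongrightarrow> 0"
    using \<phi>(2) \<psi>(2) p unfolding n1 n2 by (simp_all add: tendsto_ennpowr_zero_iff)
  have Nle: "N (\<lambda>x. a x + t * b x) \<le> ennreal (2 powr p) * (N a + ennreal (\<bar>t\<bar> powr p) * N b)"
    if [measurable]: "a \<in> borel_measurable borel" "b \<in> borel_measurable borel" for a b :: "'a \<Rightarrow> real"
  proof -
    have 1: "(\<integral>\<^sup>+x. ennreal (\<bar>a x + t * b x\<bar> powr p) * indicator \<Omega> x \<partial>lborel)
       \<le> (\<integral>\<^sup>+x. ennreal (2 powr p) * (ennreal (\<bar>a x\<bar> powr p) * indicator \<Omega> x + ennreal (\<bar>t\<bar> powr p) * (ennreal (\<bar>b x\<bar> powr p) * indicator \<Omega> x)) \<partial>lborel)"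
    proof (intro nn_integral_mono)
      fix x
      show "ennreal (\<bar>a x + t * b x\<bar> powr p) * indicator \<Omega> x \<le> ennreal (2 powr p) * (ennreal (\<bar>a x\<bar> powr p) * indicator \<Omega> x + ennreal (\<bar>t\<bar> powr p) * (ennreal (\<bar>b x\<bar> powr p) * indicator \<Omega> x))"
        using powr_add_cmult_le[OF p, of "a x" t "b x"]
        by (cases "x \<in> \<Omega>") (auto simp: ennreal_leI simp flip: ennreal_mult' ennreal_plus)
    qed
    have 2: "frac_energy s p \<Omega> (\<lambda>x. a x + t * b x)
       \<le> (\<integral>\<^sup>+x. \<integral>\<^sup>+y. ennreal (2 powr p) * (ennreal (dq s a x y powr p) * (indicator \<Omega> x * indicator \<Omega> y) + ennreal (\<bar>t\<bar> powr p) * (ennreal (dq s b x y powr p) * (indicator \<Omega> x * indicator \<Omega> y))) \<partial>lborel \<partial>lborel)"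
      unfolding frac_energy_def
    proof (intro nn_integral_mono)
      fix x y :: 'a
      define c where "c = 1 / norm (x - y) powr (real DIM('a) + s)"
      have dqc: "dq s z x y = \<bar>(z x - z y) * c\<bar>" for z :: "'a \<Rightarrow> real" by (simp add: dq_def c_def abs_mult)
      have "(a x + t * b x - (a y + t * b y)) * c = (a x - a y) * c + t * ((b x - b y) * c)" by (simp add: algebra_simps)
      then have "dq s (\<lambda>x. a x + t * b x) x y powr p \<le> 2 powr p * (dq s a x y powr p + \<bar>t\<bar> powr p * dq s b x y powr p)"
        unfolding dqc using powr_add_cmult_le[OF p, of "(a x - a y) * c" t "(b x - b y) * c"] by simp
      then show "ennreal (dq s (\<lambda>x. a x + t * b x) x y powr p) * (indicator \<Omega> x * indicator \<Omega> y)
        \<le> ennreal (2 powr p) * (ennreal (dq s a x y powr p) * (indicator \<Omega> x * indicator \<Omega> y) + ennreal (\<bar>t\<bar> powr p) * (ennreal (dq s b x y powr p) * (indicator \<Omega> x * indicator \<Omega> y)))"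
        by (cases "x \<in> \<Omega> \<and> y \<in> \<Omega>") (auto simp: ennreal_leI simp flip: ennreal_mult' ennreal_plus)
    qed
    have "N (\<lambda>x. a x + t * b x) \<le> ennreal (2 powr p) * ((\<integral>\<^sup>+x. ennreal (\<bar>a x\<bar> powr p) * indicator \<Omega> x \<partial>lborel) + ennreal (\<bar>t\<bar> powr p) * (\<integral>\<^sup>+x. ennreal (\<bar>b x\<bar> powr p) * indicator \<Omega> x \<partial>lborel))
       + ennreal (2 powr p) * (frac_energy s p \<Omega> a + ennreal (\<bar>t\<bar> powr p) * frac_energy s p \<Omega> b)"
      unfolding N_def by (rule add_mono[OF order_trans[OF 1] order_trans[OF 2]])
        (simp_all add: nn_integral_cmult nn_integral_add frac_energy_def)
    also have "\<dots> = ennreal (2 powr p) * (N a + ennreal (\<bar>t\<bar> powr p) * N b)"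
      by (simp add: N_def distrib_left ac_simps)
    finally show ?thesis .
  qed
  have "(\<lambda>k. ennreal (2 powr p) * (N (\<lambda>x. \<phi> k x - u' x) + ennreal (\<bar>t\<bar> powr p) * N (\<lambda>x. \<psi> k x - w' x))) \<longlonglongrightarrow> ennreal (2 powr p) * (0 + ennreal (\<bar>t\<bar> powr p) * 0)"
    by (intro ennreal_tendsto_cmult tendsto_add N0) auto
  then have "(\<lambda>k. N (\<lambda>x. (\<phi> k x - u' x) + t * (\<psi> k x - w' x))) \<longlonglongrightarrow> 0"
    by (intro tendsto_0_le_ennreal[OF Nle]) auto
  then have "(\<lambda>k. sobolev_norm ?r p \<Omega> (\<lambda>x. (\<phi> k x + t * \<psi> k x) - (u x + t * w x))) \<longlonglongrightarrow> 0"
    unfolding n3 using p by (simp add: tendsto_ennpowr_zero_iff)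
  moreover have "\<forall>k. (\<lambda>x. \<phi> k x + t * \<psi> k x) \<in> test_functions \<Omega>"
    using test_functions_add_cmult[OF \<phi>(1) \<psi>(1)] by blast
  moreover have "(\<lambda>x. u x + t * w x) \<in> borel_measurable lebesgue" using um(1) wm(1) by measurable
  ultimately show ?thesis
    unfolding sobolev_space0_def using um(2) wm(2)
    by (auto intro!: exI[of _ "\<lambda>k x. \<phi> k x + t * \<psi> k x"])
qed

lemma test_functions_in_sobolev_space0:
  fixes \<phi> :: "'a::euclidean_space \<Rightarrow> real"
  assumes \<phi>: "\<phi> \<in> test_functions \<Omega>" and p: "0 < p" and \<Omega>: "open \<Omega>"
  shows "\<phi> \<in> sobolev_space0 (shifted_order DIM('a) s p) p \<Omega>"
proof -
  have m [measurable]: "\<phi> \<in> borel_measurable borel" by (rule test_functions_measurable[OF \<phi>])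
  have "sobolev_norm (shifted_order DIM('a) s p) p \<Omega> (\<lambda>x. \<phi> x - \<phi> x) = ennpowr 0 (1 / p)"
    using p \<Omega> by (subst sobolev_norm_eq[where v="\<lambda>x. 0"]) (auto simp: frac_energy_def dq_def)
  also have "\<dots> = 0" by (simp add: ennpowr_def)
  finally show ?thesis
    unfolding sobolev_space0_def using \<phi> test_functions_eq_0[OF \<phi>] m
    by (auto intro!: exI[of _ "\<lambda>k. \<phi>"] measurable_completion)
qed

text \<open>A single member of the approximating sequence, at norm less than 1, transfers finiteness
  from test functions to \<open>u\<close>.\<close>

lemma sobolev_space0_approx:
  fixes u :: "'a::euclidean_space \<Rightarrow> real"
  assumes \<Omega>: "open \<Omega>" and p: "0 < p" and u: "u \<in> sobolev_space0 (shifted_order DIM('a) s p) p \<Omega>"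
    and v [measurable]: "v \<in> borel_measurable borel" and uv: "AE x in lborel. u x = v x"
  obtains \<phi> where "\<phi> \<in> test_functions \<Omega>"
    "(\<integral>\<^sup>+x. ennreal (\<bar>\<phi> x - v x\<bar> powr p) * indicator \<Omega> x \<partial>lborel) < \<infinity>" "frac_energy s p \<Omega> (\<lambda>x. \<phi> x - v x) < \<infinity>"
proof -
  let ?r = "shifted_order DIM('a) s p"
  have \<Omega>m [measurable]: "\<Omega> \<in> sets borel" using \<Omega> by simp
  obtain \<phi> where \<phi>: "\<And>k. \<phi> k \<in> test_functions \<Omega>" "(\<lambda>k. sobolev_norm ?r p \<Omega> (\<lambda>x. \<phi> k x - u x)) \<longlonglongrightarrow> 0"
    using u by (auto simp: sobolev_space0_def)
  have "eventually (\<lambda>k. sobolev_norm ?r p \<Omega> (\<lambda>x. \<phi> k x - u x) < 1) sequentially"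
    using \<phi>(2) by (rule order_tendstoD(2)) simp
  then obtain k where k: "sobolev_norm ?r p \<Omega> (\<lambda>x. \<phi> k x - u x) < 1"
    using eventually_happens'[OF sequentially_bot] by blast
  have [measurable]: "\<phi> k \<in> borel_measurable borel" using test_functions_measurable \<phi>(1) by blast
  have e: "sobolev_norm ?r p \<Omega> (\<lambda>x. \<phi> k x - u x) = ennpowr ((\<integral>\<^sup>+x. ennreal (\<bar>\<phi> k x - v x\<bar> powr p) * indicator \<Omega> x \<partial>lborel) + frac_energy s p \<Omega> (\<lambda>x. \<phi> k x - v x)) (1 / p)"
    by (rule sobolev_norm_eq[OF p \<Omega>m]) (use uv in \<open>auto elim: eventually_mono\<close>)
  have "sobolev_norm ?r p \<Omega> (\<lambda>x. \<phi> k x - u x) < top"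
    using k by (rule less_trans) simp
  then show thesis using that[OF \<phi>(1)[of k]] unfolding e by simp
qed

text \<open>\<open>\<bar>a\<bar> \<le> 1 + \<bar>a\<bar> powr p\<close>, and the constant 1 is
  integrable over the bounded set \<open>\<Omega>\<close>.\<close>

lemma sobolev_space0_integrable:
  fixes u :: "'a::euclidean_space \<Rightarrow> real"
  assumes \<Omega>: "open \<Omega>" "bounded \<Omega>" and p: "1 \<le> p" and u: "u \<in> sobolev_space0 (shifted_order DIM('a) s p) p \<Omega>"
    and v [measurable]: "v \<in> borel_measurable borel" and uv: "AE x in lborel. u x = v x" and off: "\<And>x. x \<notin> \<Omega> \<Longrightarrow> v x = 0"
  shows "(\<integral>\<^sup>+x. ennreal \<bar>v x\<bar> \<partial>lborel) < \<infinity>"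
proof -
  have p0: "0 < p" using p by simp
  have \<Omega>m [measurable]: "\<Omega> \<in> sets borel" using \<Omega> by simp
  obtain \<phi> where \<phi>: "\<phi> \<in> test_functions \<Omega>"
    "(\<integral>\<^sup>+x. ennreal (\<bar>\<phi> x - v x\<bar> powr p) * indicator \<Omega> x \<partial>lborel) < \<infinity>"
    using sobolev_space0_approx[OF \<Omega>(1) p0 u v uv] by metis
  have [measurable]: "\<phi> \<in> borel_measurable borel" by (rule test_functions_measurable[OF \<phi>(1)])
  have i1: "(\<integral>\<^sup>+x. ennreal \<bar>\<phi> x\<bar> \<partial>lborel) < \<infinity>"
    using smooth_compact_integrable_powr[OF test_functions_smooth_compact[OF \<phi>(1)], of 1] by simp
  have fin: "emeasure lborel \<Omega> < \<infinity>" using emeasure_bounded_finite[OF \<Omega>(2)] by simp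
  have "(\<integral>\<^sup>+x. ennreal \<bar>v x\<bar> \<partial>lborel) \<le> (\<integral>\<^sup>+x. ennreal \<bar>\<phi> x\<bar> + (indicator \<Omega> x + ennreal (\<bar>\<phi> x - v x\<bar> powr p) * indicator \<Omega> x) \<partial>lborel)"
  proof (intro nn_integral_mono)
    fix x
    show "ennreal \<bar>v x\<bar> \<le> ennreal \<bar>\<phi> x\<bar> + (indicator \<Omega> x + ennreal (\<bar>\<phi> x - v x\<bar> powr p) * indicator \<Omega> x)"
    proof (cases "x \<in> \<Omega>")
      case True
      have "\<bar>\<phi> x - v x\<bar> \<le> 1 + \<bar>\<phi> x - v x\<bar> powr p"
      proof (cases "\<bar>\<phi> x - v x\<bar> \<le> 1")
        case False
        then have "\<bar>\<phi> x - v x\<bar> powr 1 \<le> \<bar>\<phi> x - v x\<bar> powr p" using p by (intro powr_mono) auto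
        then show ?thesis by simp
      qed (simp add: add_increasing2)
      then have "\<bar>v x\<bar> \<le> \<bar>\<phi> x\<bar> + (1 + \<bar>\<phi> x - v x\<bar> powr p)" by linarith
      then have "ennreal \<bar>v x\<bar> \<le> ennreal (\<bar>\<phi> x\<bar> + (1 + \<bar>\<phi> x - v x\<bar> powr p))" by (rule ennreal_leI)
      then show ?thesis using True by simp
    qed (simp add: off)
  qed
  also have "\<dots> = (\<integral>\<^sup>+x. ennreal \<bar>\<phi> x\<bar> \<partial>lborel) + (emeasure lborel \<Omega> + (\<integral>\<^sup>+x. ennreal (\<bar>\<phi> x - v x\<bar> powr p) * indicator \<Omega> x \<partial>lborel))"
    by (simp add: nn_integral_add)
  also have "\<dots> < \<infinity>" using i1 fin \<phi>(2) by simp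
  finally show ?thesis .
qed

text \<open>The definition controls pairs inside \<open>\<Omega>\<close> only;
  \<open>zero_extension_bound\<close> supplies the others. Together with
  \<open>sobolev_space0_1I\<close> this identifies the space of order 1, up to null sets, with the
  integrable functions vanishing off \<open>\<Omega>\<close> whose energy over all pairs is
  finite.\<close>

theorem sobolev_space0_1D:
  fixes u :: "'a::euclidean_space \<Rightarrow> real"
  assumes s: "0 < s" "s < 1" and \<Omega>: "open \<Omega>" "bounded \<Omega>" "lipschitz_boundary \<Omega>" and u: "u \<in> sobolev_space0 s 1 \<Omega>"
    and v [measurable]: "v \<in> borel_measurable borel" and uv: "AE x in lborel. u x = v x" and off: "\<And>x. x \<notin> \<Omega> \<Longrightarrow> v x = 0"
  shows "(\<integral>\<^sup>+x. ennreal \<bar>v x\<bar> \<partial>lborel) < \<infinity>" "frac_energy s 1 UNIV v < \<infinity>"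
proof -
  have \<Omega>m [measurable]: "\<Omega> \<in> sets borel" using \<Omega> by simp
  have u1: "u \<in> sobolev_space0 (shifted_order DIM('a) s 1) 1 \<Omega>" using u by simp
  show L1: "(\<integral>\<^sup>+x. ennreal \<bar>v x\<bar> \<partial>lborel) < \<infinity>"
    by (rule sobolev_space0_integrable[OF \<Omega>(1,2) _ u1 v uv off]) auto
  obtain \<phi> where \<phi>: "\<phi> \<in> test_functions \<Omega>" "frac_energy s 1 \<Omega> (\<lambda>x. \<phi> x - v x) < \<infinity>"
    using sobolev_space0_approx[OF \<Omega>(1) _ u1 v uv] by (metis zero_less_one)
  have [measurable]: "\<phi> \<in> borel_measurable borel" by (rule test_functions_measurable[OF \<phi>(1)])
  have "frac_energy s 1 \<Omega> v \<le> frac_energy s 1 \<Omega> (\<lambda>x. v x - \<phi> x) + frac_energy s 1 \<Omega> \<phi>"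
    using frac_energy_triangle[of "\<lambda>x. v x - \<phi> x" \<phi> \<Omega> s] by simp
  also have "\<dots> \<le> frac_energy s 1 \<Omega> (\<lambda>x. \<phi> x - v x) + frac_energy s 1 UNIV \<phi>"
    by (intro add_mono frac_energy_mono_set) (auto simp: frac_energy_diff_commute[of s 1 \<Omega> v \<phi>])
  also have "\<dots> < \<infinity>"
    using \<phi>(2) smooth_compact_energy_finite[OF test_functions_smooth_compact[OF \<phi>(1)] s, of 1] s by simp
  finally have E: "frac_energy s 1 \<Omega> v < \<infinity>" .
  obtain C where C: "0 \<le> C"
    "\<And>w. w \<in> borel_measurable borel \<Longrightarrow> (\<And>x. x \<notin> \<Omega> \<Longrightarrow> w x = 0) \<Longrightarrow> (\<integral>\<^sup>+x. ennreal \<bar>w x\<bar> \<partial>lborel) < \<infinity> \<Longrightarrow>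
      frac_energy s 1 UNIV w \<le> ennreal C * (frac_energy s 1 \<Omega> w + (\<integral>\<^sup>+x. ennreal \<bar>w x\<bar> \<partial>lborel))"
    using zero_extension_bound[OF s \<Omega>] by blast
  have "frac_energy s 1 UNIV v \<le> ennreal C * (frac_energy s 1 \<Omega> v + (\<integral>\<^sup>+x. ennreal \<bar>v x\<bar> \<partial>lborel))"
    by (rule C(2)[OF v off L1])
  also have "\<dots> < \<infinity>" using E L1 by (simp add: ennreal_mult_less_top)
  finally show "frac_energy s 1 UNIV v < \<infinity>" .
qed

text \<open>\<open>test_functions_dense\<close> gives approximation over all pairs, which is
  stronger than approximation in the norm over \<open>\<Omega>\<close>.\<close>

theorem sobolev_space0_1I:
  fixes u :: "'a::euclidean_space \<Rightarrow> real"
  assumes s: "0 < s" "s < 1" and \<Omega>: "open \<Omega>" "bounded \<Omega>" "lipschitz_boundary \<Omega>"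
    and u: "u \<in> borel_measurable lebesgue" "\<And>x. x \<notin> \<Omega> \<Longrightarrow> u x = 0"
    and v [measurable]: "v \<in> borel_measurable borel" and uv: "AE x in lborel. u x = v x" and off: "\<And>x. x \<notin> \<Omega> \<Longrightarrow> v x = 0"
    and fin: "(\<integral>\<^sup>+x. ennreal \<bar>v x\<bar> \<partial>lborel) < \<infinity>" "frac_energy s 1 UNIV v < \<infinity>"
  shows "u \<in> sobolev_space0 s 1 \<Omega>"
proof -
  have \<Omega>m [measurable]: "\<Omega> \<in> sets borel" using \<Omega> by simp
  obtain \<phi> where \<phi>: "\<And>k::nat. \<phi> k \<in> test_functions \<Omega>" "(\<lambda>k. \<integral>\<^sup>+x. ennreal \<bar>\<phi> k x - v x\<bar> \<partial>lborel) \<longlonglongrightarrow> 0"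
    "(\<lambda>k. frac_energy s 1 UNIV (\<lambda>x. \<phi> k x - v x)) \<longlonglongrightarrow> 0"
    using test_functions_dense[OF s \<Omega> v off fin] by blast
  have [measurable]: "\<phi> k \<in> borel_measurable borel" for k using test_functions_measurable \<phi>(1) by blast
  have "sobolev_norm s 1 \<Omega> (\<lambda>x. \<phi> k x - u x) \<le> (\<integral>\<^sup>+x. ennreal \<bar>\<phi> k x - v x\<bar> \<partial>lborel) + frac_energy s 1 UNIV (\<lambda>x. \<phi> k x - v x)" for k
  proof -
    have "sobolev_norm s 1 \<Omega> (\<lambda>x. \<phi> k x - u x) = ennpowr ((\<integral>\<^sup>+x. ennreal (\<bar>\<phi> k x - v x\<bar> powr 1) * indicator \<Omega> x \<partial>lborel) + frac_energy s 1 \<Omega> (\<lambda>x. \<phi> k x - v x)) (1 / 1)"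
      using sobolev_norm_eq[of 1 \<Omega> "\<lambda>x. \<phi> k x - v x" "\<lambda>x. \<phi> k x - u x" s] uv by (auto elim: eventually_mono)
    also have "\<dots> \<le> (\<integral>\<^sup>+x. ennreal \<bar>\<phi> k x - v x\<bar> \<partial>lborel) + frac_energy s 1 UNIV (\<lambda>x. \<phi> k x - v x)"
      by (auto intro!: add_mono nn_integral_mono frac_energy_mono_set simp: indicator_def)
    finally show ?thesis .
  qed
  moreover have "(\<lambda>k. (\<integral>\<^sup>+x. ennreal \<bar>\<phi> k x - v x\<bar> \<partial>lborel) + frac_energy s 1 UNIV (\<lambda>x. \<phi> k x - v x)) \<longlonglongrightarrow> 0"
    using tendsto_add[OF \<phi>(2,3)] by simp
  ultimately have "(\<lambda>k. sobolev_norm s 1 \<Omega> (\<lambda>x. \<phi> k x - u x)) \<longlonglongrightarrow> 0" by (rule tendsto_0_le_ennreal)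
  then show ?thesis unfolding sobolev_space0_def using u \<phi>(1) by blast
qed

section \<open>Almost everywhere convergent convex combinations\<close>

text \<open>Only midpoints are taken: the parallelogram identity uses no other convex combination,
  and each stability property is then an induction with one step. The index \<open>k\<close>
  restricts to the tail of the sequence.\<close>

inductive_set mid_hull :: "(nat \<Rightarrow> 'b \<Rightarrow> real) \<Rightarrow> nat \<Rightarrow> ('b \<Rightarrow> real) set" for y k where
  base: "k \<le> j \<Longrightarrow> y j \<in> mid_hull y k"
| mid: "v \<in> mid_hull y k \<Longrightarrow> w \<in> mid_hull y k \<Longrightarrow> (\<lambda>x. (v x + w x) / 2) \<in> mid_hull y k"

lemma mid_hull_antimono:
  assumes "k \<le> l" "v \<in> mid_hull y l"
  shows "v \<in> mid_hull y k"
  using assms(2) by induction (use assms(1) in \<open>auto intro: mid_hull.intros\<close>)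

lemma mid_hull_measurable:
  assumes "v \<in> mid_hull y k" "\<And>j. y j \<in> borel_measurable M"
  shows "v \<in> borel_measurable M"
  using assms(1)
proof induction
  case (mid v w)
  note [measurable] = mid.IH
  show ?case by measurable
qed (rule assms(2))

text \<open>Closed intervals are stable under midpoints. Used with \<open>c = 0\<close> for the
  bound by 1, and with \<open>c\<close> a limit value to show that the combinations keep pointwise
  limits.\<close>

lemma mid_hull_bound:
  assumes "v \<in> mid_hull y k" "\<And>j. k \<le> j \<Longrightarrow> \<bar>y j x - c\<bar> \<le> e"
  shows "\<bar>v x - c\<bar> \<le> e"
  using assms(1)
proof induction
  case (mid v w)
  then show ?case unfolding abs_le_iff by (auto simp: field_simps)
qed (rule assms(2))

text \<open>Elements of almost minimal \<open>L\<^sup>2\<close> norm in the hulls of the tails form a Cauchy sequence by the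
  parallelogram identity. This replaces weak compactness.\<close>

theorem mid_hull_convergent:
  fixes y :: "nat \<Rightarrow> 'b \<Rightarrow> real"
  assumes "sigma_finite_measure M" and ym: "\<And>k. y k \<in> borel_measurable M" and yb: "\<And>k x. \<bar>y k x\<bar> \<le> 1"
  obtains g where "\<And>k. g k \<in> mid_hull y k" "AE x in M. convergent (\<lambda>k. g k x)"
proof -
  interpret sigma_finite_measure M by fact
  \<comment> \<open>A positive density of finite integral turns \<open>M\<close> into a finite
    measure with the same null sets, on which bounded functions are square integrable.\<close>
  obtain \<rho> where \<rho>: "\<rho> \<in> borel_measurable M" "integral\<^sup>N M \<rho> \<noteq> \<infinity>" "\<And>x. x \<in> space M \<Longrightarrow> 0 < \<rho> x \<and> \<rho> x < \<infinity>"
    using Ex_finite_integrable_function by blast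
  define \<mu> where "\<mu> = density M \<rho>"
  have "emeasure \<mu> (space \<mu>) \<noteq> \<infinity>" using \<rho>(1,2) by (simp add: \<mu>_def emeasure_density cong: nn_integral_cong)
  then interpret \<mu>: finite_measure \<mu> by (rule finite_measureI)
  have sets: "sets \<mu> = sets M" by (simp add: \<mu>_def)
  have hm: "v \<in> borel_measurable \<mu>" if "v \<in> mid_hull y k" for v k
    using mid_hull_measurable[OF that ym] by (simp add: measurable_cong_sets[OF sets refl])
  have hb: "\<bar>v x\<bar> \<le> 1" if "v \<in> mid_hull y k" for v k x
    using mid_hull_bound[OF that, of x 0 1] yb by simp
  define N where "N = (\<lambda>v :: 'b \<Rightarrow> real. \<integral>x. (v x)\<^sup>2 \<partial>\<mu>)"
  have N0: "0 \<le> N v" for v by (simp add: N_def)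
  have hi: "integrable \<mu> (\<lambda>x. (v x)\<^sup>2)" if "v \<in> mid_hull y k" for v k
  proof (rule \<mu>.integrable_const_bound[where B=1])
    show "AE x in \<mu>. norm ((v x)\<^sup>2) \<le> 1" using hb[OF that] by (simp add: abs_square_le_1)
    show "(\<lambda>x. (v x)\<^sup>2) \<in> borel_measurable \<mu>" using hm[OF that] by measurable
  qed
  define m where "m = (\<lambda>k. Inf (N ` mid_hull y k))"
  have ne: "N ` mid_hull y k \<noteq> {}" for k using mid_hull.base[of k k y] by blast
  have bb: "bdd_below (N ` mid_hull y k)" for k by (rule bdd_belowI[where m=0]) (auto simp: N0)
  have mle: "m k \<le> N v" if "v \<in> mid_hull y k" for v k
    unfolding m_def using that bb by (intro cInf_lower) auto
  have "\<exists>v\<in>mid_hull y k. N v < m k + 1 / real (Suc k)" for k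
    using cInf_lessD[OF ne, of k "m k + 1 / real (Suc k)"] by (auto simp: m_def)
  then obtain h where h: "\<And>k. h k \<in> mid_hull y k" "\<And>k. N (h k) < m k + 1 / real (Suc k)" by metis
  have minc: "incseq m"
  proof (rule incseq_SucI)
    fix k
    show "m k \<le> m (Suc k)"
      unfolding m_def by (intro cInf_superset_mono bb ne image_mono subsetI mid_hull_antimono[of k "Suc k"]) auto
  qed
  have mub: "m k \<le> measure \<mu> (space \<mu>)" for k
  proof -
    have "m k \<le> N (h k)" by (rule mle[OF h(1)])
    also have "\<dots> \<le> (\<integral>x. 1 \<partial>\<mu>)"
      unfolding N_def using hi[OF h(1)] hb[OF h(1)] by (intro integral_mono) (auto simp: abs_square_le_1)
    finally show ?thesis by simp
  qed
  obtain L where L: "m \<longlonglongrightarrow> L" using incseq_convergent[OF minc, of "measure \<mu> (space \<mu>)"] mub by blast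
  have mL: "m k \<le> L" for k using incseq_le[OF minc L] .
  \<comment> \<open>Parallelogram identity with \<open>j = min k l\<close>: the midpoint lies in the
    hull of the tail from \<open>j\<close> on, so its squared norm is at least \<open>m j\<close>,
    while those of \<open>h k\<close> and \<open>h l\<close> are at most
    \<open>L + 1 / real (Suc j)\<close>.\<close>
  have sq: "N (\<lambda>x. h k x - h l x) \<le> 2 * (L - m (min k l)) * 2 + 2 / real (Suc (min k l)) * 2" for k l
  proof -
    let ?j = "min k l"
    have hk: "h k \<in> mid_hull y ?j" and hl: "h l \<in> mid_hull y ?j"
      using mid_hull_antimono[of ?j] h(1) by (meson min.cobounded1, meson min.cobounded2)
    have "N (\<lambda>x. h k x - h l x) = (\<integral>x. (2 * (h k x)\<^sup>2 + 2 * (h l x)\<^sup>2) - 4 * ((h k x + h l x) / 2)\<^sup>2 \<partial>\<mu>)"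
      unfolding N_def by (rule Bochner_Integration.integral_cong) (auto simp: power2_eq_square field_simps)
    also have "\<dots> = 2 * N (h k) + 2 * N (h l) - 4 * N (\<lambda>x. (h k x + h l x) / 2)"
      unfolding N_def using hi[OF hk] hi[OF hl] hi[OF mid_hull.mid[OF hk hl]]
      by (simp add: Bochner_Integration.integral_diff Bochner_Integration.integral_add)
    also have "\<dots> \<le> 2 * (L + 1 / real (Suc ?j)) + 2 * (L + 1 / real (Suc ?j)) - 4 * m ?j"
    proof -
      have "1 / real (Suc k) \<le> 1 / real (Suc ?j)" "1 / real (Suc l) \<le> 1 / real (Suc ?j)" by (auto intro!: divide_left_mono)
      then have "N (h k) \<le> L + 1 / real (Suc ?j)" "N (h l) \<le> L + 1 / real (Suc ?j)"
        using h(2)[of k] h(2)[of l] mL[of k] mL[of l] by linarith+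
      moreover have "m ?j \<le> N (\<lambda>x. (h k x + h l x) / 2)" by (rule mle[OF mid_hull.mid[OF hk hl]])
      ultimately show ?thesis by (intro diff_mono add_mono mult_left_mono) auto
    qed
    finally show ?thesis by (simp add: algebra_simps)
  qed
  define V where "V = measure \<mu> (space \<mu>)"
  have hint: "integrable \<mu> (h k)" for k
    by (rule \<mu>.integrable_const_bound[where B=1]) (use hb[OF h(1)] hm[OF h(1)] in auto)
  obtain r where r: "strict_mono r" "AE x in \<mu>. Cauchy (\<lambda>i. h (r i) x)"
  proof (rule cauchy_L1_AE_cauchy_subseq[of \<mu> h])
    show "integrable \<mu> (h k)" for k by (rule hint)
    fix e :: real assume e: "0 < e"
    \<comment> \<open>Passes from squares to first powers by
      \<open>t \<le> d + t\<^sup>2 / d\<close>; the choice ensures \<open>d * V < e / 2\<close>,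
      also for \<open>V = 0\<close>.\<close>
    define d where "d = e / (2 * (V + 1))"
    have V: "0 \<le> V" by (simp add: V_def)
    have d: "0 < d" "d * V < e / 2" using e V by (auto simp: d_def field_simps)
    have lim: "(\<lambda>j. 2 * (L - m j) * 2 + 2 / real (Suc j) * 2) \<longlonglongrightarrow> 2 * (L - L) * 2 + 2 * 0 * 2"
      by (intro tendsto_intros L) (use tendsto_mult[OF tendsto_const[of 2] LIMSEQ_Suc[OF lim_1_over_n[where 'a=real]]] in \<open>simp\<close>)
    then have "eventually (\<lambda>j. 2 * (L - m j) * 2 + 2 / real (Suc j) * 2 < d * (e / 2)) sequentially"
      using d e by (intro order_tendstoD(2)[OF lim]) auto
    then obtain J where J: "\<And>j. j \<ge> J \<Longrightarrow> 2 * (L - m j) * 2 + 2 / real (Suc j) * 2 < d * (e / 2)"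
      by (auto simp: eventually_sequentially)
    have "(LINT x|\<mu>. norm (h k x - h l x)) < e" if kl: "k \<ge> J" "l \<ge> J" for k l
    proof -
      have si: "integrable \<mu> (\<lambda>x. (h k x - h l x)\<^sup>2)"
      proof (rule \<mu>.integrable_const_bound[where B="2\<^sup>2"])
        have "\<bar>h k x - h l x\<bar> \<le> 2" for x using hb[OF h(1), of k x] hb[OF h(1), of l x] by linarith
        then show "AE x in \<mu>. norm ((h k x - h l x)\<^sup>2) \<le> 2\<^sup>2"
          using abs_le_square_iff[of "h k _ - h l _" 2] by auto
      qed (use hm[OF h(1)] in measurable)
      have "(LINT x|\<mu>. norm (h k x - h l x)) \<le> (\<integral>x. d + (h k x - h l x)\<^sup>2 / d \<partial>\<mu>)"
      proof (rule integral_mono)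
        show "integrable \<mu> (\<lambda>x. norm (h k x - h l x))" using hint by auto
        show "integrable \<mu> (\<lambda>x. d + (h k x - h l x)\<^sup>2 / d)" using si by auto
        fix x
        define t where "t = \<bar>h k x - h l x\<bar>"
        have "t \<le> d + t\<^sup>2 / d"
        proof (cases "t \<le> d")
          case False
          then have "t * d \<le> t * t" using d by (intro mult_left_mono) (auto simp: t_def)
          then have "t \<le> t\<^sup>2 / d" using d by (simp add: pos_le_divide_eq power2_eq_square)
          then show ?thesis using d by linarith
        qed (use d in \<open>simp add: add_increasing2\<close>)
        then show "norm (h k x - h l x) \<le> d + (h k x - h l x)\<^sup>2 / d" by (simp add: t_def)
      qed
      also have "\<dots> = d * V + N (\<lambda>x. h k x - h l x) / d"
        using si by (simp add: N_def V_def)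
      also have "\<dots> < e / 2 + e / 2"
      proof (rule add_strict_mono)
        have "N (\<lambda>x. h k x - h l x) < d * (e / 2)"
          using sq[of k l] J[of "min k l"] kl by simp
        then show "N (\<lambda>x. h k x - h l x) / d < e / 2" using d by (simp add: pos_divide_less_eq mult.commute)
      qed (rule d)
      finally show ?thesis by simp
    qed
    then show "\<exists>N. \<forall>i\<ge>N. \<forall>j\<ge>N. (LINT x|\<mu>. norm (h i x - h j x)) < e" by blast
  qed blast
  show thesis
  proof (rule that[of "\<lambda>k. h (r k)"])
    show "h (r k) \<in> mid_hull y k" for k
      by (rule mid_hull_antimono[OF seq_suble[OF r(1)] h(1)])
    have "AE x in M. 0 < \<rho> x \<longrightarrow> Cauchy (\<lambda>i. h (r i) x)"
      using r(2) unfolding \<mu>_def AE_density[OF \<rho>(1)] .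
    then show "AE x in M. convergent (\<lambda>k. h (r k) x)"
      using AE_space by eventually_elim (use \<rho>(3) in \<open>simp add: Cauchy_convergent_iff\<close>)
  qed
qed

section \<open>Comparison of the energies of order \<open>p\<close> and \<open>1\<close>\<close>

text \<open>Young's inequality for \<open>a\<close> and 1 with the exponents \<open>p\<close> and
  \<open>p / (p - 1)\<close>. The bound is uniform in \<open>a\<close>, which suits pairs filling a
  set of finite measure.\<close>

lemma diff_powr_le:
  fixes a p :: real
  assumes a: "0 \<le> a" and p: "1 < p"
  shows "a - a powr p / p \<le> p - 1"
proof -
  have "a * 1 \<le> a powr p / p + 1 powr (p / (p - 1)) / (p / (p - 1))"
    using a p by (intro Youngs_inequality) (auto simp: field_simps)
  then have "a \<le> a powr p / p + (p - 1) / p" by simp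
  moreover have "(p - 1) / p \<le> (p - 1) / 1" using p by (intro divide_left_mono) auto
  ultimately show ?thesis by simp
qed

text \<open>Gives decay for small \<open>a\<close>, for use at distant pairs. From
  \<open>a powr (p - 1) \<ge> 1 + (p - 1) * ln a\<close> the left side is at most
  \<open>(p - 1) / p * (a * (1 - ln a))\<close>, and \<open>ln x \<le> x - 1\<close> at
  \<open>x = a powr (\<theta> - 1)\<close> turns the logarithm into a power.\<close>

lemma diff_powr_le_powr:
  fixes a p \<theta> :: real
  assumes a: "0 \<le> a" and p: "1 < p" and \<theta>: "0 < \<theta>" "\<theta> < 1"
  shows "a - a powr p / p \<le> (p - 1) * (a powr \<theta> / (1 - \<theta>))"
proof (cases "a = 0")
  case False
  then have a: "0 < a" using a by simp
  have "1 + (p - 1) * ln a \<le> exp ((p - 1) * ln a)" by (rule exp_ge_add_one_self)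
  then have "a * (1 + (p - 1) * ln a) \<le> a * exp ((p - 1) * ln a)" using a by (intro mult_left_mono) auto
  also have "\<dots> = a powr p" using a by (simp add: powr_def exp_add[symmetric] algebra_simps exp_diff)
  finally have "a * p - a powr p \<le> (p - 1) * (a * (1 - ln a))" by (simp add: algebra_simps)
  then have "(a * p - a powr p) / p \<le> (p - 1) * (a * (1 - ln a)) / p" using p by (intro divide_right_mono) auto
  moreover have "(a * p - a powr p) / p = a - a powr p / p" using p by (simp add: diff_divide_distrib)
  ultimately have 1: "a - a powr p / p \<le> (p - 1) / p * (a * (1 - ln a))" by (simp only: times_divide_eq_left)
  define b where "b = a powr (1 - \<theta>)"
  have b: "0 < b" using a by (simp add: b_def)
  have lnb: "ln b = (1 - \<theta>) * ln a" using a by (simp add: b_def ln_powr)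
  have "ln (1 / b) \<le> 1 / b - 1" using b by (intro ln_le_minus_one) auto
  then have "b * (- ln b) \<le> b * (1 / b - 1)" using b by (intro mult_left_mono) (auto simp: ln_div)
  then have "b - b * ln b \<le> 1" using b by (simp add: right_diff_distrib)
  moreover have "(1 - \<theta>) * (b * (1 - ln a)) = b - b * ln b - \<theta> * b" by (simp add: lnb algebra_simps)
  ultimately have "(1 - \<theta>) * (b * (1 - ln a)) \<le> 1" using b \<theta> by (smt (verit) mult_pos_pos)
  then have "b * (1 - ln a) \<le> 1 / (1 - \<theta>)" using \<theta> by (simp add: pos_le_divide_eq mult.commute)
  then have "a powr \<theta> * (b * (1 - ln a)) \<le> a powr \<theta> * (1 / (1 - \<theta>))" by (rule mult_left_mono) simp
  moreover have "a powr \<theta> * b = a" using a by (simp add: b_def flip: powr_add)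
  ultimately have "a * (1 - ln a) \<le> a powr \<theta> / (1 - \<theta>)" by (simp add: mult.assoc[symmetric])
  then have "(p - 1) / p * (a * (1 - ln a)) \<le> (p - 1) / p * (a powr \<theta> / (1 - \<theta>))" using p by (intro mult_left_mono) auto
  also have "\<dots> \<le> (p - 1) / 1 * (a powr \<theta> / (1 - \<theta>))" using p \<theta> by (intro mult_right_mono divide_left_mono) auto
  finally show ?thesis using 1 by simp
qed (use p \<theta> in simp)

text \<open>Only pairs with a point in \<open>\<Omega>\<close> contribute. At distance less than 1
  the uniform \<open>diff_powr_le\<close> is integrable in the other point; at larger distance
  \<open>diff_powr_le_powr\<close> is used, with \<open>\<theta>\<close> so close to 1 that the
  kernel remains integrable at infinity.\<close>

theorem frac_energy_gap:
  fixes s :: real and \<Omega> :: "'a::euclidean_space set"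
  assumes s: "0 < s" "s < 1" and \<Omega>: "\<Omega> \<in> sets borel"
  obtains C where "0 \<le> C" "\<And>v p. v \<in> borel_measurable borel \<Longrightarrow> (\<And>x. x \<notin> \<Omega> \<Longrightarrow> v x = 0) \<Longrightarrow> 1 < p \<Longrightarrow>
    frac_energy s 1 UNIV v \<le> ennreal (1 / p) * frac_energy s p UNIV v
      + ennreal (p - 1) * (ennreal C * (emeasure lborel \<Omega> + (\<integral>\<^sup>+x. ennreal \<bar>v x\<bar> \<partial>lborel)))"
proof -
  define n where "n = real DIM('a)"
  have n: "1 \<le> n" unfolding n_def using DIM_positive[where 'a='a] by linarith
  \<comment> \<open>Chosen so that \<open>(n + s) * \<theta> = n + s / 2\<close>: the kernel of
    \<open>dq\<close> to the power \<open>\<theta>\<close> still decays faster than the critical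
    order \<open>n\<close>.\<close>
  define \<theta> where "\<theta> = (n + s / 2) / (n + s)"
  have \<theta>: "0 < \<theta>" "\<theta> < 1" using n s by (auto simp: \<theta>_def)
  have n\<theta>: "(n + s) * \<theta> = n + s / 2" using n s by (simp add: \<theta>_def)
  define c where "c = 1 / (1 - \<theta>)"
  have c: "0 \<le> c" using \<theta> by (simp add: c_def)
  define \<kappa> where "\<kappa> = (\<lambda>x y::'a. indicator {y. norm (x - y) < 1} y + ennreal c * (ennreal (norm (x - y) powr - (n + s / 2)) * indicator {y. 1 \<le> norm (x - y)} y) :: ennreal)"
  have \<kappa>c: "\<kappa> x y = \<kappa> y x" for x y by (simp add: \<kappa>_def norm_minus_commute indicator_def)
  have \<kappa>if: "\<kappa> x y = ennreal (if norm (x - y) < 1 then 1 else c * norm (x - y) powr - (n + s / 2))" for x y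
    by (auto simp: \<kappa>_def indicator_def ennreal_mult' c)
  have [measurable]: "case_prod \<kappa> \<in> borel_measurable (borel \<Otimes>\<^sub>M borel)"
    unfolding \<kappa>if case_prod_beta' by measurable
  define T where "T = unit_ball_vol n * 2 ^ DIM('a) / (1 - 2 powr - (s / 2))"
  define D where "D = unit_ball_vol n + c * T"
  have D1: "0 \<le> unit_ball_vol n" by (simp add: n_def)
  have D2: "0 \<le> T"
    unfolding T_def using D1 s by (auto intro!: divide_nonneg_pos simp: powr_less_one)
  have D: "0 \<le> D" unfolding D_def using D1 D2 c by (intro add_nonneg_nonneg mult_nonneg_nonneg)
  have \<kappa>D: "(\<integral>\<^sup>+y. \<kappa> x y \<partial>lborel) \<le> ennreal D" for x
  proof -
    have [measurable]: "{y. norm (x - y) < 1} \<in> sets lborel" "{y. 1 \<le> norm (x - y)} \<in> sets lborel" by simp_all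
    have b: "{y. norm (x - y) < 1} = ball x 1" by (auto simp: dist_norm)
    have "(\<integral>\<^sup>+y. \<kappa> x y \<partial>lborel) = emeasure lborel {y. norm (x - y) < 1}
      + ennreal c * (\<integral>\<^sup>+y. ennreal (norm (x - y) powr - (n + s / 2)) * indicator {y. 1 \<le> norm (x - y)} y \<partial>lborel)"
      unfolding \<kappa>_def by (simp add: nn_integral_add nn_integral_cmult)
    also have "emeasure lborel {y. norm (x - y) < 1} = ennreal (unit_ball_vol n)"
      unfolding b by (simp add: emeasure_ball n_def)
    also have "ennreal c * (\<integral>\<^sup>+y. ennreal (norm (x - y) powr - (n + s / 2)) * indicator {y. 1 \<le> norm (x - y)} y \<partial>lborel)
      \<le> ennreal c * ennreal (T * 1 powr - (s / 2))"
      unfolding T_def n_def using s by (intro mult_left_mono nn_integral_tail_powr) auto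
    also have "ennreal (unit_ball_vol n) + ennreal c * ennreal (T * 1 powr - (s / 2)) = ennreal D"
      unfolding D_def using D1 D2 c by (subst ennreal_plus) (auto simp: ennreal_mult')
    finally show ?thesis by (simp add: add_left_mono)
  qed
  show thesis
  proof (rule that[of "2 * D"])
    show "0 \<le> 2 * D" using D by simp
    fix v :: "'a \<Rightarrow> real" and p :: real
    assume v [measurable]: "v \<in> borel_measurable borel" and off: "\<And>x. x \<notin> \<Omega> \<Longrightarrow> v x = 0" and p: "1 < p"
    note \<Omega>[measurable]
    \<comment> \<open>Charges a pair to its two points: as soon as one of them lies in
      \<open>\<Omega>\<close>,
      \<open>1 + \<bar>v x\<bar> + \<bar>v y\<bar> \<le> h x + h y\<close>.\<close>
    define h where "h = (\<lambda>x. indicator \<Omega> x + ennreal \<bar>v x\<bar>)"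
    have [measurable]: "h \<in> borel_measurable borel" unfolding h_def by measurable
    have hint: "(\<integral>\<^sup>+x. h x \<partial>lborel) = emeasure lborel \<Omega> + (\<integral>\<^sup>+x. ennreal \<bar>v x\<bar> \<partial>lborel)"
      unfolding h_def by (simp add: nn_integral_add)
    have pt: "ennreal (dq s v x y) \<le> ennreal (1 / p) * ennreal (dq s v x y powr p) + ennreal (p - 1) * (h x * \<kappa> x y + h y * \<kappa> x y)" for x y
    proof (cases "x \<in> \<Omega> \<or> y \<in> \<Omega>")
      case True
      let ?a = "dq s v x y"
      define b where "b = indicator \<Omega> x + indicator \<Omega> y + \<bar>v x\<bar> + \<bar>v y\<bar>"
      have b: "1 + \<bar>v x\<bar> + \<bar>v y\<bar> \<le> b" using True by (auto simp: b_def indicator_def)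
      have hb: "h x + h y = ennreal b"
        by (simp add: h_def b_def ennreal_plus ennreal_indicator ac_simps)
      define \<kappa>r where "\<kappa>r = (if norm (x - y) < 1 then 1 else c * norm (x - y) powr - (n + s / 2))"
      have \<kappa>r: "\<kappa> x y = ennreal \<kappa>r" "0 \<le> \<kappa>r" using c by (auto simp: \<kappa>if \<kappa>r_def)
      have "?a - ?a powr p / p \<le> (p - 1) * (b * \<kappa>r)"
      proof (cases "norm (x - y) < 1")
        case True
        have "?a - ?a powr p / p \<le> (p - 1) * 1" using diff_powr_le[OF _ p, of ?a] by simp
        also have "\<dots> \<le> (p - 1) * b" using p b by (intro mult_left_mono) auto
        finally show ?thesis using True by (simp add: \<kappa>r_def)
      next
        case False
        have "?a - ?a powr p / p \<le> (p - 1) * (?a powr \<theta> / (1 - \<theta>))" using diff_powr_le_powr[OF _ p \<theta>, of ?a] by simp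
        also have "\<dots> \<le> (p - 1) * (b * \<kappa>r)"
        proof (rule mult_left_mono)
          define t where "t = \<bar>v x - v y\<bar>"
          have "t powr \<theta> \<le> 1 + t"
          proof (cases "t \<le> 1")
            case True
            then have "t powr \<theta> \<le> 1 powr \<theta>" using \<theta> by (intro powr_mono2) (auto simp: t_def)
            then show ?thesis by (simp add: t_def add_increasing2)
          next
            case False
            then have "t powr \<theta> \<le> t powr 1" using \<theta> by (intro powr_mono) auto
            then show ?thesis using False by simp
          qed
          also have "\<dots> \<le> b" using b unfolding t_def by linarith
          finally have "t powr \<theta> \<le> b" .
          moreover have "?a powr \<theta> = t powr \<theta> * norm (x - y) powr - (n + s / 2)"
            unfolding dq_def t_def n_def[symmetric] n\<theta>[symmetric] powr_minus_divide
            by (simp add: powr_divide powr_powr)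
          ultimately have "?a powr \<theta> \<le> b * norm (x - y) powr - (n + s / 2)" by (simp add: mult_right_mono)
          then have "?a powr \<theta> * c \<le> b * norm (x - y) powr - (n + s / 2) * c" using c by (rule mult_right_mono)
          then show "?a powr \<theta> / (1 - \<theta>) \<le> b * \<kappa>r" using False by (simp add: c_def \<kappa>r_def mult_ac)
        qed (use p in simp)
        finally show ?thesis .
      qed
      then have "?a \<le> 1 / p * ?a powr p + (p - 1) * (b * \<kappa>r)" by simp
      then have "ennreal ?a \<le> ennreal (1 / p * ?a powr p + (p - 1) * (b * \<kappa>r))" by (rule ennreal_leI)
      also have "\<dots> = ennreal (1 / p) * ennreal (?a powr p) + ennreal (p - 1) * (ennreal b * ennreal \<kappa>r)"
      proof -
        have b0: "0 \<le> b" using b by linarith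
        have "ennreal (1 / p * ?a powr p + (p - 1) * (b * \<kappa>r)) = ennreal (1 / p * ?a powr p) + ennreal ((p - 1) * (b * \<kappa>r))"
          using p b0 \<kappa>r(2) by (intro ennreal_plus mult_nonneg_nonneg) auto
        also have "ennreal (1 / p * ?a powr p) = ennreal (1 / p) * ennreal (?a powr p)" using p by (intro ennreal_mult) auto
        also have "ennreal ((p - 1) * (b * \<kappa>r)) = ennreal (p - 1) * (ennreal b * ennreal \<kappa>r)"
          using p b0 \<kappa>r(2) by (simp add: ennreal_mult')
        finally show ?thesis .
      qed
      also have "ennreal b * ennreal \<kappa>r = h x * \<kappa> x y + h y * \<kappa> x y"
        unfolding hb[symmetric] \<kappa>r(1) by (rule distrib_right)
      finally show ?thesis .
    qed (simp add: off dq_def)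
    have half: "(\<integral>\<^sup>+x. \<integral>\<^sup>+y. h x * \<kappa> x y \<partial>lborel \<partial>lborel) \<le> ennreal D * (\<integral>\<^sup>+x. h x \<partial>lborel)"
    proof -
      have "(\<integral>\<^sup>+x. \<integral>\<^sup>+y. h x * \<kappa> x y \<partial>lborel \<partial>lborel) = (\<integral>\<^sup>+x. h x * (\<integral>\<^sup>+y. \<kappa> x y \<partial>lborel) \<partial>lborel)"
        by (simp add: nn_integral_cmult)
      also have "\<dots> \<le> (\<integral>\<^sup>+x. h x * ennreal D \<partial>lborel)" by (intro nn_integral_mono mult_left_mono \<kappa>D) auto
      also have "\<dots> = ennreal D * (\<integral>\<^sup>+x. h x \<partial>lborel)" by (simp add: nn_integral_multc nn_integral_cmult mult.commute)
      finally show ?thesis .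
    qed
    have half': "(\<integral>\<^sup>+x. \<integral>\<^sup>+y. h y * \<kappa> x y \<partial>lborel \<partial>lborel) \<le> ennreal D * (\<integral>\<^sup>+x. h x \<partial>lborel)"
    proof -
      have "(\<integral>\<^sup>+x. \<integral>\<^sup>+y. h y * \<kappa> x y \<partial>lborel \<partial>lborel) = (\<integral>\<^sup>+y. \<integral>\<^sup>+x. h y * \<kappa> x y \<partial>lborel \<partial>lborel)"
        by (rule nn_integral_lborel_commute) measurable
      also have "\<dots> = (\<integral>\<^sup>+x. \<integral>\<^sup>+y. h x * \<kappa> x y \<partial>lborel \<partial>lborel)" using \<kappa>c by simp
      finally show ?thesis using half by simp
    qed
    have "frac_energy s 1 UNIV v \<le> (\<integral>\<^sup>+x. \<integral>\<^sup>+y. ennreal (1 / p) * ennreal (dq s v x y powr p) + ennreal (p - 1) * (h x * \<kappa> x y + h y * \<kappa> x y) \<partial>lborel \<partial>lborel)"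
      unfolding frac_energy_UNIV using pt by (auto intro!: nn_integral_mono)
    also have "\<dots> = ennreal (1 / p) * frac_energy s p UNIV v + ennreal (p - 1) * ((\<integral>\<^sup>+x. \<integral>\<^sup>+y. h x * \<kappa> x y \<partial>lborel \<partial>lborel) + (\<integral>\<^sup>+x. \<integral>\<^sup>+y. h y * \<kappa> x y \<partial>lborel \<partial>lborel))"
      unfolding frac_energy_UNIV by (simp add: nn_integral_add nn_integral_cmult)
    also have "\<dots> \<le> ennreal (1 / p) * frac_energy s p UNIV v + ennreal (p - 1) * (ennreal D * (\<integral>\<^sup>+x. h x \<partial>lborel) + ennreal D * (\<integral>\<^sup>+x. h x \<partial>lborel))"
      by (intro add_left_mono mult_left_mono add_mono half half') auto
    also have "ennreal D * (\<integral>\<^sup>+x. h x \<partial>lborel) + ennreal D * (\<integral>\<^sup>+x. h x \<partial>lborel) = ennreal (2 * D) * (\<integral>\<^sup>+x. h x \<partial>lborel)"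
      using D by (simp add: ennreal_mult' mult_2[symmetric] mult.assoc)
    finally show "frac_energy s 1 UNIV v \<le> ennreal (1 / p) * frac_energy s p UNIV v
      + ennreal (p - 1) * (ennreal (2 * D) * (emeasure lborel \<Omega> + (\<integral>\<^sup>+x. ennreal \<bar>v x\<bar> \<partial>lborel)))"
      unfolding hint .
  qed
qed

section \<open>The signed power\<close>

text \<open>For \<open>p > 1\<close>, \<open>p * spow p r\<close> is the derivative of
  \<open>\<bar>r\<bar> powr p\<close>.\<close>

definition spow :: "real \<Rightarrow> real \<Rightarrow> real" where
  "spow p r = sgn r * \<bar>r\<bar> powr (p - 1)"

lemma spow_measurable [measurable]: "spow p \<in> borel_measurable borel"
  unfolding spow_def by measurable

lemma spow_minus: "spow p (- r) = - spow p r"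
  by (simp add: spow_def sgn_minus)

lemma abs_spow: "1 < p \<Longrightarrow> \<bar>spow p r\<bar> = \<bar>r\<bar> powr (p - 1)"
  by (simp add: spow_def abs_mult abs_sgn_eq)

lemma spow_times_self: "1 < p \<Longrightarrow> spow p r * r = \<bar>r\<bar> powr p"
  by (cases "r = 0") (simp_all add: spow_def powr_diff sgn_if)

text \<open>A convex function lies above its tangents. Obtained from Young's inequality with the
  exponents \<open>p / (p - 1)\<close> and \<open>p\<close>, without differentiation.\<close>

lemma powr_convex_tangent:
  assumes p: "1 < p"
  shows "\<bar>x\<bar> powr p + p * spow p x * (y - x) \<le> \<bar>y\<bar> powr p"
proof -
  have "spow p x * y \<le> \<bar>x\<bar> powr (p - 1) * \<bar>y\<bar>"
    using abs_ge_self[of "spow p x * y"] by (simp add: abs_mult abs_spow[OF p])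
  also have "\<dots> \<le> (\<bar>x\<bar> powr (p - 1)) powr (p / (p - 1)) / (p / (p - 1)) + \<bar>y\<bar> powr p / p"
    using p by (intro Youngs_inequality) (auto simp: field_simps)
  also have "(\<bar>x\<bar> powr (p - 1)) powr (p / (p - 1)) = \<bar>x\<bar> powr p" using p by (simp add: powr_powr)
  finally have "p * (spow p x * y) \<le> p * (\<bar>x\<bar> powr p / (p / (p - 1)) + \<bar>y\<bar> powr p / p)"
    using p by (intro mult_left_mono) auto
  also have "\<dots> = (p - 1) * \<bar>x\<bar> powr p + \<bar>y\<bar> powr p" using p by (simp add: field_simps)
  finally show ?thesis using spow_times_self[OF p, of x] by (simp add: algebra_simps)
qed

text \<open>\<open>sgn\<close> jumps at 0, but there the factor
  \<open>\<bar>r\<bar> powr (p - 1)\<close> tends to 0; hence the separate case.\<close>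

lemma tendsto_spow:
  assumes p: "1 < p" and X: "X \<longlonglongrightarrow> r"
  shows "(\<lambda>k. spow p (X k)) \<longlonglongrightarrow> spow p r"
proof (cases "r = 0")
  case True
  have "(\<lambda>k. \<bar>X k\<bar> powr (p - 1)) \<longlonglongrightarrow> 0 powr (p - 1)"
    using tendsto_rabs[OF X] True p by (intro tendsto_powr' tendsto_const) auto
  then have "(\<lambda>k. \<bar>spow p (X k)\<bar>) \<longlonglongrightarrow> 0" using p by (simp add: abs_spow)
  then show ?thesis using True by (simp add: spow_def tendsto_rabs_zero_iff)
next
  case False
  then show ?thesis unfolding spow_def
    by (intro tendsto_mult tendsto_sgn X tendsto_powr tendsto_rabs tendsto_const) auto
qed

lemma abs_add_powr_le:
  fixes a b :: real
  assumes "0 < p"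
  shows "(\<bar>a\<bar> + \<bar>b\<bar>) powr p \<le> 2 powr p * (\<bar>a\<bar> powr p + \<bar>b\<bar> powr p)"
  using powr_add_cmult_le[OF assms, of "\<bar>a\<bar>" 1 "\<bar>b\<bar>"] by simp

section \<open>The variational problem\<close>

text \<open>The signed counterpart of \<open>dq\<close>, written on pairs: it is linear in
  \<open>u\<close>, as the pairing with a field \<open>z\<close> requires.\<close>

definition sdq :: "real \<Rightarrow> ('a::euclidean_space \<Rightarrow> real) \<Rightarrow> 'a \<times> 'a \<Rightarrow> real" where
  "sdq s u z = (u (fst z) - u (snd z)) / norm (fst z - snd z) powr (real DIM('a) + s)"

lemma sdq_measurable [measurable]:
  fixes u :: "'a::euclidean_space \<Rightarrow> real"
  assumes u: "u \<in> borel_measurable borel"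
  shows "sdq s u \<in> borel_measurable borel"
proof -
  have [measurable]: "(\<lambda>z :: 'a \<times> 'a. u (fst z)) \<in> borel_measurable borel" "(\<lambda>z :: 'a \<times> 'a. u (snd z)) \<in> borel_measurable borel"
    using borel_measurable_fst_borel by (auto intro: measurable_compose[OF _ u])
  have [measurable]: "(\<lambda>z :: 'a \<times> 'a. norm (fst z - snd z)) \<in> borel_measurable borel"
    by (intro borel_measurable_continuous_onI continuous_intros)
  show ?thesis unfolding sdq_def by measurable
qed

lemma abs_sdq: "\<bar>sdq s u z\<bar> = dq s u (fst z) (snd z)"
  by (simp add: sdq_def dq_def)

lemma sdq_add_cmult: "sdq s (\<lambda>x. u x + t * w x) z = sdq s u z + t * sdq s w z"
  by (simp add: sdq_def diff_divide_distrib add_divide_distrib distrib_left right_diff_distrib)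

lemma sdq_uminus: "sdq s (\<lambda>x. - u x) z = - sdq s u z"
  unfolding sdq_def minus_divide_left by (rule arg_cong2[where f="(/)"]) simp_all

lemma frac_energy_sdq:
  "u \<in> borel_measurable borel \<Longrightarrow> frac_energy s p UNIV u = (\<integral>\<^sup>+z. ennreal (\<bar>sdq s u z\<bar> powr p) \<partial>lborel)"
  by (simp add: frac_energy_pair abs_sdq)

locale frac_problem =
  fixes s :: real and \<Omega> :: "'a::euclidean_space set" and f :: "'a \<Rightarrow> real"
  assumes s: "0 < s" "s < 1" and \<Omega>: "open \<Omega>" "bounded \<Omega>" "lipschitz_boundary \<Omega>"
    and f: "f \<in> Lp_space (lebesgue_on \<Omega>) (real DIM('a) / s)"
    and f_le: "Lp_norm (lebesgue_on \<Omega>) (real DIM('a) / s) f \<le> ennreal (1 / (2 * sobolev_constant TYPE('a) s))"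
begin

lemma n_ge_1: "1 \<le> real DIM('a)" using DIM_positive[where 'a='a] by linarith

lemma q: "1 < (real DIM('a) / (real DIM('a) - s))" "1 < real DIM('a) / s" "1 / (real DIM('a) / s) + 1 / (real DIM('a) / (real DIM('a) - s)) = 1" "(real DIM('a) / (real DIM('a) - s)) / ((real DIM('a) / (real DIM('a) - s)) - 1) = real DIM('a) / s"
proof -
  define m where "m = real DIM('a)"
  have m: "s < m" "0 < m" using n_ge_1 s unfolding m_def by linarith+
  have "1 < m / (m - s)" "1 < m / s" "1 / (m / s) + 1 / (m / (m - s)) = 1" using m s by (auto simp: field_simps)
  moreover have "m / (m - s) - 1 = s / (m - s)" using m by (simp add: field_simps)
  then have "m / (m - s) / (m / (m - s) - 1) = m / s" using m by simp
  ultimately show "1 < real DIM('a) / (real DIM('a) - s)" "1 < real DIM('a) / s"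
    "1 / (real DIM('a) / s) + 1 / (real DIM('a) / (real DIM('a) - s)) = 1"
    "(real DIM('a) / (real DIM('a) - s)) / ((real DIM('a) / (real DIM('a) - s)) - 1) = real DIM('a) / s"
    unfolding m_def by auto
qed

lemma \<Omega>_sets [measurable]: "\<Omega> \<in> sets borel" using \<Omega>(1) by simp

lemma \<Omega>_finite: "emeasure lborel \<Omega> < \<infinity>" using emeasure_bounded_finite[OF \<Omega>(2)] by simp

text \<open>Borel representatives of the members of \<open>sobolev_space0 s 1 \<Omega>\<close>, by
  \<open>adm_sobolev_space0\<close> and \<open>sobolev_space0_adm\<close>. On them the energy of
  order 1 is a real number.\<close>

definition adm :: "('a \<Rightarrow> real) \<Rightarrow> bool" where
  "adm v \<longleftrightarrow> v \<in> borel_measurable borel \<and> (\<forall>x. x \<notin> \<Omega> \<longrightarrow> v x = 0) \<and>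
     (\<integral>\<^sup>+x. ennreal \<bar>v x\<bar> \<partial>lborel) < \<infinity> \<and> frac_energy s 1 UNIV v < \<infinity>"

definition E :: "('a \<Rightarrow> real) \<Rightarrow> real" where
  "E v = enn2real (frac_energy s 1 UNIV v)"

definition F :: "('a \<Rightarrow> real) \<Rightarrow> real" where
  "F v = (\<integral>x. f x * v x \<partial>lebesgue_on \<Omega>)"

lemma admD:
  assumes "adm v"
  shows "v \<in> borel_measurable borel" "\<And>x. x \<notin> \<Omega> \<Longrightarrow> v x = 0" "(\<integral>\<^sup>+x. ennreal \<bar>v x\<bar> \<partial>lborel) < \<infinity>"
    "frac_energy s 1 UNIV v < \<infinity>" "frac_energy s 1 UNIV v = ennreal (E v)"
  using assms by (auto simp: adm_def E_def)

lemma E_nonneg: "0 \<le> E v" by (simp add: E_def)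

lemma borel_lebesgue_on: "v \<in> borel_measurable borel \<Longrightarrow> v \<in> borel_measurable (lebesgue_on \<Omega>)"
  by (intro measurable_restrict_space1 measurable_completion) simp

lemma adm_add_cmult:
  assumes v: "adm v" and w: "adm w"
  shows "adm (\<lambda>x. v x + t * w x)" "E (\<lambda>x. v x + t * w x) \<le> E v + \<bar>t\<bar> * E w"
proof -
  note [measurable] = admD(1)[OF v] admD(1)[OF w]
  have tw: "frac_energy s 1 UNIV (\<lambda>x. t * w x) = ennreal \<bar>t\<bar> * frac_energy s 1 UNIV w"
  proof -
    have "dq s (\<lambda>x. t * w x) x y = \<bar>t\<bar> * dq s w x y" for x y
      by (simp add: dq_def abs_mult right_diff_distrib[symmetric])
    then show ?thesis by (simp add: frac_energy_UNIV ennreal_mult' nn_integral_cmult)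
  qed
  have e: "frac_energy s 1 UNIV (\<lambda>x. v x + t * w x) \<le> ennreal (E v + \<bar>t\<bar> * E w)"
    using frac_energy_triangle[of v "\<lambda>x. t * w x" UNIV s] E_nonneg[of v] E_nonneg[of w]
    by (simp add: tw admD(5)[OF v] admD(5)[OF w] ennreal_mult')
  then have efin: "frac_energy s 1 UNIV (\<lambda>x. v x + t * w x) < \<infinity>" by (rule order_le_less_trans) simp
  have "(\<integral>\<^sup>+x. ennreal \<bar>v x + t * w x\<bar> \<partial>lborel) \<le> (\<integral>\<^sup>+x. ennreal \<bar>v x\<bar> + ennreal \<bar>t\<bar> * ennreal \<bar>w x\<bar> \<partial>lborel)"
  proof (intro nn_integral_mono)
    fix x
    have "\<bar>v x + t * w x\<bar> \<le> \<bar>v x\<bar> + \<bar>t\<bar> * \<bar>w x\<bar>" using abs_triangle_ineq[of "v x" "t * w x"] by (simp add: abs_mult)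
    then show "ennreal \<bar>v x + t * w x\<bar> \<le> ennreal \<bar>v x\<bar> + ennreal \<bar>t\<bar> * ennreal \<bar>w x\<bar>"
      by (simp add: ennreal_leI flip: ennreal_mult' ennreal_plus)
  qed
  also have "\<dots> = (\<integral>\<^sup>+x. ennreal \<bar>v x\<bar> \<partial>lborel) + ennreal \<bar>t\<bar> * (\<integral>\<^sup>+x. ennreal \<bar>w x\<bar> \<partial>lborel)"
    by (simp add: nn_integral_add nn_integral_cmult)
  also have "\<dots> < \<infinity>" using admD(3)[OF v] admD(3)[OF w] by (simp add: ennreal_mult_less_top)
  finally show "adm (\<lambda>x. v x + t * w x)"
    unfolding adm_def using efin admD(2)[OF v] admD(2)[OF w] by auto
  have "E (\<lambda>x. v x + t * w x) \<le> enn2real (ennreal (E v + \<bar>t\<bar> * E w))"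
    unfolding E_def[of "\<lambda>x. v x + t * w x"] by (rule enn2real_mono[OF e]) simp
  then show "E (\<lambda>x. v x + t * w x) \<le> E v + \<bar>t\<bar> * E w" 
    using E_nonneg[of v] E_nonneg[of w] by (simp del: ennreal_plus)
qed

lemma adm_Lp:
  assumes v: "adm v"
  shows "v \<in> Lp_space (lebesgue_on \<Omega>) (real DIM('a) / (real DIM('a) - s))" "Lp_norm (lebesgue_on \<Omega>) (real DIM('a) / (real DIM('a) - s)) v \<le> ennreal (sobolev_constant TYPE('a) s * E v)"
    "Lp_norm lborel (real DIM('a) / (real DIM('a) - s)) v \<le> ennreal (sobolev_constant TYPE('a) s * E v)"
proof -
  note vb = admD(1)[OF v]
  have vl: "v \<in> borel_measurable lebesgue" using vb by (intro measurable_completion) simp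
  have L1: "Lp_norm lebesgue 1 v = (\<integral>\<^sup>+x. ennreal \<bar>v x\<bar> \<partial>lborel)"
    using Lp_norm_lebesgue_UNIV[of v v 1] by (simp add: Lp_norm_1)
  have G: "gagliardo_integral s 1 UNIV v = ennreal (E v)"
    using gagliardo_integral_1_eq[of UNIV v v s] vb admD(5)[OF v] by simp
  have "sobolev_norm s 1 UNIV v < \<infinity>"
    using admD(3)[OF v] by (simp add: sobolev_norm_1 lebesgue_on_UNIV_eq L1 G)
  from sobolev_constant_inequality[OF s vl this]
  have le: "Lp_norm lborel (real DIM('a) / (real DIM('a) - s)) v \<le> ennreal (sobolev_constant TYPE('a) s * E v)"
    using Lp_norm_lebesgue_UNIV[of v v "real DIM('a) / (real DIM('a) - s)"] by (simp add: G ennreal_mult')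
  then show "Lp_norm lborel (real DIM('a) / (real DIM('a) - s)) v \<le> ennreal (sobolev_constant TYPE('a) s * E v)" .
  have eq: "Lp_norm (lebesgue_on \<Omega>) (real DIM('a) / (real DIM('a) - s)) v = Lp_norm lborel (real DIM('a) / (real DIM('a) - s)) v"
    by (rule Lp_norm_lebesgue_on_lborel) (use admD(2)[OF v] in auto)
  show "Lp_norm (lebesgue_on \<Omega>) (real DIM('a) / (real DIM('a) - s)) v \<le> ennreal (sobolev_constant TYPE('a) s * E v)" using le eq by simp
  then show "v \<in> Lp_space (lebesgue_on \<Omega>) (real DIM('a) / (real DIM('a) - s))"
    unfolding Lp_space_def using borel_lebesgue_on[OF vb] by (auto intro: order_le_less_trans)
qed

lemma S_nonneg: "0 \<le> sobolev_constant TYPE('a) s"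
proof -
  have "sobolev_norm s 1 UNIV (\<lambda>x::'a. 0) < \<infinity>"
    using gagliardo_integral_1_eq[of UNIV "\<lambda>x::'a. 0" "\<lambda>x. 0" s] by (simp add: sobolev_norm_1 Lp_norm_1 frac_energy_def dq_def)
  then show ?thesis using sobolev_constant_inequality(2)[OF s, of "\<lambda>x. 0"] by simp
qed

text \<open>The factor by which \<open>F\<close> is bounded in terms of \<open>E\<close>, from
  Hoelder and the Sobolev inequality; the critical value is \<open>1 / 2\<close>.\<close>

definition fS :: real where
  "fS = enn2real (Lp_norm (lebesgue_on \<Omega>) (real DIM('a) / s) f) * sobolev_constant TYPE('a) s"

lemma fS: "0 \<le> fS" "fS \<le> 1 / 2"
  and fS_strict: "Lp_norm (lebesgue_on \<Omega>) (real DIM('a) / s) f < ennreal (1 / (2 * sobolev_constant TYPE('a) s)) \<Longrightarrow> fS < 1 / 2"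
proof -
  have fin: "Lp_norm (lebesgue_on \<Omega>) (real DIM('a) / s) f < \<infinity>" using f by (simp add: Lp_space_def)
  define r where "r = enn2real (Lp_norm (lebesgue_on \<Omega>) (real DIM('a) / s) f)"
  have r: "Lp_norm (lebesgue_on \<Omega>) (real DIM('a) / s) f = ennreal r" "0 \<le> r" using fin by (auto simp: r_def)
  show "0 \<le> fS" using S_nonneg by (simp add: fS_def)
  have "r \<le> 1 / (2 * sobolev_constant TYPE('a) s)" using f_le r S_nonneg by simp
  then have "r * sobolev_constant TYPE('a) s \<le> 1 / (2 * sobolev_constant TYPE('a) s) * sobolev_constant TYPE('a) s" using S_nonneg by (rule mult_right_mono)
  \<comment> \<open>For a Sobolev constant 0 the product is 0, as division by 0 gives 0.\<close>
  also have "\<dots> \<le> 1 / 2" by (cases "sobolev_constant TYPE('a) s = 0") auto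
  finally show "fS \<le> 1 / 2" by (simp add: fS_def r_def)
  assume "Lp_norm (lebesgue_on \<Omega>) (real DIM('a) / s) f < ennreal (1 / (2 * sobolev_constant TYPE('a) s))"
  then have lt: "r < 1 / (2 * sobolev_constant TYPE('a) s)" using r by (simp add: ennreal_less_iff)
  then have "sobolev_constant TYPE('a) s \<noteq> 0" using r(2) by (cases "sobolev_constant TYPE('a) s = 0") auto
  then have S: "0 < sobolev_constant TYPE('a) s" using S_nonneg by simp
  then have "r * sobolev_constant TYPE('a) s < 1 / (2 * sobolev_constant TYPE('a) s) * sobolev_constant TYPE('a) s" using lt by (intro mult_strict_right_mono) auto
  then show "fS < 1 / 2" using S by (simp add: fS_def r_def)
qed

lemma F_adm:
  assumes v: "adm v"
  shows "integrable (lebesgue_on \<Omega>) (\<lambda>x. f x * v x)" "\<bar>F v\<bar> \<le> fS * E v"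
proof -
  note H = Holder_integral[OF q(2,1,3) f adm_Lp(1)[OF v]]
  show "integrable (lebesgue_on \<Omega>) (\<lambda>x. f x * v x)" by (rule H(1))
  have fin: "Lp_norm (lebesgue_on \<Omega>) (real DIM('a) / s) f < \<infinity>" using f by (simp add: Lp_space_def)
  have "ennreal \<bar>F v\<bar> \<le> Lp_norm (lebesgue_on \<Omega>) (real DIM('a) / s) f * ennreal (sobolev_constant TYPE('a) s * E v)"
    unfolding F_def using H(2) adm_Lp(2)[OF v] by (meson mult_left_mono order_trans zero_le)
  also have "\<dots> = ennreal (enn2real (Lp_norm (lebesgue_on \<Omega>) (real DIM('a) / s) f)) * ennreal (sobolev_constant TYPE('a) s * E v)" using fin by simp
  also have "\<dots> = ennreal (fS * E v)" by (simp add: fS_def ennreal_mult'[symmetric] mult.assoc)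
  finally show "\<bar>F v\<bar> \<le> fS * E v" using fS(1) E_nonneg[of v] by simp
qed

text \<open>The meaning of the threshold for the norm of \<open>f\<close>: the energy
  \<open>E v / 2 - F v\<close> of order 1 is nonnegative, so 0 is a minimizer. In the case of
  equality this gives no bound on \<open>E v\<close>.\<close>

lemma F_le_half: "adm v \<Longrightarrow> \<bar>F v\<bar> \<le> E v / 2"
  using F_adm(2)[of v] mult_right_mono[OF fS(2) E_nonneg[of v]] by simp

lemma F_add_cmult:
  assumes "adm v" "adm w"
  shows "F (\<lambda>x. v x + t * w x) = F v + t * F w"
proof -
  have "(\<lambda>x. f x * (v x + t * w x)) = (\<lambda>x. f x * v x + t * (f x * w x))" by (simp add: algebra_simps)
  then show ?thesis
    unfolding F_def using F_adm(1)[OF assms(1)] F_adm(1)[OF assms(2)] by simp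
qed

lemma adm_test_function:
  assumes "\<phi> \<in> test_functions \<Omega>"
  shows "adm \<phi>"
proof -
  have "smooth_compact \<phi>" by (rule test_functions_smooth_compact[OF assms])
  then show ?thesis unfolding adm_def
    using test_functions_measurable[OF assms] test_functions_eq_0[OF assms] smooth_compact_integrable_powr[of \<phi> 1]
      smooth_compact_energy_finite[of \<phi> s 1] s by simp
qed

lemma adm_zero: "adm (\<lambda>x. 0)"
  by (rule adm_test_function[OF zero_in_test_functions])

lemma adm_sobolev_space0:
  assumes v: "adm v"
  shows "v \<in> sobolev_space0 s 1 \<Omega>"
  by (rule sobolev_space0_1I[OF s \<Omega> _ _ admD(1)[OF v] _ _ admD(3,4)[OF v]])
     (use admD(1,2)[OF v] in \<open>auto intro: measurable_completion\<close>)

lemma sobolev_space0_rep: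
  assumes "u \<in> sobolev_space0 r p \<Omega>"
  obtains v where "v \<in> borel_measurable borel" "\<And>x. x \<notin> \<Omega> \<Longrightarrow> v x = 0" "AE x in lborel. u x = v x"
proof -
  have u: "u \<in> borel_measurable lebesgue" "\<And>x. x \<notin> \<Omega> \<Longrightarrow> u x = 0" using assms by (auto simp: sobolev_space0_def)
  show thesis using borel_representative[OF u(1) \<Omega>_sets u(2)] that by blast
qed

lemma sobolev_space0_adm:
  assumes u: "u \<in> sobolev_space0 s 1 \<Omega>"
  obtains v where "adm v" "AE x in lborel. u x = v x"
proof -
  obtain v where v: "v \<in> borel_measurable borel" "\<And>x. x \<notin> \<Omega> \<Longrightarrow> v x = 0" "AE x in lborel. u x = v x"
    using sobolev_space0_rep[OF u] by blast
  have "adm v" unfolding adm_def using v sobolev_space0_1D[OF s \<Omega> u v(1,3,2)] by auto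
  with v(3) show thesis using that by blast
qed

lemma F_cong_AE:
  assumes "u \<in> borel_measurable lebesgue" "v \<in> borel_measurable borel" "AE x in lborel. u x = v x"
  shows "F u = F v"
  unfolding F_def
proof (rule integral_cong_AE)
  have fm: "f \<in> borel_measurable (lebesgue_on \<Omega>)" using f by (simp add: Lp_space_def)
  show "(\<lambda>x. f x * u x) \<in> borel_measurable (lebesgue_on \<Omega>)"
    using fm measurable_restrict_space1[OF assms(1)] by (rule borel_measurable_times)
  show "(\<lambda>x. f x * v x) \<in> borel_measurable (lebesgue_on \<Omega>)"
    using fm borel_lebesgue_on[OF assms(2)] by (rule borel_measurable_times)
  have "AE x in lebesgue_on \<Omega>. u x = v x"
    unfolding AE_lebesgue_on[OF \<Omega>_sets] using assms(3) by eventually_elim simp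
  then show "AE x in lebesgue_on \<Omega>. f x * u x = f x * v x" by eventually_elim simp
qed

lemma energy_eq:
  assumes "u \<in> borel_measurable lebesgue" "v \<in> borel_measurable borel" "AE x in lborel. u x = v x" "0 < p"
    and fin: "frac_energy s p UNIV v < \<infinity>"
  shows "energy \<Omega> f (shifted_order DIM('a) s p) p u = ereal (enn2real (frac_energy s p UNIV v) / (2 * p) - F v)"
proof -
  obtain e where e: "frac_energy s p UNIV v = ennreal e" "0 \<le> e" using fin by (cases "frac_energy s p UNIV v") auto
  have g: "gagliardo_integral (shifted_order DIM('a) s p) p UNIV u = ennreal e"
    using gagliardo_integral_eq[of UNIV v u p s] assms e by simp
  show ?thesis
    unfolding energy_def g F_def[symmetric] F_cong_AE[OF assms(1-3)] e(1) using e(2) by (simp add: enn2ereal_ennreal)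
qed

lemma energy_top:
  assumes "v \<in> borel_measurable borel" "AE x in lborel. u x = v x" "0 < p"
    and "frac_energy s p UNIV v = \<infinity>"
  shows "energy \<Omega> f (shifted_order DIM('a) s p) p u = \<infinity>"
  using gagliardo_integral_eq[of UNIV v u p s] assms by (simp add: energy_def)

lemma energy_1_eq:
  assumes "u \<in> borel_measurable lebesgue" "adm v" "AE x in lborel. u x = v x"
  shows "energy \<Omega> f s 1 u = ereal (E v / 2 - F v)"
  using energy_eq[OF assms(1) admD(1)[OF assms(2)] assms(3), of 1] admD(4)[OF assms(2)] by (simp add: E_def)

lemma sobolev_space0_lebesgue: "u \<in> sobolev_space0 r p \<Omega> \<Longrightarrow> u \<in> borel_measurable lebesgue"
  by (simp add: sobolev_space0_def)

text \<open>Competitors may be changed on null sets, so it suffices to compete with admissible ones,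
  whose energies are real.\<close>

lemma adm_minimizer_iff:
  assumes v: "adm v"
  shows "is_minimizer \<Omega> f s 1 v \<longleftrightarrow> (\<forall>w. adm w \<longrightarrow> E v / 2 - F v \<le> E w / 2 - F w)"
proof -
  have ev: "energy \<Omega> f s 1 w = ereal (E w / 2 - F w)" if "adm w" for w
    by (rule energy_1_eq[OF _ that]) (use admD(1)[OF that] in \<open>auto intro: measurable_completion\<close>)
  show ?thesis
  proof
    assume "is_minimizer \<Omega> f s 1 v"
    then show "\<forall>w. adm w \<longrightarrow> E v / 2 - F v \<le> E w / 2 - F w"
      unfolding is_minimizer_def using adm_sobolev_space0 ev v by fastforce
  next
    assume *: "\<forall>w. adm w \<longrightarrow> E v / 2 - F v \<le> E w / 2 - F w"
    show "is_minimizer \<Omega> f s 1 v"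
      unfolding is_minimizer_def
    proof (intro conjI ballI adm_sobolev_space0 v)
      fix w assume w: "w \<in> sobolev_space0 s 1 \<Omega>"
      obtain w' where w': "adm w'" "AE x in lborel. w x = w' x" using sobolev_space0_adm[OF w] by blast
      have "energy \<Omega> f s 1 w = ereal (E w' / 2 - F w')"
        by (rule energy_1_eq[OF sobolev_space0_lebesgue[OF w] w'])
      then show "energy \<Omega> f s 1 v \<le> energy \<Omega> f s 1 w" using * w'(1) ev[OF v] by simp
    qed
  qed
qed

text \<open>Hoelder against \<open>indicator \<Omega>\<close>, whose norm is finite because
  \<open>\<Omega>\<close> is bounded, followed by the Sobolev inequality.\<close>

lemma adm_L1_bound:
  obtains C where "0 \<le> C" "\<And>v. adm v \<Longrightarrow> (\<integral>\<^sup>+x. ennreal \<bar>v x\<bar> \<partial>lborel) \<le> ennreal (C * E v)"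
proof -
  obtain m where m: "emeasure lborel \<Omega> = ennreal m" "0 \<le> m" using \<Omega>_finite by (cases "emeasure lborel \<Omega>") auto
  have ind: "(indicator \<Omega> y :: real) powr (real DIM('a) / s) = indicator \<Omega> y" for y by (auto simp: indicator_def)
  have L: "Lp_norm lborel (real DIM('a) / s) (indicator \<Omega>) = ennreal (m powr (1 / (real DIM('a) / s)))"
    by (rule Lp_norm_eq_powr) (use m in \<open>auto simp: ind ennreal_indicator\<close>)
  show thesis
  proof (rule that[of "sobolev_constant TYPE('a) s * m powr (1 / (real DIM('a) / s))"])
    show "0 \<le> sobolev_constant TYPE('a) s * m powr (1 / (real DIM('a) / s))" using S_nonneg by simp
    fix v assume v: "adm v"
    have "(\<integral>\<^sup>+x. ennreal \<bar>v x\<bar> \<partial>lborel) = (\<integral>\<^sup>+x. ennreal \<bar>indicator \<Omega> x * v x\<bar> \<partial>lborel)"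
      using admD(2)[OF v] by (intro nn_integral_cong) (auto simp: indicator_def)
    also have "\<dots> \<le> Lp_norm lborel (real DIM('a) / s) (indicator \<Omega>) * Lp_norm lborel (real DIM('a) / (real DIM('a) - s)) v"
      using q admD(1)[OF v] adm_Lp(3)[OF v] L
      by (intro Holder_inequality_nn) (auto intro: order_le_less_trans)
    also have "\<dots> \<le> ennreal (m powr (1 / (real DIM('a) / s))) * ennreal (sobolev_constant TYPE('a) s * E v)"
      unfolding L by (intro mult_left_mono adm_Lp(3)[OF v]) auto
    also have "\<dots> = ennreal (sobolev_constant TYPE('a) s * m powr (1 / (real DIM('a) / s)) * E v)"
      by (subst ennreal_mult'[symmetric]) (auto simp: mult_ac)
    finally show "(\<integral>\<^sup>+x. ennreal \<bar>v x\<bar> \<partial>lborel) \<le> ennreal (sobolev_constant TYPE('a) s * m powr (1 / (real DIM('a) / s)) * E v)" .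
  qed
qed

section \<open>Minimizers of order \<open>p > 1\<close>\<close>

text \<open>Membership in the space controls pairs inside \<open>\<Omega>\<close> only. Finiteness
  over all pairs follows from minimality, because the competitor 0 has finite energy;
  \<open>frac_energy_gap\<close> then gives finite energy of order 1.\<close>

lemma minimizer_p_adm:
  assumes p: "1 < p" and u: "is_minimizer \<Omega> f (shifted_order DIM('a) s p) p u"
    and v: "v \<in> borel_measurable borel" "\<And>x. x \<notin> \<Omega> \<Longrightarrow> v x = 0" "AE x in lborel. u x = v x"
  shows "frac_energy s p UNIV v < \<infinity>" "adm v"
proof -
  let ?r = "shifted_order DIM('a) s p"
  have us: "u \<in> sobolev_space0 ?r p \<Omega>" and le: "\<And>w. w \<in> sobolev_space0 ?r p \<Omega> \<Longrightarrow> energy \<Omega> f ?r p u \<le> energy \<Omega> f ?r p w"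
    using u by (auto simp: is_minimizer_def)
  have z: "(\<lambda>x. 0) \<in> sobolev_space0 ?r p \<Omega>"
    using test_functions_in_sobolev_space0[OF zero_in_test_functions _ \<Omega>(1), of p s] p by simp
  have "energy \<Omega> f ?r p (\<lambda>x. 0) = ereal (enn2real (frac_energy s p UNIV (\<lambda>x::'a. 0)) / (2 * p) - F (\<lambda>x. 0))"
    using p by (intro energy_eq) (auto simp: frac_energy_def dq_def)
  then have "energy \<Omega> f ?r p u \<noteq> \<infinity>" using le[OF z] by auto
  then show fin: "frac_energy s p UNIV v < \<infinity>"
    using energy_top[OF v(1,3), of p] p by (cases "frac_energy s p UNIV v = \<infinity>") (auto simp: less_top)
  have L1: "(\<integral>\<^sup>+x. ennreal \<bar>v x\<bar> \<partial>lborel) < \<infinity>"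
    by (rule sobolev_space0_integrable[OF \<Omega>(1,2) _ us v(1,3,2)]) (use p in auto)
  obtain C where C: "0 \<le> C" "\<And>v p. v \<in> borel_measurable borel \<Longrightarrow> (\<And>x. x \<notin> \<Omega> \<Longrightarrow> v x = 0) \<Longrightarrow> 1 < p \<Longrightarrow>
    frac_energy s 1 UNIV v \<le> ennreal (1 / p) * frac_energy s p UNIV v
      + ennreal (p - 1) * (ennreal C * (emeasure lborel \<Omega> + (\<integral>\<^sup>+x. ennreal \<bar>v x\<bar> \<partial>lborel)))"
    using frac_energy_gap[OF s \<Omega>_sets] by blast
  have "frac_energy s 1 UNIV v < \<infinity>"
    by (rule order_le_less_trans[OF C(2)[OF v(1,2) p]])
       (use fin L1 \<Omega>_finite in \<open>auto simp: ennreal_mult_less_top\<close>)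
  then show "adm v" unfolding adm_def using v L1 by auto
qed

text \<open>By convexity, in the form of the tangent at the end point \<open>A z + t * B z\<close>,
  the increment of the power is at most \<open>p * t\<close> times the signed power there times
  \<open>B z\<close>. Dividing by \<open>t\<close> and letting it tend to 0 gives one
  inequality.\<close>

lemma euler_lagrange_le:
  assumes p: "1 < p" and u: "is_minimizer \<Omega> f (shifted_order DIM('a) s p) p u"
    and v: "v \<in> borel_measurable borel" "\<And>x. x \<notin> \<Omega> \<Longrightarrow> v x = 0" "AE x in lborel. u x = v x"
    and w: "w \<in> sobolev_space0 (shifted_order DIM('a) s p) p \<Omega>"
    and w': "adm w'" "AE x in lborel. w x = w' x" "frac_energy s p UNIV w' < \<infinity>"
  shows "integrable lborel (\<lambda>z. spow p (sdq s v z) * sdq s w' z)"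
    and "F w' \<le> (\<integral>z. spow p (sdq s v z) * sdq s w' z \<partial>lborel) / 2"
proof -
  let ?r = "shifted_order DIM('a) s p"
  note vadm = minimizer_p_adm(2)[OF p u v] and vfin = minimizer_p_adm(1)[OF p u v]
  note [measurable] = v(1) admD(1)[OF w'(1)]
  define A where "A = sdq s v"
  define B where "B = sdq s w'"
  have [measurable]: "A \<in> borel_measurable borel" "B \<in> borel_measurable borel" unfolding A_def B_def by measurable
  have us: "u \<in> sobolev_space0 ?r p \<Omega>" and le: "\<And>w. w \<in> sobolev_space0 ?r p \<Omega> \<Longrightarrow> energy \<Omega> f ?r p u \<le> energy \<Omega> f ?r p w"
    using u by (auto simp: is_minimizer_def)
  \<comment> \<open>A common majorant, for all \<open>t\<close> in \<open>[0, 1]\<close>, of the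
    powers and of the signed powers times \<open>B\<close>.\<close>
  define D where "D = (\<lambda>z. (\<bar>A z\<bar> + \<bar>B z\<bar>) powr p)"
  have [measurable]: "D \<in> borel_measurable borel" unfolding D_def by measurable
  have Dint: "integrable lborel D"
  proof (rule integrableI_bounded)
    have "(\<integral>\<^sup>+z. ennreal (norm (D z)) \<partial>lborel) \<le> (\<integral>\<^sup>+z. ennreal (2 powr p) * (ennreal (\<bar>A z\<bar> powr p) + ennreal (\<bar>B z\<bar> powr p)) \<partial>lborel)"
    proof (intro nn_integral_mono)
      fix z
      show "ennreal (norm (D z)) \<le> ennreal (2 powr p) * (ennreal (\<bar>A z\<bar> powr p) + ennreal (\<bar>B z\<bar> powr p))"
        using abs_add_powr_le[of p "A z" "B z"] p by (simp add: D_def ennreal_leI flip: ennreal_mult' ennreal_plus)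
    qed
    also have "\<dots> = ennreal (2 powr p) * (frac_energy s p UNIV v + frac_energy s p UNIV w')"
      by (simp add: nn_integral_cmult nn_integral_add A_def B_def frac_energy_sdq)
    also have "\<dots> < \<infinity>" using vfin w'(3) by (simp add: ennreal_mult_less_top)
    finally show "(\<integral>\<^sup>+z. ennreal (norm (D z)) \<partial>lborel) < \<infinity>" .
  qed measurable
  have D1: "\<bar>A z + t * B z\<bar> powr p \<le> D z" if "0 \<le> t" "t \<le> 1" for t z
  proof -
    have "\<bar>A z + t * B z\<bar> \<le> \<bar>A z\<bar> + \<bar>t * B z\<bar>" by (rule abs_triangle_ineq)
    also have "\<dots> \<le> \<bar>A z\<bar> + \<bar>B z\<bar>" using that by (simp add: abs_mult mult_left_le_one_le)
    finally show ?thesis unfolding D_def using p by (intro powr_mono2) auto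
  qed
  have D2: "\<bar>spow p (A z + t * B z) * B z\<bar> \<le> D z" if "0 \<le> t" "t \<le> 1" for t z
  proof -
    have "\<bar>A z + t * B z\<bar> \<le> \<bar>A z\<bar> + \<bar>t * B z\<bar>" by (rule abs_triangle_ineq)
    also have "\<dots> \<le> \<bar>A z\<bar> + \<bar>B z\<bar>" using that by (simp add: abs_mult mult_left_le_one_le)
    finally have "\<bar>A z + t * B z\<bar> powr (p - 1) * \<bar>B z\<bar> \<le> (\<bar>A z\<bar> + \<bar>B z\<bar>) powr (p - 1) * (\<bar>A z\<bar> + \<bar>B z\<bar>)"
      using p by (intro mult_mono powr_mono2) auto
    also have "\<dots> = D z"
      by (cases "\<bar>A z\<bar> + \<bar>B z\<bar> = 0") (use p in \<open>auto simp: D_def powr_diff\<close>)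
    finally show ?thesis using p by (simp add: abs_mult abs_spow)
  qed
  have int1: "integrable lborel (\<lambda>z. \<bar>A z + t * B z\<bar> powr p)" if "0 \<le> t" "t \<le> 1" for t
    by (rule Bochner_Integration.integrable_bound[OF Dint]) (use D1[OF that] in \<open>auto intro!: AE_I2 order_trans[OF _ abs_ge_self]\<close>)
  have int2: "integrable lborel (\<lambda>z. spow p (A z + t * B z) * B z)" if "0 \<le> t" "t \<le> 1" for t
    by (rule Bochner_Integration.integrable_bound[OF Dint]) (use D2[OF that] in \<open>auto intro!: AE_I2 order_trans[OF _ abs_ge_self]\<close>)
  show "integrable lborel (\<lambda>z. spow p (sdq s v z) * sdq s w' z)"
    using int2[of 0] by (simp add: A_def B_def)
  have en: "frac_energy s p UNIV (\<lambda>x. v x + t * w' x) = ennreal (\<integral>z. \<bar>A z + t * B z\<bar> powr p \<partial>lborel)" if "0 \<le> t" "t \<le> 1" for t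
  proof -
    have "frac_energy s p UNIV (\<lambda>x. v x + t * w' x) = (\<integral>\<^sup>+z. ennreal (\<bar>A z + t * B z\<bar> powr p) \<partial>lborel)"
      by (simp add: frac_energy_sdq sdq_add_cmult A_def B_def)
    also have "\<dots> = ennreal (\<integral>z. \<bar>A z + t * B z\<bar> powr p \<partial>lborel)"
      by (rule nn_integral_eq_integral[OF int1[OF that]]) simp
    finally show ?thesis .
  qed
  have main: "F w' \<le> (\<integral>z. spow p (A z + t * B z) * B z \<partial>lborel) / 2" if t: "0 < t" "t \<le> 1" for t
  proof -
    define I0 where "I0 = (\<integral>z. \<bar>A z\<bar> powr p \<partial>lborel)"
    define It where "It = (\<integral>z. \<bar>A z + t * B z\<bar> powr p \<partial>lborel)"
    have I0: "0 \<le> I0" "0 \<le> It" by (auto simp: I0_def It_def)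
    have e0: "frac_energy s p UNIV v = ennreal I0" using en[of 0] by (simp add: I0_def)
    have et: "frac_energy s p UNIV (\<lambda>x. v x + t * w' x) = ennreal It" unfolding It_def by (rule en) (use t in auto)
    have "energy \<Omega> f ?r p u = ereal (I0 / (2 * p) - F v)"
      using energy_eq[OF sobolev_space0_lebesgue[OF us] v(1,3), of p] p e0 I0 by simp
    moreover have "energy \<Omega> f ?r p (\<lambda>x. u x + t * w x) = ereal (It / (2 * p) - F (\<lambda>x. v x + t * w' x))"
    proof -
      have "AE x in lborel. u x + t * w x = v x + t * w' x" using v(3) w'(2) by eventually_elim simp
      moreover have "(\<lambda>x. u x + t * w x) \<in> borel_measurable lebesgue"
        using sobolev_space0_lebesgue[OF us] sobolev_space0_lebesgue[OF w] by measurable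
      ultimately show ?thesis
        using energy_eq[of "\<lambda>x. u x + t * w x" "\<lambda>x. v x + t * w' x" p] p et I0 by simp
    qed
    moreover have "energy \<Omega> f ?r p u \<le> energy \<Omega> f ?r p (\<lambda>x. u x + t * w x)"
      by (rule le[OF sobolev_space0_add_cmult[OF \<Omega>(1) _ us w]]) (use p in simp)
    ultimately have "t * F w' \<le> (It - I0) / (2 * p)"
      by (simp add: F_add_cmult[OF vadm w'(1)] diff_divide_distrib)
    also have "It - I0 = (\<integral>z. \<bar>A z + t * B z\<bar> powr p - \<bar>A z\<bar> powr p \<partial>lborel)"
      unfolding It_def I0_def using int1[of t] int1[of 0] t by simp
    also have "\<dots> / (2 * p) \<le> (\<integral>z. p * (t * (spow p (A z + t * B z) * B z)) \<partial>lborel) / (2 * p)"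
    proof (intro divide_right_mono integral_mono)
      show "integrable lborel (\<lambda>z. \<bar>A z + t * B z\<bar> powr p - \<bar>A z\<bar> powr p)" using int1[of t] int1[of 0] t by simp
      show "integrable lborel (\<lambda>z. p * (t * (spow p (A z + t * B z) * B z)))" using int2[of t] t by simp
      fix z
      show "\<bar>A z + t * B z\<bar> powr p - \<bar>A z\<bar> powr p \<le> p * (t * (spow p (A z + t * B z) * B z))"
        using powr_convex_tangent[OF p, of "A z + t * B z" "A z"] by (simp add: algebra_simps)
    qed (use p in simp)
    also have "\<dots> = t * ((\<integral>z. spow p (A z + t * B z) * B z \<partial>lborel) / 2)" using p by simp
    finally show ?thesis using t by simp
  qed
  have "(\<lambda>k. \<integral>z. spow p (A z + (1 / real (Suc k)) * B z) * B z \<partial>lborel) \<longlonglongrightarrow> (\<integral>z. spow p (A z) * B z \<partial>lborel)"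
  proof (rule integral_dominated_convergence[where w=D])
    show "AE z in lborel. (\<lambda>k. spow p (A z + (1 / real (Suc k)) * B z) * B z) \<longlonglongrightarrow> spow p (A z) * B z"
    proof (intro AE_I2)
      fix z
      have "(\<lambda>k. A z + (1 / real (Suc k)) * B z) \<longlonglongrightarrow> A z + 0 * B z"
        by (intro tendsto_add tendsto_mult tendsto_const LIMSEQ_Suc[OF lim_1_over_n])
      then have "(\<lambda>k. A z + (1 / real (Suc k)) * B z) \<longlonglongrightarrow> A z" by simp
      from tendsto_spow[OF p this] show "(\<lambda>k. spow p (A z + (1 / real (Suc k)) * B z) * B z) \<longlonglongrightarrow> spow p (A z) * B z"
        by (rule tendsto_mult_right)
    qed
    show "AE z in lborel. norm (spow p (A z + (1 / real (Suc k)) * B z) * B z) \<le> D z" for k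
      using D2[of "1 / real (Suc k)"] by (auto simp: field_simps)
  qed (use Dint in measurable)
  then have "(\<lambda>k. (\<integral>z. spow p (A z + (1 / real (Suc k)) * B z) * B z \<partial>lborel) / 2) \<longlonglongrightarrow> (\<integral>z. spow p (A z) * B z \<partial>lborel) / 2"
    by (intro tendsto_divide tendsto_const) auto
  then show "F w' \<le> (\<integral>z. spow p (sdq s v z) * sdq s w' z \<partial>lborel) / 2"
    unfolding A_def[symmetric] B_def[symmetric]
    by (rule LIMSEQ_le_const) (intro exI allI impI main, simp_all)
qed

text \<open>The inequality for \<open>w\<close> and for \<open>- w\<close>.\<close>

lemma euler_lagrange:
  assumes p: "1 < p" and u: "is_minimizer \<Omega> f (shifted_order DIM('a) s p) p u"
    and v: "v \<in> borel_measurable borel" "\<And>x. x \<notin> \<Omega> \<Longrightarrow> v x = 0" "AE x in lborel. u x = v x"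
    and w: "w \<in> sobolev_space0 (shifted_order DIM('a) s p) p \<Omega>"
    and w': "adm w'" "AE x in lborel. w x = w' x" "frac_energy s p UNIV w' < \<infinity>"
  shows "(\<integral>z. spow p (sdq s v z) * sdq s w' z \<partial>lborel) / 2 = F w'"
proof -
  have p0: "0 < p" using p by simp
  have "(\<lambda>x. 0 + (- 1) * w x) \<in> sobolev_space0 (shifted_order DIM('a) s p) p \<Omega>"
    by (rule sobolev_space0_add_cmult[OF \<Omega>(1) p0 test_functions_in_sobolev_space0[OF zero_in_test_functions p0 \<Omega>(1)] w])
  then have mw: "(\<lambda>x. - w x) \<in> sobolev_space0 (shifted_order DIM('a) s p) p \<Omega>" by simp
  have madm: "adm (\<lambda>x. - w' x)" using adm_add_cmult(1)[OF adm_zero w'(1), of "-1"] by simp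
  have mae: "AE x in lborel. - w x = - w' x" using w'(2) by eventually_elim simp
  have Fm: "F (\<lambda>x. - w' x) = - F w'" by (simp add: F_def)
  have "- F w' \<le> (\<integral>z. spow p (sdq s v z) * sdq s (\<lambda>x. - w' x) z \<partial>lborel) / 2"
    using euler_lagrange_le(2)[OF p u v mw madm mae] w'(3) by (simp add: Fm)
  then have "- F w' \<le> - ((\<integral>z. spow p (sdq s v z) * sdq s w' z \<partial>lborel) / 2)" by (simp add: sdq_uminus)
  with euler_lagrange_le(2)[OF p u v w w'] show ?thesis by linarith
qed

text \<open>Testing the equation with the minimizer itself shows that its energy of order
  \<open>p\<close> equals \<open>2 * F v\<close>, and \<open>F v \<le> E v / 2\<close>.\<close>

lemma minimizer_p_energy_le:
  assumes p: "1 < p" and u: "is_minimizer \<Omega> f (shifted_order DIM('a) s p) p u"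
    and v: "v \<in> borel_measurable borel" "\<And>x. x \<notin> \<Omega> \<Longrightarrow> v x = 0" "AE x in lborel. u x = v x"
  shows "frac_energy s p UNIV v \<le> ennreal (E v)"
proof -
  note vadm = minimizer_p_adm(2)[OF p u v] and vfin = minimizer_p_adm(1)[OF p u v]
  note [measurable] = v(1)
  have us: "u \<in> sobolev_space0 (shifted_order DIM('a) s p) p \<Omega>" using u by (simp add: is_minimizer_def)
  have eq: "(\<integral>z. \<bar>sdq s v z\<bar> powr p \<partial>lborel) / 2 = F v"
    using euler_lagrange[OF p u v us vadm v(3) vfin] by (simp add: spow_times_self[OF p])
  have i: "integrable lborel (\<lambda>z. \<bar>sdq s v z\<bar> powr p)"
    using vfin by (intro integrableI_bounded) (auto simp: frac_energy_sdq[OF v(1)])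
  have "frac_energy s p UNIV v = ennreal (\<integral>z. \<bar>sdq s v z\<bar> powr p \<partial>lborel)"
    unfolding frac_energy_sdq[OF v(1)] by (rule nn_integral_eq_integral[OF i]) simp
  also have "\<dots> \<le> ennreal (E v)"
    using eq F_le_half[OF vadm] by (intro ennreal_leI) linarith
  finally show ?thesis .
qed

text \<open>Rescaling by \<open>E v\<close> turns the energy gap into \<open>(E v)\<^sup>p\<^sup>-\<^sup>1 \<le> 1 / (1 - O(p - 1))\<close>, which bounds \<open>E v\<close>.\<close>

theorem minimizer_p_uniform_bound:
  obtains p0 B where "1 < p0" "0 \<le> B"
    "\<And>p u v. 1 < p \<Longrightarrow> p \<le> p0 \<Longrightarrow> is_minimizer \<Omega> f (shifted_order DIM('a) s p) p u \<Longrightarrow>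
      v \<in> borel_measurable borel \<Longrightarrow> (\<And>x. x \<notin> \<Omega> \<Longrightarrow> v x = 0) \<Longrightarrow> AE x in lborel. u x = v x \<Longrightarrow> E v \<le> B"
proof -
  obtain C where C: "0 \<le> C" "\<And>v p. v \<in> borel_measurable borel \<Longrightarrow> (\<And>x. x \<notin> \<Omega> \<Longrightarrow> v x = 0) \<Longrightarrow> 1 < p \<Longrightarrow>
    frac_energy s 1 UNIV v \<le> ennreal (1 / p) * frac_energy s p UNIV v
      + ennreal (p - 1) * (ennreal C * (emeasure lborel \<Omega> + (\<integral>\<^sup>+x. ennreal \<bar>v x\<bar> \<partial>lborel)))"
    using frac_energy_gap[OF s \<Omega>_sets] by blast
  obtain C3 where C3: "0 \<le> C3" "\<And>v. adm v \<Longrightarrow> (\<integral>\<^sup>+x. ennreal \<bar>v x\<bar> \<partial>lborel) \<le> ennreal (C3 * E v)"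
    using adm_L1_bound by blast
  obtain m where m: "emeasure lborel \<Omega> = ennreal m" "0 \<le> m" using \<Omega>_finite by (cases "emeasure lborel \<Omega>") auto
  define K where "K = C * (m + C3) + 1"
  have K: "0 < K" using C(1) C3(1) m(2) by (simp add: K_def add_nonneg_pos)
  show thesis
  \<comment> \<open>\<open>1 / (2 * K)\<close> keeps \<open>(p - 1) * K\<close> at most
    \<open>1 / 2\<close>, a range where \<open>ln (1 - x) \<ge> - 2 * x\<close>; dividing by
    \<open>p - 1\<close> then yields \<open>ln (E v) \<le> 2 * K\<close>.\<close>
  proof (rule that[of "1 + 1 / (2 * K)" "exp (2 * K)"])
    show "1 < 1 + 1 / (2 * K)" using K by simp
    show "0 \<le> exp (2 * K)" by simp
    fix p u v
    assume p: "1 < p" "p \<le> 1 + 1 / (2 * K)" and u: "is_minimizer \<Omega> f (shifted_order DIM('a) s p) p u"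
      and v: "v \<in> borel_measurable borel" "\<And>x. x \<notin> \<Omega> \<Longrightarrow> v x = 0" "AE x in lborel. u x = v x"
    note vadm = minimizer_p_adm(2)[OF p(1) u v]
    note [measurable] = v(1)
    show "E v \<le> exp (2 * K)"
    proof (cases "E v = 0")
      case False
      define N where "N = E v"
      have N: "0 < N" using False E_nonneg[of v] by (simp add: N_def)
      have A: "frac_energy s p UNIV v \<le> ennreal N" using minimizer_p_energy_le[OF p(1) u v] by (simp add: N_def)
      define w where "w = (\<lambda>x. v x / N)"
      have [measurable]: "w \<in> borel_measurable borel" unfolding w_def by measurable
      have woff: "\<And>x. x \<notin> \<Omega> \<Longrightarrow> w x = 0" using v(2) by (simp add: w_def)
      have dqw: "dq s w x y = dq s v x y / N" for x y
        using N by (simp add: dq_def w_def flip: diff_divide_distrib)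
      have w1: "frac_energy s 1 UNIV w = 1"
      proof -
        have "frac_energy s 1 UNIV w = (\<integral>\<^sup>+x. \<integral>\<^sup>+y. ennreal (1 / N) * ennreal (dq s v x y) \<partial>lborel \<partial>lborel)"
          unfolding frac_energy_UNIV dqw using N by (intro nn_integral_cong) (simp flip: ennreal_mult')
        also have "\<dots> = ennreal (1 / N) * frac_energy s 1 UNIV v" by (simp add: nn_integral_cmult frac_energy_UNIV)
        also have "\<dots> = 1" using N by (simp add: admD(5)[OF vadm] N_def[symmetric] flip: ennreal_mult')
        finally show ?thesis .
      qed
      have wp: "frac_energy s p UNIV w \<le> ennreal (N powr (1 - p))"
      proof -
        have "frac_energy s p UNIV w = (\<integral>\<^sup>+x. \<integral>\<^sup>+y. ennreal (N powr - p) * ennreal (dq s v x y powr p) \<partial>lborel \<partial>lborel)"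
          unfolding frac_energy_UNIV dqw using N
          by (intro nn_integral_cong) (simp add: powr_divide powr_minus_divide flip: ennreal_mult')
        also have "\<dots> = ennreal (N powr - p) * frac_energy s p UNIV v" by (simp add: nn_integral_cmult frac_energy_UNIV)
        also have "\<dots> \<le> ennreal (N powr - p) * ennreal N" by (intro mult_left_mono A) simp
        also have "\<dots> = ennreal (N powr (1 - p))"
          using N by (simp add: powr_diff powr_minus divide_inverse mult.commute flip: ennreal_mult')
        finally show ?thesis .
      qed
      have wL: "(\<integral>\<^sup>+x. ennreal \<bar>w x\<bar> \<partial>lborel) \<le> ennreal C3"
      proof -
        have "(\<integral>\<^sup>+x. ennreal \<bar>w x\<bar> \<partial>lborel) = (\<integral>\<^sup>+x. ennreal (1 / N) * ennreal \<bar>v x\<bar> \<partial>lborel)"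
          unfolding w_def using N by (intro nn_integral_cong) (simp flip: ennreal_mult')
        also have "\<dots> = ennreal (1 / N) * (\<integral>\<^sup>+x. ennreal \<bar>v x\<bar> \<partial>lborel)" by (simp add: nn_integral_cmult)
        also have "\<dots> \<le> ennreal (1 / N) * ennreal (C3 * N)" unfolding N_def by (intro mult_left_mono C3 vadm) simp_all
        also have "\<dots> = ennreal C3" using N by (simp flip: ennreal_mult')
        finally show ?thesis .
      qed
      \<comment> \<open>The gap inequality for the normalised \<open>w\<close>. The left side is its
        energy of order 1; its energy of order \<open>p\<close> is at most
        \<open>N powr - p * N\<close>, so on the right \<open>N\<close> survives with exponent
        \<open>1 - p\<close>.\<close>
      have "1 \<le> ennreal (1 / p) * frac_energy s p UNIV w + ennreal (p - 1) * (ennreal C * (emeasure lborel \<Omega> + (\<integral>\<^sup>+x. ennreal \<bar>w x\<bar> \<partial>lborel)))"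
        using C(2)[of w p] woff p(1) by (simp add: w1)
      also have "\<dots> \<le> ennreal (1 / p) * ennreal (N powr (1 - p)) + ennreal (p - 1) * (ennreal C * (ennreal m + ennreal C3))"
        unfolding m(1) by (intro add_mono mult_left_mono wp wL order_refl) auto
      also have "\<dots> = ennreal (1 / p * N powr (1 - p) + (p - 1) * (C * (m + C3)))"
        using p C(1) C3(1) m(2) by (simp add: ennreal_plus[symmetric] ennreal_mult'[symmetric] del: ennreal_plus)
      finally have "ennreal 1 \<le> ennreal (1 / p * N powr (1 - p) + (p - 1) * (C * (m + C3)))" by simp
      then have "1 \<le> 1 / p * N powr (1 - p) + (p - 1) * (C * (m + C3))"
        using p C(1) C3(1) m(2) by (subst (asm) ennreal_le_iff) auto
      also have "1 / p * N powr (1 - p) \<le> 1 * N powr (1 - p)" using p by (intro mult_right_mono) auto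
      also have "(p - 1) * (C * (m + C3)) \<le> (p - 1) * K" using p by (intro mult_left_mono) (auto simp: K_def)
      finally have lo: "1 - (p - 1) * K \<le> N powr (1 - p)" by simp
      define x where "x = (p - 1) * K"
      have x: "0 \<le> x" "x \<le> 1 / 2" using p K by (auto simp: x_def field_simps)
      have "- 2 * x \<le> - x - 2 * x\<^sup>2"
      proof -
        have "x * x \<le> 1 / 2 * x" using x by (intro mult_right_mono) auto
        then show ?thesis by (simp add: power2_eq_square)
      qed
      also have "\<dots> \<le> ln (1 - x)" using x by (rule ln_one_minus_pos_lower_bound)
      also have "\<dots> \<le> ln (N powr (1 - p))" using lo x by (subst ln_le_cancel_iff) (auto simp: x_def N)
      also have "\<dots> = (1 - p) * ln N" using N by (simp add: ln_powr)
      finally have "(p - 1) * ln N \<le> (p - 1) * (2 * K)" by (simp add: x_def algebra_simps)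
      then have "ln N \<le> 2 * K" using p by simp
      then have "N \<le> exp (2 * K)" using N by (simp add: ln_le_cancel_iff[symmetric])
      then show ?thesis by (simp add: N_def)
    qed simp
  qed
qed

end

section \<open>Passage to the limit\<close>

text \<open>The dual function \<open>g\<close> is split at height \<open>m\<close>. Against the
  bounded part, convergence in L1 suffices; against the tail \<open>h m\<close>, whose norm tends to
  0, Hoelder and the uniform bound \<open>B\<close> are used. First \<open>m\<close> is fixed, then
  \<open>k\<close> is taken large.\<close>

lemma weakly_converges_LpI:
  fixes X :: "nat \<Rightarrow> 'b \<Rightarrow> real" and x :: "'b \<Rightarrow> real"
  assumes q: "1 < q" and X: "\<And>k. X k \<in> Lp_space M q" and x: "x \<in> Lp_space M q"
    and B: "\<And>k. Lp_norm M q (X k) \<le> ennreal B"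
    and lim: "(\<lambda>k. \<integral>\<^sup>+y. ennreal \<bar>X k y - x y\<bar> \<partial>M) \<longlonglongrightarrow> 0"
  shows "weakly_converges_Lp M q X x"
  unfolding weakly_converges_Lp_def
proof (intro conjI allI ballI X x)
  fix g assume g: "g \<in> Lp_space M (q / (q - 1))"
  define q' where "q' = q / (q - 1)"
  have q': "1 < q'" "1 / q' + 1 / q = 1" using q by (auto simp: q'_def field_simps)
  have [measurable]: "\<And>k. X k \<in> borel_measurable M" "x \<in> borel_measurable M" "g \<in> borel_measurable M"
    using X x g by (auto simp: Lp_space_def)
  define h where "h = (\<lambda>(m::nat) y. if real m < \<bar>g y\<bar> then g y else 0)"
  have [measurable]: "h m \<in> borel_measurable M" for m unfolding h_def by measurable
  have gfin: "(\<integral>\<^sup>+y. ennreal (\<bar>g y\<bar> powr q') \<partial>M) < \<infinity>" using g by (simp add: Lp_space_def Lp_norm_def q'_def)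
  have "(\<lambda>m. \<integral>\<^sup>+y. ennreal (\<bar>h m y\<bar> powr q') \<partial>M) \<longlonglongrightarrow> (\<integral>\<^sup>+y. 0 \<partial>M)"
  proof (rule nn_integral_dominated_convergence[where w="\<lambda>y. ennreal (\<bar>g y\<bar> powr q')"])
    show "AE y in M. (\<lambda>m. ennreal (\<bar>h m y\<bar> powr q')) \<longlonglongrightarrow> 0"
    proof (rule AE_I2)
      fix y
      have "eventually (\<lambda>m. ennreal (\<bar>h m y\<bar> powr q') = 0) sequentially"
        using eventually_ge_at_top[of "nat \<lceil>\<bar>g y\<bar>\<rceil>"] by eventually_elim (auto simp: h_def)
      then show "(\<lambda>m. ennreal (\<bar>h m y\<bar> powr q')) \<longlonglongrightarrow> 0" by (rule tendsto_eventually)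
    qed
    show "AE y in M. ennreal (\<bar>h m y\<bar> powr q') \<le> ennreal (\<bar>g y\<bar> powr q')" for m by (auto simp: h_def)
  qed (use gfin in simp_all)
  then have hlim: "(\<lambda>m. Lp_norm M q' (h m)) \<longlonglongrightarrow> 0"
    unfolding Lp_norm_def using q'(1) by (subst tendsto_ennpowr_zero_iff) auto
  have hle: "(\<integral>\<^sup>+y. ennreal (\<bar>h m y\<bar> powr q') \<partial>M) \<le> (\<integral>\<^sup>+y. ennreal (\<bar>g y\<bar> powr q') \<partial>M)" for m
    by (intro nn_integral_mono) (auto simp: h_def)
  have hL: "h m \<in> Lp_space M q'" for m
    using order_le_less_trans[OF hle gfin] by (simp add: Lp_space_def Lp_norm_def)
  have gL: "g \<in> Lp_space M q'" using g by (simp add: q'_def)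
  obtain D where D: "Lp_norm M q x \<le> ennreal D" using x by (cases "Lp_norm M q x") (auto simp: Lp_space_def)
  define I where "I = (\<lambda>k. \<integral>y. X k y * g y \<partial>M)"
  define J where "J = (\<integral>y. x y * g y \<partial>M)"
  define K where "K = ennreal B + ennreal D"
  have main: "ennreal \<bar>I k - J\<bar> \<le> ennreal (real m) * (\<integral>\<^sup>+y. ennreal \<bar>X k y - x y\<bar> \<partial>M) + K * Lp_norm M q' (h m)" for k m
  proof -
    note i1 = Holder_integral(1)[OF q'(1) q q'(2) gL X[of k]] and i2 = Holder_integral(1)[OF q'(1) q q'(2) gL x]
      and i3 = Holder_integral(1)[OF q'(1) q q'(2) hL[of m] X[of k]] and i4 = Holder_integral(1)[OF q'(1) q q'(2) hL[of m] x]
    have i5: "integrable M (\<lambda>y. (X k y - x y) * (g y - h m y))"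
    proof -
      have "integrable M (\<lambda>y. (g y * X k y - g y * x y) - (h m y * X k y - h m y * x y))"
        by (intro Bochner_Integration.integrable_diff i1 i2 i3 i4)
      then show ?thesis by (simp add: algebra_simps)
    qed
    have "I k - J = (\<integral>y. g y * X k y \<partial>M) - (\<integral>y. g y * x y \<partial>M)" by (simp add: I_def J_def mult.commute)
    also have "\<dots> = (\<integral>y. (X k y - x y) * (g y - h m y) \<partial>M) + ((\<integral>y. h m y * X k y \<partial>M) - (\<integral>y. h m y * x y \<partial>M))"
    proof -
      have "(\<integral>y. (X k y - x y) * (g y - h m y) \<partial>M) = (\<integral>y. (g y * X k y - g y * x y) - (h m y * X k y - h m y * x y) \<partial>M)"
        by (intro Bochner_Integration.integral_cong) (auto simp: algebra_simps)
      also have "\<dots> = ((\<integral>y. g y * X k y \<partial>M) - (\<integral>y. g y * x y \<partial>M)) - ((\<integral>y. h m y * X k y \<partial>M) - (\<integral>y. h m y * x y \<partial>M))"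
        using i1 i2 i3 i4 by simp
      finally show ?thesis by simp
    qed
    finally have le: "\<bar>I k - J\<bar> \<le> \<bar>\<integral>y. (X k y - x y) * (g y - h m y) \<partial>M\<bar> + (\<bar>\<integral>y. h m y * X k y \<partial>M\<bar> + \<bar>\<integral>y. h m y * x y \<partial>M\<bar>)"
      by linarith
    have a1: "ennreal \<bar>\<integral>y. (X k y - x y) * (g y - h m y) \<partial>M\<bar> \<le> ennreal (real m) * (\<integral>\<^sup>+y. ennreal \<bar>X k y - x y\<bar> \<partial>M)"
    proof -
      have "ennreal \<bar>\<integral>y. (X k y - x y) * (g y - h m y) \<partial>M\<bar> \<le> (\<integral>\<^sup>+y. ennreal \<bar>(X k y - x y) * (g y - h m y)\<bar> \<partial>M)"
        using integral_norm_bound_ennreal[OF i5] by simp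
      also have "\<dots> \<le> (\<integral>\<^sup>+y. ennreal (real m) * ennreal \<bar>X k y - x y\<bar> \<partial>M)"
      proof (rule nn_integral_mono)
        fix y
        have "\<bar>g y - h m y\<bar> \<le> real m" by (auto simp: h_def)
        then have "\<bar>(X k y - x y) * (g y - h m y)\<bar> \<le> \<bar>X k y - x y\<bar> * real m" by (simp add: abs_mult mult_left_mono)
        then show "ennreal \<bar>(X k y - x y) * (g y - h m y)\<bar> \<le> ennreal (real m) * ennreal \<bar>X k y - x y\<bar>"
          by (simp add: mult.commute ennreal_leI flip: ennreal_mult')
      qed
      also have "\<dots> = ennreal (real m) * (\<integral>\<^sup>+y. ennreal \<bar>X k y - x y\<bar> \<partial>M)" by (simp add: nn_integral_cmult)
      finally show ?thesis .
    qed
    have a2: "ennreal \<bar>\<integral>y. h m y * X k y \<partial>M\<bar> \<le> Lp_norm M q' (h m) * ennreal B"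
      using Holder_integral(2)[OF q'(1) q q'(2) hL[of m] X[of k]] mult_left_mono[OF B[of k], of "Lp_norm M q' (h m)"] by simp
    have a3: "ennreal \<bar>\<integral>y. h m y * x y \<partial>M\<bar> \<le> Lp_norm M q' (h m) * ennreal D"
      using Holder_integral(2)[OF q'(1) q q'(2) hL[of m] x] mult_left_mono[OF D, of "Lp_norm M q' (h m)"] by simp
    have "ennreal \<bar>I k - J\<bar> \<le> ennreal (\<bar>\<integral>y. (X k y - x y) * (g y - h m y) \<partial>M\<bar> + (\<bar>\<integral>y. h m y * X k y \<partial>M\<bar> + \<bar>\<integral>y. h m y * x y \<partial>M\<bar>))"
      using le by (rule ennreal_leI)
    also have "\<dots> = ennreal \<bar>\<integral>y. (X k y - x y) * (g y - h m y) \<partial>M\<bar> + (ennreal \<bar>\<integral>y. h m y * X k y \<partial>M\<bar> + ennreal \<bar>\<integral>y. h m y * x y \<partial>M\<bar>)"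
      by simp
    also have "\<dots> \<le> ennreal (real m) * (\<integral>\<^sup>+y. ennreal \<bar>X k y - x y\<bar> \<partial>M) + (Lp_norm M q' (h m) * ennreal B + Lp_norm M q' (h m) * ennreal D)"
      by (intro add_mono a1 a2 a3)
    finally show ?thesis by (simp add: K_def distrib_right distrib_left mult.commute)
  qed
  have "(\<lambda>k. ennreal \<bar>I k - J\<bar>) \<longlonglongrightarrow> 0"
  proof (rule tendsto_0_if_le_ennreal)
    fix e :: real assume e: "0 < e"
    have e2: "0 < ennreal (e/2)" using e ennreal_less_iff[of 0 "e/2"] by simp
    have "(\<lambda>m. K * Lp_norm M q' (h m)) \<longlonglongrightarrow> K * 0"
      by (intro ennreal_tendsto_cmult hlim) (simp add: K_def)
    then have "eventually (\<lambda>m. K * Lp_norm M q' (h m) < ennreal (e/2)) sequentially"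
      by (intro order_tendstoD(2)[OF _ e2]) simp_all
    then obtain m where m: "K * Lp_norm M q' (h m) < ennreal (e/2)" using eventually_happens'[OF sequentially_bot] by blast
    have "(\<lambda>k. ennreal (real m) * (\<integral>\<^sup>+y. ennreal \<bar>X k y - x y\<bar> \<partial>M)) \<longlonglongrightarrow> ennreal (real m) * 0"
      by (intro ennreal_tendsto_cmult lim) simp
    then have "eventually (\<lambda>k. ennreal (real m) * (\<integral>\<^sup>+y. ennreal \<bar>X k y - x y\<bar> \<partial>M) < ennreal (e/2)) sequentially"
      by (intro order_tendstoD(2)[OF _ e2]) simp_all
    then have "eventually (\<lambda>k. ennreal \<bar>I k - J\<bar> \<le> ennreal e) sequentially"
    proof eventually_elim
      case (elim k)
      have "ennreal \<bar>I k - J\<bar> \<le> ennreal (e/2) + ennreal (e/2)"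
        using main[of k m] add_mono[OF less_imp_le[OF elim] less_imp_le[OF m]] by (rule order_trans)
      also have "\<dots> = ennreal e" using e by (simp flip: ennreal_plus)
      finally show ?case .
    qed
    then show "\<exists>N. \<forall>k\<ge>N. ennreal \<bar>I k - J\<bar> \<le> ennreal e" by (simp add: eventually_sequentially)
  qed
  then have "(\<lambda>k. ennreal \<bar>I k - J\<bar>) \<longlonglongrightarrow> ennreal 0" by simp
  then have "(\<lambda>k. \<bar>I k - J\<bar>) \<longlonglongrightarrow> 0" by (subst (asm) tendsto_ennreal_iff) auto
  then have "(\<lambda>k. I k - J) \<longlonglongrightarrow> 0" by (simp add: tendsto_rabs_zero_iff)
  then have "I \<longlonglongrightarrow> J" by (rule LIM_zero_cancel)
  then show "(\<lambda>k. \<integral>y. X k y * g y \<partial>M) \<longlonglongrightarrow> (\<integral>y. x y * g y \<partial>M)" by (simp add: I_def J_def)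
qed

section \<open>Limits of admissible functions and a criterion for weak solutions\<close>

context frac_problem
begin

text \<open>\<open>E\<close> obeys the triangle inequality and \<open>F\<close> is linear and
  bounded by \<open>E / 2\<close>, so convergence in the seminorm \<open>E\<close> carries both
  values to the limit.\<close>

lemma adm_dense:
  assumes w: "adm w"
  obtains \<phi> :: "nat \<Rightarrow> 'a \<Rightarrow> real" where "\<And>j. \<phi> j \<in> test_functions \<Omega>" "(\<lambda>j. E (\<lambda>x. \<phi> j x - w x)) \<longlonglongrightarrow> 0"
    "(\<lambda>j. E (\<phi> j)) \<longlonglongrightarrow> E w" "(\<lambda>j. F (\<phi> j)) \<longlonglongrightarrow> F w"
proof -
  obtain \<phi> where \<phi>: "\<And>k::nat. \<phi> k \<in> test_functions \<Omega>"
    "(\<lambda>k. frac_energy s 1 UNIV (\<lambda>x. \<phi> k x - w x)) \<longlonglongrightarrow> 0"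
    using test_functions_dense[OF s \<Omega> admD(1)[OF w] admD(2)[OF w] admD(3)[OF w] admD(4)[OF w]] by blast
  have a: "adm (\<lambda>x. \<phi> j x - w x)" for j
    using adm_add_cmult(1)[OF adm_test_function[OF \<phi>(1)[of j]] w, of "-1"] by simp
  have "(\<lambda>k. ennreal (E (\<lambda>x. \<phi> k x - w x))) \<longlonglongrightarrow> ennreal 0"
    using \<phi>(2) by (simp add: admD(5)[OF a])
  then have e: "(\<lambda>j. E (\<lambda>x. \<phi> j x - w x)) \<longlonglongrightarrow> 0" by (subst (asm) tendsto_ennreal_iff) (auto simp: E_nonneg)
  have u: "E (\<phi> j) \<le> E w + E (\<lambda>x. \<phi> j x - w x)" for j
    using adm_add_cmult(2)[OF w a[of j], of 1] by simp
  have l: "E w \<le> E (\<phi> j) + E (\<lambda>x. \<phi> j x - w x)" for j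
    using adm_add_cmult(2)[OF adm_test_function[OF \<phi>(1)[of j]] a[of j], of "-1"] by simp
  have EE: "(\<lambda>j. E (\<phi> j)) \<longlonglongrightarrow> E w"
  proof (rule LIM_zero_cancel, rule tendsto_rabs_zero_cancel, rule tendsto_sandwich[OF _ _ tendsto_const e])
    show "\<forall>\<^sub>F j in sequentially. \<bar>E (\<phi> j) - E w\<bar> \<le> E (\<lambda>x. \<phi> j x - w x)"
      using u l by (intro always_eventually allI) (simp add: abs_le_iff algebra_simps)
  qed simp
  have FF: "(\<lambda>j. F (\<phi> j)) \<longlonglongrightarrow> F w"
  proof (rule LIM_zero_cancel, rule tendsto_rabs_zero_cancel, rule tendsto_sandwich[OF _ _ tendsto_const e])
    show "\<forall>\<^sub>F j in sequentially. \<bar>F (\<phi> j) - F w\<bar> \<le> E (\<lambda>x. \<phi> j x - w x)"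
    proof (intro always_eventually allI)
      fix j
      have "F (\<lambda>x. \<phi> j x - w x) = F (\<phi> j) - F w"
        using F_add_cmult[OF adm_test_function[OF \<phi>(1)[of j]] w, of "-1"] by simp
      then show "\<bar>F (\<phi> j) - F w\<bar> \<le> E (\<lambda>x. \<phi> j x - w x)"
        using F_le_half[OF a[of j]] E_nonneg[of "\<lambda>x. \<phi> j x - w x"] by linarith
    qed
  qed simp
  show thesis by (rule that[OF \<phi>(1) e EE FF])
qed

lemma sdq_integrable:
  assumes w: "adm w"
  shows "integrable lborel (sdq s w)" "(\<integral>z. \<bar>sdq s w z\<bar> \<partial>lborel) = E w"
proof -
  note [measurable] = admD(1)[OF w]
  have e: "(\<integral>\<^sup>+z. ennreal \<bar>sdq s w z\<bar> \<partial>lborel) = ennreal (E w)"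
    using admD(5)[OF w] by (simp add: frac_energy_sdq)
  show i: "integrable lborel (sdq s w)" by (rule integrableI_bounded) (use e in auto)
  have "(\<integral>\<^sup>+z. ennreal \<bar>sdq s w z\<bar> \<partial>lborel) = ennreal (\<integral>z. \<bar>sdq s w z\<bar> \<partial>lborel)"
    by (rule nn_integral_eq_integral) (use i in auto)
  then show "(\<integral>z. \<bar>sdq s w z\<bar> \<partial>lborel) = E w" using e by (simp add: E_nonneg)
qed

text \<open>Transfers the weak formulation from Borel functions on \<open>lborel\<close> to the
  definition over \<open>lebesgue\<close>. The sign is prescribed only where \<open>v\<close>
  differs at the two points, because elsewhere \<open>multi_sgn\<close> is all of
  \<open>[-1, 1]\<close>.\<close>

lemma weak_solutionI:
  assumes u: "u \<in> sobolev_space0 s 1 \<Omega>" and v: "v \<in> borel_measurable borel" "AE x in lborel. u x = v x"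
    and z: "z \<in> borel_measurable borel" "\<And>t. \<bar>z t\<bar> \<le> 1" "\<And>x y. z (x, y) = - z (y, x)"
    and eq: "\<And>w. adm w \<Longrightarrow> (\<integral>t. z t * sdq s w t \<partial>lborel) / 2 = F w"
    and sgn: "AE t in lborel. v (fst t) \<noteq> v (snd t) \<longrightarrow> z t = sgn (v (fst t) - v (snd t))"
  shows "is_weak_solution \<Omega> f s u"
  unfolding is_weak_solution_def
proof (intro conjI u exI[of _ z] ballI allI z(3))
  show "z \<in> borel_measurable lebesgue" using z(1) by (intro measurable_completion) simp
  show "AE xy in lebesgue. \<bar>z xy\<bar> \<le> 1" using z(2) by simp
  have "AE t in lborel. (fst t, snd t) \<notin> (- \<Omega>) \<times> (- \<Omega>) \<longrightarrow> z (fst t, snd t) \<in> multi_sgn (u (fst t) - u (snd t))"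
    using AE_lborel_pair[OF v(2) v(2)] sgn
  proof eventually_elim
    case (elim t)
    show ?case using elim z(2)[of t] by (auto simp: multi_sgn_def sgn_if abs_le_iff split: if_splits)
  qed
  then show "AE (x, y) in lebesgue. (x, y) \<notin> (- \<Omega>) \<times> (- \<Omega>) \<longrightarrow> z (x, y) \<in> multi_sgn (u x - u y)"
    unfolding case_prod_beta' by (rule AE_completion)
  fix w assume w: "w \<in> sobolev_space0 s 1 \<Omega>"
  obtain w' where w': "adm w'" "AE x in lborel. w x = w' x" using sobolev_space0_adm[OF w] by blast
  note [measurable] = admD(1)[OF w'(1)] z(1)
  define G where "G = (\<lambda>t. z (fst t, snd t) / norm (fst t - snd t) powr (real DIM('a) + s) * (w (fst t) - w (snd t)))"
  have m: "(\<lambda>t. z t * sdq s w' t) \<in> borel_measurable lborel" by measurable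
  have ml: "(\<lambda>t. z t * sdq s w' t) \<in> borel_measurable lebesgue" by (rule measurable_completion[OF m])
  have "AE t in lborel. z t * sdq s w' t = G t"
    using AE_lborel_pair[OF w'(2) w'(2)] by eventually_elim (simp add: G_def sdq_def)
  then have ae: "AE t in lebesgue. z t * sdq s w' t = G t" by (rule AE_completion)
  have Gm: "G \<in> borel_measurable lebesgue" by (rule borel_measurable_AE[OF ml ae])
  have "(\<integral>(x, y). z (x, y) / norm (x - y) powr (real DIM('a) + s) * (w x - w y) \<partial>lebesgue) = (\<integral>t. G t \<partial>lebesgue)"
    by (simp add: G_def case_prod_beta')
  also have "\<dots> = (\<integral>t. z t * sdq s w' t \<partial>lebesgue)"
    by (rule integral_cong_AE[OF Gm ml]) (use ae in \<open>eventually_elim, simp\<close>)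
  also have "\<dots> = (\<integral>t. z t * sdq s w' t \<partial>lborel)" by (rule integral_completion[OF m])
  finally have "1 / 2 * (\<integral>(x, y). z (x, y) / norm (x - y) powr (real DIM('a) + s) * (w x - w y) \<partial>lebesgue) = F w'"
    using eq[OF w'(1)] by simp
  also have "F w' = F w" using F_cong_AE[OF sobolev_space0_lebesgue[OF w] admD(1)[OF w'(1)] w'(2)] by simp
  finally show "1 / 2 * (\<integral>(x, y). z (x, y) / norm (x - y) powr (real DIM('a) + s) * (w x - w y) \<partial>lebesgue)
    = (\<integral>x. f x * w x \<partial>lebesgue_on \<Omega>)" by (simp add: F_def)
qed

text \<open>Fatou for the quotients gives lower semicontinuity of \<open>E\<close>, Fatou for the
  functions gives integrability, so admissibility of the limit is a conclusion. The bounds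
  \<open>b\<close> may vary with \<open>k\<close>.\<close>

lemma E_Fatou:
  assumes V: "\<And>k::nat. adm (V k)" and v: "v \<in> borel_measurable borel" "\<And>x. x \<notin> \<Omega> \<Longrightarrow> v x = 0"
    and lim: "AE x in lborel. (\<lambda>k. V k x) \<longlonglongrightarrow> v x" and b: "\<And>k. E (V k) \<le> b k" "b \<longlonglongrightarrow> l"
  shows "adm v" "E v \<le> l"
proof -
  note [measurable] = admD(1)[OF V] v(1)
  have lim2: "AE z in lborel. (\<lambda>k. sdq s (V k) z) \<longlonglongrightarrow> sdq s v z"
    using AE_lborel_pair[OF lim lim] unfolding sdq_def divide_inverse by eventually_elim (intro tendsto_intros, auto)
  have l0: "0 \<le> l" by (rule LIMSEQ_le_const[OF b(2)]) (use b(1) E_nonneg order_trans in blast)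
  have "(\<integral>\<^sup>+z. ennreal \<bar>sdq s v z\<bar> \<partial>lborel) \<le> ennreal l"
  proof (rule nn_integral_Fatou_bound[where X="\<lambda>k z. ennreal \<bar>sdq s (V k) z\<bar>" and B="\<lambda>k. ennreal (b k)"])
    show "AE z in lborel. (\<lambda>k. ennreal \<bar>sdq s (V k) z\<bar>) \<longlonglongrightarrow> ennreal \<bar>sdq s v z\<bar>"
      using lim2 by eventually_elim (intro tendsto_ennrealI tendsto_rabs)
    show "(\<integral>\<^sup>+z. ennreal \<bar>sdq s (V k) z\<bar> \<partial>lborel) \<le> ennreal (b k)" for k
      using admD(5)[OF V[of k]] ennreal_leI[OF b(1)[of k]] by (simp add: frac_energy_sdq)
    show "(\<lambda>k. ennreal (b k)) \<longlonglongrightarrow> ennreal l" by (intro tendsto_ennrealI b)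
  qed measurable
  then have e: "frac_energy s 1 UNIV v \<le> ennreal l" by (simp add: frac_energy_sdq)
  obtain C where C: "0 \<le> C" "\<And>v. adm v \<Longrightarrow> (\<integral>\<^sup>+x. ennreal \<bar>v x\<bar> \<partial>lborel) \<le> ennreal (C * E v)"
    using adm_L1_bound by blast
  have "(\<integral>\<^sup>+x. ennreal \<bar>v x\<bar> \<partial>lborel) \<le> ennreal (C * l)"
  proof (rule nn_integral_Fatou_bound[where X="\<lambda>k x. ennreal \<bar>V k x\<bar>" and B="\<lambda>k. ennreal (C * b k)"])
    show "AE x in lborel. (\<lambda>k. ennreal \<bar>V k x\<bar>) \<longlonglongrightarrow> ennreal \<bar>v x\<bar>"
      using lim by eventually_elim (intro tendsto_ennrealI tendsto_rabs)
    show "(\<integral>\<^sup>+x. ennreal \<bar>V k x\<bar> \<partial>lborel) \<le> ennreal (C * b k)" for k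
      using C(2)[OF V[of k]] ennreal_leI[OF mult_left_mono[OF b(1)[of k] C(1)]] by simp
    show "(\<lambda>k. ennreal (C * b k)) \<longlonglongrightarrow> ennreal (C * l)" by (intro tendsto_ennrealI tendsto_mult_left b)
  qed measurable
  then have "(\<integral>\<^sup>+x. ennreal \<bar>v x\<bar> \<partial>lborel) < \<infinity>" by (rule order_le_less_trans) simp
  moreover have "frac_energy s 1 UNIV v < \<infinity>" using e by (rule order_le_less_trans) simp
  ultimately show "adm v" using v by (simp add: adm_def)
  show "E v \<le> l" unfolding E_def using enn2real_mono[OF e] l0 by simp
qed

end

text \<open>The situation after extraction of a subsequence: \<open>V k\<close> is a Borel
  representative of the minimizer \<open>u k\<close>. The second condition on \<open>p1\<close> is
  the one under which test functions have finite energy of order \<open>p1\<close>.\<close>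

locale frac_limit = frac_problem s \<Omega> f
  for s :: real and \<Omega> :: "'a::euclidean_space set" and f :: "'a \<Rightarrow> real" +
  fixes P :: "nat \<Rightarrow> real" and p1 B :: real and u V :: "nat \<Rightarrow> 'a \<Rightarrow> real" and v :: "'a \<Rightarrow> real"
  assumes p1: "1 < p1" "(real DIM('a) + s - 1) * p1 < real DIM('a)"
    and P: "\<And>k. 1 < P k" "\<And>k. P k \<le> p1" "P \<longlonglongrightarrow> 1"
    and u: "\<And>k. is_minimizer \<Omega> f (shifted_order DIM('a) s (P k)) (P k) (u k)"
    and V: "\<And>k. V k \<in> borel_measurable borel" "\<And>k x. x \<notin> \<Omega> \<Longrightarrow> V k x = 0" "\<And>k. AE x in lborel. u k x = V k x"
    and B: "\<And>k. E (V k) \<le> B"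
    and v: "v \<in> borel_measurable borel" "\<And>x. x \<notin> \<Omega> \<Longrightarrow> v x = 0"
    and lim: "AE x in lborel. (\<lambda>k. V k x) \<longlonglongrightarrow> v x" "(\<lambda>k. \<integral>\<^sup>+x. ennreal \<bar>V k x - v x\<bar> \<partial>lborel) \<longlonglongrightarrow> 0"
begin

lemma adm_V: "adm (V k)" and energy_p_V: "frac_energy s (P k) UNIV (V k) < \<infinity>"
  using minimizer_p_adm[OF P(1) u V] by auto

lemma adm_v: "adm v" and E_v_le: "E v \<le> B"
  using E_Fatou[OF adm_V v lim(1) B tendsto_const] by auto

lemma lim_sdq: "AE z in lborel. (\<lambda>k. sdq s (V k) z) \<longlonglongrightarrow> sdq s v z"
  using AE_lborel_pair[OF lim(1) lim(1)] unfolding sdq_def divide_inverse by eventually_elim (intro tendsto_intros, auto)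

lemma L1_V: "(\<lambda>k. \<integral>\<^sup>+x. ennreal \<bar>V k x - v x\<bar> \<partial>lebesgue_on \<Omega>) \<longlonglongrightarrow> 0"
proof (rule tendsto_0_le_ennreal[OF _ lim(2)])
  show "(\<integral>\<^sup>+x. ennreal \<bar>V k x - v x\<bar> \<partial>lebesgue_on \<Omega>) \<le> (\<integral>\<^sup>+x. ennreal \<bar>V k x - v x\<bar> \<partial>lborel)" for k
    unfolding nn_integral_lebesgue_on[OF \<Omega>_sets] by (intro nn_integral_mono) (simp add: indicator_def)
qed

lemma weak_V: "weakly_converges_Lp (lebesgue_on \<Omega>) (real DIM('a) / (real DIM('a) - s)) V v"
proof (rule weakly_converges_LpI[OF q(1) adm_Lp(1)[OF adm_V] adm_Lp(1)[OF adm_v] _ L1_V])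
  show "Lp_norm (lebesgue_on \<Omega>) (real DIM('a) / (real DIM('a) - s)) (V k) \<le> ennreal (sobolev_constant TYPE('a) s * B)" for k
    using adm_Lp(2)[OF adm_V[of k]] ennreal_leI[OF mult_left_mono[OF B[of k] S_nonneg]] by simp
qed

lemma F_V: "(\<lambda>k. F (V k)) \<longlonglongrightarrow> F v"
  using weak_V f unfolding weakly_converges_Lp_def q(4) F_def by (simp add: mult.commute)

definition J :: "nat \<Rightarrow> real" where
  "J k = enn2real (frac_energy s (P k) UNIV (V k)) / (2 * P k) - F (V k)"

lemma u_lebesgue: "u k \<in> borel_measurable lebesgue"
  using u[of k] sobolev_space0_lebesgue by (auto simp: is_minimizer_def)

lemma energy_u: "energy \<Omega> f (shifted_order DIM('a) s (P k)) (P k) (u k) = ereal (J k)"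
  unfolding J_def by (rule energy_eq[OF u_lebesgue V(1) V(3) _ energy_p_V]) (use P(1)[of k] in simp)

lemma energy_p_test: "\<phi> \<in> test_functions \<Omega> \<Longrightarrow> frac_energy s (P k) UNIV \<phi> < \<infinity>"
proof (rule smooth_compact_energy_finite[OF test_functions_smooth_compact s])
  show "1 \<le> P k" using P(1)[of k] by simp
  have "(real DIM('a) + s - 1) * P k \<le> (real DIM('a) + s - 1) * p1"
    by (rule mult_left_mono[OF P(2)]) (use n_ge_1 s(1) in linarith)
  then show "(real DIM('a) + s - 1) * P k < real DIM('a)" using p1(2) by linarith
qed

lemma J_le:
  assumes \<phi>: "\<phi> \<in> test_functions \<Omega>"
  shows "J k \<le> enn2real (frac_energy s (P k) UNIV \<phi>) / (2 * P k) - F \<phi>"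
proof -
  have p: "0 < P k" using P(1)[of k] by simp
  note m = test_functions_measurable[OF \<phi>]
  have "energy \<Omega> f (shifted_order DIM('a) s (P k)) (P k) \<phi> = ereal (enn2real (frac_energy s (P k) UNIV \<phi>) / (2 * P k) - F \<phi>)"
    by (rule energy_eq[OF measurable_completion m _ p energy_p_test[OF \<phi>]]) (use m in auto)
  moreover have "energy \<Omega> f (shifted_order DIM('a) s (P k)) (P k) (u k) \<le> energy \<Omega> f (shifted_order DIM('a) s (P k)) (P k) \<phi>"
    using u[of k] test_functions_in_sobolev_space0[OF \<phi> p \<Omega>(1)] by (auto simp: is_minimizer_def)
  ultimately show ?thesis by (simp add: energy_u)
qed

lemma J_test_tendsto:
  assumes \<phi>: "\<phi> \<in> test_functions \<Omega>"
  shows "(\<lambda>k. enn2real (frac_energy s (P k) UNIV \<phi>) / (2 * P k) - F \<phi>) \<longlonglongrightarrow> E \<phi> / 2 - F \<phi>"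
proof -
  have "(\<lambda>k. frac_energy s (P k) UNIV \<phi>) \<longlonglongrightarrow> frac_energy s 1 UNIV \<phi>"
    by (rule smooth_compact_energy_tendsto[OF test_functions_smooth_compact[OF \<phi>] s _ p1(2) _ P(2,3)])
      (use p1 P(1) in \<open>auto intro: less_imp_le\<close>)
  then have "(\<lambda>k. enn2real (frac_energy s (P k) UNIV \<phi>)) \<longlonglongrightarrow> E \<phi>"
    unfolding E_def using admD(4)[OF adm_test_function[OF \<phi>]] by (intro tendsto_enn2real) auto
  moreover have "(\<lambda>k. 2 * P k) \<longlonglongrightarrow> 2 * 1" by (intro tendsto_mult_left P)
  ultimately show ?thesis by (intro tendsto_diff tendsto_divide tendsto_const) auto
qed

text \<open>\<open>frac_energy_gap\<close> read as a lower bound for \<open>J k\<close>; the L1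
  norms in it are bounded through \<open>B\<close>, so the defect is \<open>P k - 1\<close> times a
  constant.\<close>

lemma J_ge:
  obtains C where "0 \<le> C" "\<And>k. E (V k) / 2 \<le> J k + F (V k) + (P k - 1) * C"
proof -
  obtain C where C: "0 \<le> C" "\<And>v p. v \<in> borel_measurable borel \<Longrightarrow> (\<And>x. x \<notin> \<Omega> \<Longrightarrow> v x = 0) \<Longrightarrow> 1 < p \<Longrightarrow>
    frac_energy s 1 UNIV v \<le> ennreal (1 / p) * frac_energy s p UNIV v
      + ennreal (p - 1) * (ennreal C * (emeasure lborel \<Omega> + (\<integral>\<^sup>+x. ennreal \<bar>v x\<bar> \<partial>lborel)))"
    using frac_energy_gap[OF s \<Omega>_sets] by blast
  obtain C3 where C3: "0 \<le> C3" "\<And>v. adm v \<Longrightarrow> (\<integral>\<^sup>+x. ennreal \<bar>v x\<bar> \<partial>lborel) \<le> ennreal (C3 * E v)"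
    using adm_L1_bound by blast
  obtain m where m: "emeasure lborel \<Omega> = ennreal m" "0 \<le> m" using \<Omega>_finite by (cases "emeasure lborel \<Omega>") auto
  have B0: "0 \<le> B" using B[of 0] E_nonneg[of "V 0"] by linarith
  define K where "K = C * (m + C3 * B)"
  have K: "0 \<le> K" using C(1) C3(1) m(2) B0 by (simp add: K_def)
  show thesis
  proof (rule that[of "K / 2"])
    show "0 \<le> K / 2" using K by simp
    fix k
    obtain e where e: "frac_energy s (P k) UNIV (V k) = ennreal e" "0 \<le> e"
      using energy_p_V[of k] by (cases "frac_energy s (P k) UNIV (V k)") auto
    have l: "(\<integral>\<^sup>+x. ennreal \<bar>V k x\<bar> \<partial>lborel) \<le> ennreal (C3 * B)"
      using C3(2)[OF adm_V[of k]] ennreal_leI[OF mult_left_mono[OF B[of k] C3(1)]] by simp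
    have "ennreal (E (V k)) \<le> ennreal (1 / P k) * ennreal e + ennreal (P k - 1) * (ennreal C * (ennreal m + (\<integral>\<^sup>+x. ennreal \<bar>V k x\<bar> \<partial>lborel)))"
      using C(2)[OF V(1)[of k] V(2)[of _ k] P(1)[of k]] by (simp add: admD(5)[OF adm_V] e(1) m(1))
    also have "\<dots> \<le> ennreal (1 / P k) * ennreal e + ennreal (P k - 1) * (ennreal C * (ennreal m + ennreal (C3 * B)))"
      by (intro add_mono mult_left_mono l order_refl) auto
    also have "\<dots> = ennreal (1 / P k * e + (P k - 1) * K)"
      unfolding K_def using P(1)[of k] C(1) C3(1) m(2) e(2) B0
      by (simp add: ennreal_plus[symmetric] ennreal_mult'[symmetric] del: ennreal_plus)
    finally have "E (V k) \<le> 1 / P k * e + (P k - 1) * K"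
      using P(1)[of k] K e(2) by (subst (asm) ennreal_le_iff) auto
    then show "E (V k) / 2 \<le> J k + F (V k) + (P k - 1) * (K / 2)"
      using e by (simp add: J_def field_simps)
  qed
qed

lemma P_shift: "(\<lambda>k. (P k - 1) * C) \<longlonglongrightarrow> 0"
proof -
  have "(\<lambda>k. (P k - 1) * C) \<longlonglongrightarrow> (1 - 1) * C" by (intro tendsto_intros P(3))
  then show ?thesis by simp
qed

text \<open>Against a test function both sides pass to the limit: its energies of order
  \<open>P k\<close> converge, and \<open>J_ge\<close> with \<open>E_Fatou\<close> handles the
  minimizers. General competitors follow by density.\<close>

lemma v_minimal:
  assumes w: "adm w"
  shows "E v / 2 - F v \<le> E w / 2 - F w"
proof -
  obtain C where C: "\<And>k. E (V k) / 2 \<le> J k + F (V k) + (P k - 1) * C" using J_ge by blast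
  have test: "E v / 2 - F v \<le> E \<phi> / 2 - F \<phi>" if \<phi>: "\<phi> \<in> test_functions \<Omega>" for \<phi>
  proof -
    define b where "b k = 2 * ((enn2real (frac_energy s (P k) UNIV \<phi>) / (2 * P k) - F \<phi>) + F (V k) + (P k - 1) * C)" for k
    have "E (V k) \<le> b k" for k using C[of k] J_le[OF \<phi>, of k] by (simp add: b_def)
    moreover have "b \<longlonglongrightarrow> 2 * ((E \<phi> / 2 - F \<phi>) + F v + 0)"
      unfolding b_def by (intro tendsto_mult_left tendsto_add J_test_tendsto \<phi> F_V P_shift)
    ultimately have "E v \<le> 2 * ((E \<phi> / 2 - F \<phi>) + F v + 0)" using E_Fatou(2)[of V v b, OF adm_V v lim(1)] by blast
    then show ?thesis by simp
  qed
  obtain \<phi> where \<phi>: "\<And>j::nat. \<phi> j \<in> test_functions \<Omega>" "(\<lambda>j. E (\<phi> j)) \<longlonglongrightarrow> E w" "(\<lambda>j. F (\<phi> j)) \<longlonglongrightarrow> F w"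
    using adm_dense[OF w] by blast
  have "(\<lambda>j. E (\<phi> j) / 2 - F (\<phi> j)) \<longlonglongrightarrow> E w / 2 - F w"
    by (intro tendsto_diff tendsto_divide tendsto_const \<phi>(2,3)) simp
  then show ?thesis by (rule LIMSEQ_le_const) (intro exI[of _ 0] allI impI test \<phi>(1))
qed

text \<open>From above, test functions whose energy is close to that of \<open>v\<close> compete
  with the minimizers. From below, a subsequence with \<open>J\<close> at most \<open>a\<close>
  would give \<open>E v / 2 - F v \<le> a\<close> by \<open>J_ge\<close> and lower
  semicontinuity.\<close>

lemma J_tendsto: "J \<longlonglongrightarrow> E v / 2 - F v"
proof (rule order_tendstoI)
  fix a assume a: "E v / 2 - F v < a"
  obtain \<phi> where \<phi>: "\<And>j::nat. \<phi> j \<in> test_functions \<Omega>" "(\<lambda>j. E (\<phi> j)) \<longlonglongrightarrow> E v" "(\<lambda>j. F (\<phi> j)) \<longlonglongrightarrow> F v"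
    using adm_dense[OF adm_v] by blast
  have "(\<lambda>j. E (\<phi> j) / 2 - F (\<phi> j)) \<longlonglongrightarrow> E v / 2 - F v"
    by (intro tendsto_diff tendsto_divide tendsto_const \<phi>(2,3)) simp
  from order_tendstoD(2)[OF this a] obtain j where j: "E (\<phi> j) / 2 - F (\<phi> j) < a"
    using eventually_happens'[OF sequentially_bot] by blast
  from order_tendstoD(2)[OF J_test_tendsto[OF \<phi>(1)] j] show "eventually (\<lambda>k. J k < a) sequentially"
    by eventually_elim (use J_le[OF \<phi>(1)] order_le_less_trans in blast)
next
  fix a assume a: "a < E v / 2 - F v"
  obtain C where C: "\<And>k. E (V k) / 2 \<le> J k + F (V k) + (P k - 1) * C" using J_ge by blast
  show "eventually (\<lambda>k. a < J k) sequentially"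
  proof (rule ccontr)
    assume "\<not> ?thesis"
    then obtain r :: "nat \<Rightarrow> nat" where r: "strict_mono r" "\<And>k. J (r k) \<le> a"
      using not_eventually_sequentiallyD[of "\<lambda>k. a < J k"] by (auto simp: not_less)
    have "E v \<le> 2 * (a + F v + 0)"
    proof (rule E_Fatou(2)[of "\<lambda>k. V (r k)"])
      show "AE x in lborel. (\<lambda>k. V (r k) x) \<longlonglongrightarrow> v x"
        using lim(1) by eventually_elim (use LIMSEQ_subseq_LIMSEQ[OF _ r(1)] in \<open>auto simp: comp_def\<close>)
      show "E (V (r k)) \<le> 2 * (a + F (V (r k)) + (P (r k) - 1) * C)" for k
        using C[of "r k"] r(2)[of k] by simp
      show "(\<lambda>k. 2 * (a + F (V (r k)) + (P (r k) - 1) * C)) \<longlonglongrightarrow> 2 * (a + F v + 0)"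
        using LIMSEQ_subseq_LIMSEQ[OF F_V r(1)] LIMSEQ_subseq_LIMSEQ[OF P_shift r(1)]
        by (intro tendsto_mult_left tendsto_add tendsto_const) (auto simp: comp_def)
    qed (use adm_V v in auto)
    with a show False by simp
  qed
qed

end

section \<open>The limit field of the truncated signed powers\<close>

lemma mid_hull_odd:
  assumes "h \<in> mid_hull y k" "\<And>j t. y j (\<tau> t) = - y j t"
  shows "h (\<tau> t) = - h t"
  using assms(1)
proof (induction rule: mid_hull.induct)
  case (base j)
  then show ?case using assms(2) by simp
next
  case (mid v w)
  show ?case unfolding mid.IH by (simp add: field_simps)
qed

text \<open>An approximate linear equation that holds with error \<open>e\<close> along the tail
  survives midpoints with the same error.\<close>

lemma mid_hull_integral_bound:
  fixes y :: "nat \<Rightarrow> 'b \<Rightarrow> real" and W :: "'b \<Rightarrow> real"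
  assumes "h \<in> mid_hull y k" and y: "\<And>j. y j \<in> borel_measurable M" "\<And>j t. \<bar>y j t\<bar> \<le> 1" and W: "integrable M W"
    and le: "\<And>j. k \<le> j \<Longrightarrow> \<bar>(\<integral>t. y j t * W t \<partial>M) - c\<bar> \<le> e"
  shows "\<bar>(\<integral>t. h t * W t \<partial>M) - c\<bar> \<le> e"
  using assms(1)
proof (induction rule: mid_hull.induct)
  case (base j)
  then show ?case using le by simp
next
  case (mid v w)
  have i: "integrable M (\<lambda>t. g t * W t)" if g: "g \<in> mid_hull y k" for g
  proof (rule Bochner_Integration.integrable_bound[OF W])
    show "(\<lambda>t. g t * W t) \<in> borel_measurable M"
      using mid_hull_measurable[OF g y(1)] W by (intro borel_measurable_times) auto
    have "\<bar>g t\<bar> \<le> 1" for t using mid_hull_bound[OF g, of t 0 1] y(2) by simp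
    then show "AE t in M. norm (g t * W t) \<le> norm (W t)" by (simp add: abs_mult mult_left_le_one_le)
  qed
  have "(\<integral>t. (v t + w t) / 2 * W t \<partial>M) = (\<integral>t. (v t * W t + w t * W t) / 2 \<partial>M)"
    by (intro Bochner_Integration.integral_cong) (auto simp: algebra_simps)
  also have "\<dots> = ((\<integral>t. v t * W t \<partial>M) + (\<integral>t. w t * W t \<partial>M)) / 2"
    using i[OF mid.hyps(1)] i[OF mid.hyps(2)] by simp
  finally have "2 * ((\<integral>t. (v t + w t) / 2 * W t \<partial>M) - c) = ((\<integral>t. v t * W t \<partial>M) - c) + ((\<integral>t. w t * W t \<partial>M) - c)"
    by simp
  moreover have "\<bar>x\<bar> \<le> e" if "2 * x = y + z" "\<bar>y\<bar> \<le> e" "\<bar>z\<bar> \<le> e" for x y z :: real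
    using that by linarith
  ultimately show ?case using mid.IH by blast
qed

text \<open>Where truncation acts, the excess is \<open>\<bar>a\<bar> powr (p - 1) - 1\<close>, and
  the tangent inequality bounds \<open>p * (\<bar>a\<bar> powr (p - 1) * \<bar>b\<bar>)\<close> by
  \<open>\<bar>b\<bar> powr p + (p - 1) * \<bar>a\<bar> powr p\<close>. With \<open>a\<close> from a
  minimizer and \<open>b\<close> from a test function, the integrals of both terms on the right tend
  to 0.\<close>

lemma spow_excess_le:
  assumes p: "1 < p"
  shows "\<bar>spow p a - max (- 1) (min 1 (spow p a))\<bar> * \<bar>b\<bar> \<le> (p - 1) * \<bar>a\<bar> powr p + max 0 (\<bar>b\<bar> powr p - \<bar>b\<bar>)"
proof (cases "\<bar>spow p a\<bar> \<le> 1")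
  case True
  then have "spow p a - max (- 1) (min 1 (spow p a)) = 0" by auto
  then show ?thesis using p by (auto intro!: add_nonneg_nonneg)
next
  case False
  have eq: "\<bar>spow p a - max (- 1) (min 1 (spow p a))\<bar> = \<bar>a\<bar> powr (p - 1) - 1"
    using False abs_spow[OF p, of a] by auto
  have "\<bar>\<bar>a\<bar>\<bar> powr p + p * spow p \<bar>a\<bar> * (\<bar>b\<bar> - \<bar>a\<bar>) \<le> \<bar>\<bar>b\<bar>\<bar> powr p" by (rule powr_convex_tangent[OF p])
  moreover have "spow p \<bar>a\<bar> = \<bar>a\<bar> powr (p - 1)" by (cases "a = 0") (auto simp: spow_def)
  moreover have "\<bar>a\<bar> powr (p - 1) * \<bar>a\<bar> = \<bar>a\<bar> powr p" by (cases "a = 0") (auto simp: powr_diff)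
  ultimately have "p * (\<bar>a\<bar> powr (p - 1) * \<bar>b\<bar>) \<le> \<bar>b\<bar> powr p + (p - 1) * \<bar>a\<bar> powr p" by (simp add: algebra_simps)
  also have "\<bar>b\<bar> powr p \<le> p * \<bar>b\<bar> + p * max 0 (\<bar>b\<bar> powr p - \<bar>b\<bar>)"
  proof (cases "\<bar>b\<bar> \<le> \<bar>b\<bar> powr p")
    case True
    then have "\<bar>b\<bar> powr p \<le> p * \<bar>b\<bar> powr p" using p by (simp add: mult_le_cancel_right1)
    with True show ?thesis by (simp add: algebra_simps)
  next
    case False
    then have "\<bar>b\<bar> powr p \<le> 1 * \<bar>b\<bar>" by simp
    also have "\<dots> \<le> p * \<bar>b\<bar>" using p by (intro mult_right_mono) auto
    finally show ?thesis using p by (intro add_increasing2 mult_nonneg_nonneg) auto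
  qed
  also have "(p - 1) * \<bar>a\<bar> powr p \<le> p * ((p - 1) * \<bar>a\<bar> powr p)"
    using mult_right_mono[of 1 p "(p - 1) * \<bar>a\<bar> powr p"] p by simp
  finally have "p * (\<bar>a\<bar> powr (p - 1) * \<bar>b\<bar>) \<le> p * (\<bar>b\<bar> + max 0 (\<bar>b\<bar> powr p - \<bar>b\<bar>) + (p - 1) * \<bar>a\<bar> powr p)"
    by (simp add: algebra_simps)
  then have "\<bar>a\<bar> powr (p - 1) * \<bar>b\<bar> \<le> \<bar>b\<bar> + max 0 (\<bar>b\<bar> powr p - \<bar>b\<bar>) + (p - 1) * \<bar>a\<bar> powr p" using p by simp
  then show ?thesis unfolding eq by (simp add: left_diff_distrib)
qed

context frac_limit
begin

definition tsgn :: "nat \<Rightarrow> 'a \<times> 'a \<Rightarrow> real" where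
  "tsgn k t = max (- 1) (min 1 (spow (P k) (sdq s (V k) t)))"

lemma tsgn_measurable [measurable]: "tsgn k \<in> borel_measurable borel"
  unfolding tsgn_def using V(1)[of k] by measurable

lemma tsgn_bound: "\<bar>tsgn k t\<bar> \<le> 1" by (auto simp: tsgn_def)

lemma sdq_swap: "sdq s w (snd t, fst t) = - sdq s w t"
  unfolding sdq_def minus_divide_left by (rule arg_cong2[where f="(/)"]) (simp_all add: norm_minus_commute)

lemma tsgn_odd: "tsgn k (snd t, fst t) = - tsgn k t"
  by (simp add: tsgn_def sdq_swap spow_minus)

text \<open>The untruncated signed power satisfies the Euler-Lagrange equation exactly. By
  \<open>spow_excess_le\<close> truncation costs at most \<open>(P k - 1) * B\<close> plus a term
  \<open>X k\<close> that depends only on \<open>\<phi>\<close> and \<open>P k\<close> and tends to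
  0.\<close>

lemma tsgn_integral:
  assumes \<phi>: "\<phi> \<in> test_functions \<Omega>"
  shows "(\<lambda>k. \<integral>t. tsgn k t * sdq s \<phi> t \<partial>lborel) \<longlonglongrightarrow> 2 * F \<phi>"
proof -
  note \<phi>a = adm_test_function[OF \<phi>]
  note [measurable] = admD(1)[OF \<phi>a] V(1)
  define W where "W = sdq s \<phi>"
  have [measurable]: "W \<in> borel_measurable borel" unfolding W_def by measurable
  have Wi: "integrable lborel W" unfolding W_def by (rule sdq_integrable(1)[OF \<phi>a])
  define X where "X k = (\<integral>\<^sup>+t. ennreal (max 0 (\<bar>W t\<bar> powr P k - \<bar>W t\<bar>)) \<partial>lborel)" for k
  have Wfin: "(\<integral>\<^sup>+t. ennreal (\<bar>W t\<bar> powr p1) \<partial>lborel) < \<infinity>"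
    using smooth_compact_energy_finite[OF test_functions_smooth_compact[OF \<phi>] s _ p1(2)] p1(1)
    by (simp add: frac_energy_sdq W_def)
  have "X \<longlonglongrightarrow> (\<integral>\<^sup>+t. 0 \<partial>(lborel :: ('a \<times> 'a) measure))"
    unfolding X_def
  proof (rule nn_integral_dominated_convergence[where w="\<lambda>t. ennreal (\<bar>W t\<bar> powr p1)"])
    show "AE t in lborel. (\<lambda>k. ennreal (max 0 (\<bar>W t\<bar> powr P k - \<bar>W t\<bar>))) \<longlonglongrightarrow> 0"
    proof (rule AE_I2)
      fix t
      have "(\<lambda>k. \<bar>W t\<bar> powr P k) \<longlonglongrightarrow> \<bar>W t\<bar>"
      proof (cases "W t = 0")
        case False
        then have "(\<lambda>k. \<bar>W t\<bar> powr P k) \<longlonglongrightarrow> \<bar>W t\<bar> powr 1" by (intro tendsto_powr tendsto_const P(3)) simp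
        then show ?thesis by simp
      qed simp
      then have "(\<lambda>k. max 0 (\<bar>W t\<bar> powr P k - \<bar>W t\<bar>)) \<longlonglongrightarrow> max 0 (\<bar>W t\<bar> - \<bar>W t\<bar>)"
        by (intro tendsto_max tendsto_diff tendsto_const)
      from tendsto_ennrealI[OF this] show "(\<lambda>k. ennreal (max 0 (\<bar>W t\<bar> powr P k - \<bar>W t\<bar>))) \<longlonglongrightarrow> 0" by simp
    qed
    show "AE t in lborel. ennreal (max 0 (\<bar>W t\<bar> powr P k - \<bar>W t\<bar>)) \<le> ennreal (\<bar>W t\<bar> powr p1)" for k
    proof (intro AE_I2 ennreal_leI)
      fix t
      show "max 0 (\<bar>W t\<bar> powr P k - \<bar>W t\<bar>) \<le> \<bar>W t\<bar> powr p1"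
      proof (cases "1 \<le> \<bar>W t\<bar>")
        case True
        then have "\<bar>W t\<bar> powr P k \<le> \<bar>W t\<bar> powr p1" using P(2)[of k] by (intro powr_mono) auto
        then show ?thesis by simp
      next
        case False
        then have "\<bar>W t\<bar> powr P k \<le> \<bar>W t\<bar> powr 1" using P(1)[of k] by (intro powr_mono') auto
        then show ?thesis by simp
      qed
    qed
  qed (use Wfin in simp_all)
  then have X0: "X \<longlonglongrightarrow> 0" by simp
  have main: "ennreal \<bar>(\<integral>t. tsgn k t * W t \<partial>lborel) - 2 * F \<phi>\<bar> \<le> ennreal ((P k - 1) * B) + X k" for k
  proof -
    define Z where "Z t = spow (P k) (sdq s (V k) t)" for t
    have [measurable]: "Z \<in> borel_measurable borel" unfolding Z_def by measurable
    have p0: "0 < P k" using P(1)[of k] by simp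
    note EL = P(1) u V test_functions_in_sobolev_space0[OF \<phi> p0 \<Omega>(1), of s] \<phi>a AE_I2[OF refl] energy_p_test[OF \<phi>]
    have i1: "integrable lborel (\<lambda>t. Z t * W t)"
      unfolding Z_def W_def by (rule euler_lagrange_le(1)[OF EL])
    have el: "(\<integral>t. Z t * W t \<partial>lborel) = 2 * F \<phi>"
      using euler_lagrange[OF EL] by (simp add: Z_def W_def)
    have i2: "integrable lborel (\<lambda>t. tsgn k t * W t)"
    proof (rule Bochner_Integration.integrable_bound[OF Wi])
      show "AE t in lborel. norm (tsgn k t * W t) \<le> norm (W t)"
        using tsgn_bound by (simp add: abs_mult mult_left_le_one_le)
    qed measurable
    have i3: "integrable lborel (\<lambda>t. Z t * W t - tsgn k t * W t)" using i1 i2 by simp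
    have "ennreal \<bar>(\<integral>t. tsgn k t * W t \<partial>lborel) - 2 * F \<phi>\<bar> = ennreal \<bar>\<integral>t. Z t * W t - tsgn k t * W t \<partial>lborel\<bar>"
      using i1 i2 el by (simp add: abs_minus_commute)
    also have "\<dots> \<le> (\<integral>\<^sup>+t. ennreal \<bar>Z t * W t - tsgn k t * W t\<bar> \<partial>lborel)"
      using integral_norm_bound_ennreal[OF i3] by simp
    also have "\<dots> \<le> (\<integral>\<^sup>+t. ennreal (P k - 1) * ennreal (\<bar>sdq s (V k) t\<bar> powr P k) + ennreal (max 0 (\<bar>W t\<bar> powr P k - \<bar>W t\<bar>)) \<partial>lborel)"
    proof (rule nn_integral_mono)
      fix t
      have "\<bar>Z t * W t - tsgn k t * W t\<bar> \<le> (P k - 1) * \<bar>sdq s (V k) t\<bar> powr P k + max 0 (\<bar>W t\<bar> powr P k - \<bar>W t\<bar>)"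
        using spow_excess_le[OF P(1)[of k], of "sdq s (V k) t" "W t"]
        by (simp add: tsgn_def Z_def abs_mult flip: left_diff_distrib)
      then have "ennreal \<bar>Z t * W t - tsgn k t * W t\<bar> \<le> ennreal ((P k - 1) * \<bar>sdq s (V k) t\<bar> powr P k + max 0 (\<bar>W t\<bar> powr P k - \<bar>W t\<bar>))"
        by (rule ennreal_leI)
      also have "\<dots> = ennreal (P k - 1) * ennreal (\<bar>sdq s (V k) t\<bar> powr P k) + ennreal (max 0 (\<bar>W t\<bar> powr P k - \<bar>W t\<bar>))"
        using P(1)[of k] by (simp add: ennreal_plus ennreal_mult')
      finally show "ennreal \<bar>Z t * W t - tsgn k t * W t\<bar> \<le> \<dots>" .
    qed
    also have "\<dots> = ennreal (P k - 1) * frac_energy s (P k) UNIV (V k) + X k"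
      by (simp add: nn_integral_add nn_integral_cmult frac_energy_sdq X_def)
    also have "\<dots> \<le> ennreal (P k - 1) * ennreal B + X k"
      using order_trans[OF minimizer_p_energy_le[OF P(1) u V] ennreal_leI[OF B], of k] by (intro add_mono mult_left_mono) auto
    also have "\<dots> = ennreal ((P k - 1) * B) + X k" using P(1)[of k] by (simp add: ennreal_mult')
    finally show ?thesis .
  qed
  have "(\<lambda>k. ennreal ((P k - 1) * B) + X k) \<longlonglongrightarrow> ennreal 0 + 0"
    by (intro tendsto_add tendsto_ennrealI P_shift X0)
  then have "(\<lambda>k. ennreal ((P k - 1) * B) + X k) \<longlonglongrightarrow> 0" by simp
  from tendsto_0_le_ennreal[OF main this]
  have "(\<lambda>k. ennreal \<bar>(\<integral>t. tsgn k t * W t \<partial>lborel) - 2 * F \<phi>\<bar>) \<longlonglongrightarrow> ennreal 0" by simp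
  then have "(\<lambda>k. \<bar>(\<integral>t. tsgn k t * W t \<partial>lborel) - 2 * F \<phi>\<bar>) \<longlonglongrightarrow> 0" by (subst (asm) tendsto_ennreal_iff) auto
  then have "(\<lambda>k. (\<integral>t. tsgn k t * W t \<partial>lborel) - 2 * F \<phi>) \<longlonglongrightarrow> 0" by (simp add: tendsto_rabs_zero_iff)
  then show ?thesis unfolding W_def by (rule LIM_zero_cancel)
qed

text \<open>The base converges to a nonzero number and the exponent \<open>P k - 1\<close> tends to
  0, so the power tends to 1 and only the sign survives; clamping leaves a sign unchanged.\<close>

lemma tsgn_tendsto:
  assumes t: "(\<lambda>k. sdq s (V k) t) \<longlonglongrightarrow> sdq s v t" and n: "sdq s v t \<noteq> 0"
  shows "(\<lambda>k. tsgn k t) \<longlonglongrightarrow> sgn (sdq s v t)"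
proof -
  have "(\<lambda>k. \<bar>sdq s (V k) t\<bar> powr (P k - 1)) \<longlonglongrightarrow> \<bar>sdq s v t\<bar> powr (1 - 1)"
    by (intro tendsto_powr tendsto_rabs t tendsto_diff P(3) tendsto_const) (use n in simp)
  then have "(\<lambda>k. spow (P k) (sdq s (V k) t)) \<longlonglongrightarrow> sgn (sdq s v t) * \<bar>sdq s v t\<bar> powr (1 - 1)"
    unfolding spow_def by (intro tendsto_mult tendsto_sgn t n)
  then have "(\<lambda>k. tsgn k t) \<longlonglongrightarrow> max (- 1) (min 1 (sgn (sdq s v t) * \<bar>sdq s v t\<bar> powr (1 - 1)))"
    unfolding tsgn_def by (intro tendsto_max tendsto_min tendsto_const)
  then show ?thesis using n by (auto simp: sgn_if)
qed

lemma limit_field: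
  obtains z :: "'a \<times> 'a \<Rightarrow> real" where "z \<in> borel_measurable borel" "\<And>t. \<bar>z t\<bar> \<le> 1" "\<And>x y. z (x, y) = - z (y, x)"
    "\<And>w. adm w \<Longrightarrow> (\<integral>t. z t * sdq s w t \<partial>lborel) / 2 = F w"
    "AE t in lborel. v (fst t) \<noteq> v (snd t) \<longrightarrow> z t = sgn (v (fst t) - v (snd t))"
proof -
  have sf: "sigma_finite_measure (lborel :: ('a \<times> 'a) measure)" by (rule sigma_finite_lborel)
  have tm: "tsgn k \<in> borel_measurable lborel" for k by measurable
  obtain g where g: "\<And>k. g k \<in> mid_hull tsgn k" "AE t in lborel. convergent (\<lambda>k. g k t)"
    by (rule mid_hull_convergent[OF sf tm tsgn_bound]) (rule that)
  have gm: "g k \<in> borel_measurable borel" for k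
    using mid_hull_measurable[OF g(1)[of k] tm] by simp
  note [measurable] = gm
  have gb: "\<bar>g k t\<bar> \<le> 1" for k t using mid_hull_bound[OF g(1)[of k], of t 0 1] tsgn_bound by simp
  have godd: "g k (snd t, fst t) = - g k t" for k t
    by (rule mid_hull_odd[OF g(1), where \<tau>="\<lambda>t. (snd t, fst t)"]) (rule tsgn_odd)
  define L where "L t = lim (\<lambda>k. g k t)" for t
  have Lm [measurable]: "L \<in> borel_measurable borel" unfolding L_def by measurable
  have sw [measurable]: "(\<lambda>t :: 'a \<times> 'a. (snd t, fst t)) \<in> borel_measurable borel"
    by (intro borel_measurable_continuous_onI continuous_intros)
  have Ls [measurable]: "(\<lambda>t. L (snd t, fst t)) \<in> borel_measurable borel" by (rule measurable_compose[OF sw Lm])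
  \<comment> \<open>Antisymmetry and the bound are claimed at every point, but \<open>g\<close>
    converges only almost everywhere. Antisymmetrising and clamping \<open>L\<close> repairs the
    null set and changes nothing where \<open>g\<close> converges.\<close>
  define z where "z t = max (- 1) (min 1 ((L t - L (snd t, fst t)) / 2))" for t
  have zm [measurable]: "z \<in> borel_measurable borel" unfolding z_def by measurable
  have zb: "\<bar>z t\<bar> \<le> 1" for t by (auto simp: z_def)
  have zo: "z (x, y) = - z (y, x)" for x y
    by (simp add: z_def max_def min_def) (auto simp: field_simps)
  have gz: "(\<lambda>k. g k t) \<longlonglongrightarrow> z t" if c: "convergent (\<lambda>k. g k t)" for t
  proof -
    have l: "(\<lambda>k. g k t) \<longlonglongrightarrow> L t" using c by (simp add: L_def convergent_LIMSEQ_iff)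
    then have "(\<lambda>k. g k (snd t, fst t)) \<longlonglongrightarrow> - L t" unfolding godd by (rule tendsto_minus)
    then have "L (snd t, fst t) = - L t" unfolding L_def[of "(snd t, fst t)"] by (rule limI)
    moreover have "\<bar>L t\<bar> \<le> 1" by (rule LIMSEQ_le_const2[OF tendsto_rabs[OF l]]) (intro exI[of _ 0] allI impI gb)
    ultimately have "z t = L t" by (auto simp: z_def)
    with l show ?thesis by simp
  qed
  \<comment> \<open>Each \<open>g k\<close> lies in the hull of the tail from \<open>k\<close> on,
    so its error in the equation is at most the largest error of that tail; dominated convergence
    then passes from \<open>g\<close> to \<open>z\<close>.\<close>
  have ztest: "(\<integral>t. z t * sdq s \<phi> t \<partial>lborel) = 2 * F \<phi>" if \<phi>: "\<phi> \<in> test_functions \<Omega>" for \<phi>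
  proof -
    note \<phi>a = adm_test_function[OF \<phi>]
    note [measurable] = admD(1)[OF \<phi>a]
    note Wi = sdq_integrable(1)[OF \<phi>a]
    have "(\<lambda>k. \<integral>t. g k t * sdq s \<phi> t \<partial>lborel) \<longlonglongrightarrow> (\<integral>t. z t * sdq s \<phi> t \<partial>lborel)"
    proof (rule integral_dominated_convergence[where w="\<lambda>t. \<bar>sdq s \<phi> t\<bar>"])
      show "AE t in lborel. (\<lambda>k. g k t * sdq s \<phi> t) \<longlonglongrightarrow> z t * sdq s \<phi> t"
        using g(2) by eventually_elim (rule tendsto_mult_right, rule gz)
      show "AE t in lborel. norm (g k t * sdq s \<phi> t) \<le> \<bar>sdq s \<phi> t\<bar>" for k
        using gb by (simp add: abs_mult mult_left_le_one_le)
      show "integrable lborel (\<lambda>t. \<bar>sdq s \<phi> t\<bar>)" using Wi by simp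
    qed measurable
    moreover have "(\<lambda>k. \<integral>t. g k t * sdq s \<phi> t \<partial>lborel) \<longlonglongrightarrow> 2 * F \<phi>"
    proof (rule metric_LIMSEQ_I)
      fix e :: real assume "0 < e"
      then obtain N where N: "\<And>k. N \<le> k \<Longrightarrow> \<bar>(\<integral>t. tsgn k t * sdq s \<phi> t \<partial>lborel) - 2 * F \<phi>\<bar> \<le> e / 2"
        using metric_LIMSEQ_D[OF tsgn_integral[OF \<phi>], of "e / 2"] by (force simp: dist_real_def)
      have "dist (\<integral>t. g k t * sdq s \<phi> t \<partial>lborel) (2 * F \<phi>) < e" if k: "N \<le> k" for k
      proof -
        have "\<bar>(\<integral>t. g k t * sdq s \<phi> t \<partial>lborel) - 2 * F \<phi>\<bar> \<le> e / 2"
          by (rule mid_hull_integral_bound[OF g(1) tm tsgn_bound Wi]) (use N k in auto)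
        then show ?thesis using \<open>0 < e\<close> by (simp add: dist_real_def)
      qed
      then show "\<exists>N. \<forall>k\<ge>N. dist (\<integral>t. g k t * sdq s \<phi> t \<partial>lborel) (2 * F \<phi>) < e" by blast
    qed
    ultimately show ?thesis by (rule LIMSEQ_unique)
  qed
  show thesis
  proof (rule that[OF zm zb zo])
    fix w assume w: "adm w"
    obtain \<phi> where \<phi>: "\<And>j::nat. \<phi> j \<in> test_functions \<Omega>" "(\<lambda>j. E (\<lambda>x. \<phi> j x - w x)) \<longlonglongrightarrow> 0"
      "(\<lambda>j. F (\<phi> j)) \<longlonglongrightarrow> F w"
      using adm_dense[OF w] by blast
    have zi: "integrable lborel (\<lambda>t. z t * sdq s a t)" if a: "adm a" for a
    proof (rule Bochner_Integration.integrable_bound[OF sdq_integrable(1)[OF a]])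
      show "(\<lambda>t. z t * sdq s a t) \<in> borel_measurable lborel" using admD(1)[OF a] by measurable
      show "AE t in lborel. norm (z t * sdq s a t) \<le> norm (sdq s a t)"
        using zb by (simp add: abs_mult mult_left_le_one_le)
    qed
    \<comment> \<open>Since \<open>\<bar>z t\<bar> \<le> 1\<close>, the pairing with
      \<open>z\<close> is continuous in the seminorm \<open>E\<close>, and the equation extends from
      test functions to \<open>w\<close>.\<close>
    have "(\<lambda>j. 2 * F (\<phi> j)) \<longlonglongrightarrow> (\<integral>t. z t * sdq s w t \<partial>lborel)"
    proof (rule LIM_zero_cancel, rule tendsto_rabs_zero_cancel, rule tendsto_sandwich[OF _ _ tendsto_const \<phi>(2)])
      show "\<forall>\<^sub>F j in sequentially. \<bar>2 * F (\<phi> j) - (\<integral>t. z t * sdq s w t \<partial>lborel)\<bar> \<le> E (\<lambda>x. \<phi> j x - w x)"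
      proof (intro always_eventually allI)
        fix j
        note pa = adm_test_function[OF \<phi>(1)[of j]]
        have da: "adm (\<lambda>x. \<phi> j x - w x)" using adm_add_cmult(1)[OF pa w, of "-1"] by simp
        have sd: "sdq s (\<lambda>x. \<phi> j x - w x) t = sdq s (\<phi> j) t - sdq s w t" for t
          using sdq_add_cmult[of s "\<phi> j" "-1" w t] by simp
        have "2 * F (\<phi> j) - (\<integral>t. z t * sdq s w t \<partial>lborel) = (\<integral>t. z t * sdq s (\<phi> j) t - z t * sdq s w t \<partial>lborel)"
          using zi[OF pa] zi[OF w] by (simp add: ztest[OF \<phi>(1)])
        also have "\<dots> = (\<integral>t. z t * sdq s (\<lambda>x. \<phi> j x - w x) t \<partial>lborel)" by (simp add: sd right_diff_distrib)
        finally have e: "2 * F (\<phi> j) - (\<integral>t. z t * sdq s w t \<partial>lborel) = (\<integral>t. z t * sdq s (\<lambda>x. \<phi> j x - w x) t \<partial>lborel)" .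
        have "\<bar>\<integral>t. z t * sdq s (\<lambda>x. \<phi> j x - w x) t \<partial>lborel\<bar> \<le> (\<integral>t. \<bar>sdq s (\<lambda>x. \<phi> j x - w x) t\<bar> \<partial>lborel)"
        proof (rule integral_abs_bound[THEN order_trans], rule integral_mono)
          show "integrable lborel (\<lambda>t. \<bar>z t * sdq s (\<lambda>x. \<phi> j x - w x) t\<bar>)" using zi[OF da] by simp
          show "integrable lborel (\<lambda>t. \<bar>sdq s (\<lambda>x. \<phi> j x - w x) t\<bar>)" using sdq_integrable(1)[OF da] by simp
          show "\<bar>z t * sdq s (\<lambda>x. \<phi> j x - w x) t\<bar> \<le> \<bar>sdq s (\<lambda>x. \<phi> j x - w x) t\<bar>" for t
            using zb[of t] by (simp add: abs_mult mult_left_le_one_le)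
        qed
        then show "\<bar>2 * F (\<phi> j) - (\<integral>t. z t * sdq s w t \<partial>lborel)\<bar> \<le> E (\<lambda>x. \<phi> j x - w x)"
          unfolding e sdq_integrable(2)[OF da] .
      qed
    qed simp
    moreover have "(\<lambda>j. 2 * F (\<phi> j)) \<longlonglongrightarrow> 2 * F w" by (intro tendsto_mult_left \<phi>(3))
    ultimately have "(\<integral>t. z t * sdq s w t \<partial>lborel) = 2 * F w" by (rule LIMSEQ_unique)
    then show "(\<integral>t. z t * sdq s w t \<partial>lborel) / 2 = F w" by simp
  next
    show "AE t in lborel. v (fst t) \<noteq> v (snd t) \<longrightarrow> z t = sgn (v (fst t) - v (snd t))"
      using g(2) lim_sdq
    proof eventually_elim
      case (elim t)
      show ?case
      proof
        assume ne: "v (fst t) \<noteq> v (snd t)"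
        then have pos: "0 < norm (fst t - snd t) powr (real DIM('a) + s)" by (cases "fst t = snd t") auto
        have n: "sdq s v t \<noteq> 0" using ne pos by (simp add: sdq_def)
        have sg: "sgn (sdq s v t) = sgn (v (fst t) - v (snd t))"
          using pos unfolding sdq_def sgn_divide by simp
        \<comment> \<open>From some index on all \<open>tsgn k t\<close> are within
          \<open>e / 2\<close> of the sign, and by \<open>mid_hull_bound\<close> so are the
          combinations of that tail.\<close>
        have "(\<lambda>k. g k t) \<longlonglongrightarrow> sgn (sdq s v t)"
        proof (rule metric_LIMSEQ_I)
          fix e :: real assume "0 < e"
          then obtain N where N: "\<And>k. N \<le> k \<Longrightarrow> \<bar>tsgn k t - sgn (sdq s v t)\<bar> \<le> e / 2"
            using metric_LIMSEQ_D[OF tsgn_tendsto[OF elim(2) n], of "e / 2"] by (force simp: dist_real_def)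
          have "dist (g k t) (sgn (sdq s v t)) < e" if k: "N \<le> k" for k
          proof -
            have "\<bar>g k t - sgn (sdq s v t)\<bar> \<le> e / 2" by (rule mid_hull_bound[OF g(1)]) (use N k in auto)
            then show ?thesis using \<open>0 < e\<close> by (simp add: dist_real_def)
          qed
          then show "\<exists>N. \<forall>k\<ge>N. dist (g k t) (sgn (sdq s v t)) < e" by blast
        qed
        then show "z t = sgn (v (fst t) - v (snd t))" unfolding sg by (rule LIMSEQ_unique[OF gz[OF elim(1)]])
      qed
    qed
  qed
qed

text \<open>Formulated for every function equal to \<open>v\<close> almost everywhere, so that in
  the strict case it also covers the zero function.\<close>

lemma weak_solution:
  assumes "w \<in> sobolev_space0 s 1 \<Omega>" "AE x in lborel. w x = v x"
  shows "is_weak_solution \<Omega> f s w"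
  by (rule limit_field) (rule weak_solutionI[OF assms(1) v(1) assms(2)])

end

section \<open>Extraction of the subsequence, the strict case, and the full limit of the
  energies\<close>

context frac_problem
begin

theorem minimizers_subsequence:
  fixes P :: "nat \<Rightarrow> real" and u :: "nat \<Rightarrow> 'a \<Rightarrow> real"
  assumes P: "\<And>k. 1 < P k" "P \<longlonglongrightarrow> 1"
    and u: "\<And>k. is_minimizer \<Omega> f (shifted_order DIM('a) s (P k)) (P k) (u k)"
  obtains \<sigma> v where "strict_mono \<sigma>" "adm v" "is_minimizer \<Omega> f s 1 v"
    "converges_Lp (lebesgue_on \<Omega>) 1 (\<lambda>k. u (\<sigma> k)) v" "AE x in lebesgue. (\<lambda>k. u (\<sigma> k) x) \<longlonglongrightarrow> v x"
    "weakly_converges_Lp (lebesgue_on \<Omega>) (real DIM('a) / (real DIM('a) - s)) (\<lambda>k. u (\<sigma> k)) v"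
    "(\<lambda>k. energy \<Omega> f (shifted_order DIM('a) s (P (\<sigma> k))) (P (\<sigma> k)) (u (\<sigma> k))) \<longlonglongrightarrow> energy \<Omega> f s 1 v"
    "\<And>w. w \<in> sobolev_space0 s 1 \<Omega> \<Longrightarrow> AE x in lborel. w x = v x \<Longrightarrow> is_weak_solution \<Omega> f s w"
proof -
  obtain p0 B where p0: "1 < p0" "0 \<le> B" and bound:
    "\<And>p u v. 1 < p \<Longrightarrow> p \<le> p0 \<Longrightarrow> is_minimizer \<Omega> f (shifted_order DIM('a) s p) p u \<Longrightarrow>
      v \<in> borel_measurable borel \<Longrightarrow> (\<And>x. x \<notin> \<Omega> \<Longrightarrow> v x = 0) \<Longrightarrow> AE x in lborel. u x = v x \<Longrightarrow> E v \<le> B"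
    using minimizer_p_uniform_bound by blast
  define n where "n = real DIM('a)"
  \<comment> \<open>The midpoint of 1 and \<open>n / (n + s - 1)\<close>, the bound on the exponent
    in \<open>smooth_compact_energy_finite\<close>; that bound exceeds 1 because
    \<open>s < 1\<close>.\<close>
  define p1 where "p1 = (1 + n / (n + s - 1)) / 2"
  have n: "0 < n + s - 1" unfolding n_def using n_ge_1 s(1) by linarith
  have "1 < n / (n + s - 1)" using n s by simp
  then have p1: "1 < p1" by (simp add: p1_def)
  have "(n + s - 1) * p1 = ((n + s - 1) + n) / 2" using n by (simp add: p1_def distrib_left)
  then have p1': "(real DIM('a) + s - 1) * p1 < real DIM('a)" using s by (simp add: n_def)
  have "eventually (\<lambda>k. P k < min p0 p1) sequentially" using order_tendstoD(2)[OF P(2), of "min p0 p1"] p0 p1 by simp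
  \<comment> \<open>The energy bound holds for exponents up to \<open>p0\<close> and the energies of
    test functions are finite up to \<open>p1\<close>, so the first \<open>k0\<close> members are
    dropped; hence the shift by \<open>k0\<close> in \<open>\<sigma>\<close>.\<close>
  then obtain k0 where k0: "\<And>k. k0 \<le> k \<Longrightarrow> P k < min p0 p1" by (auto simp: eventually_sequentially)
  have "\<exists>V. V \<in> borel_measurable borel \<and> (\<forall>x. x \<notin> \<Omega> \<longrightarrow> V x = 0) \<and> (AE x in lborel. u k x = V x)" for k
    using u[of k] by (auto simp: is_minimizer_def elim!: sobolev_space0_rep)
  then obtain V where V': "\<forall>k. V k \<in> borel_measurable borel \<and> (\<forall>x. x \<notin> \<Omega> \<longrightarrow> V k x = 0) \<and> (AE x in lborel. u k x = V k x)"
    by metis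
  have V: "\<And>k. V k \<in> borel_measurable borel" "\<And>k x. x \<notin> \<Omega> \<Longrightarrow> V k x = 0" "\<And>k. AE x in lborel. u k x = V k x"
    using V' by auto
  have EB: "E (V k) \<le> B" if "k0 \<le> k" for k
    by (rule bound[OF P(1) _ u V]) (use k0[OF that] in simp)
  have aV: "adm (V k)" for k by (rule minimizer_p_adm(2)[OF P(1) u V])
  obtain C where C: "0 \<le> C" "\<And>v. adm v \<Longrightarrow> (\<integral>\<^sup>+x. ennreal \<bar>v x\<bar> \<partial>lborel) \<le> ennreal (C * E v)"
    using adm_L1_bound by blast
  have L1B: "(\<integral>\<^sup>+x. ennreal \<bar>V (k + k0) x\<bar> \<partial>lborel) \<le> ennreal (C * B)" for k
    using C(2)[OF aV] ennreal_leI[OF mult_left_mono[OF EB C(1)]] by (rule order_trans) simp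
  have FB: "frac_energy s 1 UNIV (V (k + k0)) \<le> ennreal B" for k
    unfolding admD(5)[OF aV] by (intro ennreal_leI EB) simp
  obtain r v where r: "strict_mono r" and v: "v \<in> borel_measurable borel" "\<And>x. x \<notin> \<Omega> \<Longrightarrow> v x = 0"
    and lim: "AE x in lborel. (\<lambda>k. V (r k + k0) x) \<longlonglongrightarrow> v x"
      "(\<lambda>k. \<integral>\<^sup>+x. ennreal \<bar>V (r k + k0) x - v x\<bar> \<partial>lborel) \<longlonglongrightarrow> 0"
    by (rule fractional_compactness[of "\<lambda>k. V (k + k0)" \<Omega> s "C * B" B, OF V(1) \<Omega>(2) \<Omega>_sets V(2) s(1) L1B FB]) (assumption, rule that)
  define \<sigma> where "\<sigma> k = r k + k0" for k
  have \<sigma>: "strict_mono \<sigma>" using r by (simp add: \<sigma>_def strict_mono_def)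
  have \<sigma>k: "k0 \<le> \<sigma> k" for k by (simp add: \<sigma>_def)
  interpret L: frac_limit s \<Omega> f "\<lambda>k. P (\<sigma> k)" p1 B "\<lambda>k. u (\<sigma> k)" "\<lambda>k. V (\<sigma> k)" v
  proof (unfold_locales, goal_cases)
    case (4 k) then show ?case using k0[OF \<sigma>k[of k]] by simp
  next
    case 5 then show ?case using LIMSEQ_subseq_LIMSEQ[OF P(2) \<sigma>] by (simp add: comp_def)
  qed (use p1 p1' P u V EB \<sigma>k v lim in \<open>simp_all add: \<sigma>_def[symmetric]\<close>)
  have ul: "u k \<in> borel_measurable (lebesgue_on \<Omega>)" for k
    using u[of k] sobolev_space0_lebesgue by (auto simp: is_minimizer_def intro: measurable_restrict_space1)
  have norm_eq: "Lp_norm (lebesgue_on \<Omega>) q (u k) = Lp_norm lborel q (V k)" for q k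
    by (rule Lp_norm_lebesgue_on_lborel[OF \<Omega>_sets V(3) V(2)])
  have Lp: "u k \<in> Lp_space (lebesgue_on \<Omega>) (real DIM('a) / (real DIM('a) - s))" for k
    using order_le_less_trans[OF adm_Lp(3)[OF aV[of k]] ennreal_less_top] ul by (simp add: Lp_space_def norm_eq)
  have L1: "u k \<in> Lp_space (lebesgue_on \<Omega>) 1" for k
    unfolding Lp_space_def mem_Collect_eq norm_eq unfolding Lp_norm_1 using admD(3)[OF aV[of k]] ul by blast
  have v_norm: "Lp_norm (lebesgue_on \<Omega>) 1 v = Lp_norm lborel 1 v"
    by (rule Lp_norm_lebesgue_on_lborel[OF \<Omega>_sets]) (simp_all add: v(2))
  have vL1: "v \<in> Lp_space (lebesgue_on \<Omega>) 1"
    unfolding Lp_space_def mem_Collect_eq v_norm unfolding Lp_norm_1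
    using admD(3)[OF L.adm_v] borel_lebesgue_on[OF v(1)] by blast
  have diff: "Lp_norm (lebesgue_on \<Omega>) 1 (\<lambda>x. u (\<sigma> k) x - v x) = (\<integral>\<^sup>+x. ennreal \<bar>V (\<sigma> k) x - v x\<bar> \<partial>lborel)" for k
    unfolding Lp_norm_1[of lborel, symmetric]
  proof (rule Lp_norm_lebesgue_on_lborel[OF \<Omega>_sets])
    show "AE x in lborel. u (\<sigma> k) x - v x = V (\<sigma> k) x - v x" using V(3)[of "\<sigma> k"] by eventually_elim simp
    show "x \<notin> \<Omega> \<Longrightarrow> V (\<sigma> k) x - v x = 0" for x by (simp add: V(2) v(2))
  qed
  have ae: "AE x in lborel. \<forall>k. u k x = V k x" using V(3) by (simp add: AE_all_countable)
  have pair: "(\<integral>x. u k x * g x \<partial>lebesgue_on \<Omega>) = (\<integral>x. V k x * g x \<partial>lebesgue_on \<Omega>)"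
    if g: "g \<in> borel_measurable (lebesgue_on \<Omega>)" for g k
  proof (rule integral_cong_AE)
    show "(\<lambda>x. u k x * g x) \<in> borel_measurable (lebesgue_on \<Omega>)" by (intro borel_measurable_times ul g)
    show "(\<lambda>x. V k x * g x) \<in> borel_measurable (lebesgue_on \<Omega>)" by (intro borel_measurable_times borel_lebesgue_on V(1) g)
    show "AE x in lebesgue_on \<Omega>. u k x * g x = V k x * g x"
      unfolding AE_lebesgue_on[OF \<Omega>_sets] using V(3)[of k] by eventually_elim simp
  qed
  show thesis
  proof (rule that[OF \<sigma> L.adm_v])
    show "is_minimizer \<Omega> f s 1 v" unfolding adm_minimizer_iff[OF L.adm_v] using L.v_minimal by blast
    show "converges_Lp (lebesgue_on \<Omega>) 1 (\<lambda>k. u (\<sigma> k)) v"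
      unfolding converges_Lp_def diff using L1 vL1 L.lim(2) by simp
    have "AE x in lborel. (\<lambda>k. u (\<sigma> k) x) \<longlonglongrightarrow> v x" using ae L.lim(1) by eventually_elim simp
    then show "AE x in lebesgue. (\<lambda>k. u (\<sigma> k) x) \<longlonglongrightarrow> v x" by (rule AE_completion)
    show "weakly_converges_Lp (lebesgue_on \<Omega>) (real DIM('a) / (real DIM('a) - s)) (\<lambda>k. u (\<sigma> k)) v"
      unfolding weakly_converges_Lp_def
    proof (intro conjI allI ballI Lp adm_Lp(1) L.adm_v)
      fix g assume g: "g \<in> Lp_space (lebesgue_on \<Omega>) (real DIM('a) / (real DIM('a) - s) / (real DIM('a) / (real DIM('a) - s) - 1))"
      then have gm: "g \<in> borel_measurable (lebesgue_on \<Omega>)" by (simp add: Lp_space_def)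
      show "(\<lambda>k. \<integral>x. u (\<sigma> k) x * g x \<partial>lebesgue_on \<Omega>) \<longlonglongrightarrow> (\<integral>x. v x * g x \<partial>lebesgue_on \<Omega>)"
        unfolding pair[OF gm] using L.weak_V g by (simp add: weakly_converges_Lp_def)
    qed
    have "energy \<Omega> f s 1 v = ereal (E v / 2 - F v)"
      by (rule energy_1_eq[OF _ L.adm_v]) (use v(1) in \<open>auto intro: measurable_completion\<close>)
    then show "(\<lambda>k. energy \<Omega> f (shifted_order DIM('a) s (P (\<sigma> k))) (P (\<sigma> k)) (u (\<sigma> k))) \<longlonglongrightarrow> energy \<Omega> f s 1 v"
      unfolding L.energy_u using tendsto_ereal[OF L.J_tendsto] by simp
  qed (rule L.weak_solution)
qed

text \<open>By \<open>adm_L1_bound\<close> the L1 norm is at most a multiple of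
  \<open>E v\<close>.\<close>

lemma E_zero_AE:
  assumes v: "adm v" and E: "E v = 0"
  shows "AE x in lborel. v x = 0"
proof -
  obtain C where "\<And>v. adm v \<Longrightarrow> (\<integral>\<^sup>+x. ennreal \<bar>v x\<bar> \<partial>lborel) \<le> ennreal (C * E v)" using adm_L1_bound by blast
  from this[OF v] have "(\<integral>\<^sup>+x. ennreal \<bar>v x\<bar> \<partial>lborel) = 0" by (simp add: E)
  moreover note [measurable] = admD(1)[OF v]
  have "(\<lambda>x. ennreal \<bar>v x\<bar>) \<in> borel_measurable lborel" by measurable
  ultimately have "AE x in lborel. ennreal \<bar>v x\<bar> = 0" by (subst (asm) nn_integral_0_iff_AE)
  then show ?thesis by eventually_elim (simp add: ennreal_eq_0_iff)
qed

lemma zero_energy: "E (\<lambda>x. 0) = 0" "F (\<lambda>x. 0) = 0"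
  by (simp_all add: E_def F_def frac_energy_UNIV dq_def)

lemma zero_minimizer: "is_minimizer \<Omega> f s 1 (\<lambda>x. 0)"
  unfolding adm_minimizer_iff[OF adm_zero] zero_energy using F_le_half by fastforce

text \<open>\<open>E v / 2 - F v\<close> is at least \<open>(1 / 2 - fS) * E v\<close>, while
  comparison with 0 makes it at most 0; the positive factor forces \<open>E v = 0\<close>.\<close>

lemma minimizer_AE_zero:
  assumes strict: "fS < 1 / 2" and w: "is_minimizer \<Omega> f s 1 w"
  shows "AE x in lborel. w x = 0"
proof -
  have ws: "w \<in> sobolev_space0 s 1 \<Omega>" using w by (simp add: is_minimizer_def)
  obtain v where v: "adm v" "AE x in lborel. w x = v x" using sobolev_space0_adm[OF ws] by blast
  have z: "energy \<Omega> f s 1 (\<lambda>x. 0) = ereal 0" using energy_1_eq[OF _ adm_zero] by (simp add: zero_energy)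
  have "energy \<Omega> f s 1 w \<le> energy \<Omega> f s 1 (\<lambda>x. 0)"
    using w adm_sobolev_space0[OF adm_zero] by (simp add: is_minimizer_def)
  then have "E v / 2 - F v \<le> 0" by (simp add: z energy_1_eq[OF sobolev_space0_lebesgue[OF ws] v])
  then have "(1 / 2 - fS) * E v \<le> 0" using F_adm(2)[OF v(1)] by (simp add: left_diff_distrib)
  then have "E v = 0" using strict E_nonneg[of v] by (simp add: mult_le_0_iff)
  from E_zero_AE[OF v(1) this] v(2) show ?thesis by eventually_elim simp
qed

text \<open>A limit along all \<open>p\<close>, not along a subsequence. If the energies stayed
  outside a neighbourhood of the minimal value along some sequence,
  \<open>minimizers_subsequence\<close> would give a further subsequence converging to the energy of
  a minimizer of order 1, and all such minimizers share one energy.\<close>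

lemma minimizers_energy_tendsto:
  fixes u :: "real \<Rightarrow> 'a \<Rightarrow> real"
  assumes c: "1 < c" and u: "\<And>p. 1 < p \<Longrightarrow> p < c \<Longrightarrow> is_minimizer \<Omega> f (shifted_order DIM('a) s p) p (u p)"
    and w: "is_minimizer \<Omega> f s 1 w"
  shows "((\<lambda>p. energy \<Omega> f (shifted_order DIM('a) s p) p (u p)) \<longlongrightarrow> energy \<Omega> f s 1 w) (at_right 1)"
proof (rule tendsto_at_right_sequentially[OF c])
  fix S :: "nat \<Rightarrow> real"
  assume S: "\<And>n. 1 < S n" "\<And>n. S n < c" "S \<longlonglongrightarrow> 1"
  define X where "X p = energy \<Omega> f (shifted_order DIM('a) s p) p (u p)" for p
  show "(\<lambda>n. energy \<Omega> f (shifted_order DIM('a) s (S n)) (S n) (u (S n))) \<longlonglongrightarrow> energy \<Omega> f s 1 w"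
    unfolding X_def[symmetric]
  proof (rule topological_tendstoI, rule ccontr)
    fix U assume U: "open U" "energy \<Omega> f s 1 w \<in> U" and "\<not> eventually (\<lambda>n. X (S n) \<in> U) sequentially"
    then obtain r :: "nat \<Rightarrow> nat" where r: "strict_mono r" "\<And>n. X (S (r n)) \<notin> U"
      using not_eventually_sequentiallyD[of "\<lambda>n. X (S n) \<in> U"] by blast
    have Sr: "(\<lambda>n. S (r n)) \<longlonglongrightarrow> 1" using LIMSEQ_subseq_LIMSEQ[OF S(3) r(1)] by (simp add: comp_def)
    obtain \<sigma> :: "nat \<Rightarrow> nat" and v where v: "is_minimizer \<Omega> f s 1 v" "(\<lambda>k. energy \<Omega> f (shifted_order DIM('a) s (S (r (\<sigma> k)))) (S (r (\<sigma> k))) (u (S (r (\<sigma> k))))) \<longlonglongrightarrow> energy \<Omega> f s 1 v"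
      by (rule minimizers_subsequence[of "\<lambda>n. S (r n)" "\<lambda>n. u (S (r n))", OF S(1) Sr u[OF S(1,2)]]) (rule that)
    have "energy \<Omega> f s 1 v = energy \<Omega> f s 1 w" using v(1) w by (auto simp: is_minimizer_def intro: antisym)
    with v(2)[folded X_def] U have "eventually (\<lambda>k. X (S (r (\<sigma> k))) \<in> U) sequentially" by (auto dest: topological_tendstoD)
    then show False using r(2) by simp
  qed
qed

end

theorem theorem3p2:
  fixes s c :: real
    and \<Omega> :: "'a::euclidean_space set"
    and f :: "'a \<Rightarrow> real"
    and u :: "real \<Rightarrow> 'a \<Rightarrow> real"
  assumes s: "0 < s" "s < 1"
    and \<Omega>: "open \<Omega>" "bounded \<Omega>" "lipschitz_boundary \<Omega>"
    and f: "f \<in> Lp_space (lebesgue_on \<Omega>) (real DIM('a) / s)"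
    and f_le: "Lp_norm (lebesgue_on \<Omega>) (real DIM('a) / s) f \<le> ennreal (1 / (2 * sobolev_constant TYPE('a) s))"
    and c: "1 < c"
      "\<forall>p \<in> {1<..<c}. shifted_order DIM('a) s p \<in> {s<..<1} \<and> shifted_order DIM('a) s p * p < 1"
    and u: "\<forall>p \<in> {1<..<c}. is_minimizer \<Omega> f (shifted_order DIM('a) s p) p (u p)"
  shows "\<forall>P :: nat \<Rightarrow> real. (\<forall>k. P k \<in> {1<..<c}) \<and> P \<longlonglongrightarrow> 1 \<longrightarrow>
    (\<exists>\<sigma> u1. strict_mono \<sigma> \<and> u1 \<in> sobolev_space0 s 1 \<Omega> \<and>
       converges_Lp (lebesgue_on \<Omega>) 1 (\<lambda>k. u (P (\<sigma> k))) u1 \<and>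
       (AE x in lebesgue. (\<lambda>k. u (P (\<sigma> k)) x) \<longlonglongrightarrow> u1 x) \<and>
       weakly_converges_Lp (lebesgue_on \<Omega>) (real DIM('a) / (real DIM('a) - s)) (\<lambda>k. u (P (\<sigma> k))) u1 \<and>
       is_minimizer \<Omega> f s 1 u1 \<and>
       is_weak_solution \<Omega> f s u1 \<and>
       (Lp_norm (lebesgue_on \<Omega>) (real DIM('a) / s) f < ennreal (1 / (2 * sobolev_constant TYPE('a) s)) \<longrightarrow>
          (AE x in lebesgue. u1 x = 0) \<and>
          is_minimizer \<Omega> f s 1 (\<lambda>x. 0) \<and>
          (\<forall>v. is_minimizer \<Omega> f s 1 v \<longrightarrow> (AE x in lebesgue. v x = 0)) \<and>
          is_weak_solution \<Omega> f s (\<lambda>x. 0)) \<and>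
       ((\<lambda>p. energy \<Omega> f (shifted_order DIM('a) s p) p (u p)) \<longlongrightarrow> energy \<Omega> f s 1 u1) (at_right 1))"
proof (intro allI impI, elim conjE, goal_cases)
  interpret frac_problem s \<Omega> f by (unfold_locales) (rule s \<Omega> f f_le)+
  case P: (1 P)
  have P1: "1 < P k" for k using P(1) by simp
  have u': "is_minimizer \<Omega> f (shifted_order DIM('a) s p) p (u p)" if "1 < p" "p < c" for p using u that by simp
  have uP: "is_minimizer \<Omega> f (shifted_order DIM('a) s (P k)) (P k) (u (P k))" for k using u P(1) by blast
  obtain \<sigma> v where \<sigma>: "strict_mono \<sigma>" and v: "adm v" "is_minimizer \<Omega> f s 1 v"
    and conv: "converges_Lp (lebesgue_on \<Omega>) 1 (\<lambda>k. u (P (\<sigma> k))) v" "AE x in lebesgue. (\<lambda>k. u (P (\<sigma> k)) x) \<longlonglongrightarrow> v x"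
      "weakly_converges_Lp (lebesgue_on \<Omega>) (real DIM('a) / (real DIM('a) - s)) (\<lambda>k. u (P (\<sigma> k))) v"
    and ws: "\<And>w. w \<in> sobolev_space0 s 1 \<Omega> \<Longrightarrow> AE x in lborel. w x = v x \<Longrightarrow> is_weak_solution \<Omega> f s w"
    by (rule minimizers_subsequence[of P "\<lambda>k. u (P k)", OF P1 P(2) uP]) (rule that)
  note vs = adm_sobolev_space0[OF v(1)]
  show ?case
  proof (rule exI[of _ \<sigma>], rule exI[of _ v], intro conjI impI)
    show "is_weak_solution \<Omega> f s v" by (rule ws[OF vs]) simp
    show "((\<lambda>p. energy \<Omega> f (shifted_order DIM('a) s p) p (u p)) \<longlongrightarrow> energy \<Omega> f s 1 v) (at_right 1)"
      by (rule minimizers_energy_tendsto[OF c(1) u' v(2)])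
    assume "Lp_norm (lebesgue_on \<Omega>) (real DIM('a) / s) f < ennreal (1 / (2 * sobolev_constant TYPE('a) s))"
    note zero = minimizer_AE_zero[OF fS_strict[OF this]]
    show "AE x in lebesgue. v x = 0" by (rule AE_completion[OF zero[OF v(2)]])
    show "\<forall>v. is_minimizer \<Omega> f s 1 v \<longrightarrow> (AE x in lebesgue. v x = 0)" using AE_completion[OF zero] by blast
    show "is_minimizer \<Omega> f s 1 (\<lambda>x. 0)" by (rule zero_minimizer)
    \<comment> \<open>In the strict case \<open>v\<close> vanishes almost everywhere, so the field
      built for \<open>v\<close> serves the zero function as well.\<close>
    show "is_weak_solution \<Omega> f s (\<lambda>x. 0)"
      by (rule ws[OF adm_sobolev_space0[OF adm_zero]]) (use zero[OF v(2)] in \<open>eventually_elim, simp\<close>)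
  qed (rule \<sigma> vs conv v(2))+
qed

end
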